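(* Let $G$ be a semisimple connected Lie group of non-compact type with finite center, with maximal compact subgroup $K$ and minimal parabolic subgroup $P$. Let $(G/P)^{(3)}$ be the set of triples $(x,y,z)\in(G/P)^3$ such that $x$ and $y$ are opposite and $z$ is opposite to every point in $\partial F_{x,y}$, where $F_{x,y}$ is the unique maximal flat of $G/K$ having $x$ and $y$ in its boundary. Then there exists a $G$-equivariant continuous map $$\Phi:(G/P)^{(3)}\longrightarrow G/K$$ such that, furthermore, $\Phi(x,y,z)\in F_{x,y}$ for every $(x,y,z)\in(G/P)^{(3)}$.
   Context: $A<P$ is a maximal split torus. The choices are compatible in the standard way: there is a Cartan decomposition $\mathfrak{g}=\mathfrak{k}\oplus\mathfrak{p}$ with $\mathfrak{k}=\mathrm{Lie}(K)$, a maximal abelian subspace $\mathfrak{a}\subset\mathfrak{p}$ with $A=\exp(\mathfrak{a})$, and a choice of positive restricted roots such that $P=MAN$, where $M=Z_K(A)$ is the centralizer of $A$ in $K$ and $N$ is the unipotent radical of $P$. Let $T=N_K(A)$ be the normalizer of $A$ in $K$ and $W=T/M$ the Weyl group. Let $w_0\in T$ be a representative of the longest element of $W$ (longest with respect to this choice of positive roots). The canonical maximal flat is $F_A:=\{aK\mid a\in A\}\subset G/K$; every maximal flat of $G/K$ is of the form $gF_A$ with $g\in G$. The boundary of $F_A$ is $\partial F_A=\{wP\mid w\in W\}\subset G/P$, and $\partial(gF_A)=g(\partial F_A)$. A pair of points of $G/P$ is called opposite if it lies in the $G$-orbit (diagonal action) of $(P,w_0P)$; this relation is symmetric. Two opposite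 points $x,y$ lie in the boundary of a unique maximal flat $F_{x,y}$: if $(x,y)=g(P,w_0P)$ then $F_{x,y}=gF_A$. $G$ acts diagonally on $(G/P)^{(3)}$, which carries the subspace topology from $(G/P)^3$, and by left multiplication on $G/K$. *)

theory Defs
  imports "HOL-Analysis.Analysis" "HOL-Algebra.Group_Action"
begin

section \<open>Smooth maps and Lie groups\<close>

text \<open>For open \<open>S\<close> in a finite-dimensional space this is the usual notion of class \<open>C\<^sup>k\<close> on \<open>S\<close>.\<close>

primrec Ck_on :: "nat \<Rightarrow> ('b::real_normed_vector \<Rightarrow> 'c::real_normed_vector) \<Rightarrow> 'b set \<Rightarrow> bool" where
  "Ck_on 0 f S \<longleftrightarrow> continuous_on S f"
| "Ck_on (Suc k) f S \<longleftrightarrow>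
     (\<forall>x\<in>S. f differentiable (at x)) \<and> (\<forall>v. Ck_on k (\<lambda>x. frechet_derivative f (at x) v) S)"

definition smooth_on :: "('b::real_normed_vector \<Rightarrow> 'c::real_normed_vector) \<Rightarrow> 'b set \<Rightarrow> bool" where
  "smooth_on f S \<longleftrightarrow> (\<forall>k. Ck_on k f S)"

type_synonym ('a, 'e) chart = "'a set \<times> ('a \<Rightarrow> 'e)"

definition chart_inv :: "('a, 'e) chart \<Rightarrow> 'e \<Rightarrow> 'a" where
  "chart_inv c = inv_into (fst c) (snd c)"

definition chart_image :: "('a, 'e) chart \<Rightarrow> 'e set" where
  "chart_image c = snd c ` fst c"

definition is_chart :: "'a topology \<Rightarrow> ('a, 'e::euclidean_space) chart \<Rightarrow> bool" where
  "is_chart X c \<longleftrightarrow> openin X (fst c) \<and> open (chart_image c) \<and>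
     homeomorphic_map (subtopology X (fst c)) (top_of_set (chart_image c)) (snd c)"

definition smooth_atlas :: "'a topology \<Rightarrow> ('a, 'e::euclidean_space) chart set \<Rightarrow> bool" where
  "smooth_atlas X At \<longleftrightarrow> (\<forall>c\<in>At. is_chart X c) \<and> (\<Union>c\<in>At. fst c) = topspace X \<and>
     (\<forall>c\<in>At. \<forall>d\<in>At. smooth_on (snd d \<circ> chart_inv c) (snd c ` (fst c \<inter> fst d)))"

record ('a, 'e) manifold_group = "'a monoid" +
  gtop :: "'a topology"
  atlas :: "('a, 'e) chart set"

locale lie_group = group G for G :: "('a, 'e::euclidean_space) manifold_group" (structure) +
  assumes topspace_gtop: "topspace (gtop G) = carrier G"
    and Hausdorff: "Hausdorff_space (gtop G)"
    and second_countable: "second_countable (gtop G)"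
    and atlas: "smooth_atlas (gtop G) (atlas G)"
    and continuous_mult:
      "continuous_map (prod_topology (gtop G) (gtop G)) (gtop G) (\<lambda>(x, y). x \<otimes> y)"
    and continuous_inv: "continuous_map (gtop G) (gtop G) (\<lambda>x. inv x)"
    and smooth_mult:
      "\<lbrakk>c \<in> atlas G; d \<in> atlas G; e \<in> atlas G\<rbrakk> \<Longrightarrow>
         smooth_on (\<lambda>(u, v). snd e (chart_inv c u \<otimes> chart_inv d v))
           {(u, v). u \<in> chart_image c \<and> v \<in> chart_image d \<and> chart_inv c u \<otimes> chart_inv d v \<in> fst e}"
    and smooth_inv:
      "\<lbrakk>c \<in> atlas G; d \<in> atlas G\<rbrakk> \<Longrightarrow>
         smooth_on (\<lambda>u. snd d (inv (chart_inv c u)))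
           {u. u \<in> chart_image c \<and> inv (chart_inv c u) \<in> fst d}"


section \<open>The Lie algebra\<close>

text \<open>The tangent space at the identity is identified with the model space \<open>'e\<close> by the
  differential of a fixed chart around the identity; a different chart yields an isomorphic
  Lie algebra and the same exponential map up to that isomorphism.\<close>

definition id_chart :: "('a, 'e) manifold_group \<Rightarrow> ('a, 'e) chart" where
  "id_chart G = (SOME c. c \<in> atlas G \<and> \<one>\<^bsub>G\<^esub> \<in> fst c)"

definition coord :: "('a, 'e) manifold_group \<Rightarrow> 'a \<Rightarrow> 'e" where
  "coord G = snd (id_chart G)"

definition coord_inv :: "('a, 'e) manifold_group \<Rightarrow> 'e \<Rightarrow> 'a" where
  "coord_inv G = chart_inv (id_chart G)"

text \<open>\<open>Ad g\<close> is the differential at the identity of conjugation by \<open>g\<close>, and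
  \<open>[X, Y] = ad X Y\<close>, where \<open>ad\<close> is the differential of \<open>Ad\<close> at the identity.\<close>

definition Ad :: "('a, 'e::euclidean_space) manifold_group \<Rightarrow> 'a \<Rightarrow> 'e \<Rightarrow> 'e" where
  "Ad G g = frechet_derivative
     (\<lambda>u. coord G (g \<otimes>\<^bsub>G\<^esub> coord_inv G u \<otimes>\<^bsub>G\<^esub> inv\<^bsub>G\<^esub> g)) (at (coord G \<one>\<^bsub>G\<^esub>))"

definition bracket :: "('a, 'e::euclidean_space) manifold_group \<Rightarrow> 'e \<Rightarrow> 'e \<Rightarrow> 'e" where
  "bracket G X Y = frechet_derivative (\<lambda>u. Ad G (coord_inv G u) Y) (at (coord G \<one>\<^bsub>G\<^esub>)) X"

definition one_parameter_subgroup ::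
  "('a, 'e::euclidean_space) manifold_group \<Rightarrow> 'e \<Rightarrow> (real \<Rightarrow> 'a) \<Rightarrow> bool" where
  "one_parameter_subgroup G X \<gamma> \<longleftrightarrow> continuous_map euclideanreal (gtop G) \<gamma> \<and>
     (\<forall>s t. \<gamma> (s + t) = \<gamma> s \<otimes>\<^bsub>G\<^esub> \<gamma> t) \<and> ((coord G \<circ> \<gamma>) has_vector_derivative X) (at 0)"

definition lie_exp :: "('a, 'e::euclidean_space) manifold_group \<Rightarrow> 'e \<Rightarrow> 'a" where
  "lie_exp G X = (THE \<gamma>. one_parameter_subgroup G X \<gamma>) 1"

text \<open>For a closed subgroup \<open>H\<close>, such as a compact one.\<close>

definition lie_algebra_of :: "('a, 'e::euclidean_space) manifold_group \<Rightarrow> 'a set \<Rightarrow> 'e set" where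
  "lie_algebra_of G H = {X. \<forall>t::real. lie_exp G (t *\<^sub>R X) \<in> H}"

definition killing_form :: "('a, 'e::euclidean_space) manifold_group \<Rightarrow> 'e \<Rightarrow> 'e \<Rightarrow> real" where
  "killing_form G X Y = (\<Sum>b\<in>Basis. bracket G X (bracket G Y b) \<bullet> b)"

definition lie_ideal :: "('a, 'e::euclidean_space) manifold_group \<Rightarrow> 'e set \<Rightarrow> bool" where
  "lie_ideal G I \<longleftrightarrow> subspace I \<and> (\<forall>X. \<forall>Y\<in>I. bracket G X Y \<in> I)"

primrec derived_series ::
  "('a, 'e::euclidean_space) manifold_group \<Rightarrow> 'e set \<Rightarrow> nat \<Rightarrow> 'e set" where
  "derived_series G I 0 = I"
| "derived_series G I (Suc k) =
     span {bracket G X Y | X Y. X \<in> derived_series G I k \<and> Y \<in> derived_series G I k}"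

definition semisimple :: "('a, 'e::euclidean_space) manifold_group \<Rightarrow> bool" where
  "semisimple G \<longleftrightarrow> (\<forall>I. lie_ideal G I \<and> (\<exists>k. derived_series G I k = {0}) \<longrightarrow> I = {0})"

text \<open>No nonzero ideal of the Lie algebra is of compact type. The Killing form of an ideal is the
  restriction of the Killing form of the whole algebra.\<close>

definition noncompact_type :: "('a, 'e::euclidean_space) manifold_group \<Rightarrow> bool" where
  "noncompact_type G \<longleftrightarrow>
     \<not> (\<exists>I. lie_ideal G I \<and> I \<noteq> {0} \<and> (\<forall>X\<in>I. X \<noteq> 0 \<longrightarrow> killing_form G X X < 0))"

definition group_center :: "('a, 'b) monoid_scheme \<Rightarrow> 'a set" where
  "group_center G = {z \<in> carrier G. \<forall>g\<in>carrier G. z \<otimes>\<^bsub>G\<^esub> g = g \<otimes>\<^bsub>G\<^esub> z}"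


section \<open>Cartan decomposition, restricted roots, Weyl group\<close>

definition maximal_compact_subgroup :: "('a, 'e) manifold_group \<Rightarrow> 'a set \<Rightarrow> bool" where
  "maximal_compact_subgroup G K \<longleftrightarrow> subgroup K G \<and> compactin (gtop G) K \<and>
     (\<forall>L. subgroup L G \<and> compactin (gtop G) L \<and> K \<subseteq> L \<longrightarrow> L = K)"

definition cartan_decomposition ::
  "('a, 'e::euclidean_space) manifold_group \<Rightarrow> 'e set \<Rightarrow> 'e set \<Rightarrow> bool" where
  "cartan_decomposition G \<kk> \<pp> \<longleftrightarrow>
     subspace \<kk> \<and> subspace \<pp> \<and> \<kk> \<inter> \<pp> = {0} \<and> span (\<kk> \<union> \<pp>) = UNIV \<and>
     (\<forall>X\<in>\<kk>. \<forall>Y\<in>\<kk>. bracket G X Y \<in> \<kk>) \<and>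
     (\<forall>X\<in>\<kk>. \<forall>Y\<in>\<pp>. bracket G X Y \<in> \<pp>) \<and>
     (\<forall>X\<in>\<pp>. \<forall>Y\<in>\<pp>. bracket G X Y \<in> \<kk>) \<and>
     (\<forall>X\<in>\<kk>. X \<noteq> 0 \<longrightarrow> killing_form G X X < 0) \<and>
     (\<forall>X\<in>\<pp>. X \<noteq> 0 \<longrightarrow> killing_form G X X > 0)"

definition abelian_subspace :: "('a, 'e::euclidean_space) manifold_group \<Rightarrow> 'e set \<Rightarrow> bool" where
  "abelian_subspace G \<aa> \<longleftrightarrow> subspace \<aa> \<and> (\<forall>X\<in>\<aa>. \<forall>Y\<in>\<aa>. bracket G X Y = 0)"

definition maximal_abelian_in ::
  "('a, 'e::euclidean_space) manifold_group \<Rightarrow> 'e set \<Rightarrow> 'e set \<Rightarrow> bool" where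
  "maximal_abelian_in G \<pp> \<aa> \<longleftrightarrow> abelian_subspace G \<aa> \<and> \<aa> \<subseteq> \<pp> \<and>
     (\<forall>\<bb>. abelian_subspace G \<bb> \<and> \<aa> \<subseteq> \<bb> \<and> \<bb> \<subseteq> \<pp> \<longrightarrow> \<bb> = \<aa>)"

definition root_space ::
  "('a, 'e::euclidean_space) manifold_group \<Rightarrow> 'e set \<Rightarrow> ('e \<Rightarrow> real) \<Rightarrow> 'e set" where
  "root_space G \<aa> \<alpha> = {X. \<forall>H\<in>\<aa>. bracket G H X = \<alpha> H *\<^sub>R X}"

text \<open>A linear functional on \<open>\<aa>\<close> is represented by a function that is \<open>undefined\<close> outside \<open>\<aa>\<close>.\<close>

definition restricted_roots ::
  "('a, 'e::euclidean_space) manifold_group \<Rightarrow> 'e set \<Rightarrow> ('e \<Rightarrow> real) set" where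
  "restricted_roots G \<aa> =
     {restrict f \<aa> | f. linear f \<and> (\<exists>H\<in>\<aa>. f H \<noteq> 0) \<and> root_space G \<aa> f \<noteq> {0}}"

text \<open>Positivity with respect to the Weyl chamber of a regular element of \<open>\<aa>\<close>.\<close>

definition positive_root_system ::
  "('a, 'e::euclidean_space) manifold_group \<Rightarrow> 'e set \<Rightarrow> ('e \<Rightarrow> real) set \<Rightarrow> bool" where
  "positive_root_system G \<aa> R \<longleftrightarrow>
     (\<exists>H\<in>\<aa>. (\<forall>\<alpha>\<in>restricted_roots G \<aa>. \<alpha> H \<noteq> 0) \<and> R = {\<alpha> \<in> restricted_roots G \<aa>. \<alpha> H > 0})"

definition simple_roots :: "'e set \<Rightarrow> ('e \<Rightarrow> real) set \<Rightarrow> ('e \<Rightarrow> real) set" where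
  "simple_roots \<aa> R = {\<alpha> \<in> R. \<not> (\<exists>\<beta>\<in>R. \<exists>\<gamma>\<in>R. \<forall>H\<in>\<aa>. \<alpha> H = \<beta> H + \<gamma> H)}"

definition root_vector ::
  "('a, 'e::euclidean_space) manifold_group \<Rightarrow> 'e set \<Rightarrow> ('e \<Rightarrow> real) \<Rightarrow> 'e" where
  "root_vector G \<aa> \<alpha> = (THE X. X \<in> \<aa> \<and> (\<forall>H\<in>\<aa>. killing_form G X H = \<alpha> H))"

definition root_reflection ::
  "('a, 'e::euclidean_space) manifold_group \<Rightarrow> 'e set \<Rightarrow> ('e \<Rightarrow> real) \<Rightarrow> 'e \<Rightarrow> 'e" where
  "root_reflection G \<aa> \<alpha> H =
     H - (2 * \<alpha> H / \<alpha> (root_vector G \<aa> \<alpha>)) *\<^sub>R root_vector G \<aa> \<alpha>"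

definition centralizer_in :: "('a, 'b) monoid_scheme \<Rightarrow> 'a set \<Rightarrow> 'a set \<Rightarrow> 'a set" where
  "centralizer_in G K A = {k \<in> K. \<forall>a\<in>A. k \<otimes>\<^bsub>G\<^esub> a = a \<otimes>\<^bsub>G\<^esub> k}"

definition normalizer_in :: "('a, 'b) monoid_scheme \<Rightarrow> 'a set \<Rightarrow> 'a set \<Rightarrow> 'a set" where
  "normalizer_in G K A = K \<inter> normalizer G A"

text \<open>Length, with respect to the simple reflections, of the Weyl group element represented by
  \<open>t \<in> normalizer_in G K A\<close>. The Weyl group acts faithfully on \<open>\<aa>\<close> through \<open>Ad\<close>.\<close>

definition weyl_length ::
  "('a, 'e::euclidean_space) manifold_group \<Rightarrow> 'e set \<Rightarrow> ('e \<Rightarrow> real) set \<Rightarrow> 'a \<Rightarrow> nat" where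
  "weyl_length G \<aa> R t =
     (LEAST l. \<exists>\<alpha>s. length \<alpha>s = l \<and> set \<alpha>s \<subseteq> simple_roots \<aa> R \<and>
        (\<forall>H\<in>\<aa>. Ad G t H = foldr (root_reflection G \<aa>) \<alpha>s H))"

text \<open>Here \<open>T\<close> is \<open>normalizer_in G K A\<close>.\<close>

definition longest_weyl_representative ::
  "('a, 'e::euclidean_space) manifold_group \<Rightarrow> 'a set \<Rightarrow> 'e set \<Rightarrow> ('e \<Rightarrow> real) set \<Rightarrow> 'a \<Rightarrow> bool" where
  "longest_weyl_representative G T \<aa> R w \<longleftrightarrow>
     w \<in> T \<and> (\<forall>t\<in>T. weyl_length G \<aa> R t \<le> weyl_length G \<aa> R w)"


section \<open>Homogeneous spaces, flats and opposite points\<close>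

definition quotient_topology :: "'a topology \<Rightarrow> ('a \<Rightarrow> 'b) \<Rightarrow> 'b topology" where
  "quotient_topology X f =
     topology (\<lambda>U. U \<subseteq> f ` topspace X \<and> openin X {x \<in> topspace X. f x \<in> U})"

lemma openin_quotient_topology:
  "openin (quotient_topology X f) U \<longleftrightarrow>
     U \<subseteq> f ` topspace X \<and> openin X {x \<in> topspace X. f x \<in> U}"
proof -
  let ?P = "\<lambda>U. U \<subseteq> f ` topspace X \<and> openin X {x \<in> topspace X. f x \<in> U}"
  have "istopology ?P"
    unfolding istopology_def
  proof (intro conjI allI impI)
    fix S T assume "?P S" "?P T"
    moreover have "{x \<in> topspace X. f x \<in> S \<inter> T} =
        {x \<in> topspace X. f x \<in> S} \<inter> {x \<in> topspace X. f x \<in> T}" by auto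
    ultimately show "S \<inter> T \<subseteq> f ` topspace X" "openin X {x \<in> topspace X. f x \<in> S \<inter> T}"
      by auto
  next
    fix \<K> assume K: "\<forall>S\<in>\<K>. ?P S"
    then show "\<Union>\<K> \<subseteq> f ` topspace X" by blast
    have "{x \<in> topspace X. f x \<in> \<Union>\<K>} = \<Union>((\<lambda>S. {x \<in> topspace X. f x \<in> S}) ` \<K>)" by auto
    then show "openin X {x \<in> topspace X. f x \<in> \<Union>\<K>}" using K by auto
  qed
  then show ?thesis
    by (simp add: quotient_topology_def topology_inverse')
qed

lemma quotient_map_quotient_topology: "quotient_map X (quotient_topology X f) f"
proof -
  have "{x \<in> topspace X. f x \<in> f ` topspace X} = topspace X" by auto
  then have "openin (quotient_topology X f) (f ` topspace X)"
    by (simp add: openin_quotient_topology)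
  moreover have "U \<subseteq> f ` topspace X" if "openin (quotient_topology X f) U" for U
    using that by (simp add: openin_quotient_topology)
  ultimately have "topspace (quotient_topology X f) = f ` topspace X"
    by (meson openin_subset openin_topspace subset_antisym)
  then show ?thesis
    by (simp add: quotient_map_def openin_quotient_topology)
qed

definition homogeneous_space :: "('a, 'e) manifold_group \<Rightarrow> 'a set \<Rightarrow> 'a set topology" where
  "homogeneous_space G H = quotient_topology (gtop G) (\<lambda>g. g <#\<^bsub>G\<^esub> H)"

definition canonical_flat :: "('a, 'b) monoid_scheme \<Rightarrow> 'a set \<Rightarrow> 'a set \<Rightarrow> 'a set set" where
  "canonical_flat G K A = {a <#\<^bsub>G\<^esub> K | a. a \<in> A}"

definition translate :: "('a, 'b) monoid_scheme \<Rightarrow> 'a \<Rightarrow> 'a set set \<Rightarrow> 'a set set" where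
  "translate G g F = (\<lambda>C. g <#\<^bsub>G\<^esub> C) ` F"

definition maximal_flats :: "('a, 'b) monoid_scheme \<Rightarrow> 'a set \<Rightarrow> 'a set \<Rightarrow> 'a set set set" where
  "maximal_flats G K A = {translate G g (canonical_flat G K A) | g. g \<in> carrier G}"

definition canonical_flat_boundary ::
  "('a, 'b) monoid_scheme \<Rightarrow> 'a set \<Rightarrow> 'a set \<Rightarrow> 'a set \<Rightarrow> 'a set set" where
  "canonical_flat_boundary G K A P = {t <#\<^bsub>G\<^esub> P | t. t \<in> normalizer_in G K A}"

text \<open>The boundary of \<open>gF\<^sub>A\<close> is \<open>g(\<partial>F\<^sub>A)\<close>, which does not depend on the choice of \<open>g\<close>.\<close>

definition flat_boundary ::
  "('a, 'b) monoid_scheme \<Rightarrow> 'a set \<Rightarrow> 'a set \<Rightarrow> 'a set \<Rightarrow> 'a set set \<Rightarrow> 'a set set" where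
  "flat_boundary G K A P F =
     \<Union>{translate G g (canonical_flat_boundary G K A P) | g.
         g \<in> carrier G \<and> F = translate G g (canonical_flat G K A)}"

definition opposite ::
  "('a, 'b) monoid_scheme \<Rightarrow> 'a set \<Rightarrow> 'a \<Rightarrow> 'a set \<Rightarrow> 'a set \<Rightarrow> bool" where
  "opposite G P w0 x y \<longleftrightarrow>
     (\<exists>g\<in>carrier G. x = g <#\<^bsub>G\<^esub> P \<and> y = g <#\<^bsub>G\<^esub> (w0 <#\<^bsub>G\<^esub> P))"

definition flat_through ::
  "('a, 'b) monoid_scheme \<Rightarrow> 'a set \<Rightarrow> 'a set \<Rightarrow> 'a set \<Rightarrow> 'a set \<Rightarrow> 'a set \<Rightarrow> 'a set set" where
  "flat_through G K A P x y =
     (THE F. F \<in> maximal_flats G K A \<and> x \<in> flat_boundary G K A P F \<and> y \<in> flat_boundary G K A P F)"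

definition admissible_triples ::
  "('a, 'e) manifold_group \<Rightarrow> 'a set \<Rightarrow> 'a set \<Rightarrow> 'a set \<Rightarrow> 'a \<Rightarrow> ('a set \<times> 'a set \<times> 'a set) set" where
  "admissible_triples G K A P w0 =
     {(x, y, z).
        x \<in> topspace (homogeneous_space G P) \<and>
        y \<in> topspace (homogeneous_space G P) \<and>
        z \<in> topspace (homogeneous_space G P) \<and>
        opposite G P w0 x y \<and>
        (\<forall>q \<in> flat_boundary G K A P (flat_through G K A P x y). opposite G P w0 z q)}"

definition triple_space ::
  "('a, 'e) manifold_group \<Rightarrow> 'a set \<Rightarrow> 'a set \<Rightarrow> 'a set \<Rightarrow> 'a \<Rightarrow> ('a set \<times> 'a set \<times> 'a set) topology" where
  "triple_space G K A P w0 =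
     subtopology
       (prod_topology (homogeneous_space G P)
         (prod_topology (homogeneous_space G P) (homogeneous_space G P)))
       (admissible_triples G K A P w0)"

end

theory Submission
  imports Defs "HOL-Complex_Analysis.Conformal_Mappings"
begin

text \<open>By equivariance \<open>\<Phi>\<close> is determined by its values \<open>exp (\<Psi> h) K \<in> F\<^sub>A\<close> on the triples \<open>(P, w\<^sub>0P, hP)\<close>,
  in which \<open>hP\<close> is opposite to \<open>tP\<close> for all \<open>t \<in> T\<close>, and one needs a continuous \<open>\<Psi>\<close> with values in \<open>\<aa>\<close>
  that is invariant under \<open>P\<close> from the right and satisfies \<open>\<Psi> (mah) = \<Psi> h + log a\<close> for \<open>m \<in> M\<close>, \<open>a \<in> A\<close>.
  For a highest root \<open>\<alpha>\<close> and a root \<open>\<mu>\<close> in its Weyl orbit let \<open>c\<^sub>\<alpha>\<^sub>\<mu>(h)\<close> be the largest squared length of the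
  \<open>\<mu>\<close>-component of \<open>Ad h e\<close>, where \<open>e\<close> runs over the unit vectors of the root space of \<open>\<alpha>\<close>. It is positive
  because of the opposition assumption, it is multiplied by \<open>exp (2 \<alpha> (log a))\<close> when \<open>h\<close> is replaced by \<open>hman\<close>
  (\<open>N\<close> fixes the root space of \<open>\<alpha>\<close>), and by \<open>exp (2 \<mu> (log a))\<close> when \<open>h\<close> is replaced by \<open>mah\<close>. Hence the sum of
  \<open>(\<mu> - \<nu>) (ln c\<^sub>\<alpha>\<^sub>\<mu>(h) - ln c\<^sub>\<alpha>\<^sub>\<nu>(h)) / 2\<close> over all \<open>\<alpha>, \<mu>, \<nu>\<close> is \<open>P\<close>-invariant, and multiplying \<open>h\<close> by \<open>ma\<close> from the
  left adds to it the value at \<open>log a\<close> of the positive definite operator \<open>H \<mapsto> \<Sum> (\<mu> H - \<nu> H) (\<mu> - \<nu>)\<close> of \<open>\<aa>\<close>;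
  applying the inverse operator gives \<open>\<Psi>\<close>.

  All Lie theory is reached through \<open>Ad\<close>: the Cartan decomposition makes \<open>ad\<close> injective and all derivations
  inner, so that near \<open>1\<close> the logarithm of \<open>Ad g\<close> is \<open>ad X\<close> with \<open>g = exp X\<close>, and no differential equation
  has to be solved.\<close>

section \<open>Charts and the adjoint representation\<close>

text \<open>The supremum over unit vectors is forced by the root spaces: they may have dimension
  above one and \<open>M\<close> acts on them by isometries, so a single vector would not give an
  \<open>M\<close>-invariant quantity. Differences are taken within one Weyl orbit because the
  factor contributed by \<open>A\<close> from the right depends on \<alpha> alone and cancels there;
  that they still determine a point of \<open>aa\<close> rests on \<open>w0\<close> reversing the
  positive roots.

  The chief obstacle is this last property, since \<open>w0\<close> is only given as longest with
  respect to words in simple reflections. It requires that an element of \<open>T\<close> preserving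
  the positive roots acts trivially on \<open>aa\<close>, a fact that depends on the connectedness
  of \<open>G\<close>; it is reached by an identity theorem for determinants along one-parameter
  subgroups. Continuity of the final map requires in addition that nearby opposite pairs be
  represented by nearby group elements.\<close>

lemma smooth_on_differentiable:
  assumes "smooth_on f S" "x \<in> S"
  shows "f differentiable (at x)"
    and "(\<lambda>x. frechet_derivative f (at x) v) differentiable (at x)"
proof -
  have "Ck_on (Suc (Suc 0)) f S" using assms(1) by (auto simp: smooth_on_def)
  then show "f differentiable (at x)"
    and "(\<lambda>x. frechet_derivative f (at x) v) differentiable (at x)"
    using assms(2) by auto
qed

context lie_group
begin

abbreviation gT where "gT \<equiv> gtop G"

lemma chart_facts:
  assumes "c \<in> atlas G"
  shows "openin gT (fst c)" "open (chart_image c)" "fst c \<subseteq> carrier G"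
    and "x \<in> fst c \<Longrightarrow> chart_inv c (snd c x) = x"
    and "x \<in> fst c \<Longrightarrow> snd c x \<in> chart_image c"
    and "v \<in> chart_image c \<Longrightarrow> chart_inv c v \<in> fst c"
    and "v \<in> chart_image c \<Longrightarrow> snd c (chart_inv c v) = v"
    and "continuous_map (subtopology gT (fst c)) euclidean (snd c)"
    and "continuous_map (top_of_set (chart_image c)) gT (chart_inv c)"
proof -
  have ch: "is_chart gT c" using atlas assms unfolding smooth_atlas_def by blast
  then have op: "openin gT (fst c)" and oi: "open (chart_image c)"
    and hm: "homeomorphic_map (subtopology gT (fst c)) (top_of_set (chart_image c)) (snd c)"
    unfolding is_chart_def by auto
  show "openin gT (fst c)" "open (chart_image c)" by fact+
  show sub: "fst c \<subseteq> carrier G" using op openin_subset topspace_gtop by blast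
  have ts: "topspace (subtopology gT (fst c)) = fst c"
    using sub topspace_gtop by auto
  have inj: "inj_on (snd c) (fst c)"
    using hm homeomorphic_imp_injective_map ts by fastforce
  show 1: "x \<in> fst c \<Longrightarrow> chart_inv c (snd c x) = x" for x
    using inj by (simp add: chart_inv_def)
  show 2: "x \<in> fst c \<Longrightarrow> snd c x \<in> chart_image c" for x
    by (simp add: chart_image_def)
  show 3: "v \<in> chart_image c \<Longrightarrow> chart_inv c v \<in> fst c" for v
    by (simp add: chart_inv_def chart_image_def inv_into_into)
  show 4: "v \<in> chart_image c \<Longrightarrow> snd c (chart_inv c v) = v" for v
    by (simp add: chart_inv_def chart_image_def f_inv_into_f)
  show "continuous_map (subtopology gT (fst c)) euclidean (snd c)"
    using homeomorphic_imp_continuous_map[OF hm] continuous_map_into_fulltopology by blast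
  obtain g where g: "homeomorphic_maps (subtopology gT (fst c)) (top_of_set (chart_image c)) (snd c) g"
    using hm homeomorphic_map_maps by blast
  have "continuous_map (top_of_set (chart_image c)) (subtopology gT (fst c)) (chart_inv c)"
  proof (rule continuous_map_eq)
    show "continuous_map (top_of_set (chart_image c)) (subtopology gT (fst c)) g"
      using g by (auto simp: homeomorphic_maps_def)
    fix v assume "v \<in> topspace (top_of_set (chart_image c))"
    then have v: "v \<in> chart_image c" by simp
    then have "g (snd c (chart_inv c v)) = chart_inv c v"
      using g 3 ts by (auto simp: homeomorphic_maps_def)
    then show "g v = chart_inv c v" using 4 v by simp
  qed
  then show "continuous_map (top_of_set (chart_image c)) gT (chart_inv c)"
    using continuous_map_into_fulltopology by blast
qed

lemma open_chart_preimage: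
  assumes c: "c \<in> atlas G" and W: "openin gT W"
  shows "open {v \<in> chart_image c. chart_inv c v \<in> W}"
proof -
  have "openin (top_of_set (chart_image c)) {v \<in> topspace (top_of_set (chart_image c)). chart_inv c v \<in> W}"
    using chart_facts(9)[OF c] W openin_continuous_map_preimage by blast
  then show ?thesis using chart_facts(2)[OF c] openin_open_trans
    by (metis (no_types, lifting) Collect_cong topspace_euclidean_subtopology)
qed

lemma open_chart_image:
  assumes c: "c \<in> atlas G" and W: "open W"
  shows "openin gT {x \<in> fst c. snd c x \<in> W}"
proof -
  have "openin (subtopology gT (fst c)) {x \<in> topspace (subtopology gT (fst c)). snd c x \<in> W}"
    using openin_continuous_map_preimage[OF chart_facts(8)[OF c], of W] W by simp
  moreover have "topspace (subtopology gT (fst c)) = fst c"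
    using chart_facts(3)[OF c] topspace_gtop by auto
  ultimately show ?thesis using chart_facts(1)[OF c] openin_trans_full by fastforce
qed

lemma chart_at:
  assumes "x \<in> carrier G" obtains c where "c \<in> atlas G" "x \<in> fst c"
  using assms atlas topspace_gtop unfolding smooth_atlas_def by blast

abbreviation dom0 where "dom0 \<equiv> fst (id_chart G)"
abbreviation img0 where "img0 \<equiv> chart_image (id_chart G)"
abbreviation o0 where "o0 \<equiv> coord G \<one>"

lemma id_chart: "id_chart G \<in> atlas G" "\<one> \<in> dom0"
proof -
  obtain c where "c \<in> atlas G \<and> \<one> \<in> fst c" using chart_at[OF one_closed] by blast
  then have "id_chart G \<in> atlas G \<and> \<one> \<in> dom0"
    unfolding id_chart_def by (rule someI)
  then show "id_chart G \<in> atlas G" "\<one> \<in> dom0" by auto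
qed

lemma coord_facts:
  shows "openin gT dom0" "open img0" "dom0 \<subseteq> carrier G"
    and "x \<in> dom0 \<Longrightarrow> coord_inv G (coord G x) = x"
    and "x \<in> dom0 \<Longrightarrow> coord G x \<in> img0"
    and "v \<in> img0 \<Longrightarrow> coord_inv G v \<in> dom0"
    and "v \<in> img0 \<Longrightarrow> coord_inv G v \<in> carrier G"
    and "v \<in> img0 \<Longrightarrow> coord G (coord_inv G v) = v"
    and "openin gT W \<Longrightarrow> open {v \<in> img0. coord_inv G v \<in> W}"
    and "open V \<Longrightarrow> openin gT {x \<in> dom0. coord G x \<in> V}"
    and "o0 \<in> img0" "coord_inv G o0 = \<one>"
  using chart_facts[OF id_chart(1)] id_chart(2) open_chart_preimage[OF id_chart(1)]
    open_chart_image[OF id_chart(1)]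
  by (auto simp: coord_def coord_inv_def)

section \<open>Translations and conjugation\<close>

lemma continuous_left_translation:
  assumes "g \<in> carrier G" shows "continuous_map gT gT (\<lambda>x. g \<otimes> x)"
proof -
  have "continuous_map gT (prod_topology gT gT) (\<lambda>x. (g, x))"
    using assms topspace_gtop by (simp add: continuous_map_paired)
  from continuous_map_compose[OF this continuous_mult] show ?thesis
    by (simp add: o_def)
qed

lemma continuous_right_translation:
  assumes "g \<in> carrier G" shows "continuous_map gT gT (\<lambda>x. x \<otimes> g)"
proof -
  have "continuous_map gT (prod_topology gT gT) (\<lambda>x. (x, g))"
    using assms topspace_gtop by (simp add: continuous_map_paired)
  from continuous_map_compose[OF this continuous_mult] show ?thesis
    by (simp add: o_def)
qed

lemma openin_preimage:
  assumes "continuous_map gT gT f" "openin gT W"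
  shows "openin gT {x \<in> carrier G. f x \<in> W}"
  using openin_continuous_map_preimage[OF assms] topspace_gtop by simp

text \<open>Smoothness is assumed for the product in two variables; freezing one of them at the
  coordinate of \<open>g\<close>, in a chart around \<open>g\<close>, gives the translation.\<close>

lemma chart_left_translation_differentiable:
  assumes "g \<in> carrier G" "c \<in> atlas G" "e \<in> atlas G" "x \<in> fst c" "g \<otimes> x \<in> fst e"
  shows "(\<lambda>v. snd e (g \<otimes> chart_inv c v)) differentiable (at (snd c x))"
proof -
  obtain d where d: "d \<in> atlas G" "g \<in> fst d" using chart_at assms(1) by blast
  have "(\<lambda>(u, v). snd e (chart_inv d u \<otimes> chart_inv c v)) differentiable (at (snd d g, snd c x))"
    by (rule smooth_on_differentiable(1)[OF smooth_mult[OF d(1) assms(2,3)]])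
      (use assms d chart_facts in auto)
  then have "((\<lambda>(u, v). snd e (chart_inv d u \<otimes> chart_inv c v)) \<circ> (\<lambda>v. (snd d g, v)))
     differentiable (at (snd c x))"
    by (intro differentiable_chain_at) (auto intro!: differentiableI has_derivative_Pair)
  then show ?thesis using chart_facts(4)[OF d] by (simp add: o_def)
qed

lemma chart_right_translation_differentiable:
  assumes "g \<in> carrier G" "c \<in> atlas G" "e \<in> atlas G" "x \<in> fst c" "x \<otimes> g \<in> fst e"
  shows "(\<lambda>v. snd e (chart_inv c v \<otimes> g)) differentiable (at (snd c x))"
proof -
  obtain d where d: "d \<in> atlas G" "g \<in> fst d" using chart_at assms(1) by blast
  have "(\<lambda>(u, v). snd e (chart_inv c u \<otimes> chart_inv d v)) differentiable (at (snd c x, snd d g))"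
    by (rule smooth_on_differentiable(1)[OF smooth_mult[OF assms(2) d(1) assms(3)]])
      (use assms d chart_facts in auto)
  then have "((\<lambda>(u, v). snd e (chart_inv c u \<otimes> chart_inv d v)) \<circ> (\<lambda>v. (v, snd d g)))
     differentiable (at (snd c x))"
    by (intro differentiable_chain_at) (auto intro!: differentiableI has_derivative_Pair)
  then show ?thesis using chart_facts(4)[OF d] by (simp add: o_def)
qed

definition conj_coord where
  "conj_coord g u = coord G (g \<otimes> coord_inv G u \<otimes> inv g)"

lemma Ad_def': "Ad G g = frechet_derivative (conj_coord g) (at o0)"
  unfolding Ad_def conj_coord_def ..

text \<open>\<open>Ad\<close> is defined by \<open>frechet_derivative\<close>, which is informative
  only once differentiability is known. The intermediate point \<open>g \<otimes> x\<close> leaves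
  the identity chart, so it is read in a chart \<open>d\<close> around \<open>g\<close>.\<close>

lemma has_derivative_Ad:
  assumes g: "g \<in> carrier G"
  shows "(conj_coord g has_derivative Ad G g) (at o0)"
proof -
  obtain d where d: "d \<in> atlas G" "g \<in> fst d" using chart_at g by blast
  have 1: "(\<lambda>v. snd d (g \<otimes> coord_inv G v)) differentiable (at o0)"
    using chart_left_translation_differentiable[OF g id_chart(1) d(1) id_chart(2)] d g
    by (simp add: coord_def coord_inv_def)
  have 2: "(\<lambda>w. coord G (chart_inv d w \<otimes> inv g)) differentiable (at (snd d g))"
    using chart_right_translation_differentiable[of "inv g" d "id_chart G" g] d g id_chart
    by (simp add: coord_def)
  have 3: "((\<lambda>w. coord G (chart_inv d w \<otimes> inv g)) \<circ> (\<lambda>v. snd d (g \<otimes> coord_inv G v)))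
      differentiable (at o0)"
    by (rule differentiable_chain_at[OF 1]) (use 2 g in \<open>simp add: coord_facts\<close>)
  \<comment> \<open>On this open set the intermediate point stays in the chart \<open>d\<close>, and
    the two factors compose to conjugation.\<close>
  let ?S = "{v \<in> img0. coord_inv G v \<in> {x \<in> carrier G. g \<otimes> x \<in> fst d}}"
  have op: "open ?S"
    by (intro coord_facts openin_preimage continuous_left_translation g chart_facts d)
  have mem: "o0 \<in> ?S" using g d by (simp add: coord_facts)
  obtain F where F: "((\<lambda>w. coord G (chart_inv d w \<otimes> inv g)) \<circ> (\<lambda>v. snd d (g \<otimes> coord_inv G v))
      has_derivative F) (at o0)"
    using 3 by (auto simp: differentiable_def)
  have "(conj_coord g has_derivative F) (at o0)"
    by (rule has_derivative_transform_within_open[OF F op mem])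
      (use d in \<open>auto simp: conj_coord_def chart_facts(4)\<close>)
  then show ?thesis
    by (metis Ad_def' frechet_derivative_at)
qed

lemma linear_Ad: "g \<in> carrier G \<Longrightarrow> linear (Ad G g)"
  using has_derivative_Ad has_derivative_linear by blast

lemma conj_coord_o0: "g \<in> carrier G \<Longrightarrow> conj_coord g o0 = o0"
  by (simp add: conj_coord_def coord_facts)

lemma continuous_conj:
  assumes "g \<in> carrier G" shows "continuous_map gT gT (\<lambda>x. g \<otimes> x \<otimes> inv g)"
  using continuous_map_compose[OF continuous_left_translation[OF assms]
      continuous_right_translation[of "inv g"]] assms
  by (simp add: o_def)

lemma open_conj_dom:
  assumes "g \<in> carrier G"
  shows "open {v \<in> img0. g \<otimes> coord_inv G v \<otimes> inv g \<in> dom0}"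
proof -
  have "open {v \<in> img0. coord_inv G v \<in> {x \<in> carrier G. g \<otimes> x \<otimes> inv g \<in> dom0}}"
    by (intro coord_facts openin_preimage continuous_conj assms)
  moreover have "{v \<in> img0. coord_inv G v \<in> {x \<in> carrier G. g \<otimes> x \<otimes> inv g \<in> dom0}}
     = {v \<in> img0. g \<otimes> coord_inv G v \<otimes> inv g \<in> dom0}"
    by (auto simp: coord_facts)
  ultimately show ?thesis by simp
qed

text \<open>Chain rule for conjugations; in coordinates they compose where the conjugate by
  \<open>h\<close> remains in the identity chart, which is an open set around
  \<open>o0\<close>.\<close>

lemma Ad_mult:
  assumes g: "g \<in> carrier G" and h: "h \<in> carrier G"
  shows "Ad G (g \<otimes> h) = Ad G g \<circ> Ad G h"
proof -
  have 1: "(conj_coord g \<circ> conj_coord h has_derivative Ad G g \<circ> Ad G h) (at o0)"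
    by (rule diff_chain_at) (use has_derivative_Ad g h conj_coord_o0 in auto)
  have "(conj_coord (g \<otimes> h) has_derivative Ad G g \<circ> Ad G h) (at o0)"
  proof (rule has_derivative_transform_within_open[OF 1 open_conj_dom[OF h]])
    show "o0 \<in> {v \<in> img0. h \<otimes> coord_inv G v \<otimes> inv h \<in> dom0}"
      using h id_chart by (simp add: coord_facts)
    fix v assume "v \<in> {v \<in> img0. h \<otimes> coord_inv G v \<otimes> inv h \<in> dom0}"
    then show "(conj_coord g \<circ> conj_coord h) v = conj_coord (g \<otimes> h) v"
      using g h by (auto simp: conj_coord_def coord_facts inv_mult_group m_assoc)
  qed
  then show ?thesis using has_derivative_Ad[of "g \<otimes> h"] g h
    by (simp add: has_derivative_unique)
qed

lemma Ad_one: "Ad G \<one> = id"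
proof -
  have "(conj_coord \<one> has_derivative id) (at o0)"
    by (rule has_derivative_transform_within_open[OF has_derivative_id coord_facts(2,11)])
      (auto simp: conj_coord_def coord_facts)
  then show ?thesis using has_derivative_Ad[of \<one>] by (simp add: has_derivative_unique)
qed

lemma Ad_inv:
  assumes "g \<in> carrier G"
  shows "Ad G (inv g) (Ad G g X) = X" "Ad G g (Ad G (inv g) X) = X"
  using Ad_mult[of "inv g" g] Ad_mult[of g "inv g"] assms Ad_one
  by (metis inv_closed l_inv o_apply id_apply, metis inv_closed r_inv o_apply id_apply)

text \<open>In the coordinates of the identity chart \<open>Ad u = D\<^sub>1 m (u, \<iota> u) \<circ> D\<^sub>2 m (u, 1)\<close>, and
  the partial derivatives of the multiplication \<open>m\<close> are differentiable.\<close>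

lemma Ad_differentiable: "(\<lambda>u. Ad G (coord_inv G u) Y) differentiable (at o0)"
proof -
  define m where "m = (\<lambda>(u, v). coord G (coord_inv G u \<otimes> coord_inv G v))"
  define j where "j u = coord G (inv (coord_inv G u))" for u
  define Om where "Om = {(u, v). u \<in> img0 \<and> v \<in> img0 \<and> coord_inv G u \<otimes> coord_inv G v \<in> dom0}"
  define Oj where "Oj = {u. u \<in> img0 \<and> inv (coord_inv G u) \<in> dom0}"
  have sm: "smooth_on m Om"
    using smooth_mult[OF id_chart(1) id_chart(1) id_chart(1)]
    by (simp add: m_def Om_def coord_def coord_inv_def)
  have sj: "smooth_on j Oj"
    using smooth_inv[OF id_chart(1) id_chart(1)]
    by (simp add: j_def[abs_def] Oj_def coord_def coord_inv_def)
  have "open {v \<in> img0. coord_inv G v \<in> {x \<in> carrier G. inv x \<in> dom0}}"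
    by (intro coord_facts openin_preimage continuous_inv)
  moreover have "{v \<in> img0. coord_inv G v \<in> {x \<in> carrier G. inv x \<in> dom0}} = Oj"
    by (auto simp: coord_facts Oj_def)
  ultimately have opj: "open Oj" by simp
  have o0j: "o0 \<in> Oj" using id_chart by (simp add: Oj_def coord_facts)
  let ?D = "\<lambda>p. frechet_derivative m (at p)"
  have Dm: "(m has_derivative ?D p) (at p)" if "p \<in> Om" for p
    using smooth_on_differentiable(1)[OF sm that] frechet_derivative_works by blast
  have Adeq: "Ad G (coord_inv G u) Y = ?D (u, j u) (?D (u, o0) (0, Y), 0)" if u: "u \<in> Oj" for u
  proof -
    have ui: "u \<in> img0" "inv (coord_inv G u) \<in> dom0" using u by (auto simp: Oj_def)
    have p1: "(u, o0) \<in> Om" using ui by (simp add: Om_def coord_facts)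
    have p2: "(u, j u) \<in> Om" using ui id_chart by (simp add: Om_def coord_facts j_def)
    have mu: "m (u, o0) = u" using ui by (simp add: m_def coord_facts)
    have e1: "((\<lambda>v. m (u, v)) has_derivative (\<lambda>Y. ?D (u, o0) (0, Y))) (at o0)"
      using diff_chain_at[OF has_derivative_Pair[OF has_derivative_const has_derivative_ident] Dm[OF p1]]
      by (simp add: o_def)
    have e2: "((\<lambda>w. m (w, j u)) has_derivative (\<lambda>W. ?D (u, j u) (W, 0))) (at u)"
      using diff_chain_at[OF has_derivative_Pair[OF has_derivative_ident has_derivative_const] Dm[OF p2]]
      by (simp add: o_def)
    have e3: "((\<lambda>w. m (w, j u)) \<circ> (\<lambda>v. m (u, v)) has_derivative
        (\<lambda>W. ?D (u, j u) (W, 0)) \<circ> (\<lambda>Y. ?D (u, o0) (0, Y))) (at o0)"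
      by (rule diff_chain_at[OF e1]) (use e2 mu in simp)
    let ?S = "{v \<in> img0. coord_inv G v \<in> {x \<in> carrier G. coord_inv G u \<otimes> x \<in> dom0}}"
    have opS: "open ?S"
      by (intro coord_facts openin_preimage continuous_left_translation ui)
    have memS: "o0 \<in> ?S" using ui by (simp add: coord_facts)
    have "(conj_coord (coord_inv G u) has_derivative
        (\<lambda>W. ?D (u, j u) (W, 0)) \<circ> (\<lambda>Y. ?D (u, o0) (0, Y))) (at o0)"
      by (rule has_derivative_transform_within_open[OF e3 opS memS])
        (use ui in \<open>auto simp: conj_coord_def m_def j_def coord_facts\<close>)
    then have "Ad G (coord_inv G u) = (\<lambda>W. ?D (u, j u) (W, 0)) \<circ> (\<lambda>Y. ?D (u, o0) (0, Y))"
      using has_derivative_Ad[of "coord_inv G u"] ui by (simp add: coord_facts has_derivative_unique)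
    then show ?thesis by simp
  qed
  define A where "A b u = ?D (u, j u) (b, 0)" for b u
  define W where "W u = ?D (u, o0) (0, Y)" for u
  have jd: "j differentiable (at o0)" by (rule smooth_on_differentiable(1)[OF sj o0j])
  have j0: "j o0 = o0" by (simp add: j_def coord_facts)
  have om0: "(o0, o0) \<in> Om" using id_chart by (simp add: Om_def coord_facts)
  have Ad1: "A b differentiable (at o0)" for b
  proof -
    have "(\<lambda>u. (u, j u)) differentiable (at o0)"
      using jd has_derivative_Pair[OF has_derivative_ident] unfolding differentiable_def by blast
    then have "((\<lambda>p. ?D p (b, 0)) \<circ> (\<lambda>u. (u, j u))) differentiable (at o0)"
      by (rule differentiable_chain_at) (use smooth_on_differentiable(2)[OF sm om0] j0 in simp)
    then show ?thesis by (simp add: A_def[abs_def] o_def)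
  qed
  have Wd: "W differentiable (at o0)"
  proof -
    have "(\<lambda>u. (u, o0)) differentiable (at o0)"
      using has_derivative_Pair[OF has_derivative_ident has_derivative_const] unfolding differentiable_def by blast
    then have "((\<lambda>p. ?D p (0, Y)) \<circ> (\<lambda>u. (u, o0))) differentiable (at o0)"
      by (rule differentiable_chain_at) (use smooth_on_differentiable(2)[OF sm om0] in simp)
    then show ?thesis by (simp add: W_def[abs_def] o_def)
  qed
  \<comment> \<open>\<open>smooth_on\<close> makes \<open>p \<mapsto> ?D p v\<close> differentiable
    for a fixed vector \<open>v\<close>, while base point and vector both move with \<open>u\<close>
    here; expanding \<open>W u\<close> in the basis separates the two.\<close>
  have sumd: "(\<lambda>u. \<Sum>b\<in>Basis. (W u \<bullet> b) *\<^sub>R A b u) differentiable (at o0)"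
    by (intro differentiable_sum differentiable_scaleR differentiable_inner
        Ad1 Wd differentiable_const ballI finite_Basis)
  have eq: "Ad G (coord_inv G u) Y = (\<Sum>b\<in>Basis. (W u \<bullet> b) *\<^sub>R A b u)" if u: "u \<in> Oj" for u
  proof -
    have p2: "(u, j u) \<in> Om" using u id_chart by (auto simp: Om_def coord_facts j_def Oj_def)
    have lin: "linear (?D (u, j u))" using Dm[OF p2] has_derivative_linear by blast
    have "(W u, 0::'e) = (\<Sum>b\<in>Basis. (W u \<bullet> b) *\<^sub>R (b, 0))"
      by (simp add: sum_prod flip: sum_prod) (simp add: prod_eq_iff fst_sum snd_sum euclidean_representation)
    then have "?D (u, j u) (W u, 0) = (\<Sum>b\<in>Basis. (W u \<bullet> b) *\<^sub>R ?D (u, j u) (b, 0))"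
      by (simp only: linear_sum[OF lin] linear_scale[OF lin])
    then show ?thesis using Adeq[OF u] by (simp add: A_def W_def)
  qed
  obtain F where F: "((\<lambda>u. \<Sum>b\<in>Basis. (W u \<bullet> b) *\<^sub>R A b u) has_derivative F) (at o0)"
    using sumd by (auto simp: differentiable_def)
  have "((\<lambda>u. Ad G (coord_inv G u) Y) has_derivative F) (at o0)"
    by (rule has_derivative_transform_within_open[OF F opj o0j]) (simp add: eq)
  then show ?thesis by (auto simp: differentiable_def)
qed

section \<open>The Lie bracket\<close>

lemma has_derivative_bracket:
  "((\<lambda>u. Ad G (coord_inv G u) Y) has_derivative (\<lambda>X. bracket G X Y)) (at o0)"
  using Ad_differentiable frechet_derivative_works unfolding bracket_def by fastforce

lemma linear_bracket_left: "linear (\<lambda>X. bracket G X Y)"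
  using has_derivative_bracket has_derivative_linear by blast

lemma linear_bracket_right: "linear (bracket G X)"
proof
  fix Y Z :: 'e and r :: real
  have ev: "eventually (\<lambda>u. u \<in> img0) (at o0)"
    by (rule eventually_at_in_open'[OF coord_facts(2,11)])
  have add: "Ad G (coord_inv G u) (Y + Z) = Ad G (coord_inv G u) Y + Ad G (coord_inv G u) Z"
    and sc: "Ad G (coord_inv G u) (r *\<^sub>R Y) = r *\<^sub>R Ad G (coord_inv G u) Y" if "u \<in> img0" for u
    using linear_Ad[of "coord_inv G u"] that by (simp_all add: coord_facts linear_add linear_scale)
  have "((\<lambda>u. Ad G (coord_inv G u) (Y + Z)) has_derivative (\<lambda>X. bracket G X Y + bracket G X Z)) (at o0)"
    by (rule has_derivative_transform_within_open[OF has_derivative_add[OF has_derivative_bracket has_derivative_bracket]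
          coord_facts(2,11)]) (simp add: add)
  then show "bracket G X (Y + Z) = bracket G X Y + bracket G X Z"
    using has_derivative_bracket[of "Y + Z"] by (metis has_derivative_unique)
  have "((\<lambda>u. Ad G (coord_inv G u) (r *\<^sub>R Y)) has_derivative (\<lambda>X. r *\<^sub>R bracket G X Y)) (at o0)"
    by (rule has_derivative_transform_within_open[OF has_derivative_scaleR_right[OF has_derivative_bracket]
          coord_facts(2,11)]) (simp add: sc)
  then show "bracket G X (r *\<^sub>R Y) = r *\<^sub>R bracket G X Y"
    using has_derivative_bracket[of "r *\<^sub>R Y"] by (metis has_derivative_unique)
qed

lemmas br_simps = linear_add[OF linear_bracket_left] linear_add[OF linear_bracket_right]
  linear_scale[OF linear_bracket_left] linear_scale[OF linear_bracket_right]
  linear_0[OF linear_bracket_left] linear_0[OF linear_bracket_right]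
  linear_diff[OF linear_bracket_left] linear_diff[OF linear_bracket_right]
  linear_neg[OF linear_bracket_left] linear_neg[OF linear_bracket_right]

lemma bounded_bilinear_bracket: "bounded_bilinear (bracket G)"
  using linear_bracket_left linear_bracket_right
  by (simp add: bilinear_conv_bounded_bilinear[symmetric] bilinear_def)

text \<open>Differentiate \<open>Ad (g x inv g) (Ad g Y) = Ad g (Ad x Y)\<close> with respect to
  \<open>x\<close> at the identity.\<close>

lemma Ad_bracket:
  assumes g: "g \<in> carrier G"
  shows "Ad G g (bracket G X Y) = bracket G (Ad G g X) (Ad G g Y)"
proof -
  have bl: "bounded_linear (Ad G g)" using linear_Ad[OF g] by (simp add: linear_conv_bounded_linear)
  have 1: "((\<lambda>u. Ad G g (Ad G (coord_inv G u) Y)) has_derivative (\<lambda>X. Ad G g (bracket G X Y))) (at o0)"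
    by (rule bounded_linear.has_derivative[OF bl has_derivative_bracket])
  have 2: "((\<lambda>u. Ad G (coord_inv G u) (Ad G g Y)) \<circ> conj_coord g has_derivative
      (\<lambda>X. bracket G X (Ad G g Y)) \<circ> Ad G g) (at o0)"
    by (rule diff_chain_at[OF has_derivative_Ad[OF g]]) (use has_derivative_bracket conj_coord_o0[OF g] in simp)
  have "((\<lambda>u. Ad G g (Ad G (coord_inv G u) Y)) has_derivative (\<lambda>X. bracket G X (Ad G g Y)) \<circ> Ad G g) (at o0)"
  proof (rule has_derivative_transform_within_open[OF 2 open_conj_dom[OF g]])
    show "o0 \<in> {v \<in> img0. g \<otimes> coord_inv G v \<otimes> inv g \<in> dom0}"
      using g id_chart by (simp add: coord_facts)
    fix v assume v: "v \<in> {v \<in> img0. g \<otimes> coord_inv G v \<otimes> inv g \<in> dom0}"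
    then have vc: "coord_inv G v \<in> carrier G" by (simp add: coord_facts)
    have "Ad G (g \<otimes> coord_inv G v \<otimes> inv g) (Ad G g Y) = Ad G g (Ad G (coord_inv G v) Y)"
      using g vc by (simp add: Ad_mult Ad_inv)
    then show "((\<lambda>u. Ad G (coord_inv G u) (Ad G g Y)) \<circ> conj_coord g) v = Ad G g (Ad G (coord_inv G v) Y)"
      using v by (simp add: conj_coord_def coord_facts)
  qed
  from has_derivative_unique[OF this 1] show ?thesis by (metis o_apply)
qed

lemma Leibniz:
  "bracket G X (bracket G Y Z) = bracket G (bracket G X Y) Z + bracket G Y (bracket G X Z)"
proof -
  have 1: "((\<lambda>u. bracket G (Ad G (coord_inv G u) Y) (Ad G (coord_inv G u) Z)) has_derivative
     (\<lambda>X. bracket G (Ad G (coord_inv G o0) Y) (bracket G X Z) + bracket G (bracket G X Y) (Ad G (coord_inv G o0) Z))) (at o0)"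
    by (rule bounded_bilinear.FDERIV[OF bounded_bilinear_bracket has_derivative_bracket has_derivative_bracket])
  have "((\<lambda>u. Ad G (coord_inv G u) (bracket G Y Z)) has_derivative
     (\<lambda>X. bracket G (Ad G (coord_inv G o0) Y) (bracket G X Z) + bracket G (bracket G X Y) (Ad G (coord_inv G o0) Z))) (at o0)"
    by (rule has_derivative_transform_within_open[OF 1 coord_facts(2,11)])
      (simp add: Ad_bracket coord_facts)
  from has_derivative_unique[OF this has_derivative_bracket]
  have "bracket G X (bracket G Y Z) = bracket G Y (bracket G X Z) + bracket G (bracket G X Y) Z"
    by (simp add: coord_facts Ad_one fun_eq_iff)
  then show ?thesis by simp
qed

text \<open>Continuity at the identity is carried to \<open>g\<close> by
  \<open>Ad x = Ad g \<circ> Ad (inv g \<otimes> x)\<close>.\<close>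

lemma continuous_Ad: "continuous_map gT euclidean (\<lambda>g. Ad G g Y)"
  unfolding continuous_map_atin
proof (intro ballI)
  fix g assume "g \<in> topspace gT"
  then have g: "g \<in> carrier G" using topspace_gtop by simp
  have c0: "isCont (\<lambda>u. Ad G (coord_inv G u) Y) o0"
    using Ad_differentiable differentiable_imp_continuous_within by blast
  have bl: "bounded_linear (Ad G g)" using linear_Ad[OF g] by (simp add: linear_conv_bounded_linear)
  have c1: "isCont (\<lambda>u. Ad G g (Ad G (coord_inv G u) Y)) o0"
    by (intro bounded_linear.isCont[OF bl] c0)
  show "limitin euclidean (\<lambda>g. Ad G g Y) (Ad G g Y) (atin gT g)"
    unfolding limitin_def
  proof (intro conjI allI impI)
    fix U assume "openin euclidean U \<and> Ad G g Y \<in> U"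
    then have U: "open U" "Ad G g Y \<in> U" by auto
    then obtain S where S: "open S" "o0 \<in> S" "\<And>u. u \<in> S \<Longrightarrow> Ad G g (Ad G (coord_inv G u) Y) \<in> U"
      using c1 unfolding continuous_at_open by (metis Ad_one coord_facts(12) id_apply)
    let ?W = "{x \<in> carrier G. inv g \<otimes> x \<in> {x \<in> dom0. coord G x \<in> S}}"
    have W: "openin gT ?W"
      by (intro openin_preimage continuous_left_translation coord_facts S) (use g in auto)
    have gW: "g \<in> ?W" using g S id_chart by simp
    have "Ad G x Y \<in> U" if "x \<in> ?W" for x
    proof -
      have "Ad G g (Ad G (coord_inv G (coord G (inv g \<otimes> x))) Y) \<in> U" using that S by auto
      moreover have "coord_inv G (coord G (inv g \<otimes> x)) = inv g \<otimes> x" using that by (simp add: coord_facts)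
      moreover have "Ad G g (Ad G (inv g \<otimes> x) Y) = Ad G x Y" using that g by (simp add: Ad_mult Ad_inv)
      ultimately show ?thesis by simp
    qed
    then show "\<forall>\<^sub>F x in atin gT g. Ad G x Y \<in> U"
      unfolding eventually_atin using W gW by blast
  qed simp
qed

end

section \<open>The Banach algebra of endomorphisms and its exponential\<close>

text \<open>A type of its own, so that composition can serve as the multiplication of a Banach
  algebra and the generic \<open>exp\<close> applies.\<close>

typedef (overloaded) 'a endo = "UNIV :: ('a::euclidean_space \<Rightarrow>\<^sub>L 'a) set"
  morphisms bl Endo by simp

lemma bl_Endo [simp]: "bl (Endo f) = f" by (simp add: Endo_inverse)

lemma endo_eq_iff: "x = y \<longleftrightarrow> bl x = bl y" by (simp add: bl_inject)

instantiation endo :: (euclidean_space) real_algebra_1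
begin
definition "0 = Endo 0"
definition "1 = Endo id_blinfun"
definition "x + y = Endo (bl x + bl y)"
definition "x - y = Endo (bl x - bl y)"
definition "- x = Endo (- bl x)"
definition "x * y = Endo (bl x o\<^sub>L bl y)"
definition "r *\<^sub>R x = Endo (r *\<^sub>R bl x)"

lemmas endo_defs = zero_endo_def one_endo_def plus_endo_def minus_endo_def uminus_endo_def
  times_endo_def scaleR_endo_def

instance
proof
  fix x y z :: "'a endo" and a b :: real
  show "x * y * z = x * (y * z)" "1 * x = x" "x * 1 = x" "(x + y) * z = x * z + y * z"
    "x * (y + z) = x * y + x * z" "a *\<^sub>R x * y = a *\<^sub>R (x * y)" "x * a *\<^sub>R y = a *\<^sub>R (x * y)"
    "x + y + z = x + (y + z)" "x + y = y + x" "0 + x = x" "- x + x = 0" "x - y = x + - y"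
    "a *\<^sub>R (x + y) = a *\<^sub>R x + a *\<^sub>R y" "(a + b) *\<^sub>R x = a *\<^sub>R x + b *\<^sub>R x"
    "a *\<^sub>R b *\<^sub>R x = (a * b) *\<^sub>R x" "1 *\<^sub>R x = x"
    by (auto intro!: blinfun_eqI
        simp: endo_eq_iff endo_defs blinfun.bilinear_simps algebra_simps)
  obtain b :: 'a where b: "b \<in> Basis" by (meson ex_in_conv nonempty_Basis)
  have "(id_blinfun :: 'a \<Rightarrow>\<^sub>L 'a) \<noteq> 0"
  proof
    assume "(id_blinfun :: 'a \<Rightarrow>\<^sub>L 'a) = 0"
    then have "blinfun_apply (id_blinfun :: 'a \<Rightarrow>\<^sub>L 'a) b = 0" by (metis blinfun.zero_left)
    then show False using b by (simp add: nonzero_Basis)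
  qed
  then show "(0::'a endo) \<noteq> 1" by (auto simp: endo_eq_iff endo_defs)
qed
end

instantiation endo :: (euclidean_space) real_normed_algebra_1
begin
definition norm_endo_def: "norm x = norm (bl x)"
definition dist_endo_def: "dist x y = norm (bl x - bl y)"
definition sgn_endo_def: "sgn x = Endo (bl x /\<^sub>R norm (bl x))"
definition uniformity_endo_def:
  "(uniformity :: ('a endo \<times> 'a endo) filter) =
     (INF e\<in>{0<..}. principal {(x, y). norm (bl x - bl y) < e})"
definition open_endo_def: "open (U :: 'a endo set) =
  (\<forall>x\<in>U. eventually (\<lambda>(x', y). x' = x \<longrightarrow> y \<in> U)
     (INF e\<in>{0<..}. principal {(x, y). norm (bl x - bl y) < e}))"

instance
proof
  fix x y z :: "'a endo" and a b :: real
  show "dist x y = norm (x - y)" "sgn x = x /\<^sub>R norm x"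
    "(uniformity :: ('a endo \<times> 'a endo) filter) = (INF e\<in>{0<..}. principal {(x, y). dist x y < e})"
    by (simp_all add: dist_endo_def sgn_endo_def uniformity_endo_def norm_endo_def endo_defs)
  show "open U = (\<forall>x\<in>U. eventually (\<lambda>(x', y). x' = x \<longrightarrow> y \<in> U) uniformity)" for U :: "'a endo set"
    by (simp add: open_endo_def uniformity_endo_def)
  show "norm x = 0 \<longleftrightarrow> x = 0" by (auto simp: norm_endo_def endo_defs endo_eq_iff)
  show "norm (x + y) \<le> norm x + norm y" "norm (a *\<^sub>R x) = \<bar>a\<bar> * norm x"
    "norm (x * y) \<le> norm x * norm y"
    by (simp_all add: norm_endo_def endo_defs norm_triangle_ineq norm_blinfun_compose)
  show "norm (1::'a endo) = 1" by (simp add: norm_endo_def endo_defs)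
qed
end

instance endo :: (euclidean_space) banach
proof
  fix X :: "nat \<Rightarrow> 'a endo" assume X: "Cauchy X"
  have d: "dist (bl x) (bl y) = dist x y" for x y :: "'a endo"
    by (simp add: dist_endo_def norm_endo_def endo_defs dist_norm)
  have "Cauchy (\<lambda>n. bl (X n))" using X by (simp add: Cauchy_def d)
  then obtain L where "(\<lambda>n. bl (X n)) \<longlonglongrightarrow> L" using Cauchy_convergent convergent_def by blast
  then have "X \<longlonglongrightarrow> Endo L" unfolding tendsto_iff by (simp flip: d)
  then show "convergent X" by (auto simp: convergent_def)
qed

section \<open>Endomorphisms as operators\<close>

definition ap :: "'a::euclidean_space endo \<Rightarrow> 'a \<Rightarrow> 'a" where
  "ap x v = blinfun_apply (bl x) v"

definition mkE :: "('a::euclidean_space \<Rightarrow> 'a) \<Rightarrow> 'a endo" where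
  "mkE f = Endo (Blinfun f)"

lemma ap_simps [simp]:
  "ap 0 v = 0" "ap 1 v = v" "ap (x + y) v = ap x v + ap y v" "ap (x - y) v = ap x v - ap y v"
  "ap (- x) v = - ap x v" "ap (x * y) v = ap x (ap y v)" "ap (r *\<^sub>R x) v = r *\<^sub>R ap x v"
  by (simp_all add: ap_def endo_defs blinfun.bilinear_simps)

lemma linear_ap: "linear (ap x)"
  by (simp add: ap_def[abs_def] linear_conv_bounded_linear blinfun.bounded_linear_right)

lemma ap_arg_simps [simp]:
  "ap x 0 = 0" "ap x (v + w) = ap x v + ap x w" "ap x (v - w) = ap x v - ap x w"
  "ap x (- v) = - ap x v" "ap x (r *\<^sub>R v) = r *\<^sub>R ap x v"
  by (simp_all add: ap_def blinfun.bilinear_simps)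

lemma endo_eqI: "(\<And>v. ap x v = ap y v) \<Longrightarrow> x = y"
  by (metis ap_def bl_inject blinfun_eqI)

lemma norm_ap: "norm (ap x v) \<le> norm x * norm v"
  by (simp add: ap_def norm_endo_def norm_blinfun)

lemma ap_mkE: "linear f \<Longrightarrow> ap (mkE f) = f"
  by (simp add: ap_def[abs_def] mkE_def bounded_linear_Blinfun_apply linear_conv_bounded_linear)

lemma norm_endo_le: "0 \<le> C \<Longrightarrow> (\<And>v. norm (ap x v) \<le> C * norm v) \<Longrightarrow> norm x \<le> C"
  unfolding norm_endo_def ap_def by (rule norm_blinfun_bound)

lemma bounded_bilinear_ap: "bounded_bilinear ap"
  by (rule bounded_bilinear.intro) (auto intro!: exI[of _ 1] norm_ap)

lemma bounded_linear_ap_left: "bounded_linear (\<lambda>x. ap x v)"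
  by (rule bounded_bilinear.bounded_linear_left[OF bounded_bilinear_ap])

text \<open>Turns convergence on each basis vector into convergence in operator norm; limits and
  derivatives of \<open>AdE\<close> are obtained in this way.\<close>

lemma norm_endo_Basis: "norm x \<le> (\<Sum>b\<in>Basis. norm (ap x b))" for x :: "'a::euclidean_space endo"
proof (rule norm_endo_le)
  show "0 \<le> (\<Sum>b\<in>Basis. norm (ap x b))" by (simp add: sum_nonneg)
  fix v :: 'a
  have "ap x v = (\<Sum>b\<in>Basis. (v \<bullet> b) *\<^sub>R ap x b)"
    using linear_sum[OF linear_ap, of x "\<lambda>b. (v \<bullet> b) *\<^sub>R b" Basis] by (simp add: euclidean_representation)
  also have "norm \<dots> \<le> (\<Sum>b\<in>Basis. norm v * norm (ap x b))"
    by (rule sum_norm_le) (simp add: mult_right_mono Basis_le_norm)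
  finally show "norm (ap x v) \<le> (\<Sum>b\<in>Basis. norm (ap x b)) * norm v"
    by (simp add: sum_distrib_left mult.commute)
qed

lemma continuous_into_endo:
  fixes f :: "'t \<Rightarrow> 'a::euclidean_space endo"
  assumes "\<And>b. b \<in> Basis \<Longrightarrow> ((\<lambda>t. ap (f t) b) \<longlongrightarrow> ap L b) F"
  shows "(f \<longlongrightarrow> L) F"
proof -
  have "((\<lambda>t. \<Sum>b\<in>Basis. norm (ap (f t) b - ap L b)) \<longlongrightarrow> (\<Sum>b\<in>(Basis::'a set). norm (ap L b - ap L b))) F"
    using assms by (intro tendsto_intros)
  then have 1: "((\<lambda>t. \<Sum>b\<in>Basis. norm (ap (f t - L) b)) \<longlongrightarrow> 0) F" by simp
  have "((\<lambda>t. f t - L) \<longlongrightarrow> 0) F"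
    by (rule tendsto_norm_zero_cancel, rule tendsto_sandwich[OF _ _ tendsto_const 1])
      (use norm_endo_Basis[of "f _ - L"] in \<open>auto intro!: always_eventually\<close>)
  then show ?thesis by (simp add: LIM_zero_iff)
qed

section \<open>The exponential series and small logarithms\<close>

lemma norm_power_diff_le:
  fixes x y :: "'b::real_normed_algebra_1"
  assumes "norm x \<le> r" "norm y \<le> r"
  shows "norm (x ^ Suc n - y ^ Suc n) \<le> real (Suc n) * r ^ n * norm (x - y)"
proof (induction n)
  case (Suc n)
  have r: "0 \<le> r" using assms(1) norm_ge_zero order_trans by blast
  have "x ^ Suc (Suc n) - y ^ Suc (Suc n) = x * (x ^ Suc n - y ^ Suc n) + (x - y) * y ^ Suc n"
    by (simp add: algebra_simps)
  also have "norm \<dots> \<le> norm x * norm (x ^ Suc n - y ^ Suc n) + norm (x - y) * norm (y ^ Suc n)"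
    by (meson norm_mult_ineq norm_triangle_mono)
  also have "\<dots> \<le> r * (real (Suc n) * r ^ n * norm (x - y)) + norm (x - y) * r ^ Suc n"
    by (intro add_mono mult_mono Suc assms r order_trans[OF norm_power_ineq] power_mono) auto
  also have "\<dots> = real (Suc (Suc n)) * r ^ Suc n * norm (x - y)" by (simp add: algebra_simps)
  finally show ?case .
qed simp

text \<open>On the ball of radius \<open>r\<close> the term of degree \<open>n\<close> has the
  Lipschitz constant \<open>r^(n-1) / (n-1)!\<close>, and summing from \<open>n = 2\<close> gives
  \<open>exp r - 1\<close>. The elements \<open>x\<close> and \<open>y\<close> need not
  commute.\<close>

lemma exp_remainder_lipschitz:
  fixes x y :: "'b::{real_normed_algebra_1,banach}"
  assumes "norm x \<le> r" "norm y \<le> r"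
  shows "norm ((exp x - x) - (exp y - y)) \<le> (exp r - 1) * norm (x - y)"
proof -
  have r: "0 \<le> r" using assms(1) norm_ge_zero order_trans by blast
  define t where "t n = (x ^ n - y ^ n) /\<^sub>R fact n" for n
  have sx: "(\<lambda>n. z ^ n /\<^sub>R fact n) sums exp z" for z :: 'b
    unfolding exp_def by (rule summable_sums[OF summable_exp_generic])
  have "t sums (exp x - exp y)"
    unfolding t_def using sums_diff[OF sx[of x] sx[of y]] by (simp add: algebra_simps)
  \<comment> \<open>Dropping degrees 0 and 1 removes the constant 1 and the identity from both
    series.\<close>
  then have "(\<lambda>n. t (n + 2)) sums (exp x - exp y - (\<Sum>n<2. t n))"
    by (simp only: sums_iff_shift')
  then have s: "(\<lambda>n. t (n + 2)) sums ((exp x - x) - (exp y - y))"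
    by (simp add: t_def numeral_2_eq_2 algebra_simps)
  have sr: "(\<lambda>n. r ^ n /\<^sub>R fact n) sums exp r"
    unfolding exp_def by (rule summable_sums[OF summable_exp_generic])
  then have "(\<lambda>n. r ^ (n + 1) /\<^sub>R fact (n + 1)) sums (exp r - (\<Sum>n<1. r ^ n /\<^sub>R fact n))"
    by (subst sums_iff_shift'[of "\<lambda>n. r ^ n /\<^sub>R fact n" 1])
  then have s2: "(\<lambda>n. r ^ (n + 1) /\<^sub>R fact (n + 1) * norm (x - y)) sums ((exp r - 1) * norm (x - y))"
    by (intro sums_mult2) simp
  have b: "norm (t (n + 2)) \<le> r ^ (n + 1) /\<^sub>R fact (n + 1) * norm (x - y)" for n
  proof -
    have "norm (t (n + 2)) \<le> (real (n + 2) * r ^ (n + 1) * norm (x - y)) / fact (n + 2)"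
      using norm_power_diff_le[OF assms, of "n + 1"] by (simp add: t_def divide_inverse_commute)
    also have "\<dots> = r ^ (n + 1) / fact (n + 1) * norm (x - y)"
    proof -
      have "fact (n + 2) = real (n + 2) * fact (n + 1)" using fact_Suc[of "n + 1", where 'a=real] by simp
      moreover have "N * P * Q / (N * F) = P / F * Q" if "N \<noteq> 0" for N P Q F :: real
        using that by simp
      ultimately show ?thesis by (metis of_nat_eq_0_iff add_eq_0_iff_both_eq_0 zero_neq_numeral)
    qed
    finally show ?thesis by (simp add: divide_inverse_commute)
  qed
  have "norm (\<Sum>n. t (n + 2)) \<le> (\<Sum>n. r ^ (n + 1) /\<^sub>R fact (n + 1) * norm (x - y))"
    by (rule norm_suminf_le[OF b sums_summable[OF s2]])
  then show ?thesis using sums_unique[OF s] sums_unique[OF s2] by simp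
qed

lemma isCont_exp_banach: "isCont exp x" for x :: "'b::{real_normed_algebra_1,banach}"
proof -
  have "\<forall>\<^sub>F y in at x. norm (exp y - exp x) \<le> exp (norm x + 1) * norm (y - x)"
    unfolding eventually_at
  proof (intro exI[of _ 1] conjI ballI impI)
    fix y assume y: "y \<noteq> x \<and> dist y x < 1"
    then have "norm y \<le> norm x + 1" using norm_triangle_sub[of y x] by (simp add: dist_norm)
    then have "norm ((exp y - y) - (exp x - x)) \<le> (exp (norm x + 1) - 1) * norm (y - x)"
      by (intro exp_remainder_lipschitz) auto
    moreover have "norm (exp y - exp x) \<le> norm ((exp y - y) - (exp x - x)) + norm (y - x)"
      by (rule order_trans[OF _ norm_triangle_ineq]) (simp add: algebra_simps)
    ultimately show "norm (exp y - exp x) \<le> exp (norm x + 1) * norm (y - x)"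
      by (simp add: algebra_simps)
  qed auto
  moreover have "((\<lambda>y. exp (norm x + 1) * norm (y - x)) \<longlongrightarrow> exp (norm x + 1) * norm (x - x)) (at x)"
    by (intro tendsto_intros)
  then have "((\<lambda>y. exp (norm x + 1) * norm (y - x)) \<longlongrightarrow> 0) (at x)" by simp
  ultimately have "((\<lambda>y. exp y - exp x) \<longlongrightarrow> 0) (at x)"
    by (rule Lim_null_comparison)
  then show ?thesis unfolding isCont_def by (rule LIM_zero_cancel)
qed

text \<open>The reason for the radius 1/4 of the logarithms below: there \<open>exp x - x\<close>
  contracts by the factor 1/2.\<close>

lemma exp_quarter: "exp (1/4::real) - 1 \<le> 1/2"
  using exp_bound[of "1/4::real"] by (simp add: power2_eq_square)

lemma small_log_lipschitz:
  fixes x y :: "'b::{real_normed_algebra_1,banach}"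
  assumes "norm x \<le> 1/4" "norm y \<le> 1/4"
  shows "norm (x - y) \<le> 2 * norm (exp x - exp y)"
proof -
  have "norm ((exp x - x) - (exp y - y)) \<le> (exp (1/4) - 1) * norm (x - y)"
    by (rule exp_remainder_lipschitz[OF assms])
  also have "\<dots> \<le> 1/2 * norm (x - y)" by (intro mult_right_mono exp_quarter) auto
  finally have "norm ((exp x - x) - (exp y - y)) \<le> 1/2 * norm (x - y)" .
  moreover have "norm (x - y) \<le> norm (exp x - exp y) + norm ((exp x - x) - (exp y - y))"
    by (rule order_trans[OF _ norm_triangle_ineq4]) (simp add: algebra_simps)
  ultimately show ?thesis by simp
qed

lemma small_log_close:
  fixes x :: "'b::{real_normed_algebra_1,banach}"
  assumes "norm x \<le> 1/4"
  shows "norm (exp x - 1 - x) \<le> 2 * norm x * norm x"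
proof -
  have "norm ((exp x - x) - (exp 0 - 0)) \<le> (exp (norm x) - 1) * norm (x - 0)"
    by (rule exp_remainder_lipschitz) auto
  also have "exp (norm x) - 1 \<le> 2 * norm x"
  proof -
    have "exp (norm x) \<le> 1 + norm x + (norm x)\<^sup>2" using assms by (intro exp_bound) auto
    also have "(norm x)\<^sup>2 \<le> norm x" using assms by (simp add: power2_eq_square mult_left_le)
    finally show ?thesis by simp
  qed
  finally show ?thesis by (simp add: algebra_simps mult_right_mono)
qed

text \<open>A fixed point of \<open>x \<mapsto> s - (exp x - x)\<close> is a logarithm of
  \<open>s\<close>. The map halves distances on the ball of radius 1/4 and moves 0 by at most 1/8,
  so it keeps the ball.\<close>

lemma small_log_exists:
  fixes s :: "'b::{real_normed_algebra_1,banach}"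
  assumes "norm (s - 1) \<le> 1/8"
  shows "\<exists>x. norm x \<le> 1/4 \<and> exp x = s"
proof -
  define f where "f x = s - (exp x - x)" for x
  have lip: "dist (f x) (f y) \<le> 1/2 * dist x y" if "x \<in> cball 0 (1/4)" "y \<in> cball 0 (1/4)" for x y
  proof -
    have "dist (f x) (f y) = norm ((exp x - x) - (exp y - y))"
      using norm_minus_cancel[of "(exp x - x) - (exp y - y)"] unfolding f_def dist_norm by (simp add: algebra_simps)
    also have "\<dots> \<le> (exp (1/4) - 1) * norm (x - y)"
      using that by (intro exp_remainder_lipschitz) auto
    also have "\<dots> \<le> 1/2 * norm (x - y)" by (intro mult_right_mono exp_quarter) auto
    finally show ?thesis by (simp add: dist_norm)
  qed
  have "f x \<in> cball 0 (1/4)" if "x \<in> cball 0 (1/4)" for x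
  proof -
    have "norm (f x - f 0) \<le> 1/2 * norm x" using lip[of x 0] that by (simp add: dist_norm)
    moreover have "norm (f 0) \<le> 1/8" using assms by (simp add: f_def)
    moreover have "norm (f x) \<le> norm (f x - f 0) + norm (f 0)" by (metis diff_add_cancel norm_triangle_ineq)
    moreover have "norm x \<le> 1/4" using that by simp
    ultimately have "norm (f x) \<le> 1/4" by linarith
    then show ?thesis by simp
  qed
  then have "f ` cball 0 (1/4) \<subseteq> cball 0 (1/4)" by blast
  then have "\<exists>!x\<in>cball 0 (1/4). f x = x"
    by (intro Banach_fix[of _ "1/2"] lip) (simp_all add: complete_eq_closed)
  then obtain x where "x \<in> cball 0 (1/4)" "f x = x" by blast
  then have "norm x \<le> 1/4" "f x = x" by simp_all
  then show ?thesis by (auto simp: f_def)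
qed

lemma exp_bilinear_sums:
  "(\<lambda>n. (1 / fact n) *\<^sub>R ap (x ^ n) v) sums ap (exp x) v"
proof -
  have "(\<lambda>n. x ^ n /\<^sub>R fact n) sums exp x"
    unfolding exp_def by (rule summable_sums[OF summable_exp_generic])
  from bounded_linear.sums[OF bounded_linear_ap_left this, of v]
  show ?thesis by (simp add: divide_inverse)
qed

lemma ap_exp_eigenvector:
  assumes "ap x v = c *\<^sub>R v"
  shows "ap (exp x) v = exp c *\<^sub>R v"
proof -
  have "ap (x ^ n) v = c ^ n *\<^sub>R v" for n
    by (induction n) (simp_all add: assms power_commutes mult.commute)
  then have "(\<lambda>n. (c ^ n /\<^sub>R fact n) *\<^sub>R v) sums ap (exp x) v"
    using exp_bilinear_sums[of x v] by (simp add: divide_inverse_commute)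
  moreover have "(\<lambda>n. (c ^ n /\<^sub>R fact n) *\<^sub>R v) sums (exp c *\<^sub>R v)"
    unfolding exp_def by (intro sums_scaleR_left summable_sums[OF summable_exp_generic])
  ultimately show ?thesis using sums_unique2 by blast
qed

text \<open>The partial sums stay in the subspace, which is closed because the dimension is
  finite.\<close>

lemma ap_exp_subspace:
  assumes S: "subspace S" and inv: "\<And>v. v \<in> S \<Longrightarrow> ap x v \<in> S" and v: "v \<in> S"
  shows "ap (exp x) v \<in> S"
proof -
  have "ap (x ^ n) v \<in> S" for n by (induction n) (simp_all add: v inv)
  then have "(\<Sum>k<n. (1 / fact k) *\<^sub>R ap (x ^ k) v) \<in> S" for n
    by (intro subspace_sum[OF S] subspace_scale[OF S])
  moreover have "(\<lambda>n. \<Sum>k<n. (1 / fact k) *\<^sub>R ap (x ^ k) v) \<longlonglongrightarrow> ap (exp x) v"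
    using exp_bilinear_sums unfolding sums_def .
  ultimately show ?thesis by (rule closed_sequentially[OF closed_subspace[OF S]])
qed

lemma exp_ap_vector_derivative:
  "((\<lambda>t. ap (exp (t *\<^sub>R x)) v) has_vector_derivative ap (exp (t *\<^sub>R x)) (ap x v)) (at t)"
proof -
  have "((\<lambda>t. ap (exp (t *\<^sub>R x)) v) has_vector_derivative ap (exp (t *\<^sub>R x) * x) v) (at t)"
    by (rule bounded_linear.has_vector_derivative[OF bounded_linear_ap_left])
      (rule exp_scaleR_has_vector_derivative_right)
  then show ?thesis by (simp only: ap_simps)
qed

section \<open>The Killing form and the Cartan involution\<close>

definition trE :: "'a::euclidean_space endo \<Rightarrow> real" where
  "trE x = (\<Sum>b\<in>Basis. ap x b \<bullet> b)"

lemma bounded_linear_trE: "bounded_linear trE"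
  unfolding trE_def[abs_def]
  by (intro bounded_linear_sum bounded_linear_inner_left_comp bounded_linear_ap_left)

lemma trE_commute: "trE (x * y) = trE (y * x)"
proof -
  have e: "trE (x * y) = (\<Sum>b\<in>Basis. \<Sum>c\<in>Basis. (ap y b \<bullet> c) * (ap x c \<bullet> b))" for x y :: "'a endo"
  proof -
    have "ap x (ap y b) \<bullet> b = (\<Sum>c\<in>Basis. (ap y b \<bullet> c) * (ap x c \<bullet> b))" for b
    proof -
      have "ap x (ap y b) = (\<Sum>c\<in>Basis. (ap y b \<bullet> c) *\<^sub>R ap x c)"
        using linear_sum[OF linear_ap, of x "\<lambda>c. (ap y b \<bullet> c) *\<^sub>R c" Basis] by (simp add: euclidean_representation)
      then show ?thesis by (simp add: inner_sum_left)
    qed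
    then show ?thesis by (simp add: trE_def)
  qed
  show ?thesis unfolding e by (subst sum.swap) (simp add: mult.commute)
qed

locale cartan_group = lie_group G for G :: "('a, 'e::euclidean_space) manifold_group" (structure) +
  fixes kk pp :: "'e set"
  assumes connected: "connected_space (gtop G)"
    and cartan: "cartan_decomposition G kk pp"
begin

definition adE where "adE X = mkE (bracket G X)"
definition AdE where "AdE g = mkE (Ad G g)"

lemma ap_adE [simp]: "ap (adE X) Y = bracket G X Y"
  by (simp add: adE_def ap_mkE linear_bracket_right)

lemma ap_AdE [simp]: "g \<in> carrier G \<Longrightarrow> ap (AdE g) Y = Ad G g Y"
  by (simp add: AdE_def ap_mkE linear_Ad)

lemma linear_adE: "linear adE"
  by (rule linearI; rule endo_eqI) (simp_all add: br_simps)

lemma AdE_one: "AdE \<one> = 1" by (rule endo_eqI) (simp add: Ad_one)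

lemma AdE_mult: "g \<in> carrier G \<Longrightarrow> h \<in> carrier G \<Longrightarrow> AdE (g \<otimes> h) = AdE g * AdE h"
  by (rule endo_eqI) (simp add: Ad_mult)

lemma AdE_inv:
  assumes "g \<in> carrier G" shows "AdE g * AdE (inv g) = 1" "AdE (inv g) * AdE g = 1"
  using assms by (simp_all flip: AdE_mult add: AdE_one)

lemma adE_Ad: "g \<in> carrier G \<Longrightarrow> adE (Ad G g X) = AdE g * adE X * AdE (inv g)"
  by (rule endo_eqI) (simp add: Ad_bracket Ad_inv)

lemma adE_bracket: "adE (bracket G X Y) = adE X * adE Y - adE Y * adE X"
  by (rule endo_eqI) (simp add: Leibniz[of X Y])

section \<open>Invariance and nondegeneracy of the Killing form\<close>

definition B where "B X Y = trE (adE X * adE Y)"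

lemma killing_B: "killing_form G X Y = B X Y"
  by (simp add: killing_form_def B_def trE_def)

lemma trE_simps: "trE (x + y) = trE x + trE y" "trE (x - y) = trE x - trE y"
   "trE (r *\<^sub>R x) = r * trE x" "trE (- x) = - trE x" "trE 0 = 0"
  by (simp_all add: trE_def inner_add_left inner_diff_left sum.distrib sum_subtractf sum_distrib_left sum_negf)

lemma B_simps [simp]:
  "B (X + Y) Z = B X Z + B Y Z" "B Z (X + Y) = B Z X + B Z Y"
  "B (X - Y) Z = B X Z - B Y Z" "B Z (X - Y) = B Z X - B Z Y"
  "B (r *\<^sub>R X) Z = r * B X Z" "B Z (r *\<^sub>R X) = r * B Z X"
  "B (- X) Z = - B X Z" "B Z (- X) = - B Z X" "B 0 Z = 0" "B Z 0 = 0"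
  by (simp_all add: B_def linear_add[OF linear_adE] linear_diff[OF linear_adE] linear_scale[OF linear_adE]
      linear_neg[OF linear_adE] linear_0[OF linear_adE] trE_simps algebra_simps)

lemma B_sym: "B X Y = B Y X" by (simp add: B_def trE_commute)

lemma B_invariant: "B (bracket G X Y) Z = B X (bracket G Y Z)"
proof -
  have "trE (adE Y * adE X * adE Z) = trE (adE X * (adE Z * adE Y))"
    using trE_commute[of "adE Y" "adE X * adE Z"] by (simp add: mult.assoc)
  then show ?thesis by (simp add: B_def adE_bracket algebra_simps trE_simps)
qed

lemma B_Ad: "g \<in> carrier G \<Longrightarrow> B (Ad G g X) (Ad G g Y) = B X Y"
proof -
  assume g: "g \<in> carrier G"
  have "B (Ad G g X) (Ad G g Y) = trE (AdE g * (adE X * (AdE (inv g) * AdE g) * adE Y * AdE (inv g)))"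
    by (simp add: B_def adE_Ad g mult.assoc)
  also have "\<dots> = trE ((adE X * (AdE (inv g) * AdE g) * adE Y * AdE (inv g)) * AdE g)"
    by (rule trE_commute)
  also have "\<dots> = B X Y" by (simp add: AdE_inv g mult.assoc B_def)
  finally show ?thesis .
qed

lemma sub_kk: "subspace kk" and sub_pp: "subspace pp"
  and kk_pp_int: "X \<in> kk \<Longrightarrow> X \<in> pp \<Longrightarrow> X = 0"
  and kk_kk: "X \<in> kk \<Longrightarrow> Y \<in> kk \<Longrightarrow> bracket G X Y \<in> kk"
  and kk_pp: "X \<in> kk \<Longrightarrow> Y \<in> pp \<Longrightarrow> bracket G X Y \<in> pp"
  and pp_pp: "X \<in> pp \<Longrightarrow> Y \<in> pp \<Longrightarrow> bracket G X Y \<in> kk"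
  and B_kk: "X \<in> kk \<Longrightarrow> X \<noteq> 0 \<Longrightarrow> B X X < 0"
  and B_pp: "X \<in> pp \<Longrightarrow> X \<noteq> 0 \<Longrightarrow> B X X > 0"
  using cartan unfolding cartan_decomposition_def killing_B by auto

lemma kp_decomp: obtains Xk Xp where "Xk \<in> kk" "Xp \<in> pp" "X = Xk + Xp"
proof -
  have "X \<in> span (kk \<union> pp)" using cartan unfolding cartan_decomposition_def by auto
  then have "X \<in> {x + y |x y. x \<in> kk \<and> y \<in> pp}"
    by (simp add: span_Un span_eq_iff[THEN iffD2, OF sub_kk] span_eq_iff[THEN iffD2, OF sub_pp])
  then show thesis using that by blast
qed

lemma nondegenerate:
  assumes "\<And>Y. B X Y = 0" shows "X = 0"
proof -
  obtain Xk Xp where X: "Xk \<in> kk" "Xp \<in> pp" "X = Xk + Xp" using kp_decomp by blast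
  have "B Xk Xk = B Xp Xp" using assms[of Xk] assms[of Xp] B_sym[of Xk Xp] X(3) by simp
  then have "Xk = 0 \<and> Xp = 0" using B_kk[OF X(1)] B_pp[OF X(2)]
    by (metis B_simps(9) less_asym)
  then show ?thesis using X by simp
qed

lemma adE_inj: "adE X = 0 \<Longrightarrow> X = 0"
  by (rule nondegenerate) (simp add: B_def trE_simps)

lemma adE_eq: "adE X = adE Y \<Longrightarrow> X = Y"
  using adE_inj[of "X - Y"] by (simp add: linear_diff[OF linear_adE])

text \<open>The Leibniz rule alone gives \<open>ad [X, X] = 0\<close>.\<close>

lemma bracket_self [simp]: "bracket G X X = 0"
  by (rule adE_inj) (simp add: adE_bracket)

lemma bracket_anti: "bracket G X Y = - bracket G Y X"
proof -
  have "bracket G X (X + Y) + bracket G Y (X + Y) = 0"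
    using linear_add[OF linear_bracket_left, of X Y "X + Y"] by simp
  then have "bracket G X Y + bracket G Y X = 0" by (simp add: linear_add[OF linear_bracket_right])
  then show ?thesis by (simp add: eq_neg_iff_add_eq_0)
qed

lemma pp_kk: "X \<in> pp \<Longrightarrow> Y \<in> kk \<Longrightarrow> bracket G X Y \<in> pp"
  using kk_pp[of Y X] bracket_anti[of X Y] sub_pp by (simp add: subspace_neg)

section \<open>The Cartan involution and its inner product\<close>

definition pk where "pk X = (SOME Y. Y \<in> kk \<and> X - Y \<in> pp)"
text \<open>The Cartan involution: 1 on \<open>kk\<close> and -1 on \<open>pp\<close>.\<close>

definition theta where "theta X = pk X - (X - pk X)"

lemma pk: "pk X \<in> kk" "X - pk X \<in> pp"
proof -
  obtain Xk Xp where "Xk \<in> kk" "Xp \<in> pp" "X = Xk + Xp" using kp_decomp by blast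
  then have "Xk \<in> kk \<and> X - Xk \<in> pp" by simp
  then have "pk X \<in> kk \<and> X - pk X \<in> pp" unfolding pk_def by (rule someI)
  then show "pk X \<in> kk" "X - pk X \<in> pp" by auto
qed

lemma pk_eqI:
  assumes "Y \<in> kk" "X - Y \<in> pp" shows "pk X = Y"
proof -
  have "pk X - Y \<in> kk" using pk assms sub_kk subspace_diff by blast
  moreover have "(X - Y) - (X - pk X) \<in> pp" using pk assms sub_pp subspace_diff by blast
  then have "pk X - Y \<in> pp" by simp
  ultimately show ?thesis using kk_pp_int by force
qed

lemma linear_pk: "linear pk"
proof
  fix X Y :: 'e and r :: real
  show "pk (X + Y) = pk X + pk Y"
    by (rule pk_eqI) (use pk[of X] pk[of Y] subspace_add[OF sub_kk] subspace_add[OF sub_pp, of "X - pk X" "Y - pk Y"]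
      in \<open>auto simp: algebra_simps\<close>)
  show "pk (r *\<^sub>R X) = r *\<^sub>R pk X"
    by (rule pk_eqI) (use pk[of X] subspace_scale[OF sub_kk] subspace_scale[OF sub_pp, of "X - pk X" r]
      in \<open>auto simp: algebra_simps\<close>)
qed

lemma linear_theta: "linear theta"
  unfolding theta_def[abs_def] by (intro linear_compose_sub linear_pk linear_ident)

lemma theta_kk: "X \<in> kk \<Longrightarrow> theta X = X"
  using pk_eqI[of X X] subspace_0[OF sub_pp] by (simp add: theta_def)

lemma theta_pp: "X \<in> pp \<Longrightarrow> theta X = - X"
  using pk_eqI[of 0 X] subspace_0[OF sub_kk] by (simp add: theta_def)

lemma theta_add: "theta (X + Y) = theta X + theta Y" by (rule linear_add[OF linear_theta])

lemma theta_theta [simp]: "theta (theta X) = X"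
proof -
  obtain Xk Xp where X: "Xk \<in> kk" "Xp \<in> pp" "X = Xk + Xp" using kp_decomp by blast
  then show ?thesis using theta_kk[OF X(1)] theta_pp[OF X(2)]
    by (simp add: theta_add linear_neg[OF linear_theta] linear_diff[OF linear_theta])
qed

lemma theta_bracket: "theta (bracket G X Y) = bracket G (theta X) (theta Y)"
proof -
  obtain Xk Xp where X: "Xk \<in> kk" "Xp \<in> pp" "X = Xk + Xp" using kp_decomp by blast
  obtain Yk Yp where Y: "Yk \<in> kk" "Yp \<in> pp" "Y = Yk + Yp" using kp_decomp by blast
  have "theta (bracket G Xk Yk) = bracket G Xk Yk" "theta (bracket G Xp Yp) = bracket G Xp Yp"
    "theta (bracket G Xk Yp) = - bracket G Xk Yp" "theta (bracket G Xp Yk) = - bracket G Xp Yk"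
    using X Y by (simp_all add: theta_kk theta_pp kk_kk pp_pp kk_pp pp_kk)
  then show ?thesis using X Y theta_kk[OF X(1)] theta_pp[OF X(2)] theta_kk[OF Y(1)] theta_pp[OF Y(2)]
    by (simp add: theta_add br_simps)
qed

text \<open>The Killing form is invariant under every automorphism of the Lie algebra, and
  \<open>theta\<close> is one by \<open>theta_bracket\<close>.\<close>

lemma B_theta: "B (theta X) (theta Y) = B X Y"
proof -
  let ?t = "mkE theta"
  have t: "ap ?t = theta" by (rule ap_mkE[OF linear_theta])
  have tt: "?t * ?t = 1" by (rule endo_eqI) (simp add: t)
  have ad: "adE (theta Z) = ?t * adE Z * ?t" for Z
    by (rule endo_eqI) (simp add: t theta_bracket)
  have "B (theta X) (theta Y) = trE (?t * (adE X * (?t * ?t) * adE Y * ?t))"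
    by (simp add: B_def ad mult.assoc)
  also have "\<dots> = trE (adE X * (?t * ?t) * adE Y * ?t * ?t)" by (rule trE_commute)
  also have "\<dots> = B X Y" by (simp add: tt mult.assoc B_def)
  finally show ?thesis .
qed

lemma B_kk_pp: "X \<in> kk \<Longrightarrow> Y \<in> pp \<Longrightarrow> B X Y = 0"
  using B_theta[of X Y] theta_kk[of X] theta_pp[of Y] by simp

text \<open>The sign and \<open>theta\<close> make this an inner product for which
  \<open>ad H\<close> is symmetric when \<open>H\<close> is in \<open>pp\<close>.\<close>

definition ip where "ip X Y = - B X (theta Y)"

lemma ip_simps [simp]:
  "ip (X + Y) Z = ip X Z + ip Y Z" "ip Z (X + Y) = ip Z X + ip Z Y"
  "ip (X - Y) Z = ip X Z - ip Y Z" "ip Z (X - Y) = ip Z X - ip Z Y"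
  "ip (r *\<^sub>R X) Z = r * ip X Z" "ip Z (r *\<^sub>R X) = r * ip Z X"
  "ip (- X) Z = - ip X Z" "ip Z (- X) = - ip Z X" "ip 0 Z = 0" "ip Z 0 = 0"
  by (simp_all add: ip_def linear_add[OF linear_theta] linear_diff[OF linear_theta] linear_scale[OF linear_theta]
      linear_neg[OF linear_theta] linear_0[OF linear_theta])

lemma ip_sym: "ip X Y = ip Y X"
  unfolding ip_def using B_theta[of X "theta Y"] by (simp add: B_sym)

lemma ip_pos: "X \<noteq> 0 \<Longrightarrow> ip X X > 0"
proof -
  assume "X \<noteq> 0"
  obtain Xk Xp where X: "Xk \<in> kk" "Xp \<in> pp" "X = Xk + Xp" using kp_decomp by blast
  have th: "theta X = Xk - Xp" using X theta_kk theta_pp by (simp add: theta_add)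
  have e: "ip X X = B Xp Xp - B Xk Xk"
    unfolding ip_def th unfolding X(3) using B_kk_pp[OF X(1,2)] B_sym[of Xp Xk] by simp
  show ?thesis
  proof (cases "Xk = 0")
    case True
    then have "Xp \<noteq> 0" using X \<open>X \<noteq> 0\<close> by simp
    then show ?thesis using e True B_pp[OF X(2)] by simp
  next
    case False
    have "B Xp Xp \<ge> 0" using B_pp[OF X(2)] by (cases "Xp = 0") auto
    then show ?thesis using e B_kk[OF X(1) False] by simp
  qed
qed

lemma ip_nonneg: "0 \<le> ip X X" using ip_pos[of X] by (cases "X = 0") auto
lemma ip_eq_0: "ip X X = 0 \<longleftrightarrow> X = 0" using ip_pos[of X] by (cases "X = 0") auto

lemma ip_bracket: "ip (bracket G X Y) Z = - ip Y (bracket G (theta X) Z)"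
proof -
  have "ip (bracket G X Y) Z = B (bracket G Y X) (theta Z)"
    using bracket_anti[of X Y] by (simp add: ip_def)
  also have "\<dots> = B Y (bracket G X (theta Z))" by (rule B_invariant)
  also have "bracket G X (theta Z) = theta (bracket G (theta X) Z)" by (simp add: theta_bracket)
  finally show ?thesis by (simp add: ip_def)
qed

lemma ip_bracket_pp: "X \<in> pp \<Longrightarrow> ip (bracket G X Y) Z = ip Y (bracket G X Z)"
  using ip_bracket[of X Y Z] theta_pp[of X] by (simp add: br_simps)

text \<open>\<open>Lad\<close> inverts \<open>ad\<close>: for a derivation \<open>D\<close>, \<open>B (Lad D) W = tr (D \<circ> ad W)\<close>.\<close>

definition "BS Z = (\<Sum>b\<in>Basis. B Z b *\<^sub>R (b::'e))"
definition "BSi = (SOME f. linear f \<and> (\<forall>Z. f (BS Z) = Z))"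
definition "Lad D = BSi (\<Sum>b\<in>Basis. trE (D * adE b) *\<^sub>R b)"

lemma B_expand: "B Z Y = BS Z \<bullet> Y"
proof -
  have "B Z Y = B Z (\<Sum>b\<in>Basis. (Y \<bullet> b) *\<^sub>R b)" by (simp add: euclidean_representation)
  also have "\<dots> = (\<Sum>b\<in>Basis. (Y \<bullet> b) * B Z b)"
  proof -
    have "linear (B Z)" by (rule linearI) simp_all
    from linear_sum[OF this, of "\<lambda>b. (Y \<bullet> b) *\<^sub>R b" Basis] show ?thesis by simp
  qed
  also have "\<dots> = BS Z \<bullet> Y" by (simp add: BS_def inner_sum_left mult.commute inner_commute[of Y])
  finally show ?thesis .
qed

lemma BSi: "linear BSi" "BSi (BS Z) = Z" "BS (BSi Y) = Y"
proof -
  have lin: "linear BS" unfolding BS_def[abs_def]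
    by (rule linearI) (simp_all add: scaleR_add_left sum.distrib scaleR_sum_right)
  have inj: "inj BS"
  proof (subst linear_injective_0[OF lin], intro allI impI)
    fix X assume "BS X = 0"
    then show "X = 0" by (intro nondegenerate) (simp add: B_expand)
  qed
  have "\<exists>f. linear f \<and> (\<forall>Z. f (BS Z) = Z)"
    using linear_injective_left_inverse[OF lin inj] by (auto simp: fun_eq_iff)
  then have 1: "linear BSi \<and> (\<forall>Z. BSi (BS Z) = Z)" unfolding BSi_def by (rule someI_ex)
  then show "linear BSi" "BSi (BS Z) = Z" by auto
  obtain Z where "Y = BS Z" using linear_injective_imp_surjective[OF lin inj] by (meson surjD)
  then show "BS (BSi Y) = Y" using 1 by simp
qed

lemma bounded_linear_Lad: "bounded_linear Lad"
  unfolding Lad_def[abs_def]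
  by (intro bounded_linear_compose[OF BSi(1)[unfolded linear_conv_bounded_linear]] bounded_linear_sum
      bounded_linear_scaleR_const bounded_linear_compose[OF bounded_linear_trE] bounded_linear_mult_left)

lemma B_Lad: "B (Lad D) W = trE (D * adE W)"
proof -
  have "linear (\<lambda>W. trE (D * adE W))"
    by (rule linearI) (simp_all add: linear_add[OF linear_adE] linear_scale[OF linear_adE] algebra_simps trE_simps)
  from linear_sum[OF this, of "\<lambda>b. (W \<bullet> b) *\<^sub>R b" Basis]
  have "trE (D * adE W) = (\<Sum>b\<in>Basis. (W \<bullet> b) * trE (D * adE b))"
    by (simp add: euclidean_representation linear_scale[OF \<open>linear (\<lambda>W. trE (D * adE W))\<close>])
  then show ?thesis by (simp add: B_expand Lad_def BSi inner_sum_left mult.commute inner_commute[of W])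
qed

lemma Lad_adE [simp]: "Lad (adE X) = X"
proof -
  have "Lad (adE X) - X = 0" by (rule nondegenerate) (simp add: B_Lad, simp add: B_def)
  then show ?thesis by simp
qed

text \<open>The difference \<open>E\<close> of \<open>D\<close> and its candidate is
  trace-orthogonal to every \<open>ad W\<close>. As \<open>ad (E X)\<close> is the commutator of
  \<open>E\<close> and \<open>ad X\<close>, the value \<open>B (E X) W\<close> is the trace of
  \<open>E\<close> times \<open>ad [X, W]\<close>, hence 0.\<close>

lemma derivation_inner:
  assumes D: "\<And>X Y. ap D (bracket G X Y) = bracket G (ap D X) Y + bracket G X (ap D Y)"
  shows "adE (Lad D) = D"
proof -
  define E where "E = D - adE (Lad D)"
  have trEz: "trE (E * adE W) = 0" for W
    unfolding E_def by (simp only: left_diff_distrib trE_simps B_Lad[symmetric]) (simp add: B_def)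
  have adEE: "adE (ap E X) = E * adE X - adE X * E" for X
    by (rule endo_eqI)
      (simp add: E_def D br_simps Leibniz[of "Lad D" X])
  have "ap E X = 0" for X
  proof (rule nondegenerate)
    fix W
    have "B (ap E X) W = trE (E * adE X * adE W) - trE (adE X * (E * adE W))"
      by (simp add: B_def adEE algebra_simps trE_simps)
    also have "trE (adE X * (E * adE W)) = trE (E * adE W * adE X)" by (rule trE_commute)
    also have "trE (E * adE X * adE W) - trE (E * adE W * adE X) = trE (E * adE (bracket G X W))"
      by (simp add: adE_bracket algebra_simps trE_simps)
    finally show "B (ap E X) W = 0" by (simp add: trEz)
  qed
  then have "E = 0" by (intro endo_eqI) simp
  then show ?thesis by (simp add: E_def)
qed

end

section \<open>Logarithms of elements near the identity\<close>

text \<open>A choice that is meaningful for \<open>norm (s - 1) \<le> 1/8\<close>, where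
  \<open>Lg_unique\<close> applies.\<close>

definition Lg :: "'b::{real_normed_algebra_1,banach} \<Rightarrow> 'b" where
  "Lg s = (SOME x. norm x \<le> 1/4 \<and> exp x = s)"

lemma Lg:
  assumes "norm (s - 1) \<le> 1/8"
  shows "norm (Lg s) \<le> 1/4" "exp (Lg s) = s" "norm (Lg s) \<le> 2 * norm (s - 1)"
proof -
  have 1: "norm (Lg s) \<le> 1/4 \<and> exp (Lg s) = s"
    unfolding Lg_def by (rule someI_ex[OF small_log_exists[OF assms]])
  then show "norm (Lg s) \<le> 1/4" "exp (Lg s) = s" by auto
  show "norm (Lg s) \<le> 2 * norm (s - 1)" using small_log_lipschitz[of "Lg s" 0] 1 by simp
qed

lemma Lg_unique:
  fixes x :: "'b::{real_normed_algebra_1,banach}"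
  assumes "norm (s - 1) \<le> 1/8" "norm x \<le> 1/4" "exp x = s" shows "Lg s = x"
  using small_log_lipschitz[of "Lg s" x] Lg[OF assms(1)] assms by simp

lemma Lg_lipschitz:
  assumes "norm (s - 1) \<le> 1/8" "norm (t - 1) \<le> 1/8"
  shows "norm (Lg s - Lg t) \<le> 2 * norm (s - t)"
  using small_log_lipschitz[of "Lg s" "Lg t"] Lg[OF assms(1)] Lg[OF assms(2)] by simp

lemma Lg_has_derivative: "((Lg :: 'b::{real_normed_algebra_1,banach} \<Rightarrow> 'b) has_derivative (\<lambda>x. x)) (at 1)"
  unfolding has_derivative_at_alt
proof (intro conjI allI impI)
  show "bounded_linear (\<lambda>x::'b. x)" by (rule bounded_linear_ident)
  fix e :: real assume e: "e > 0"
  have L1: "Lg (1::'b) = 0" by (rule Lg_unique) auto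
  show "\<exists>d>0. \<forall>y. norm (y - 1) < d \<longrightarrow> norm (Lg y - Lg 1 - (y - (1::'b))) \<le> e * norm (y - 1)"
  \<comment> \<open>By \<open>small_log_close\<close> and
    \<open>norm (Lg y) \<le> 2 * norm (y - 1)\<close> the error is at most 8 times the square of
    \<open>norm (y - 1)\<close>; the other 1/8 is the domain of \<open>Lg\<close>.\<close>
  proof (intro exI[of _ "min (1/8) (e/8)"] conjI allI impI)
    show "0 < min (1/8) (e/8)" using e by simp
    fix y :: 'b assume y: "norm (y - 1) < min (1/8) (e/8)"
    note L = Lg[of y]
    have "norm (Lg y - (y - 1)) = norm (exp (Lg y) - 1 - Lg y)"
      using L(2) y norm_minus_commute[of "Lg y" "y - 1"] by simp
    also have "\<dots> \<le> 2 * norm (Lg y) * norm (Lg y)" by (rule small_log_close) (use L y in auto)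
    also have "\<dots> \<le> 2 * (2 * norm (y - 1)) * (2 * norm (y - 1))"
      using L(3) y by (intro mult_mono) auto
    also have "\<dots> = 8 * norm (y - 1) * norm (y - 1)" by simp
    also have "\<dots> \<le> e * norm (y - 1)" using y by (intro mult_right_mono) auto
    finally show "norm (Lg y - Lg 1 - (y - 1)) \<le> e * norm (y - 1)" by (simp add: L1)
  qed
qed

lemma has_derivative_into_endo:
  fixes f :: "'t::euclidean_space \<Rightarrow> 'b::euclidean_space endo"
  assumes "\<And>b. b \<in> Basis \<Longrightarrow> ((\<lambda>t. ap (f t) b) has_derivative (\<lambda>h. ap (f' h) b)) (at a)"
    and lin: "linear f'"
  shows "(f has_derivative f') (at a)"
  unfolding has_derivative_at
proof
  show "bounded_linear f'" using lin by (simp add: linear_conv_bounded_linear)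
  have "((\<lambda>h. \<Sum>b\<in>Basis. norm (ap (f (a + h)) b - ap (f a) b - ap (f' h) b) / norm h) \<longlongrightarrow> (\<Sum>b\<in>(Basis::'b set). 0)) (at 0)"
    using assms(1) unfolding has_derivative_at by (intro tendsto_sum) auto
  then have "((\<lambda>h. \<Sum>b\<in>Basis. norm (ap (f (a + h)) b - ap (f a) b - ap (f' h) b) / norm h) \<longlongrightarrow> 0) (at 0)"
    by simp
  moreover have "\<forall>\<^sub>F h in at 0. norm (norm (f (a + h) - f a - f' h) / norm h)
      \<le> (\<Sum>b\<in>Basis. norm (ap (f (a + h)) b - ap (f a) b - ap (f' h) b) / norm h)"
    using norm_endo_Basis[of "f (a + _) - f a - f' _"]
    by (intro always_eventually allI) (simp add: sum_divide_distrib[symmetric] divide_right_mono)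
  ultimately show "((\<lambda>h. norm (f (a + h) - f a - f' h) / norm h) \<longlongrightarrow> 0) (at 0)"
    by (rule Lim_null_comparison[rotated])
qed

lemma norm_exp_minus_1:
  fixes x :: "'b::{real_normed_algebra_1,banach}"
  assumes "norm x \<le> 1/4" shows "norm (exp x - 1) \<le> 2 * norm x"
proof -
  have "norm (exp x - 1) \<le> norm (exp x - 1 - x) + norm x"
    by (metis diff_add_cancel norm_triangle_ineq)
  also have "\<dots> \<le> 2 * norm x * norm x + norm x" using small_log_close[OF assms] by simp
  also have "2 * norm x * norm x \<le> 1 * norm x" using assms by (intro mult_right_mono) auto
  finally show ?thesis by simp
qed

context cartan_group
begin

text \<open>The defect of the derivation rule is at most half of itself: differentiate
  \<open>exp (tx) [exp (-tx) X, exp (-tx) Y]\<close>, whose values at \<open>0\<close> and \<open>1\<close> agree.\<close>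

lemma derivation_of_automorphism:
  assumes nx: "norm x \<le> 1/20"
    and aut: "\<And>X Y. ap (exp x) (bracket G X Y) = bracket G (ap (exp x) X) (ap (exp x) Y)"
  shows "ap x (bracket G X Y) = bracket G (ap x X) Y + bracket G X (ap x Y)"
proof -
  define y where "y X Y = ap x (bracket G X Y) - bracket G (ap x X) Y - bracket G X (ap x Y)" for X Y
  have ys: "y (X - X') Y = y X Y - y X' Y" "y X (Y - Y') = y X Y - y X Y'" for X X' Y Y'
    by (simp_all add: y_def br_simps)
  have step: "norm (y X Y) \<le> C / 2 * norm X * norm Y"
    if C: "\<And>X Y. norm (y X Y) \<le> C * norm X * norm Y" and C0: "0 \<le> C" for C X Y
  proof -
    define E where "E t = exp (t *\<^sub>R x)" for t :: real
    define F where "F t = exp (t *\<^sub>R (- x))" for t :: real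
    define f where "f t = ap (E t) (bracket G (ap (F t) X) (ap (F t) Y))" for t
    define f' where "f' t = ap (E t) (y (ap (F t) X) (ap (F t) Y))" for t
    have dF: "((\<lambda>t. ap (F t) Z) has_vector_derivative - ap x (ap (F t) Z)) (at t)" for t Z
    proof -
      have "((\<lambda>t. ap (exp (t *\<^sub>R (- x))) Z) has_vector_derivative ap ((- x) * exp (t *\<^sub>R (- x))) Z) (at t)"
        by (rule bounded_linear.has_vector_derivative[OF bounded_linear_ap_left])
          (rule exp_scaleR_has_vector_derivative_left)
      then show ?thesis by (simp add: F_def)
    qed
    have dE: "(E has_vector_derivative E t * x) (at t)" for t
      unfolding E_def by (rule exp_scaleR_has_vector_derivative_right)
    have "(f has_vector_derivative
        (ap (E t) (bracket G (ap (F t) X) (- ap x (ap (F t) Y)) + bracket G (- ap x (ap (F t) X)) (ap (F t) Y))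
          + ap (E t * x) (bracket G (ap (F t) X) (ap (F t) Y)))) (at t)" for t
      unfolding f_def
      by (intro bounded_bilinear.has_vector_derivative[OF bounded_bilinear_ap]
          bounded_bilinear.has_vector_derivative[OF bounded_bilinear_bracket] dF dE)
    moreover have "ap (E t) (bracket G (ap (F t) X) (- ap x (ap (F t) Y)) + bracket G (- ap x (ap (F t) X)) (ap (F t) Y))
          + ap (E t * x) (bracket G (ap (F t) X) (ap (F t) Y)) = f' t" for t
      by (simp add: f'_def y_def br_simps)
    ultimately have df: "(f has_vector_derivative f' t) (at t within {0..1})" for t
      using has_vector_derivative_at_within by metis
    have eF: "ap (exp x) (ap (F 1) Z) = Z" for Z
    proof -
      have "exp x * F 1 = 1" by (simp add: F_def exp_minus_inverse)
      then show ?thesis by (metis ap_simps(2,6))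
    qed
    have f1: "f 1 = bracket G X Y" using aut by (simp add: f_def E_def eF)
    have f0: "f 0 = bracket G X Y" "f' 0 = y X Y" by (simp_all add: f_def f'_def E_def F_def)
    have bd: "norm (f' t - f' 0) \<le> C / 2 * norm X * norm Y" if t: "t \<in> {0..1}" for t
    proof -
      have tx: "norm (t *\<^sub>R x) \<le> 1/20" using nx t mult_left_le_one_le[of "norm x" t] by simp
      have En: "norm (E t - 1) \<le> 1/10" using norm_exp_minus_1[of "t *\<^sub>R x"] tx by (simp add: E_def)
      have Fn: "norm (F t - 1) \<le> 1/10" using norm_exp_minus_1[of "t *\<^sub>R (- x)"] tx by (simp add: F_def)
      have FZ: "norm (ap (F t) Z - Z) \<le> 1/10 * norm Z" for Z
        using norm_ap[of "F t - 1" Z] mult_right_mono[OF Fn norm_ge_zero[of Z]] by simp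
      have FZ2: "norm (ap (F t) Z) \<le> 11/10 * norm Z" for Z
        using FZ[of Z] norm_triangle_sub[of "ap (F t) Z" Z] by simp
      have a1: "norm (ap (E t - 1) (y (ap (F t) X) (ap (F t) Y))) \<le> 1/10 * (C * (11/10 * norm X) * (11/10 * norm Y))"
        by (intro order_trans[OF norm_ap] mult_mono En order_trans[OF C] FZ2 C0 order_refl mult_nonneg_nonneg) auto
      have a2: "norm (y (ap (F t) X - X) (ap (F t) Y)) \<le> C * (1/10 * norm X) * (11/10 * norm Y)"
        by (intro order_trans[OF C] mult_mono FZ FZ2 C0 order_refl mult_nonneg_nonneg) auto
      have a3: "norm (y X (ap (F t) Y - Y)) \<le> C * norm X * (1/10 * norm Y)"
        by (intro order_trans[OF C] mult_mono FZ FZ2 C0 order_refl mult_nonneg_nonneg) auto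
      have "f' t - f' 0 = ap (E t - 1) (y (ap (F t) X) (ap (F t) Y)) + y (ap (F t) X - X) (ap (F t) Y) + y X (ap (F t) Y - Y)"
        by (simp add: f0 ys) (simp add: f'_def)
      then have "norm (f' t - f' 0) \<le> 1/10 * (C * (11/10 * norm X) * (11/10 * norm Y))
          + C * (1/10 * norm X) * (11/10 * norm Y) + C * norm X * (1/10 * norm Y)"
        using a1 a2 a3 by (metis (no_types, lifting) norm_triangle_mono)
      \<comment> \<open>The three summands contribute 0.121, 0.11 and 0.1: the assumption
        \<open>norm x \<le> 1/20\<close> keeps \<open>E t\<close> and \<open>F t\<close> within 1/10
        of 1.\<close>
      also have "\<dots> = 331/1000 * (C * norm X * norm Y)" by (simp add: algebra_simps)
      also have "\<dots> \<le> 1/2 * (C * norm X * norm Y)"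
        using C0 by (intro mult_right_mono mult_nonneg_nonneg) auto
      finally show ?thesis by simp
    qed
    have "norm (f 1 - f 0 - (1 - 0) *\<^sub>R f' 0) \<le> norm (1 - 0 :: real) * (C / 2 * norm X * norm Y)"
      by (rule vector_differentiable_bound_linearization[of "{0..1}" f f' 0 1])
        (use df bd in \<open>auto simp: closed_segment_eq_real_ivl\<close>)
    then show ?thesis using f1 f0 by simp
  qed
  obtain K where K: "K \<ge> 0" "\<And>X Y. norm (bracket G X Y) \<le> norm X * norm Y * K"
    using bounded_bilinear.nonneg_bounded[OF bounded_bilinear_bracket] by metis
  \<comment> \<open>Any bilinear bound for the defect can start the iteration. This one comes from
    its three terms, and each use of \<open>step\<close> halves it.\<close>
  define C0 where "C0 = 3 * norm x * K"
  have "norm (y X Y) \<le> C0 / 2 ^ n * norm X * norm Y" for n X Y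
  proof (induction n arbitrary: X Y)
    case 0
    have a1: "norm (ap x (bracket G X Y)) \<le> norm x * (norm X * norm Y * K)"
      by (intro order_trans[OF norm_ap] mult_left_mono K) auto
    have a2: "norm (bracket G (ap x X) Y) \<le> norm x * norm X * norm Y * K"
      by (intro order_trans[OF K(2)] mult_right_mono norm_ap K) auto
    have a3: "norm (bracket G X (ap x Y)) \<le> norm X * (norm x * norm Y) * K"
      by (intro order_trans[OF K(2)] mult_right_mono mult_left_mono norm_ap K) auto
    have "norm (y X Y) \<le> norm (ap x (bracket G X Y)) + norm (bracket G (ap x X) Y) + norm (bracket G X (ap x Y))"
      unfolding y_def by (meson norm_triangle_ineq4 order_trans add_right_mono)
    also have "\<dots> \<le> norm x * (norm X * norm Y * K) + norm x * norm X * norm Y * K + norm X * (norm x * norm Y) * K"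
      by (intro add_mono a1 a2 a3)
    also have "\<dots> = C0 / 2 ^ 0 * norm X * norm Y" by (simp add: C0_def algebra_simps)
    finally show ?case .
  next
    case (Suc n)
    have "norm (y X Y) \<le> (C0 / 2 ^ n) / 2 * norm X * norm Y"
      by (rule step[OF Suc]) (use K in \<open>simp add: C0_def\<close>)
    then show ?case by (simp add: mult.commute)
  qed
  then have bnd: "\<exists>N. \<forall>n\<ge>N. norm (y X Y) \<le> C0 / 2 ^ n * norm X * norm Y" by blast
  have "(\<lambda>n. C0 / 2 ^ n * norm X * norm Y) \<longlonglongrightarrow> 0 * norm X * norm Y"
  proof -
    have "(\<lambda>n. (1/2::real) ^ n) \<longlonglongrightarrow> 0" by (rule LIMSEQ_power_zero) simp
    from tendsto_mult_left[OF this, of C0]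
    have "(\<lambda>n. C0 / 2 ^ n) \<longlonglongrightarrow> 0" by (simp only: power_one_over times_divide_eq_right mult_1_right mult_zero_right)
    then show ?thesis by (intro tendsto_mult tendsto_const)
  qed
  from LIMSEQ_le_const[OF this bnd] have "norm (y X Y) \<le> 0 * norm X * norm Y" .
  then show ?thesis by (simp add: y_def algebra_simps)
qed

text \<open>The logarithm at most doubles the distance to 1, so 1/40 yields the bound 1/20 that
  \<open>derivation_of_automorphism\<close> asks for.\<close>

definition near where "near = {g \<in> carrier G. norm (AdE g - 1) < 1/40}"
definition psi where "psi g = Lad (Lg (AdE g))"

text \<open>The logarithm of an automorphism close to 1 is a derivation, and derivations are inner;
  so \<open>Lg (AdE g)\<close> lies in the image of \<open>adE\<close>.\<close>

lemma psi:
  assumes "g \<in> near"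
  shows "adE (psi g) = Lg (AdE g)" "exp (adE (psi g)) = AdE g" "norm (adE (psi g)) \<le> 1/20"
proof -
  have g: "g \<in> carrier G" "norm (AdE g - 1) < 1/40" using assms by (auto simp: near_def)
  then have L: "exp (Lg (AdE g)) = AdE g" "norm (Lg (AdE g)) \<le> 1/20"
    using Lg[of "AdE g"] by auto
  show 1: "adE (psi g) = Lg (AdE g)"
    unfolding psi_def
    by (rule derivation_inner, rule derivation_of_automorphism[OF L(2)]) (simp add: L g Ad_bracket)
  show "exp (adE (psi g)) = AdE g" "norm (adE (psi g)) \<le> 1/20" using L 1 by auto
qed

lemma ad_exp_unique:
  assumes "exp (adE X) = exp (adE Y)" "norm (adE X) \<le> 1/4" "norm (adE Y) \<le> 1/4"
  shows "X = Y"
  using small_log_lipschitz[OF assms(2,3)] assms(1) by (intro adE_eq) simp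

lemma psi_unique:
  assumes "g \<in> near" "exp (adE X) = AdE g" "norm (adE X) \<le> 1/4"
  shows "psi g = X"
  using psi[OF assms(1)] assms by (intro ad_exp_unique) auto

lemma psi_lipschitz:
  "\<exists>C>0. \<forall>g\<in>near. \<forall>h\<in>near. norm (psi g - psi h) \<le> C * norm (AdE g - AdE h)"
proof -
  obtain K where K: "K > 0" "\<And>D. norm (Lad D) \<le> norm D * K"
    using bounded_linear.pos_bounded[OF bounded_linear_Lad] by metis
  show ?thesis
  proof (intro exI[of _ "2 * K"] conjI ballI)
    fix g h assume gh: "g \<in> near" "h \<in> near"
    have "norm (psi g - psi h) = norm (Lad (Lg (AdE g) - Lg (AdE h)))"
      by (simp add: psi_def linear_diff[OF bounded_linear.linear[OF bounded_linear_Lad]])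
    also have "\<dots> \<le> norm (Lg (AdE g) - Lg (AdE h)) * K" by (rule K)
    also have "\<dots> \<le> 2 * norm (AdE g - AdE h) * K"
      using gh K by (intro mult_right_mono Lg_lipschitz) (auto simp: near_def)
    finally show "norm (psi g - psi h) \<le> 2 * K * norm (AdE g - AdE h)" by (simp add: mult_ac)
  qed (use K in simp)
qed

lemma near_one: "\<one> \<in> near" by (simp add: near_def AdE_one)

lemma psi_one: "psi \<one> = 0"
  by (rule psi_unique[OF near_one]) (simp_all add: linear_0[OF linear_adE] AdE_one)

lemma continuous_AdE: "continuous_map gT euclidean AdE"
  unfolding continuous_map_atin limitin_canonical_iff
proof (intro ballI continuous_into_endo)
  fix x and b :: 'e assume x: "x \<in> topspace gT"
  then have x': "x \<in> carrier G" using topspace_gtop by simp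
  have "limitin euclidean (\<lambda>g. Ad G g b) (Ad G x b) (atin gT x)"
    using continuous_Ad x unfolding continuous_map_atin by blast
  then have "((\<lambda>g. Ad G g b) \<longlongrightarrow> Ad G x b) (atin gT x)" by simp
  moreover have "\<forall>\<^sub>F g in atin gT x. Ad G g b = ap (AdE g) b"
    unfolding eventually_atin using topspace_gtop x openin_topspace[of gT]
    by (intro disjI2 exI[of _ "topspace gT"]) auto
  ultimately show "((\<lambda>g. ap (AdE g) b) \<longlongrightarrow> ap (AdE x) b) (atin gT x)"
    using x' by (auto intro: Lim_transform_eventually)
qed

lemma openin_AdE:
  assumes "open U" shows "openin gT {g \<in> carrier G. AdE g \<in> U}"
  using openin_continuous_map_preimage[OF continuous_AdE, of U] assms topspace_gtop by simp

lemma openin_near: "openin gT near"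
proof -
  have "near = {g \<in> carrier G. AdE g \<in> ball 1 (1/40)}"
    by (auto simp: near_def dist_norm norm_minus_commute)
  then show ?thesis using openin_AdE[of "ball 1 (1/40)"] by simp
qed

lemma AdE_has_derivative: "((\<lambda>u. AdE (coord_inv G u)) has_derivative adE) (at o0)"
proof (rule has_derivative_into_endo[OF _ linear_adE])
  fix b :: 'e
  have "((\<lambda>u. ap (AdE (coord_inv G u)) b) has_derivative (\<lambda>X. bracket G X b)) (at o0)"
    by (rule has_derivative_transform_within_open[OF has_derivative_bracket coord_facts(2,11)])
      (simp add: coord_facts)
  then show "((\<lambda>u. ap (AdE (coord_inv G u)) b) has_derivative (\<lambda>h. ap (adE h) b)) (at o0)" by simp
qed

text \<open>The derivatives compose to \<open>Lad \<circ> adE\<close>, the identity. So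
  \<open>psi\<close> agrees with the chart to first order, which ties notions defined in the chart
  to operators.\<close>

lemma psi_has_derivative: "((\<lambda>u. psi (coord_inv G u)) has_derivative (\<lambda>X. X)) (at o0)"
proof -
  have 1: "(Lg \<circ> (\<lambda>u. AdE (coord_inv G u)) has_derivative (\<lambda>x. x) \<circ> adE) (at o0)"
    by (rule diff_chain_at[OF AdE_has_derivative]) (use Lg_has_derivative in \<open>simp add: coord_facts AdE_one\<close>)
  have "((\<lambda>u. Lad ((Lg \<circ> (\<lambda>u. AdE (coord_inv G u))) u)) has_derivative (\<lambda>X. Lad (((\<lambda>x. x) \<circ> adE) X))) (at o0)"
    by (rule bounded_linear.has_derivative[OF bounded_linear_Lad 1])
  then show ?thesis by (simp add: psi_def o_def)
qed

lemma open_near_coord: "open {u \<in> img0. coord_inv G u \<in> near}" (is "open ?S")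
  and o0_near_coord: "o0 \<in> {u \<in> img0. coord_inv G u \<in> near}"
  and continuous_psi_coord: "continuous_on {u \<in> img0. coord_inv G u \<in> near} (\<lambda>u. psi (coord_inv G u))"
proof -
  show "open ?S" by (intro coord_facts openin_near)
  show "o0 \<in> ?S" by (simp add: coord_facts near_one)
  have "continuous_map (top_of_set img0) euclidean (AdE \<circ> coord_inv G)"
    using chart_facts(9)[OF id_chart(1)] continuous_AdE
    by (metis continuous_map_compose coord_inv_def)
  then have "continuous_on img0 (\<lambda>u. AdE (coord_inv G u))" by (simp add: o_def)
  then have c: "continuous_on ?S (\<lambda>u. AdE (coord_inv G u))" by (rule continuous_on_subset) auto
  obtain C where C: "C > 0" "\<And>g h. g \<in> near \<Longrightarrow> h \<in> near \<Longrightarrow> norm (psi g - psi h) \<le> C * norm (AdE g - AdE h)"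
    using psi_lipschitz by blast
  show "continuous_on ?S (\<lambda>u. psi (coord_inv G u))"
    unfolding continuous_on_iff
  proof (intro ballI allI impI)
    fix x e assume x: "x \<in> ?S" and e: "(0::real) < e"
    have "0 < e / C" using e C by simp
    from c[unfolded continuous_on_iff, rule_format, OF x this]
    obtain d where d: "d > 0" "\<And>x'. x' \<in> ?S \<Longrightarrow> dist x' x < d \<Longrightarrow> dist (AdE (coord_inv G x')) (AdE (coord_inv G x)) < e / C"
      by blast
    show "\<exists>d>0. \<forall>x'\<in>?S. dist x' x < d \<longrightarrow> dist (psi (coord_inv G x')) (psi (coord_inv G x)) < e"
    proof (intro exI[of _ d] conjI ballI impI)
      fix x' assume x': "x' \<in> ?S" "dist x' x < d"
      have "dist (psi (coord_inv G x')) (psi (coord_inv G x)) \<le> C * dist (AdE (coord_inv G x')) (AdE (coord_inv G x))"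
        using C(2)[of "coord_inv G x'" "coord_inv G x"] x x' unfolding dist_norm by blast
      also have "\<dots> < C * (e / C)" using d x' C by (intro mult_strict_left_mono) auto
      finally show "dist (psi (coord_inv G x')) (psi (coord_inv G x)) < e" using C by simp
    qed (rule d)
  qed
qed

section \<open>Local injectivity and surjectivity\<close>

lemma nbhd_mult:
  assumes "openin gT V" "\<one> \<in> V"
  obtains U where "openin gT U" "\<one> \<in> U" "U \<subseteq> V"
    "\<And>g h. g \<in> U \<Longrightarrow> h \<in> U \<Longrightarrow> g \<otimes> h \<in> V"
    "\<And>g h. g \<in> U \<Longrightarrow> h \<in> U \<Longrightarrow> inv g \<otimes> h \<in> V"
    "\<And>g. g \<in> U \<Longrightarrow> inv g \<in> V"
proof -
  have "openin (prod_topology gT gT) {z \<in> topspace (prod_topology gT gT). (\<lambda>(x, y). x \<otimes> y) z \<in> V}"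
    using openin_continuous_map_preimage[OF continuous_mult assms(1)] .
  moreover have "(\<one>, \<one>) \<in> {z \<in> topspace (prod_topology gT gT). (\<lambda>(x, y). x \<otimes> y) z \<in> V}"
    using assms topspace_gtop by simp
  ultimately obtain A B where AB: "openin gT A" "openin gT B" "\<one> \<in> A" "\<one> \<in> B"
    and sub: "A \<times> B \<subseteq> {z \<in> topspace (prod_topology gT gT). (\<lambda>(x, y). x \<otimes> y) z \<in> V}"
    unfolding openin_prod_topology_alt by meson
  have ABV: "g \<otimes> h \<in> V" if "g \<in> A" "h \<in> B" for g h using sub that by auto
  define U where "U = A \<inter> B \<inter> V \<inter> {g \<in> carrier G. inv g \<in> A} \<inter> {g \<in> carrier G. inv g \<in> V}"
  show thesis
  proof (rule that[of U])
    show "openin gT U" unfolding U_def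
      by (intro openin_Int AB assms openin_preimage continuous_inv)
  qed (use AB ABV assms in \<open>auto simp: U_def\<close>)
qed

text \<open>Where \<open>AdE\<close> is 1 the function \<open>psi\<close> vanishes; but near
  \<open>o0\<close> it differs from \<open>u - o0\<close> by at most half the length of that vector,
  so only the identity is left. Injectivity follows by applying this to
  \<open>inv g \<otimes> h\<close>.\<close>

lemma AdE_locally_injective:
  obtains V where "openin gT V" "\<one> \<in> V" "V \<subseteq> near" "\<And>g h. g \<in> V \<Longrightarrow> h \<in> V \<Longrightarrow> AdE g = AdE h \<Longrightarrow> g = h"
proof -
  have "\<forall>e>0. \<exists>d>0. \<forall>y. norm (y - o0) < d \<longrightarrow>
      norm (psi (coord_inv G y) - psi (coord_inv G o0) - (y - o0)) \<le> e * norm (y - o0)"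
    using psi_has_derivative unfolding has_derivative_at_alt by blast
  then obtain d where d: "d > 0" "\<And>y. norm (y - o0) < d \<Longrightarrow> norm (psi (coord_inv G y) - (y - o0)) \<le> 1/2 * norm (y - o0)"
    by (metis (no_types, lifting) coord_facts(12) diff_zero half_gt_zero_iff psi_one zero_less_one)
  define V0 where "V0 = {x \<in> dom0. coord G x \<in> ball o0 d} \<inter> near"
  have V0: "openin gT V0" "\<one> \<in> V0"
    using d id_chart near_one openin_Int[OF coord_facts(10)[OF open_ball] openin_near]
    by (simp_all add: V0_def)
  have ker: "g = \<one>" if g: "g \<in> V0" "AdE g = 1" for g
  proof -
    have "psi g = 0" by (rule psi_unique) (use g in \<open>auto simp: V0_def linear_0[OF linear_adE]\<close>)
    moreover have gc: "coord_inv G (coord G g) = g" using g by (auto simp: V0_def coord_facts)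
    moreover have "norm (coord G g - o0) < d" using g by (auto simp: V0_def dist_norm norm_minus_commute)
    ultimately have "norm (0 - (coord G g - o0)) \<le> 1/2 * norm (coord G g - o0)" using d(2) by metis
    then have "norm (coord G g - o0) \<le> 1/2 * norm (coord G g - o0)" by (simp only: diff_0 norm_minus_cancel)
    then have "coord G g = o0" by simp
    then show ?thesis using gc coord_facts(12) by metis
  qed
  obtain U where U: "openin gT U" "\<one> \<in> U" "U \<subseteq> V0" "\<And>g h. g \<in> U \<Longrightarrow> h \<in> U \<Longrightarrow> inv g \<otimes> h \<in> V0"
    using nbhd_mult[OF V0] by metis
  show thesis
  proof (rule that[OF U(1,2)])
    show "U \<subseteq> near" using U(3) by (auto simp: V0_def)
    fix g h assume gh: "g \<in> U" "h \<in> U" "AdE g = AdE h"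
    have c: "g \<in> carrier G" "h \<in> carrier G" using gh U(1) openin_subset topspace_gtop by blast+
    have "AdE (inv g \<otimes> h) = 1" using c gh by (simp add: AdE_mult AdE_inv flip: gh(3))
    then have "inv g \<otimes> h = \<one>" using ker U(4) gh by blast
    then show "g = h" using c by (metis inv_equality inv_inv inv_closed)
  qed
qed

text \<open>Differentiability of \<open>psi\<close> is known at one point, together with continuity
  around it; this is the setting of \<open>sussmann_open_mapping\<close>.\<close>

lemma psi_surjective:
  assumes "openin gT W" "\<one> \<in> W"
  obtains r where "r > 0" "\<And>X. norm X < r \<Longrightarrow> \<exists>g\<in>W. g \<in> near \<and> psi g = X"
proof -
  let ?S = "{u \<in> img0. coord_inv G u \<in> near}"
  let ?f = "\<lambda>u. psi (coord_inv G u)"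
  define T where "T = {u \<in> img0. coord_inv G u \<in> W \<inter> near}"
  have opT: "open T" unfolding T_def by (intro coord_facts openin_Int assms openin_near)
  have oT: "o0 \<in> T" using assms near_one by (simp add: T_def coord_facts)
  have "?f o0 \<in> interior (?f ` T)"
  proof (rule sussmann_open_mapping[OF open_near_coord continuous_psi_coord o0_near_coord psi_has_derivative])
    show "bounded_linear (\<lambda>X::'e. X)" by (rule bounded_linear_ident)
    show "(\<lambda>X::'e. X) \<circ> (\<lambda>X. X) = id" by auto
    show "T \<subseteq> ?S" by (auto simp: T_def)
    show "o0 \<in> interior T" using opT oT by (simp add: interior_open)
  qed
  then obtain r where r: "r > 0" "ball 0 r \<subseteq> ?f ` T"
    by (auto simp: mem_interior coord_facts psi_one)
  show thesis
  proof (rule that[OF r(1)])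
    fix X :: 'e assume "norm X < r"
    then have "X \<in> ?f ` T" using r by auto
    then show "\<exists>g\<in>W. g \<in> near \<and> psi g = X" by (auto simp: T_def)
  qed
qed

end

section \<open>The exponential map\<close>

lemma (in group) inv_mult_cancel:
  assumes "g \<in> carrier G" "x \<in> carrier G"
  shows "inv g \<otimes> (g \<otimes> x) = x" "g \<otimes> (inv g \<otimes> x) = x"
  using assms by (simp_all flip: m_assoc)

text \<open>The extension is the \<open>n\<close>-th power of \<open>f (t / n)\<close> for large
  \<open>n\<close>; two values of \<open>n\<close> are compared through their product.\<close>

lemma (in group) extend_local_hom:
  fixes f :: "real \<Rightarrow> 'a"
  assumes d: "0 < d" and car: "\<And>t. \<bar>t\<bar> < d \<Longrightarrow> f t \<in> carrier G"
    and hom: "\<And>s t. \<bar>s\<bar> < d \<Longrightarrow> \<bar>t\<bar> < d \<Longrightarrow> \<bar>s + t\<bar> < d \<Longrightarrow> f (s + t) = f s \<otimes> f t"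
  obtains c where "\<And>t. c t \<in> carrier G" "\<And>s t. c (s + t) = c s \<otimes> c t" "\<And>t. \<bar>t\<bar> < d \<Longrightarrow> c t = f t"
proof -
  have f0: "f 0 = \<one>"
    using hom[of 0 0] car[of 0] d by simp
  have pow: "f (real m * s) = f s [^] m" if "\<bar>s\<bar> * real m < d" for m s
    using that
  proof (induction m)
    case (Suc m)
    have a: "\<bar>s\<bar> * real m + \<bar>s\<bar> < d" using Suc.prems by (simp add: algebra_simps)
    have b: "0 \<le> \<bar>s\<bar> * real m" by simp
    have c: "\<bar>real m * s\<bar> = \<bar>s\<bar> * real m" by (simp add: abs_mult)
    have e: "\<bar>s\<bar> < d" "\<bar>s\<bar> * real m < d" using a b abs_ge_zero[of s] by linarith+
    have "\<bar>real m * s + s\<bar> \<le> \<bar>real m * s\<bar> + \<bar>s\<bar>" by (rule abs_triangle_ineq)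
    then have "f (real m * s + s) = f (real m * s) \<otimes> f s"
      using a c e by (intro hom) auto
    then show ?case using Suc.IH e by (simp add: algebra_simps)
  qed (simp add: f0)
  have indep: "f (t / real n) [^] n = f (t / real (n * m)) [^] (n * m)"
    if "\<bar>t\<bar> < d * real n" "n > 0" "m > 0" for t n m
  proof -
    have l: "\<bar>t / real (n * m)\<bar> * real m < d"
      using that by (simp add: field_simps)
    have "f (t / real n) = f (real m * (t / real (n * m)))" using that by simp
    also have "\<dots> = f (t / real (n * m)) [^] m" by (rule pow[OF l])
    finally have 1: "f (t / real n) = f (t / real (n * m)) [^] m" .
    have "\<bar>t / real (n * m)\<bar> * 1 \<le> \<bar>t / real (n * m)\<bar> * real m"
      using that by (intro mult_left_mono) auto
    then have "f (t / real (n * m)) \<in> carrier G" using l by (intro car) linarith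
    then show ?thesis unfolding 1 by (simp add: nat_pow_pow mult.commute)
  qed
  \<comment> \<open>The added 1 makes \<open>\<bar>t\<bar> / N t < d\<close> strict.\<close>
  define N where "N t = nat \<lceil>\<bar>t\<bar> / d\<rceil> + 1" for t
  define c where "c t = f (t / real (N t)) [^] N t" for t
  have Nb: "\<bar>t\<bar> < d * real (N t)" "N t > 0" for t
  proof -
    have "\<bar>t\<bar> / d < real (N t)" unfolding N_def by (simp add: of_nat_nat) linarith
    then show "\<bar>t\<bar> < d * real (N t)" using d by (simp add: field_simps)
  qed (simp add: N_def)
  have cn: "c t = f (t / real n) [^] n" if "\<bar>t\<bar> < d * real n" "n > 0" for t n
    using indep[OF Nb(1) Nb(2) that(2), of t] indep[OF that Nb(2), of t]
    by (simp add: c_def mult.commute)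
  have lt: "\<bar>t / real n\<bar> < d" if "\<bar>t\<bar> < d * real n" "n > 0" for t n
    using that by (simp add: field_simps)
  show thesis
  proof (rule that[of c])
    show "c t \<in> carrier G" for t
      unfolding c_def by (intro nat_pow_closed car lt Nb)
    show "c t = f t" if "\<bar>t\<bar> < d" for t using cn[of t 1] that car by simp
    fix s t
    define n where "n = N (\<bar>s\<bar> + \<bar>t\<bar>)"
    have n: "\<bar>s\<bar> + \<bar>t\<bar> < d * real n" "n > 0" using Nb[of "\<bar>s\<bar> + \<bar>t\<bar>"] by (auto simp: n_def)
    have b: "\<bar>s\<bar> < d * real n" "\<bar>t\<bar> < d * real n" "\<bar>s + t\<bar> < d * real n" using n by linarith+
    \<comment> \<open>Both orders are recorded because \<open>pow_mult_distrib\<close> needs the two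
      factors to commute.\<close>
    have l3: "\<bar>s / real n + t / real n\<bar> < d" "\<bar>t / real n + s / real n\<bar> < d"
      using lt[OF b(3) n(2)] by (simp_all add: add_divide_distrib add.commute)
    have st: "f (s / real n + t / real n) = f (s / real n) \<otimes> f (t / real n)"
      "f (t / real n + s / real n) = f (t / real n) \<otimes> f (s / real n)"
      by (intro hom lt b n l3)+
    have "c (s + t) = (f (s / real n) \<otimes> f (t / real n)) [^] n"
      using cn[OF b(3) n(2)] st by (simp add: add_divide_distrib)
    also have "\<dots> = f (s / real n) [^] n \<otimes> f (t / real n) [^] n"
      using st by (intro pow_mult_distrib car lt b n) (simp add: add.commute)
    also have "\<dots> = c s \<otimes> c t" using cn[OF b(1) n(2)] cn[OF b(2) n(2)] by simp
    finally show "c (s + t) = c s \<otimes> c t" .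
  qed
qed

lemma (in group) real_hom_determined:
  fixes c c' :: "real \<Rightarrow> 'a"
  assumes car: "\<And>t. c t \<in> carrier G" "\<And>t. c' t \<in> carrier G"
    and hom: "\<And>s t. c (s + t) = c s \<otimes> c t" "\<And>s t. c' (s + t) = c' s \<otimes> c' t"
    and d: "0 < d" "\<And>t. \<bar>t\<bar> < d \<Longrightarrow> c t = c' t"
  shows "c = c'"
proof
  fix t
  have pow: "e (real n * s) = e s [^] n"
    if "\<And>t. e t \<in> carrier G" "\<And>s t. e (s + t) = e s \<otimes> e t" for e :: "real \<Rightarrow> 'a" and n s
  proof (induction n)
    case 0
    have "e 0 \<otimes> e 0 = e 0" using that(2)[of 0 0] by simp
    then show ?case using that(1)[of 0] by simp
  next
    case (Suc n)
    then show ?case using that(2)[of "real n * s" s] by (simp add: algebra_simps)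
  qed
  obtain n where n: "\<bar>t\<bar> / d < real n" using reals_Archimedean2 by blast
  have n0: "n > 0" using n d by (cases n) (auto simp: divide_less_0_iff)
  have "\<bar>t / real n\<bar> < d" using n n0 d by (simp add: field_simps)
  then have "c (t / real n) [^] n = c' (t / real n) [^] n" using d by simp
  then have "c (real n * (t / real n)) = c' (real n * (t / real n))"
    unfolding pow[of c, OF car(1) hom(1)] pow[of c', OF car(2) hom(2)] .
  then show "c t = c' t" using n0 by simp
qed

context cartan_group
begin

section \<open>One-parameter subgroups\<close>

lemma nbhd_carrier: "openin gT V \<Longrightarrow> V \<subseteq> carrier G"
  using openin_subset topspace_gtop by blast

lemma continuous_real_hom:
  fixes c :: "real \<Rightarrow> 'a"
  assumes car: "\<And>t. c t \<in> carrier G" and hom: "\<And>s t. c (s + t) = c s \<otimes> c t"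
    and cont: "\<And>W. openin gT W \<Longrightarrow> \<one> \<in> W \<Longrightarrow> \<exists>d>0. \<forall>t. \<bar>t\<bar> < d \<longrightarrow> c t \<in> W"
  shows "continuous_map euclideanreal gT c"
  unfolding continuous_map
proof (intro conjI allI impI)
  show "c ` topspace euclideanreal \<subseteq> topspace gT" using car topspace_gtop by auto
  fix W assume W: "openin gT W"
  have "\<exists>d>0. ball t d \<subseteq> {x. c x \<in> W}" if t: "c t \<in> W" for t
  proof -
    let ?W = "{x \<in> carrier G. c t \<otimes> x \<in> W}"
    have "openin gT ?W" by (intro openin_preimage continuous_left_translation car W)
    moreover have "\<one> \<in> ?W" using t car by simp
    ultimately obtain d where d: "d > 0" "\<And>s. \<bar>s\<bar> < d \<Longrightarrow> c s \<in> ?W" using cont by metis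
    have "ball t d \<subseteq> {x. c x \<in> W}"
    proof
      fix x assume "x \<in> ball t d"
      then have "\<bar>x - t\<bar> < d" by (simp add: dist_real_def)
      then have "c t \<otimes> c (x - t) \<in> W" using d(2) by simp
      then show "x \<in> {x. c x \<in> W}" using hom[of t "x - t"] by simp
    qed
    then show ?thesis using d(1) by blast
  qed
  then show "openin euclideanreal {x \<in> topspace euclideanreal. c x \<in> W}"
    by (auto simp: open_contains_ball)
qed

lemma real_hom_continuous_at_0:
  fixes c :: "real \<Rightarrow> 'a"
  assumes "continuous_map euclideanreal gT c" "openin gT W" "c 0 \<in> W"
  shows "\<exists>d>0. \<forall>t. \<bar>t\<bar> < d \<longrightarrow> c t \<in> W"
proof -
  have "open {t. c t \<in> W}" using openin_continuous_map_preimage[OF assms(1,2)] by simp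
  then obtain d where "d > 0" "ball 0 d \<subseteq> {t. c t \<in> W}" using assms(3) open_contains_ball by blast
  then show ?thesis by (intro exI[of _ d]) (auto simp: dist_real_def subset_iff)
qed

lemma hom_0:
  fixes c :: "real \<Rightarrow> 'a"
  assumes "\<And>t. c t \<in> carrier G" "\<And>s t. c (s + t) = c s \<otimes> c t" shows "c 0 = \<one>"
  using assms(1)[of 0] assms(2)[of 0 0] by simp

text \<open>The curve \<open>A t = AdE (c t)\<close> solves \<open>A' = A * adE X\<close>, and
  uniqueness of the solution is the constancy of \<open>C t\<close>, whose derivative
  vanishes.\<close>

lemma one_parameter_AdE:
  assumes c: "one_parameter_subgroup G X c"
  shows "AdE (c t) = exp (t *\<^sub>R adE X)"
proof -
  have cm: "continuous_map euclideanreal gT c" and hom: "\<And>s t. c (s + t) = c s \<otimes> c t"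
    and der: "((coord G \<circ> c) has_vector_derivative X) (at 0)"
    using c by (auto simp: one_parameter_subgroup_def)
  have car: "c t \<in> carrier G" for t using cm topspace_gtop by (auto simp: continuous_map_def Pi_iff)
  have c0: "c 0 = \<one>" by (rule hom_0) (use car hom in auto)
  obtain d where d: "d > 0" "\<And>t. \<bar>t\<bar> < d \<Longrightarrow> c t \<in> dom0"
    using real_hom_continuous_at_0[OF cm coord_facts(1)] c0 id_chart by metis
  define A where "A t = AdE (c t)" for t
  have "((\<lambda>u. AdE (coord_inv G u)) \<circ> (coord G \<circ> c) has_derivative adE \<circ> (\<lambda>h. h *\<^sub>R X)) (at 0)"
    by (rule diff_chain_at) (use der AdE_has_derivative c0 in \<open>auto simp: has_vector_derivative_def\<close>)
  then have "((\<lambda>u. AdE (coord_inv G u)) \<circ> (coord G \<circ> c) has_vector_derivative adE X) (at 0)"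
    by (simp add: has_vector_derivative_def o_def linear_scale[OF linear_adE])
  then have A0: "(A has_vector_derivative adE X) (at 0)"
    by (rule has_vector_derivative_transform_within_open[of _ _ _ "ball 0 d"])
      (use d in \<open>auto simp: A_def dist_real_def coord_facts\<close>)
  have Ahom: "A (s + t) = A s * A t" for s t by (simp add: A_def hom AdE_mult car)
  have dA: "(A has_vector_derivative A t * adE X) (at t)" for t
  proof -
    have "((\<lambda>s. A t * A (s - t)) has_vector_derivative A t * adE X) (at t)"
    proof (rule bounded_linear.has_vector_derivative[OF bounded_linear_mult_right])
      have "(A \<circ> (\<lambda>s. s - t) has_vector_derivative 1 *\<^sub>R adE X) (at t)"
        by (rule vector_diff_chain_at) (use A0 in \<open>auto intro!: derivative_eq_intros\<close>)
      then show "((\<lambda>s. A (s - t)) has_vector_derivative adE X) (at t)" by (simp add: o_def)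
    qed
    moreover have "A t * A (s - t) = A s" for s using Ahom[of t "s - t"] by simp
    ultimately show ?thesis by simp
  qed
  define C where "C t = A t * exp (t *\<^sub>R (- adE X))" for t
  have dC: "(C has_vector_derivative 0) (at t)" for t
  proof -
    have "(C has_vector_derivative A t * (- adE X * exp (t *\<^sub>R (- adE X))) + A t * adE X * exp (t *\<^sub>R (- adE X))) (at t)"
      unfolding C_def
      by (rule bounded_bilinear.has_vector_derivative[OF bounded_bilinear_mult dA])
        (rule exp_scaleR_has_vector_derivative_left)
    then show ?thesis by (simp add: mult.assoc)
  qed
  have "C t = C 0"
    by (rule has_derivative_zero_unique[of UNIV]) (use dC in \<open>auto simp: has_vector_derivative_def\<close>)
  then have "A t * exp (- (t *\<^sub>R adE X)) = 1" by (simp add: C_def A_def c0 AdE_one)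
  then have "A t * (exp (- (t *\<^sub>R adE X)) * exp (t *\<^sub>R adE X)) = exp (t *\<^sub>R adE X)"
    by (simp flip: mult.assoc)
  moreover have "exp (- (t *\<^sub>R adE X)) * exp (t *\<^sub>R adE X) = 1"
    using exp_minus_inverse[of "- (t *\<^sub>R adE X)"] by simp
  ultimately show ?thesis by (simp add: A_def)
qed

lemma one_parameter_unique:
  assumes c: "one_parameter_subgroup G X c" and c': "one_parameter_subgroup G X c'"
  shows "c = c'"
proof -
  obtain V where V: "openin gT V" "\<one> \<in> V" "\<And>g h. g \<in> V \<Longrightarrow> h \<in> V \<Longrightarrow> AdE g = AdE h \<Longrightarrow> g = h"
    using AdE_locally_injective by metis
  have cm: "continuous_map euclideanreal gT c" "continuous_map euclideanreal gT c'"
    and hom: "\<And>s t. c (s + t) = c s \<otimes> c t" "\<And>s t. c' (s + t) = c' s \<otimes> c' t"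
    using c c' by (auto simp: one_parameter_subgroup_def)
  have car: "c t \<in> carrier G" "c' t \<in> carrier G" for t
    using cm topspace_gtop by (auto simp: continuous_map_def Pi_iff)
  have 0: "c 0 = \<one>" "c' 0 = \<one>" by (rule hom_0; use car hom in simp)+
  obtain d1 where d1: "d1 > 0" "\<And>t. \<bar>t\<bar> < d1 \<Longrightarrow> c t \<in> V"
    using real_hom_continuous_at_0[OF cm(1) V(1)] 0 V(2) by metis
  obtain d2 where d2: "d2 > 0" "\<And>t. \<bar>t\<bar> < d2 \<Longrightarrow> c' t \<in> V"
    using real_hom_continuous_at_0[OF cm(2) V(1)] 0 V(2) by metis
  show ?thesis
  proof (rule real_hom_determined[OF car hom])
    show "0 < min d1 d2" using d1 d2 by simp
    fix t assume "\<bar>t\<bar> < min d1 d2"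
    then show "c t = c' t" using d1 d2 one_parameter_AdE[OF c] one_parameter_AdE[OF c'] by (intro V(3)) auto
  qed
qed

text \<open>Near \<open>1\<close> the element \<open>e X\<close> is the only one with \<open>Ad (e X) = exp (ad X)\<close>, so that
  \<open>t \<mapsto> e (tX)\<close> is a local homomorphism.\<close>

lemma local_exp:
  obtains V :: "'a set" and r and e :: "'e \<Rightarrow> 'a" where
    "r > 0" "openin gT V" "\<one> \<in> V" "V \<subseteq> near"
    "\<And>g h. g \<in> V \<Longrightarrow> h \<in> V \<Longrightarrow> AdE g = AdE h \<Longrightarrow> g = h"
    "\<And>X. norm X < r \<Longrightarrow> e X \<in> V \<and> psi (e X) = X \<and> AdE (e X) = exp (adE X)"
    "\<And>W. openin gT W \<Longrightarrow> \<one> \<in> W \<Longrightarrow> \<exists>s>0. \<forall>X. norm X < s \<longrightarrow> e X \<in> W"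
    "\<And>X s t. norm (s *\<^sub>R X) < r \<Longrightarrow> norm (t *\<^sub>R X) < r \<Longrightarrow> norm ((s + t) *\<^sub>R X) < r \<Longrightarrow>
       e ((s + t) *\<^sub>R X) = e (s *\<^sub>R X) \<otimes> e (t *\<^sub>R X)"
proof -
  obtain V where V: "openin gT V" "\<one> \<in> V" "V \<subseteq> near" "\<And>g h. g \<in> V \<Longrightarrow> h \<in> V \<Longrightarrow> AdE g = AdE h \<Longrightarrow> g = h"
    using AdE_locally_injective by metis
  obtain U where U: "openin gT U" "\<one> \<in> U" "U \<subseteq> V" "\<And>g h. g \<in> U \<Longrightarrow> h \<in> U \<Longrightarrow> g \<otimes> h \<in> V"
    using nbhd_mult[OF V(1,2)] by metis
  obtain r where r: "r > 0" "\<And>X. norm X < r \<Longrightarrow> \<exists>g\<in>U. g \<in> near \<and> psi g = X"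
    using psi_surjective[OF U(1,2)] by metis
  \<comment> \<open>Values are chosen in \<open>U\<close>, not just in \<open>V\<close>, so that a
    product of two of them still lies where \<open>AdE\<close> is injective.\<close>
  define e where "e X = (SOME g. g \<in> U \<and> psi g = X)" for X
  have e: "e X \<in> U" "psi (e X) = X" if "norm X < r" for X
  proof -
    have "\<exists>g. g \<in> U \<and> psi g = X" using r(2)[OF that] by blast
    then have "e X \<in> U \<and> psi (e X) = X" unfolding e_def by (rule someI_ex)
    then show "e X \<in> U" "psi (e X) = X" by auto
  qed
  have Ade: "AdE (e X) = exp (adE X)" if "norm X < r" for X
    using psi(2)[of "e X"] e[OF that] U(3) V(3) by auto
  show thesis
  proof (rule that[OF r(1) V])
    show "e X \<in> V \<and> psi (e X) = X \<and> AdE (e X) = exp (adE X)" if "norm X < r" for X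
      using e[OF that] Ade[OF that] U(3) by blast
    show "\<exists>s>0. \<forall>X. norm X < s \<longrightarrow> e X \<in> W" if W: "openin gT W" "\<one> \<in> W" for W
    proof -
      obtain s where s: "s > 0" "\<And>X. norm X < s \<Longrightarrow> \<exists>g\<in>W \<inter> V. g \<in> near \<and> psi g = X"
        using psi_surjective[OF openin_Int[OF W(1) V(1)]] W(2) V(2) by (metis IntI)
      have "e X \<in> W" if X: "norm X < min s r" for X
      proof -
        \<comment> \<open>The element with logarithm \<open>X\<close> found inside \<open>W\<close>
          must be \<open>e X\<close>, since \<open>AdE\<close> separates the points of
          \<open>V\<close>.\<close>
        obtain g where g: "g \<in> W" "g \<in> V" "psi g = X" using s(2)[of X] X by auto
        have "AdE g = AdE (e X)" using psi(2)[of g] g V(3) Ade[of X] X by auto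
        then have "g = e X" using V(4)[OF g(2)] e[of X] U(3) X by auto
        then show ?thesis using g by simp
      qed
      then show ?thesis using s(1) r(1) by (intro exI[of _ "min s r"]) auto
    qed
    fix X :: 'e and s t :: real
    assume n: "norm (s *\<^sub>R X) < r" "norm (t *\<^sub>R X) < r" "norm ((s + t) *\<^sub>R X) < r"
    have c: "e (s *\<^sub>R X) \<in> carrier G" "e (t *\<^sub>R X) \<in> carrier G"
      using e n nbhd_carrier[OF U(1)] by blast+
    have "AdE (e (s *\<^sub>R X) \<otimes> e (t *\<^sub>R X)) = exp (adE (s *\<^sub>R X)) * exp (adE (t *\<^sub>R X))"
      using c Ade n by (simp add: AdE_mult)
    also have "\<dots> = exp (adE (s *\<^sub>R X) + adE (t *\<^sub>R X))"
      by (rule exp_add_commuting[symmetric]) (simp add: linear_scale[OF linear_adE])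
    also have "\<dots> = AdE (e ((s + t) *\<^sub>R X))"
      using Ade[OF n(3)] by (simp add: linear_scale[OF linear_adE] linear_add[OF linear_adE] scaleR_add_left)
    finally show "e ((s + t) *\<^sub>R X) = e (s *\<^sub>R X) \<otimes> e (t *\<^sub>R X)"
      using U(3) e(1)[OF n(3)] by (intro V(4)[OF _ U(4)[OF e(1)[OF n(1)] e(1)[OF n(2)]]]) auto
  qed
qed

text \<open>In the coordinate \<open>psi\<close> the curve is exactly linear, and the chart agrees
  with \<open>psi\<close> to first order. The error is relative to the unknown length of
  \<open>v\<close>, which is absorbed through
  \<open>norm v \<le> 2 * norm (t *\<^sub>R X)\<close>.\<close>

lemma coord_psi_derivative:
  assumes u: "\<And>t. \<bar>t\<bar> < d \<Longrightarrow> c t \<in> dom0 \<and> psi (c t) = t *\<^sub>R X" and d: "d > (0::real)"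
    and cont: "\<And>W. openin gT W \<Longrightarrow> \<one> \<in> W \<Longrightarrow> \<exists>d>0. \<forall>t. \<bar>t\<bar> < d \<longrightarrow> c t \<in> W" and c0: "c 0 = \<one>"
  shows "((coord G \<circ> c) has_vector_derivative X) (at 0)"
  unfolding has_vector_derivative_def has_derivative_at_alt
proof (intro conjI allI impI)
  show "bounded_linear (\<lambda>x. x *\<^sub>R X)" by (rule bounded_linear_scaleR_left)
  fix e :: real assume e: "e > 0"
  \<comment> \<open>The bound 1/2 allows the absorption; the other one turns
    \<open>e' * (2 * (\<bar>t\<bar> * norm X))\<close> into at most
    \<open>e * \<bar>t\<bar>\<close>, with 1 added to avoid division by 0.\<close>
  define e' where "e' = min (1/2) (e / (2 * (norm X + 1)))"
  have e': "e' > 0" "e' \<le> 1/2" "e' * (2 * (norm X + 1)) \<le> e"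
  proof -
    have p: "0 < 2 * (norm X + 1)" by (simp add: add_nonneg_pos)
    show "e' > 0" using e p by (simp add: e'_def)
    show "e' \<le> 1/2" unfolding e'_def by (rule min.cobounded1)
    have "e' \<le> e / (2 * (norm X + 1))" unfolding e'_def by (rule min.cobounded2)
    then show "e' * (2 * (norm X + 1)) \<le> e" using p by (simp add: pos_le_divide_eq)
  qed
  have "\<forall>e>0. \<exists>d>0. \<forall>y. norm (y - o0) < d \<longrightarrow>
      norm (psi (coord_inv G y) - psi (coord_inv G o0) - (y - o0)) \<le> e * norm (y - o0)"
    using psi_has_derivative unfolding has_derivative_at_alt by blast
  then obtain d1 where d1: "d1 > 0"
    "\<And>y. norm (y - o0) < d1 \<Longrightarrow> norm (psi (coord_inv G y) - (y - o0)) \<le> e' * norm (y - o0)"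
    using e'(1) by (metis (no_types, lifting) coord_facts(12) diff_zero psi_one)
  have "\<one> \<in> {x \<in> dom0. coord G x \<in> ball o0 d1}" using d1 id_chart by simp
  from cont[OF coord_facts(10)[OF open_ball] this]
  obtain d2 where d2: "d2 > 0" "\<And>t. \<bar>t\<bar> < d2 \<Longrightarrow> c t \<in> {x \<in> dom0. coord G x \<in> ball o0 d1}"
    by blast
  show "\<exists>d>0. \<forall>y. norm (y - 0) < d \<longrightarrow>
      norm ((coord G \<circ> c) y - (coord G \<circ> c) 0 - (y - 0) *\<^sub>R X) \<le> e * norm (y - 0)"
  proof (intro exI[of _ "min d d2"] conjI allI impI)
    fix t :: real assume t: "norm (t - 0) < min d d2"
    define v where "v = coord G (c t) - o0"
    have ci: "coord_inv G (coord G (c t)) = c t" "psi (c t) = t *\<^sub>R X" using u[of t] t by (auto simp: coord_facts)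
    have "norm v < d1" using d2(2)[of t] t by (auto simp: v_def dist_norm norm_minus_commute)
    then have 1: "norm (t *\<^sub>R X - v) \<le> e' * norm v" using d1(2)[of "coord G (c t)"] ci by (simp add: v_def)
    also have "\<dots> \<le> 1/2 * norm v" using e' by (intro mult_right_mono) auto
    finally have "norm (t *\<^sub>R X - v) \<le> 1/2 * norm v" .
    moreover have "norm v \<le> norm (t *\<^sub>R X) + norm (t *\<^sub>R X - v)"
      using norm_triangle_ineq4[of "t *\<^sub>R X" "t *\<^sub>R X - v"] by simp
    ultimately have 2: "norm v \<le> 2 * (\<bar>t\<bar> * norm X)" by simp
    have "norm (v - t *\<^sub>R X) \<le> e' * (2 * (\<bar>t\<bar> * norm X))"
      using 1 2 e' by (subst norm_minus_commute) (meson mult_left_mono order_trans less_imp_le)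
    also have "\<dots> \<le> e' * (2 * (norm X + 1)) * \<bar>t\<bar>"
    proof -
      have "2 * (\<bar>t\<bar> * norm X) \<le> 2 * (norm X + 1) * \<bar>t\<bar>" by (simp add: algebra_simps)
      then have "e' * (2 * (\<bar>t\<bar> * norm X)) \<le> e' * (2 * (norm X + 1) * \<bar>t\<bar>)"
        using e'(1) by (intro mult_left_mono) auto
      then show ?thesis by (simp only: mult.assoc)
    qed
    also have "\<dots> \<le> e * \<bar>t\<bar>" using e'(3) by (intro mult_right_mono) auto
    finally show "norm ((coord G \<circ> c) t - (coord G \<circ> c) 0 - (t - 0) *\<^sub>R X) \<le> e * norm (t - 0)"
      by (simp add: v_def c0)
  qed (use d d2 in simp)
qed

lemma exists_one_parameter:
  "(\<forall>X. \<exists>c. one_parameter_subgroup G X c) \<and> (\<forall>W. openin gT W \<longrightarrow> \<one> \<in> W \<longrightarrow>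
     (\<exists>s>0. \<forall>X c. norm X < s \<longrightarrow> one_parameter_subgroup G X c \<longrightarrow> c 1 \<in> W))"
proof (rule local_exp)
  fix V r and e :: "'e \<Rightarrow> 'a"
  assume r: "r > 0" and V: "openin gT V" "\<one> \<in> V" "V \<subseteq> near"
    and inj: "\<And>g h. g \<in> V \<Longrightarrow> h \<in> V \<Longrightarrow> AdE g = AdE h \<Longrightarrow> g = h"
    and e: "\<And>X. norm X < r \<Longrightarrow> e X \<in> V \<and> psi (e X) = X \<and> AdE (e X) = exp (adE X)"
    and ec: "\<And>W. openin gT W \<Longrightarrow> \<one> \<in> W \<Longrightarrow> \<exists>s>0. \<forall>X. norm X < s \<longrightarrow> e X \<in> W"
    and ea: "\<And>X s t. norm (s *\<^sub>R X) < r \<Longrightarrow> norm (t *\<^sub>R X) < r \<Longrightarrow> norm ((s + t) *\<^sub>R X) < r \<Longrightarrow>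
       e ((s + t) *\<^sub>R X) = e (s *\<^sub>R X) \<otimes> e (t *\<^sub>R X)"
  have *: "\<exists>c. one_parameter_subgroup G X c \<and> (norm X < r \<longrightarrow> c 1 = e X)" for X
  proof -
    \<comment> \<open>Written out, \<open>d\<close> is 2 for \<open>X = 0\<close>,
      \<open>r / norm X\<close> for \<open>0 < norm X < r\<close>, and
      \<open>r / (norm X + 1)\<close> otherwise. In the first two cases \<open>d > 1\<close>, so
      that \<open>c 1 = e X\<close>; the continuity of the exponential at 0 is read off from
      this.\<close>
    define d where "d = r / (norm X + 1) * (if norm X < r then (norm X + 1) / r * (if X = 0 then 2 else r / norm X) else 1)"
    have dp: "d > 0" and dX: "\<And>t. \<bar>t\<bar> < d \<Longrightarrow> norm (t *\<^sub>R X) < r" and d1: "norm X < r \<Longrightarrow> 1 < d"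
    proof -
      consider (a) "norm X < r" "X = 0" | (b) "norm X < r" "X \<noteq> 0" | (c) "\<not> norm X < r" by blast
      then have "d > 0 \<and> (\<forall>t. \<bar>t\<bar> < d \<longrightarrow> norm (t *\<^sub>R X) < r) \<and> (norm X < r \<longrightarrow> 1 < d)"
      proof cases
        case a
        then have "d = 2" using r by (simp add: d_def)
        then show ?thesis using a r by simp
      next
        case b
        have "norm X + 1 \<noteq> 0" using norm_ge_zero[of X] by linarith
        then have "d = r / norm X" using b r by (simp add: d_def)
        then show ?thesis using b r by (simp add: pos_less_divide_eq)
      next
        case c
        have p: "norm X + 1 > 0" using norm_ge_zero[of X] by linarith
        have d: "d = r / (norm X + 1)" using c by (simp add: d_def)
        have "norm (t *\<^sub>R X) < r" if "\<bar>t\<bar> < d" for t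
        proof -
          have "\<bar>t\<bar> * (norm X + 1) < r" using that p d by (simp add: pos_less_divide_eq)
          moreover have "\<bar>t\<bar> * norm X \<le> \<bar>t\<bar> * (norm X + 1)" by (intro mult_left_mono) auto
          ultimately show ?thesis by simp
        qed
        then show ?thesis using c p d r by simp
      qed
      then show "d > 0" "\<And>t. \<bar>t\<bar> < d \<Longrightarrow> norm (t *\<^sub>R X) < r" "norm X < r \<Longrightarrow> 1 < d" by auto
    qed
    have Vc: "V \<subseteq> carrier G" by (rule nbhd_carrier[OF V(1)])
    obtain c where c: "\<And>t. c t \<in> carrier G" "\<And>s t. c (s + t) = c s \<otimes> c t" "\<And>t. \<bar>t\<bar> < d \<Longrightarrow> c t = e (t *\<^sub>R X)"
    proof (rule extend_local_hom[OF dp, of "\<lambda>t. e (t *\<^sub>R X)"])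
      show "e (t *\<^sub>R X) \<in> carrier G" if "\<bar>t\<bar> < d" for t using e[OF dX[OF that]] Vc by blast
      show "e ((s + t) *\<^sub>R X) = e (s *\<^sub>R X) \<otimes> e (t *\<^sub>R X)" if "\<bar>s\<bar> < d" "\<bar>t\<bar> < d" "\<bar>s + t\<bar> < d" for s t
        by (intro ea dX that)
    qed blast
    have cont: "\<exists>d>0. \<forall>t. \<bar>t\<bar> < d \<longrightarrow> c t \<in> W" if W: "openin gT W" "\<one> \<in> W" for W
    proof -
      from ec[OF W] obtain s where s: "s > 0" "\<And>X. norm X < s \<Longrightarrow> e X \<in> W" by blast
      have "c t \<in> W" if "\<bar>t\<bar> < min d (s / (norm X + 1))" for t
      proof -
        have p: "norm X + 1 > 0" using norm_ge_zero[of X] by linarith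
        have "\<bar>t\<bar> * (norm X + 1) < s" using that p by (simp add: pos_less_divide_eq)
        moreover have "\<bar>t\<bar> * norm X \<le> \<bar>t\<bar> * (norm X + 1)" by (intro mult_left_mono) auto
        ultimately have "norm (t *\<^sub>R X) < s" by simp
        then show ?thesis using s c(3) that by simp
      qed
      moreover have "0 < min d (s / (norm X + 1))" using dp s norm_ge_zero[of X] by (simp add: add_nonneg_pos)
      ultimately show ?thesis by blast
    qed
    have c0: "c 0 = \<one>" by (rule hom_0) (use c in auto)
    obtain d3 where d3: "d3 > 0" "\<And>t. \<bar>t\<bar> < d3 \<Longrightarrow> c t \<in> dom0"
      using cont[OF coord_facts(1) id_chart(2)] by blast
    have der: "((coord G \<circ> c) has_vector_derivative X) (at 0)"
    proof (rule coord_psi_derivative[of "min d d3"])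
      fix t :: real assume "\<bar>t\<bar> < min d d3"
      then show "c t \<in> dom0 \<and> psi (c t) = t *\<^sub>R X" using d3(2)[of t] c(3)[of t] e[OF dX[of t]] by auto
    qed (use d3 dp cont c0 in auto)
    have "one_parameter_subgroup G X c"
      unfolding one_parameter_subgroup_def using continuous_real_hom[OF c(1,2) cont] c(2) der by blast
    moreover have "norm X < r \<longrightarrow> c 1 = e X" using c(3)[of 1] d1 by simp
    ultimately show ?thesis by blast
  qed
  have "\<exists>s>0. \<forall>X c. norm X < s \<longrightarrow> one_parameter_subgroup G X c \<longrightarrow> c 1 \<in> W" if W: "openin gT W" "\<one> \<in> W" for W
  proof -
    from ec[OF W] obtain s where s: "s > 0" "\<And>X. norm X < s \<Longrightarrow> e X \<in> W" by blast
    have "c 1 \<in> W" if Xc: "norm X < min s r" "one_parameter_subgroup G X c" for X c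
    proof -
      obtain c' where c': "one_parameter_subgroup G X c'" "c' 1 = e X" using *[of X] Xc by auto
      then show ?thesis using one_parameter_unique[OF Xc(2) c'(1)] s(2)[of X] Xc(1) by auto
    qed
    then show ?thesis using s(1) r by (intro exI[of _ "min s r"]) auto
  qed
  then show ?thesis using * by blast
qed

section \<open>Properties of the exponential map\<close>

definition expG where "expG X = lie_exp G X"
abbreviation gam where "gam X \<equiv> (THE c. one_parameter_subgroup G X c)"

lemma gam: "one_parameter_subgroup G X (gam X)"
proof -
  have "\<exists>!c. one_parameter_subgroup G X c" using exists_one_parameter one_parameter_unique by blast
  then show ?thesis by (rule theI')
qed

lemma one_parameter_scale:
  assumes "one_parameter_subgroup G X c"
  shows "one_parameter_subgroup G (s *\<^sub>R X) (\<lambda>t. c (s * t))"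
proof -
  have cm: "continuous_map euclideanreal gT c" and hom: "\<And>s t. c (s + t) = c s \<otimes> c t"
    and der: "((coord G \<circ> c) has_vector_derivative X) (at 0)"
    using assms by (auto simp: one_parameter_subgroup_def)
  have 1: "continuous_map euclideanreal gT (c \<circ> (\<lambda>t. s * t))"
    by (rule continuous_map_compose[OF _ cm]) (auto intro!: continuous_intros)
  have "((coord G \<circ> c) \<circ> (\<lambda>t. s * t) has_vector_derivative s *\<^sub>R X) (at 0)"
    by (rule vector_diff_chain_at) (use der in \<open>auto intro!: derivative_eq_intros\<close>)
  then show ?thesis unfolding one_parameter_subgroup_def using 1 hom by (simp add: o_def distrib_left)
qed

lemma gam_exp: "gam X t = expG (t *\<^sub>R X)"
proof -
  have "gam (t *\<^sub>R X) = (\<lambda>s. gam X (t * s))"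
    by (rule one_parameter_unique[OF gam one_parameter_scale[OF gam]])
  then show ?thesis by (simp add: expG_def lie_exp_def)
qed

lemma one_parameter_exp: "one_parameter_subgroup G X (\<lambda>t. expG (t *\<^sub>R X))"
proof -
  have "gam X = (\<lambda>t. expG (t *\<^sub>R X))" by (rule ext) (rule gam_exp)
  with gam[of X] show ?thesis by simp
qed

lemma exp_eqI: "one_parameter_subgroup G X c \<Longrightarrow> c t = expG (t *\<^sub>R X)"
  using one_parameter_unique[OF _ one_parameter_exp] by metis

lemma exp_closed [simp]: "expG X \<in> carrier G"
proof -
  have "continuous_map euclideanreal gT (\<lambda>t. expG (t *\<^sub>R X))"
    using one_parameter_exp[of X] by (simp add: one_parameter_subgroup_def)
  then have "expG (t *\<^sub>R X) \<in> topspace gT" for t by (simp add: continuous_map_def Pi_iff)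
  from this[of 1] show ?thesis using topspace_gtop by simp
qed

lemma expG_add: "expG ((s + t) *\<^sub>R X) = expG (s *\<^sub>R X) \<otimes> expG (t *\<^sub>R X)"
  using one_parameter_exp[of X] by (simp add: one_parameter_subgroup_def)

lemma exp_0 [simp]: "expG 0 = \<one>"
  using hom_0[of "\<lambda>t. expG (t *\<^sub>R 0)"] expG_add[of 0 0 0] by simp

lemma expG_minus: "expG (- X) = inv (expG X)"
proof -
  have "expG (- X) \<otimes> expG X = \<one>" using expG_add[of "-1" 1 X] by simp
  then show ?thesis by (metis exp_closed inv_equality)
qed

lemma AdE_exp: "AdE (expG X) = exp (adE X)"
  using one_parameter_AdE[OF one_parameter_exp[of X], of 1] by simp

lemma exp_nbhd: "openin gT W \<Longrightarrow> \<one> \<in> W \<Longrightarrow> \<exists>s>0. \<forall>X. norm X < s \<longrightarrow> expG X \<in> W"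
  using exists_one_parameter one_parameter_exp by (metis scaleR_one)

text \<open>The conjugated curve is a one-parameter subgroup with velocity \<open>Ad g X\<close>,
  and such subgroups are unique.\<close>

lemma exp_conj:
  assumes g: "g \<in> carrier G"
  shows "g \<otimes> expG X \<otimes> inv g = expG (Ad G g X)"
proof -
  let ?c = "\<lambda>t. expG (t *\<^sub>R X)"
  have o: "continuous_map euclideanreal gT ?c" "((coord G \<circ> ?c) has_vector_derivative X) (at 0)"
    using one_parameter_exp[of X] by (simp_all add: one_parameter_subgroup_def)
  have 1: "continuous_map euclideanreal gT (\<lambda>t. g \<otimes> ?c t \<otimes> inv g)"
    using continuous_map_compose[OF o(1) continuous_conj[OF g]] by (simp add: o_def)
  have 2: "g \<otimes> ?c (s + t) \<otimes> inv g = (g \<otimes> ?c s \<otimes> inv g) \<otimes> (g \<otimes> ?c t \<otimes> inv g)" for s t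
    using g by (simp add: expG_add m_assoc inv_mult_cancel)
  obtain d where d: "d > 0" "\<And>t. \<bar>t\<bar> < d \<Longrightarrow> ?c t \<in> dom0"
    using real_hom_continuous_at_0[OF o(1) coord_facts(1)] id_chart by (metis exp_0 scale_zero_left)
  have "((conj_coord g) \<circ> (coord G \<circ> ?c) has_derivative Ad G g \<circ> (\<lambda>h. h *\<^sub>R X)) (at 0)"
    by (rule diff_chain_at) (use o has_derivative_Ad[OF g] in \<open>auto simp: has_vector_derivative_def\<close>)
  then have "((conj_coord g) \<circ> (coord G \<circ> ?c) has_vector_derivative Ad G g X) (at 0)"
    by (simp add: has_vector_derivative_def o_def linear_scale[OF linear_Ad[OF g]])
  then have 3: "((coord G \<circ> (\<lambda>t. g \<otimes> ?c t \<otimes> inv g)) has_vector_derivative Ad G g X) (at 0)"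
    by (rule has_vector_derivative_transform_within_open[of _ _ _ "ball 0 d"])
      (use d in \<open>auto simp: conj_coord_def dist_real_def coord_facts\<close>)
  have "one_parameter_subgroup G (Ad G g X) (\<lambda>t. g \<otimes> ?c t \<otimes> inv g)"
    unfolding one_parameter_subgroup_def using 1 2 3 by blast
  from exp_eqI[OF this, of 1] show ?thesis by simp
qed

lemma exp_commute: "bracket G X Y = 0 \<Longrightarrow> expG X \<otimes> expG Y = expG Y \<otimes> expG X"
proof -
  assume XY: "bracket G X Y = 0"
  have "ap (exp (adE X)) Y = exp 0 *\<^sub>R Y" by (rule ap_exp_eigenvector) (simp add: XY)
  then have "Ad G (expG X) Y = Y" by (simp flip: AdE_exp ap_AdE)
  then have "expG X \<otimes> expG Y \<otimes> inv (expG X) = expG Y" by (simp add: exp_conj)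
  then show ?thesis by (metis exp_closed inv_solve_right' m_closed)
qed

text \<open>The product curve is a homomorphism, since the factors commute; it is compared with
  \<open>expG (t *\<^sub>R (X + Y))\<close> through \<open>AdE\<close>, which is injective near the
  identity.\<close>

lemma expG_sum:
  assumes "bracket G X Y = 0" shows "expG (X + Y) = expG X \<otimes> expG Y"
proof -
  have com: "expG (s *\<^sub>R X) \<otimes> expG (t *\<^sub>R Y) = expG (t *\<^sub>R Y) \<otimes> expG (s *\<^sub>R X)" for s t
    by (rule exp_commute) (simp add: br_simps assms)
  let ?c = "\<lambda>t. expG (t *\<^sub>R X) \<otimes> expG (t *\<^sub>R Y)"
  have hom: "?c (s + t) = ?c s \<otimes> ?c t" for s t
  proof -
    have "?c (s + t) = expG (s *\<^sub>R X) \<otimes> (expG (t *\<^sub>R X) \<otimes> expG (s *\<^sub>R Y)) \<otimes> expG (t *\<^sub>R Y)"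
      by (simp add: expG_add m_assoc)
    also have "expG (t *\<^sub>R X) \<otimes> expG (s *\<^sub>R Y) = expG (s *\<^sub>R Y) \<otimes> expG (t *\<^sub>R X)" by (rule com)
    finally show ?thesis by (simp add: m_assoc)
  qed
  have o: "continuous_map euclideanreal gT (\<lambda>t. expG (t *\<^sub>R Z))" for Z
    using one_parameter_exp[of Z] by (simp add: one_parameter_subgroup_def)
  have "continuous_map euclideanreal (prod_topology gT gT) (\<lambda>t. (expG (t *\<^sub>R X), expG (t *\<^sub>R Y)))"
    by (simp add: continuous_map_paired o)
  from continuous_map_compose[OF this continuous_mult]
  have cm: "continuous_map euclideanreal gT ?c" by (simp add: o_def)
  have cont: "\<exists>d>0. \<forall>t. \<bar>t\<bar> < d \<longrightarrow> ?c t \<in> W" if "openin gT W" "\<one> \<in> W" for W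
    using real_hom_continuous_at_0[OF cm that(1)] that(2) by simp
  obtain V where V: "openin gT V" "\<one> \<in> V" "V \<subseteq> near" "\<And>g h. g \<in> V \<Longrightarrow> h \<in> V \<Longrightarrow> AdE g = AdE h \<Longrightarrow> g = h"
    using AdE_locally_injective by metis
  have AdE: "AdE (?c t) = exp (t *\<^sub>R adE (X + Y))" for t
  proof -
    have "adE X * adE Y = adE Y * adE X" using adE_bracket[of X Y] assms by (simp add: linear_0[OF linear_adE])
    then have "exp (t *\<^sub>R adE X + t *\<^sub>R adE Y) = exp (t *\<^sub>R adE X) * exp (t *\<^sub>R adE Y)"
      by (intro exp_add_commuting) simp
    then show ?thesis by (simp add: AdE_mult AdE_exp linear_add[OF linear_adE] linear_scale[OF linear_adE] scaleR_add_right)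
  qed
  obtain d1 where d1: "d1 > 0" "\<And>t. \<bar>t\<bar> < d1 \<Longrightarrow> ?c t \<in> V" using cont[OF V(1,2)] by blast
  obtain d2 where d2: "d2 > 0" "\<And>t. \<bar>t\<bar> < d2 \<Longrightarrow> expG (t *\<^sub>R (X + Y)) \<in> V"
    using real_hom_continuous_at_0[OF o V(1), of "X + Y"] V(2) by auto
  have "?c = (\<lambda>t. expG (t *\<^sub>R (X + Y)))"
  proof (rule real_hom_determined)
    show "0 < min d1 d2" using d1 d2 by simp
    fix t assume "\<bar>t\<bar> < min d1 d2"
    then show "?c t = expG (t *\<^sub>R (X + Y))"
      using d1 d2 by (intro V(4)) (auto simp: AdE AdE_exp linear_scale[OF linear_adE])
  qed (use hom expG_add in auto)
  from fun_cong[OF this, of 1] show ?thesis by simp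
qed

lemma log_nbhd:
  assumes e: "e > 0"
  obtains V where "openin gT V" "\<one> \<in> V" "\<And>g. g \<in> V \<Longrightarrow> \<exists>Z. norm Z < e \<and> g = expG Z"
proof -
  obtain V where V: "openin gT V" "\<one> \<in> V" "V \<subseteq> near" "\<And>g h. g \<in> V \<Longrightarrow> h \<in> V \<Longrightarrow> AdE g = AdE h \<Longrightarrow> g = h"
    using AdE_locally_injective by metis
  obtain s where s: "s > 0" "\<And>X. norm X < s \<Longrightarrow> expG X \<in> V" using exp_nbhd[OF V(1,2)] by blast
  obtain C where C: "C > 0" "\<And>g h. g \<in> near \<Longrightarrow> h \<in> near \<Longrightarrow> norm (psi g - psi h) \<le> C * norm (AdE g - AdE h)"
    using psi_lipschitz by blast
  let ?U = "V \<inter> {g \<in> carrier G. AdE g \<in> ball 1 (min e s / C)}"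
  show thesis
  proof (rule that[of ?U])
    show "openin gT ?U" by (intro openin_Int V openin_AdE open_ball)
    show "\<one> \<in> ?U" using V C s e by (simp add: AdE_one)
    fix g assume g: "g \<in> ?U"
    then have gn: "g \<in> near" "g \<in> V" using V(3) by auto
    have "norm (psi g - psi \<one>) \<le> C * norm (AdE g - AdE \<one>)" by (rule C(2)[OF gn(1) near_one])
    also have "\<dots> < C * (min e s / C)" using g C(1)
      by (intro mult_strict_left_mono) (auto simp: AdE_one dist_norm norm_minus_commute)
    finally have n: "norm (psi g) < min e s" using C(1) by (simp add: psi_one)
    then have "g = expG (psi g)" using psi(2)[OF gn(1)] gn(2) s(2) by (intro V(4)) (auto simp: AdE_exp)
    then show "\<exists>Z. norm Z < e \<and> g = expG Z" using n by auto
  qed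
qed

text \<open>The set where \<open>P\<close> holds is open, and so is its complement: as
  \<open>U\<close> has its inverses in \<open>V\<close>, the way back from \<open>x\<close> to
  \<open>g\<close> is again a step by an element of \<open>V\<close>.\<close>

lemma conn_induct:
  assumes V: "openin gT V" "\<one> \<in> V" and P1: "P \<one>"
    and step: "\<And>g v. g \<in> carrier G \<Longrightarrow> P g \<Longrightarrow> v \<in> V \<Longrightarrow> P (g \<otimes> v)" and g: "g \<in> carrier G"
  shows "P g"
proof -
  obtain U where U: "openin gT U" "\<one> \<in> U" "U \<subseteq> V" "\<And>g. g \<in> U \<Longrightarrow> inv g \<in> V"
    using nbhd_mult[OF V] by metis
  have tr: "openin gT {x \<in> carrier G. inv g \<otimes> x \<in> U}" "g \<in> {x \<in> carrier G. inv g \<otimes> x \<in> U}"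
    if "g \<in> carrier G" for g
    using that U by (auto intro!: openin_preimage continuous_left_translation)
  have inU: "x = g \<otimes> (inv g \<otimes> x)" "g = x \<otimes> inv (inv g \<otimes> x)" if "g \<in> carrier G" "x \<in> carrier G" for g x
    using that by (simp_all add: inv_mult_group flip: m_assoc)
  let ?S = "{x \<in> carrier G. P x}"
  have "openin gT ?S"
  proof (subst openin_subopen, intro ballI)
    fix g assume "g \<in> ?S"
    then have g: "g \<in> carrier G" "P g" by auto
    show "\<exists>T. openin gT T \<and> g \<in> T \<and> T \<subseteq> ?S"
    proof (intro exI[of _ "{x \<in> carrier G. inv g \<otimes> x \<in> U}"] conjI subsetI tr[OF g(1)])
      fix x assume x: "x \<in> {x \<in> carrier G. inv g \<otimes> x \<in> U}"
      then have "P (g \<otimes> (inv g \<otimes> x))" using step[OF g] U(3) by blast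
      then show "x \<in> ?S" using x inU(1)[OF g(1)] by simp
    qed
  qed
  moreover have "openin gT (carrier G - ?S)"
  proof (subst openin_subopen, intro ballI)
    fix g assume "g \<in> carrier G - ?S"
    then have g: "g \<in> carrier G" "\<not> P g" by auto
    show "\<exists>T. openin gT T \<and> g \<in> T \<and> T \<subseteq> carrier G - ?S"
    proof (intro exI[of _ "{x \<in> carrier G. inv g \<otimes> x \<in> U}"] conjI subsetI tr[OF g(1)])
      fix x assume x: "x \<in> {x \<in> carrier G. inv g \<otimes> x \<in> U}"
      have "\<not> P x"
      proof
        assume "P x"
        then have "P (x \<otimes> inv (inv g \<otimes> x))" using step x U(4) by blast
        then show False using g x inU(2)[OF g(1)] by simp
      qed
      then show "x \<in> carrier G - ?S" using x by simp
    qed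
  qed
  moreover have "?S \<subseteq> topspace gT" using topspace_gtop by blast
  ultimately have "openin gT ?S \<and> closedin gT ?S" by (simp only: closedin_def topspace_gtop)
  then have "?S = {} \<or> ?S = topspace gT"
    using connected unfolding connected_space_clopen_in by blast
  then show ?thesis using P1 g topspace_gtop by blast
qed

end

lemma exp_has_derivative_0:
  "((exp :: 'b::{real_normed_algebra_1,banach} \<Rightarrow> 'b) has_derivative (\<lambda>x. x)) (at 0)"
  unfolding has_derivative_at_alt
proof (intro conjI allI impI)
  show "bounded_linear (\<lambda>x::'b. x)" by (rule bounded_linear_ident)
  fix e :: real assume e: "e > 0"
  show "\<exists>d>0. \<forall>y. norm (y - 0) < d \<longrightarrow> norm (exp y - exp 0 - (y - (0::'b))) \<le> e * norm (y - 0)"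
  proof (intro exI[of _ "min (1/4) (e/2)"] conjI allI impI)
    show "0 < min (1/4) (e/2)" using e by simp
    fix y :: 'b assume y: "norm (y - 0) < min (1/4) (e/2)"
    have "norm (exp y - 1 - y) \<le> 2 * norm y * norm y" by (rule small_log_close) (use y in simp)
    also have "\<dots> \<le> e * norm y" using y by (intro mult_right_mono) auto
    finally show "norm (exp y - exp 0 - (y - 0)) \<le> e * norm (y - 0)" by simp
  qed
qed

context cartan_group
begin

text \<open>The logarithm \<open>chi\<close> of the product of the two exponentials has the identity
  as its derivative at 0, so it is open there. With complementary projections onto sums of weight
  spaces this gives the big cell around the identity.\<close>

lemma two_factor:
  assumes lin: "linear p" "linear q" and pq: "\<And>Z. p Z + q Z = Z" and e: "e > 0"
  obtains V where "openin gT V" "\<one> \<in> V"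
    "\<And>g. g \<in> V \<Longrightarrow> \<exists>Z. norm Z < e \<and> g = expG (p Z) \<otimes> expG (q Z)"
proof -
  define k where "k Z = expG (p Z) \<otimes> expG (q Z)" for Z
  define F where "F Z = exp (adE (p Z)) * exp (adE (q Z))" for Z
  define chi where "chi Z = Lad (Lg (F Z))" for Z
  have kc: "k Z \<in> carrier G" for Z by (simp add: k_def)
  have AdEk: "AdE (k Z) = F Z" for Z by (simp add: k_def F_def AdE_mult AdE_exp)
  have p0: "p 0 = 0" "q 0 = 0" using lin by (simp_all add: linear_0)
  have F0: "F 0 = 1" by (simp add: F_def p0 linear_0[OF linear_adE])
  have linad: "linear (\<lambda>Z. adE (r Z))" if "linear r" for r :: "'e \<Rightarrow> 'e"
    using linear_compose[OF that linear_adE] by (simp add: o_def)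
  have dexp: "((\<lambda>Z. exp (adE (r Z))) has_derivative (\<lambda>Z. adE (r Z))) (at 0)"
    if r: "linear r" for r :: "'e \<Rightarrow> 'e"
  proof -
    have "((\<lambda>Z. adE (r Z)) has_derivative (\<lambda>Z. adE (r Z))) (at 0)"
      using linad[OF r] by (intro bounded_linear_imp_has_derivative) (simp add: linear_conv_bounded_linear)
    moreover have "adE (r 0) = 0" by (rule linear_0[OF linad[OF r]])
    ultimately have "(exp \<circ> (\<lambda>Z. adE (r Z)) has_derivative (\<lambda>x. x) \<circ> (\<lambda>Z. adE (r Z))) (at 0)"
      by (intro diff_chain_at) (simp_all add: exp_has_derivative_0)
    then show ?thesis by (simp add: o_def)
  qed
  have contexp: "isCont (\<lambda>Z. exp (adE (r Z))) Z" if r: "linear r" for r :: "'e \<Rightarrow> 'e" and Z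
  proof -
    have "isCont (\<lambda>Z. adE (r Z)) Z"
      using linad[OF r] by (intro linear_continuous_at) (simp add: linear_conv_bounded_linear)
    then show ?thesis by (rule isCont_o2) (rule isCont_exp_banach)
  qed
  have contF: "isCont F Z" for Z
    unfolding F_def[abs_def] by (intro isCont_mult contexp lin)
  have dF: "(F has_derivative adE) (at 0)"
  proof -
    have "(F has_derivative (\<lambda>h. exp (adE (p 0)) * adE (q h) + adE (p h) * exp (adE (q 0)))) (at 0)"
      unfolding F_def[abs_def]
      by (rule bounded_bilinear.FDERIV[OF bounded_bilinear_mult dexp[OF lin(1)] dexp[OF lin(2)]])
    then show ?thesis
      by (simp add: p0 linear_0[OF linear_adE] flip: linear_add[OF linear_adE])
        (simp add: add.commute[of "q _"] pq)
  qed
  have dchi: "(chi has_derivative (\<lambda>X. X)) (at 0)"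
  proof -
    have 1: "(Lg \<circ> F has_derivative (\<lambda>x. x) \<circ> adE) (at 0)"
      by (rule diff_chain_at[OF dF]) (simp add: F0 Lg_has_derivative)
    have "((\<lambda>Z. Lad ((Lg \<circ> F) Z)) has_derivative (\<lambda>X. Lad (((\<lambda>x. x) \<circ> adE) X))) (at 0)"
      by (rule bounded_linear.has_derivative[OF bounded_linear_Lad 1])
    then show ?thesis by (simp add: chi_def[abs_def])
  qed
  define S where "S = {Z. norm (F Z - 1) < 1/8}"
  have contF': "continuous_on UNIV F" using contF by (simp add: continuous_on_eq_continuous_at)
  have opS: "open S" unfolding S_def
    by (intro open_Collect_less continuous_intros contF')
  have contchi: "continuous_on S chi"
  proof -
    have "continuous_on S (\<lambda>Z. Lg (F Z))"
      unfolding continuous_on_iff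
    proof (intro ballI allI impI)
      fix x e assume x: "x \<in> S" and e: "(0::real) < e"
      have "continuous_on S F" using contF' by (rule continuous_on_subset) simp
      then obtain d where d: "d > 0" "\<And>x'. x' \<in> S \<Longrightarrow> dist x' x < d \<Longrightarrow> dist (F x') (F x) < e / 2"
        using x e unfolding continuous_on_iff by (meson half_gt_zero)
      show "\<exists>d>0. \<forall>x'\<in>S. dist x' x < d \<longrightarrow> dist (Lg (F x')) (Lg (F x)) < e"
      proof (intro exI[of _ d] conjI ballI impI d(1))
        fix x' assume x': "x' \<in> S" "dist x' x < d"
        have "norm (Lg (F x') - Lg (F x)) \<le> 2 * norm (F x' - F x)"
          by (rule Lg_lipschitz) (use x x' in \<open>auto simp: S_def\<close>)
        then show "dist (Lg (F x')) (Lg (F x)) < e" using d(2)[OF x'] by (simp add: dist_norm)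
      qed
    qed
    then show ?thesis unfolding chi_def[abs_def]
      by (rule bounded_linear.continuous_on[OF bounded_linear_Lad])
  qed
  obtain V where V: "openin gT V" "\<one> \<in> V" "V \<subseteq> near" "\<And>g h. g \<in> V \<Longrightarrow> h \<in> V \<Longrightarrow> AdE g = AdE h \<Longrightarrow> g = h"
    using AdE_locally_injective by metis
  obtain U where U: "openin gT U" "\<one> \<in> U" "U \<subseteq> V" "\<And>g h. g \<in> U \<Longrightarrow> h \<in> U \<Longrightarrow> g \<otimes> h \<in> V"
    using nbhd_mult[OF V(1,2)] by metis
  obtain s where s: "s > 0" "\<And>X. norm X < s \<Longrightarrow> expG X \<in> U" using exp_nbhd[OF U(1,2)] by blast
  define T where "T = {Z. norm Z < e} \<inter> {Z. norm (p Z) < s} \<inter> {Z. norm (q Z) < s} \<inter> S"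
  have contlin: "continuous_on UNIV p" "continuous_on UNIV q"
    using lin by (simp_all add: linear_continuous_on linear_conv_bounded_linear)
  have opT: "open T" unfolding T_def
    by (intro open_Int open_Collect_less continuous_intros contlin opS)
  have T0: "0 \<in> T" using e s by (simp add: T_def S_def p0 F0)
  have kT: "k Z \<in> V" if "Z \<in> T" for Z using that s U by (simp add: k_def T_def)
  have "chi 0 \<in> interior (chi ` T)"
  proof (rule sussmann_open_mapping[OF opS contchi _ dchi])
    show "0 \<in> S" "T \<subseteq> S" using T0 by (auto simp: T_def)
    show "bounded_linear (\<lambda>X::'e. X)" by (rule bounded_linear_ident)
    show "(\<lambda>X::'e. X) \<circ> (\<lambda>X. X) = id" by auto
    show "0 \<in> interior T" using opT T0 by (simp add: interior_open)
  qed
  moreover have "chi 0 = 0"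
    using psi_one by (simp add: chi_def psi_def F0 AdE_one)
  ultimately obtain r where r: "r > 0" "ball 0 r \<subseteq> chi ` T" by (auto simp: mem_interior)
  obtain C where C: "C > 0" "\<And>g h. g \<in> near \<Longrightarrow> h \<in> near \<Longrightarrow> norm (psi g - psi h) \<le> C * norm (AdE g - AdE h)"
    using psi_lipschitz by blast
  let ?V = "V \<inter> {g \<in> carrier G. AdE g \<in> ball 1 (r / C)}"
  show thesis
  proof (rule that[of ?V])
    show "openin gT ?V" by (intro openin_Int V openin_AdE open_ball)
    show "\<one> \<in> ?V" using V C r by (simp add: AdE_one)
    fix g assume g: "g \<in> ?V"
    then have gn: "g \<in> near" "g \<in> V" using V(3) by auto
    have "norm (psi g - psi \<one>) \<le> C * norm (AdE g - AdE \<one>)" by (rule C(2)[OF gn(1) near_one])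
    also have "\<dots> < C * (r / C)" using g C(1)
      by (intro mult_strict_left_mono) (auto simp: AdE_one dist_norm norm_minus_commute)
    finally have "norm (psi g) < r" using C(1) by (simp add: psi_one)
    then have "psi g \<in> chi ` T" using r by auto
    then obtain Z where Z: "Z \<in> T" "psi g = chi Z" by auto
    have "psi (k Z) = psi g" using Z by (simp add: psi_def[of "k Z"] AdEk chi_def)
    then have "AdE g = AdE (k Z)" using psi(2)[OF gn(1)] psi(2)[of "k Z"] kT[OF Z(1)] V(3) by auto
    then have "g = k Z" using V(4) gn(2) kT[OF Z(1)] by blast
    then show "\<exists>Z. norm Z < e \<and> g = expG (p Z) \<otimes> expG (q Z)" using Z by (auto simp: k_def T_def)
  qed
qed

end

section \<open>Weight spaces\<close>

locale flat_group = cartan_group G kk pp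
  for G :: "('a, 'e::euclidean_space) manifold_group" (structure) and kk pp +
  fixes aa :: "'e set"
  assumes maximal: "maximal_abelian_in G pp aa"
begin

lemma sub_aa: "subspace aa" and aa_pp: "X \<in> aa \<Longrightarrow> X \<in> pp"
  and aa_abelian: "X \<in> aa \<Longrightarrow> Y \<in> aa \<Longrightarrow> bracket G X Y = 0"
  using maximal unfolding maximal_abelian_in_def abelian_subspace_def by auto

text \<open>Otherwise \<open>X\<close> and \<open>aa\<close> would span a larger abelian subspace of
  \<open>pp\<close>.\<close>

lemma centralizer_in_aa:
  assumes X: "X \<in> pp" and com: "\<And>H. H \<in> aa \<Longrightarrow> bracket G H X = 0" shows "X \<in> aa"
proof -
  let ?b = "span (insert X aa)"
  have com': "bracket G X H = 0" if "H \<in> aa" for H using com[OF that] bracket_anti[of X H] by simp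
  have 1: "bracket G Y Z = 0" if "Y \<in> ?b" "Z \<in> insert X aa" for Y Z
    using that(1)
  proof (induction rule: span_induct)
    show "subspace {Y. bracket G Y Z = 0}" by (auto simp: subspace_def br_simps)
    show "bracket G Y Z = 0" if "Y \<in> insert X aa" for Y
      using that \<open>Z \<in> insert X aa\<close> com com' aa_abelian by auto
  qed
  have 2: "bracket G Y Z = 0" if "Y \<in> ?b" "Z \<in> ?b" for Y Z
    using that(2)
  proof (induction rule: span_induct)
    show "subspace {Z. bracket G Y Z = 0}" by (auto simp: subspace_def br_simps)
  qed (rule 1[OF that(1)])
  have "?b \<subseteq> pp" using X aa_pp sub_pp by (intro span_minimal) auto
  moreover have "aa \<subseteq> ?b" by (auto intro: span_base)
  moreover have "abelian_subspace G ?b" unfolding abelian_subspace_def using 2 by simp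
  ultimately have "?b = aa" using maximal unfolding maximal_abelian_in_def by blast
  then show ?thesis using span_base[of X "insert X aa"] by simp
qed

lemma B_aa_eq_ip: "H \<in> aa \<Longrightarrow> ip X H = B X H"
  using theta_pp[OF aa_pp] by (simp add: ip_def)

lemma B_aa_eqI:
  assumes "h \<in> aa" "k \<in> aa" "\<And>H. H \<in> aa \<Longrightarrow> B h H = B k H" shows "h = k"
proof -
  have d: "h - k \<in> aa" using assms sub_aa subspace_diff by blast
  have "B (h - k) (h - k) = 0" using assms(3)[OF d] by simp
  then show ?thesis using B_pp[OF aa_pp[OF d]] by force
qed

text \<open>Roots are represented by the vectors of \<open>aa\<close> dual to them under
  \<open>B\<close>; sums, inner products and the Weyl group action on roots then take place in
  \<open>aa\<close>.\<close>

definition ws where "ws h = {X. \<forall>H\<in>aa. bracket G H X = B h H *\<^sub>R X}"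
text \<open>The weight 0 is included, so that the weight spaces add up to the whole algebra.\<close>

definition Wt where "Wt = {h \<in> aa. ws h \<noteq> {0}}"

lemma wsD: "X \<in> ws h \<Longrightarrow> H \<in> aa \<Longrightarrow> bracket G H X = B h H *\<^sub>R X" by (simp add: ws_def)

lemma sub_ws: "subspace (ws h)"
  by (auto simp: subspace_def ws_def br_simps algebra_simps)

lemma ws_bracket:
  assumes "X \<in> ws h" "Y \<in> ws k" shows "bracket G X Y \<in> ws (h + k)"
  unfolding ws_def mem_Collect_eq
proof
  fix H assume "H \<in> aa"
  then show "bracket G H (bracket G X Y) = B (h + k) H *\<^sub>R bracket G X Y"
    using Leibniz[of H X Y] wsD[OF assms(1)] wsD[OF assms(2)] by (simp add: br_simps algebra_simps)
qed

lemma ws_theta: "X \<in> ws h \<Longrightarrow> theta X \<in> ws (- h)"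
  unfolding ws_def mem_Collect_eq
proof
  fix H assume X: "\<forall>H\<in>aa. bracket G H X = B h H *\<^sub>R X" and H: "H \<in> aa"
  have "bracket G (theta H) (theta X) = B h H *\<^sub>R theta X"
    using X H linear_scale[OF linear_theta] by (metis theta_bracket)
  then show "bracket G H (theta X) = B (- h) H *\<^sub>R theta X"
    using theta_pp[OF aa_pp[OF H]] by (simp add: br_simps) (metis minus_equation_iff)
qed

lemma ws_orthogonal:
  assumes X: "X \<in> ws h" and Y: "Y \<in> ws k" and hk: "h \<in> aa" "k \<in> aa" "h \<noteq> k"
  shows "ip X Y = 0"
proof (rule ccontr)
  assume n: "ip X Y \<noteq> 0"
  have "B h H = B k H" if H: "H \<in> aa" for H
  proof -
    have "ip (bracket G H X) Y = ip X (bracket G H Y)" by (rule ip_bracket_pp[OF aa_pp[OF H]])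
    then show ?thesis using n wsD[OF X H] wsD[OF Y H] by simp
  qed
  then show False using B_aa_eqI hk by blast
qed

lemma ws_zero: "aa \<subseteq> ws 0"
  using aa_abelian by (auto simp: ws_def)

text \<open>A root vector \<open>X\<close> determines the vector dual to its root: \<open>[X, \<theta> X] = - ip X X h\<close>.\<close>

lemma eigenvector_weight:
  assumes X0: "X \<noteq> 0" and c: "\<And>H. H \<in> aa \<Longrightarrow> \<exists>c. bracket G H X = c *\<^sub>R X"
  shows "- (1 / ip X X) *\<^sub>R bracket G X (theta X) \<in> aa \<and> X \<in> ws (- (1 / ip X X) *\<^sub>R bracket G X (theta X))"
proof -
  let ?h = "- (1 / ip X X) *\<^sub>R bracket G X (theta X)"
  have p: "ip X X > 0" by (rule ip_pos[OF X0])
  have Bh: "B ?h H *\<^sub>R X = bracket G H X" if H: "H \<in> aa" for H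
  proof -
    obtain c where c: "bracket G H X = c *\<^sub>R X" using c H by blast
    have "c * ip X X = ip (bracket G H X) X" using c by simp
    also have "\<dots> = - B H (bracket G X (theta X))" unfolding ip_def by (simp add: B_invariant)
    also have "\<dots> = ip X X * B ?h H" using p by (simp add: B_sym)
    finally have "c = B ?h H" using p by (metis mult.commute mult_cancel_left less_irrefl)
    then show ?thesis using c by (simp only:)
  qed
  have th: "theta (bracket G X (theta X)) = - bracket G X (theta X)"
    using bracket_anti[of "theta X" X] by (simp add: theta_bracket)
  have "bracket G X (theta X) \<in> pp"
  proof -
    let ?Z = "bracket G X (theta X)"
    have "pk ?Z = 0" using th unfolding theta_def by (simp add: algebra_simps flip: scaleR_2)
    then show ?thesis using pk(2)[of ?Z] by simp
  qed
  then have hp: "?h \<in> pp" using sub_pp subspace_scale by blast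
  have Xws: "X \<in> ws ?h" using Bh by (simp add: ws_def)
  have "bracket G X (theta X) \<in> ws (?h + - ?h)" by (rule ws_bracket[OF Xws ws_theta[OF Xws]])
  then have "bracket G X (theta X) \<in> ws 0" by simp
  then have "?h \<in> ws 0" by (rule subspace_scale[OF sub_ws])
  then have "?h \<in> aa" by (intro centralizer_in_aa hp) (auto simp: ws_def)
  then show ?thesis using Xws by blast
qed

text \<open>As \<open>ad H\<close> is symmetric for \<open>ip\<close>, consider a point
  \<open>X\<close> where its Rayleigh quotient on \<open>V\<close> attains the maximum
  \<open>m\<close>. A null vector of the semidefinite form of \<open>D = m - ad H\<close> lies in
  the kernel of \<open>D\<close>, as moving from \<open>X\<close> along \<open>D X\<close>
  shows.\<close>

lemma exists_eigenvector:
  assumes V: "subspace V" "V \<noteq> {0}" and H: "H \<in> aa" and inv: "\<And>X. X \<in> V \<Longrightarrow> bracket G H X \<in> V"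
  obtains X c where "X \<in> V" "X \<noteq> 0" "bracket G H X = c *\<^sub>R X"
proof -
  let ?q = "\<lambda>X. ip (bracket G H X) X" and ?r = "\<lambda>X. ip X X"
  let ?S = "V \<inter> sphere 0 1"
  obtain v where v: "v \<in> V" "v \<noteq> 0" using V subspace_0 by blast
  then have "(1 / norm v) *\<^sub>R v \<in> ?S" using V by (simp add: subspace_scale)
  then have ne: "?S \<noteq> {}" by blast
  have cS: "compact ?S" using closed_subspace[OF V(1)] by (simp add: closed_Int_compact)
  have bil: "bilinear ip" by (auto simp: bilinear_def intro!: linearI)
  have cad: "continuous_on ?S (bracket G H)"
    by (rule linear_continuous_on) (simp add: linear_bracket_right flip: linear_conv_bounded_linear)
  have cont: "continuous_on ?S (\<lambda>X. ?q X / ?r X)"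
  proof (intro continuous_on_divide)
    show "continuous_on ?S ?q" "continuous_on ?S ?r"
      by (rule bilinear_continuous_on_compose[OF _ _ bil]; use cad in \<open>auto intro: continuous_intros\<close>)+
    show "\<forall>X\<in>?S. ?r X \<noteq> 0" using ip_pos by (metis IntE ip_eq_0 dist_self mem_sphere zero_neq_one)
  qed
  obtain X where X: "X \<in> ?S" "\<And>Y. Y \<in> ?S \<Longrightarrow> ?q Y / ?r Y \<le> ?q X / ?r X"
    using continuous_attains_sup[OF cS ne cont] by blast
  define m where "m = ?q X / ?r X"
  have Xn: "X \<noteq> 0" using X by auto
  have mle: "?q Y \<le> m * ?r Y" if "Y \<in> V" for Y
  proof (cases "Y = 0")
    case False
    let ?Y = "(1 / norm Y) *\<^sub>R Y"
    have "?Y \<in> ?S" using that False V by (simp add: subspace_scale)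
    then have "?q ?Y / ?r ?Y \<le> m" using X(2) unfolding m_def by blast
    moreover have "?q ?Y / ?r ?Y = ?q Y / ?r Y" using False by (simp add: br_simps)
    ultimately show ?thesis using ip_pos[OF False] by (simp add: pos_divide_le_eq)
  qed (simp add: br_simps)
  define D where "D Y = m *\<^sub>R Y - bracket G H Y" for Y
  have DV: "D Y \<in> V" if "Y \<in> V" for Y
    unfolding D_def using that inv V by (intro subspace_diff subspace_scale) auto
  have Dsym: "ip (D Y) Z = ip Y (D Z)" for Y Z
    unfolding D_def using ip_bracket_pp[OF aa_pp[OF H], of Y Z] by simp
  have DX: "ip (D X) X = 0" using ip_pos[OF Xn] by (simp add: D_def m_def)
  have Dpos: "0 \<le> ip (D Y) Y" if "Y \<in> V" for Y using mle[OF that] by (simp add: D_def)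
  have lin: "D (X + t *\<^sub>R Y) = D X + t *\<^sub>R D Y" for t Y by (simp add: D_def br_simps algebra_simps)
  let ?Y = "D X"
  have YV: "?Y \<in> V" using DV X by blast
  have ineq: "0 \<le> 2 * t * ip ?Y ?Y + t * t * ip (D ?Y) ?Y" for t
  proof -
    have "0 \<le> ip (D (X + t *\<^sub>R ?Y)) (X + t *\<^sub>R ?Y)"
      by (intro Dpos subspace_add[OF V(1)] subspace_scale[OF V(1)] YV) (use X in auto)
    also have "\<dots> = 2 * t * ip ?Y ?Y + t * t * ip (D ?Y) ?Y"
      using DX Dsym[of ?Y X] by (simp add: lin algebra_simps)
    finally show ?thesis .
  qed
  have "ip ?Y ?Y = 0"
  proof (rule ccontr)
    assume "ip ?Y ?Y \<noteq> 0"
    then have a: "ip ?Y ?Y > 0" using ip_nonneg[of ?Y] by simp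
    define b where "b = ip (D ?Y) ?Y"
    have b: "b \<ge> 0" using Dpos[OF YV] by (simp add: b_def)
    \<comment> \<open>The denominator is \<open>b + 1\<close> because \<open>b\<close> may be 0;
      with this \<open>t\<close> the linear term outweighs the quadratic one and contradicts
      \<open>ineq\<close>.\<close>
    define t where "t = - (ip ?Y ?Y / (b + 1))"
    have t0: "t < 0" using a b by (simp add: t_def)
    have tb: "- (t * (b + 1)) = ip ?Y ?Y" using b by (simp add: t_def)
    have "t * b + 2 * ip ?Y ?Y > 0"
    proof -
      have "t * b + 2 * ip ?Y ?Y = ip ?Y ?Y - t" using tb by (simp add: algebra_simps)
      then show ?thesis using a t0 by simp
    qed
    then have "t * (t * b + 2 * ip ?Y ?Y) < 0" using t0 by (simp add: mult_neg_pos)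
    moreover have "t * (t * b + 2 * ip ?Y ?Y) = 2 * t * ip ?Y ?Y + t * t * ip (D ?Y) ?Y"
      by (simp add: b_def algebra_simps)
    ultimately show False using ineq[of t] by simp
  qed
  then have "D X = 0" by (simp only: ip_eq_0)
  then have "bracket G H X = m *\<^sub>R X" by (simp add: D_def)
  then show thesis using that X Xn by blast
qed

text \<open>Either every \<open>ad H\<close> is scalar on \<open>V\<close>, or some
  \<open>ad H\<close> has a proper eigenspace in \<open>V\<close>, which is invariant because
  \<open>aa\<close> is abelian.\<close>

lemma exists_weight_vector:
  assumes "subspace V" "V \<noteq> {0}" "\<And>H X. H \<in> aa \<Longrightarrow> X \<in> V \<Longrightarrow> bracket G H X \<in> V"
  shows "\<exists>X\<in>V. X \<noteq> 0 \<and> (\<exists>h\<in>aa. X \<in> ws h)"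
  using assms
proof (induction "dim V" arbitrary: V rule: less_induct)
  case less
  show ?case
  proof (cases "\<forall>H\<in>aa. \<exists>c. \<forall>X\<in>V. bracket G H X = c *\<^sub>R X")
    case True
    obtain X where X: "X \<in> V" "X \<noteq> 0" using less.prems subspace_0 by blast
    have "\<exists>c. bracket G H X = c *\<^sub>R X" if "H \<in> aa" for H using True that X by blast
    then show ?thesis using eigenvector_weight[OF X(2)] X by blast
  next
    case False
    then obtain H where H: "H \<in> aa" "\<And>c. \<exists>X\<in>V. bracket G H X \<noteq> c *\<^sub>R X" by blast
    obtain X c where X: "X \<in> V" "X \<noteq> 0" "bracket G H X = c *\<^sub>R X"
      using exists_eigenvector[OF less.prems(1,2) H(1)] less.prems(3)[OF H(1)] by blast
    let ?W = "{Y \<in> V. bracket G H Y = c *\<^sub>R Y}"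
    have sW: "subspace ?W" using less.prems(1) by (auto simp: subspace_def br_simps algebra_simps)
    have neq: "?W \<noteq> V" using H(2)[of c] by blast
    have "dim ?W < dim V"
    proof -
      have "span ?W = ?W" "span V = V"
        by (rule span_eq_iff[THEN iffD2, OF sW], rule span_eq_iff[THEN iffD2, OF less.prems(1)])
      moreover have "?W \<subset> V" using neq by blast
      ultimately have "span ?W \<subset> span V" by (simp only:)
      then show ?thesis by (rule dim_psubset)
    qed
    moreover have "?W \<noteq> {0}" using X by blast
    moreover have "bracket G H' Y \<in> ?W" if H': "H' \<in> aa" "Y \<in> ?W" for H' Y
    proof -
      have "bracket G H (bracket G H' Y) = bracket G H' (bracket G H Y)"
        using Leibniz[of H H' Y] aa_abelian[OF H(1) H'(1)] by (simp add: br_simps)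
      then show ?thesis using H' less.prems(3) by (simp add: br_simps)
    qed
    ultimately obtain Y where "Y \<in> ?W" "Y \<noteq> 0" "\<exists>h\<in>aa. Y \<in> ws h"
      using less.hyps[OF _ sW] by blast
    then show ?thesis by blast
  qed
qed

text \<open>The \<open>ip\<close>-complement of the span is invariant under \<open>aa\<close>, so it
  would contain a weight vector if it were nonzero.\<close>

lemma span_ws: "span (\<Union>h\<in>aa. ws h) = UNIV"
proof -
  let ?U = "span (\<Union>h\<in>aa. ws h)"
  let ?V = "{X. \<forall>Y\<in>?U. ip X Y = 0}"
  have sV: "subspace ?V" by (auto simp: subspace_def)
  have inv: "bracket G H X \<in> ?V" if H: "H \<in> aa" and X: "X \<in> ?V" for H X
  proof -
    have "bracket G H Y \<in> ?U" if "Y \<in> ?U" for Y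
      using that
    proof (induction rule: span_induct)
      show "subspace {Y. bracket G H Y \<in> ?U}"
        by (auto simp: subspace_def br_simps span_add span_scale span_zero)
      fix Y assume "Y \<in> (\<Union>h\<in>aa. ws h)"
      then obtain h where h: "h \<in> aa" "Y \<in> ws h" by blast
      then have "bracket G H Y \<in> ws h" using wsD[OF h(2) H] subspace_scale[OF sub_ws] by metis
      then show "bracket G H Y \<in> ?U" using h by (blast intro: span_base)
    qed
    then show ?thesis using X ip_bracket_pp[OF aa_pp[OF H]] by simp
  qed
  have V0: "?V = {0}"
  proof (rule ccontr)
    assume "?V \<noteq> {0}"
    then obtain X h where X: "X \<in> ?V" "X \<noteq> 0" "h \<in> aa" "X \<in> ws h"
      using exists_weight_vector[OF sV] inv by blast
    have "X \<in> ?U" using X by (blast intro: span_base)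
    then have "ip X X = 0" using X by blast
    then show False using X by (simp add: ip_eq_0)
  qed
  have lin: "linear (\<lambda>X. \<Sum>b\<in>Basis. ip X b *\<^sub>R b)"
    by (rule linearI) (simp_all add: algebra_simps sum.distrib scaleR_sum_right)
  show ?thesis
  proof (rule ccontr)
    assume "?U \<noteq> UNIV"
    then have "span (\<Union>h\<in>aa. ws h) \<subset> span UNIV" by auto
    then obtain a where a: "a \<noteq> 0" "\<And>x. x \<in> ?U \<Longrightarrow> orthogonal a x"
      by (rule orthogonal_to_subspace_exists_gen) blast
    \<comment> \<open>A Euclidean normal vector is turned into one that is normal for
      \<open>ip\<close>.\<close>
    have "a \<bullet> Y = B (BSi a) Y" for Y by (simp add: B_expand BSi)
    then have "ip (theta (BSi a)) Y = - (a \<bullet> Y)" for Y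
      using B_theta[of "BSi a" Y] by (simp add: ip_def)
    then have "theta (BSi a) \<in> ?V" using a(2) by (simp add: orthogonal_def)
    then have "theta (BSi a) = 0" using V0 by blast
    then have "BSi a = 0" by (metis theta_theta linear_0[OF linear_theta])
    then show False using a BSi(3)[of a] by (simp add: BS_def)
  qed
qed

text \<open>In a basis of weight vectors every weight occurs: otherwise its weight vectors would be
  orthogonal to the whole basis.\<close>

lemma finite_Wt: "finite Wt"
proof -
  obtain b where b: "b \<subseteq> (\<Union>h\<in>aa. ws h)" "independent b" "(\<Union>h\<in>aa. ws h) \<subseteq> span b"
    using maximal_independent_subset by blast
  have spb: "span b = UNIV" using span_ws span_minimal[OF b(3) subspace_span] by auto
  have fb: "finite b" using b(2) by (rule independent_imp_finite)
  define w where "w v = (SOME h. h \<in> aa \<and> v \<in> ws h)" for v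
  have w: "w v \<in> aa" "v \<in> ws (w v)" if "v \<in> b" for v
  proof -
    have "\<exists>h. h \<in> aa \<and> v \<in> ws h" using b(1) that by blast
    then have "w v \<in> aa \<and> v \<in> ws (w v)" unfolding w_def by (rule someI_ex)
    then show "w v \<in> aa" "v \<in> ws (w v)" by auto
  qed
  have "Wt \<subseteq> w ` b"
  proof
    fix h assume h: "h \<in> Wt"
    then obtain X where X: "X \<in> ws h" "X \<noteq> 0" "h \<in> aa"
      unfolding Wt_def using subspace_0[OF sub_ws] by auto
    show "h \<in> w ` b"
    proof (rule ccontr)
      assume n: "h \<notin> w ` b"
      have "ip X Y = 0" if "Y \<in> span b" for Y
        using that
      proof (induction rule: span_induct)
        show "subspace {Y. ip X Y = 0}" by (auto simp: subspace_def)
        show "ip X v = 0" if "v \<in> b" for v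
          using ws_orthogonal[OF X(1) w(2)[OF that] X(3) w(1)[OF that]] n that by blast
      qed
      then have "ip X X = 0" using spb by simp
      then show False using X by (simp add: ip_eq_0)
    qed
  qed
  then show ?thesis using fb finite_subset by blast
qed

section \<open>Components with respect to the weights\<close>

lemma weight_decomposition: "\<exists>f. (\<forall>h\<in>Wt. f h \<in> ws h) \<and> X = (\<Sum>h\<in>Wt. f h)"
proof -
  have "X \<in> span (\<Union>h\<in>aa. ws h)" using span_ws by simp
  then show ?thesis
  proof (induction rule: span_induct)
    show "subspace {X. \<exists>f. (\<forall>h\<in>Wt. f h \<in> ws h) \<and> X = (\<Sum>h\<in>Wt. f h)}"
      unfolding subspace_def mem_Collect_eq
    proof (intro conjI ballI allI impI)
      show "\<exists>f. (\<forall>h\<in>Wt. f h \<in> ws h) \<and> 0 = (\<Sum>h\<in>Wt. f h)"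
        by (intro exI[of _ "\<lambda>_. 0"]) (simp add: subspace_0[OF sub_ws])
      fix x assume "x \<in> {X. \<exists>f. (\<forall>h\<in>Wt. f h \<in> ws h) \<and> X = (\<Sum>h\<in>Wt. f h)}"
      then obtain f where f: "\<forall>h\<in>Wt. f h \<in> ws h" "x = (\<Sum>h\<in>Wt. f h)" by blast
      show "\<exists>f. (\<forall>h\<in>Wt. f h \<in> ws h) \<and> c *\<^sub>R x = (\<Sum>h\<in>Wt. f h)" for c
        using f by (intro exI[of _ "\<lambda>h. c *\<^sub>R f h"]) (simp add: subspace_scale[OF sub_ws] scaleR_sum_right)
      fix y assume "y \<in> {X. \<exists>f. (\<forall>h\<in>Wt. f h \<in> ws h) \<and> X = (\<Sum>h\<in>Wt. f h)}"
      then obtain g where g: "\<forall>h\<in>Wt. g h \<in> ws h" "y = (\<Sum>h\<in>Wt. g h)" by blast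
      show "\<exists>f. (\<forall>h\<in>Wt. f h \<in> ws h) \<and> x + y = (\<Sum>h\<in>Wt. f h)"
        using f g by (intro exI[of _ "\<lambda>h. f h + g h"]) (simp add: subspace_add[OF sub_ws] sum.distrib)
    qed
    fix X assume "X \<in> (\<Union>h\<in>aa. ws h)"
    then obtain h where h: "h \<in> aa" "X \<in> ws h" by blast
    show "\<exists>f. (\<forall>h\<in>Wt. f h \<in> ws h) \<and> X = (\<Sum>h\<in>Wt. f h)"
    proof (cases "h \<in> Wt")
      case True
      then show ?thesis using h finite_Wt
        by (intro exI[of _ "\<lambda>k. if k = h then X else 0"]) (auto simp: subspace_0[OF sub_ws] sum.delta)
    next
      case False
      then have "X = 0" using h by (auto simp: Wt_def)
      then show ?thesis by (intro exI[of _ "\<lambda>_. 0"]) (simp add: subspace_0[OF sub_ws])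
    qed
  qed
qed

definition decomp where "decomp X = (SOME f. (\<forall>h\<in>Wt. f h \<in> ws h) \<and> X = (\<Sum>h\<in>Wt. f h))"
text \<open>The value 0 outside \<open>Wt\<close> keeps \<open>pr h\<close> linear for every vector
  \<open>h\<close>, so that later formulas need no case distinction.\<close>

definition pr where "pr h X = (if h \<in> Wt then decomp X h else 0)"

lemma pr: "pr h X \<in> ws h" "X = (\<Sum>h\<in>Wt. pr h X)"
proof -
  have d: "(\<forall>h\<in>Wt. decomp X h \<in> ws h) \<and> X = (\<Sum>h\<in>Wt. decomp X h)"
    unfolding decomp_def by (rule someI_ex[OF weight_decomposition])
  then show "pr h X \<in> ws h" by (auto simp: pr_def subspace_0[OF sub_ws])
  show "X = (\<Sum>h\<in>Wt. pr h X)" using d by (simp add: pr_def)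
qed

lemma Wt_aa: "h \<in> Wt \<Longrightarrow> h \<in> aa" by (simp add: Wt_def)

lemma pr_unique:
  assumes f: "\<And>h. h \<in> Wt \<Longrightarrow> f h \<in> ws h" and X: "X = (\<Sum>h\<in>Wt. f h)" and h: "h \<in> Wt"
  shows "pr h X = f h"
proof -
  define g where "g k = pr k X - f k" for k
  have gws: "g k \<in> ws k" if "k \<in> Wt" for k
    unfolding g_def using f[OF that] pr(1) by (intro subspace_diff[OF sub_ws])
  have "(\<Sum>k\<in>Wt. g k) = 0" using pr(2)[of X] X by (simp add: g_def sum_subtractf)
  then have "0 = ip (\<Sum>k\<in>Wt. g k) (g h)" by simp
  also have "\<dots> = (\<Sum>k\<in>Wt. ip (g k) (g h))"
  proof -
    have "linear (\<lambda>X. ip X (g h))" by (rule linearI) simp_all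
    then show ?thesis by (rule linear_sum)
  qed
  also have "\<dots> = (\<Sum>k\<in>Wt. if k = h then ip (g h) (g h) else 0)"
    by (rule sum.cong) (use ws_orthogonal[OF gws gws[OF h]] Wt_aa h in auto)
  also have "\<dots> = ip (g h) (g h)" using finite_Wt h by simp
  finally have "g h = 0" by (simp add: ip_eq_0)
  then show ?thesis by (simp add: g_def)
qed

lemma linear_pr: "linear (pr h)"
proof (cases "h \<in> Wt")
  case True
  show ?thesis
  proof
    fix X Y :: 'e and c :: real
    show "pr h (X + Y) = pr h X + pr h Y"
      by (rule pr_unique[OF _ _ True]) (use pr in \<open>auto simp: sum.distrib intro: subspace_add[OF sub_ws]\<close>)
    show "pr h (c *\<^sub>R X) = c *\<^sub>R pr h X"
      by (rule pr_unique[OF _ _ True])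
        (use pr in \<open>auto simp flip: scaleR_sum_right intro: subspace_scale[OF sub_ws]\<close>)
  qed
next
  case False
  then have "pr h = (\<lambda>X. 0)" by (auto simp: pr_def)
  then show ?thesis by (simp add: linear_zero)
qed

lemma pr_ws: "X \<in> ws k \<Longrightarrow> k \<in> aa \<Longrightarrow> pr h X = (if h = k then X else 0)"
proof (cases "k \<in> Wt")
  case True
  assume X: "X \<in> ws k"
  show ?thesis
  proof (cases "h \<in> Wt")
    case h: True
    show ?thesis
      by (rule pr_unique[OF _ _ h]) (use X True finite_Wt in \<open>auto simp: subspace_0[OF sub_ws]\<close>)
  qed (use True in \<open>auto simp: pr_def\<close>)
next
  case False
  assume "X \<in> ws k" "k \<in> aa"
  then have "X = 0" using False by (auto simp: Wt_def)
  then show ?thesis by (simp add: linear_0[OF linear_pr])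
qed

lemma pr_bracket_aa: "H \<in> aa \<Longrightarrow> pr h (bracket G H X) = B h H *\<^sub>R pr h X"
proof (cases "h \<in> Wt")
  case True
  assume H: "H \<in> aa"
  have "bracket G H X = (\<Sum>k\<in>Wt. B k H *\<^sub>R pr k X)"
  proof -
    have "bracket G H (\<Sum>k\<in>Wt. pr k X) = (\<Sum>k\<in>Wt. bracket G H (pr k X))"
      by (rule linear_sum[OF linear_bracket_right])
    then show ?thesis using wsD[OF pr(1) H] pr(2)[of X] by simp
  qed
  then show ?thesis by (intro pr_unique[OF _ _ True]) (auto intro: subspace_scale[OF sub_ws] pr)
qed (simp add: pr_def)

text \<open>The sum of the weight spaces with weight in \<open>S\<close>, stated through vanishing
  components; \<open>S\<close> may contain non-weights, so that half-spaces can be used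
  directly.\<close>

definition gr where "gr S = {X. \<forall>h\<in>Wt. h \<notin> S \<longrightarrow> pr h X = 0}"

lemma sub_gr: "subspace (gr S)"
  by (auto simp: subspace_def gr_def linear_0[OF linear_pr] linear_add[OF linear_pr] linear_scale[OF linear_pr])

lemma ws_gr: "X \<in> ws h \<Longrightarrow> h \<in> S \<Longrightarrow> h \<in> aa \<Longrightarrow> X \<in> gr S"
  by (auto simp: gr_def pr_ws)

lemma gr_induct [consumes 1, case_names subspace ws]:
  assumes X: "X \<in> gr S" and sub: "subspace {X. P X}" and b: "\<And>h Y. h \<in> Wt \<Longrightarrow> h \<in> S \<Longrightarrow> Y \<in> ws h \<Longrightarrow> P Y"
  shows "P X"
proof -
  have "(\<Sum>h\<in>Wt. pr h X) \<in> {X. P X}"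
  proof (intro subspace_sum[OF sub])
    fix h assume h: "h \<in> Wt"
    show "pr h X \<in> {X. P X}"
    proof (cases "h \<in> S")
      case False
      then have "pr h X = 0" using X h by (simp add: gr_def)
      then show ?thesis using subspace_0[OF sub] by simp
    qed (use b h pr in auto)
  qed
  then show ?thesis using pr(2)[of X] by simp
qed

lemma gr_bracket:
  assumes X: "X \<in> gr S" and Y: "Y \<in> gr S'" and sum: "\<And>h k. h \<in> S \<Longrightarrow> k \<in> S' \<Longrightarrow> h + k \<in> Wt \<Longrightarrow> h + k \<in> S''"
  shows "bracket G X Y \<in> gr S''"
  using X
proof (induction rule: gr_induct)
  case subspace
  show ?case using sub_gr[of S''] by (auto simp: subspace_def br_simps)
next
  case (ws h Z)
  show ?case using Y
  proof (induction rule: gr_induct)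
    case subspace
    show ?case using sub_gr[of S''] by (auto simp: subspace_def br_simps)
  next
    case ws': (ws k Z')
    have b: "bracket G Z Z' \<in> ws (h + k)" by (rule ws_bracket) fact+
    have hk: "h + k \<in> aa" using ws ws' Wt_aa subspace_add[OF sub_aa] by blast
    show ?case
    proof (cases "h + k \<in> Wt")
      case True
      then show ?thesis using ws_gr[OF b sum hk] ws ws' by blast
    next
      case False
      then have "bracket G Z Z' = 0" using b hk by (auto simp: Wt_def)
      then show ?thesis by (simp add: subspace_0[OF sub_gr])
    qed
  qed
qed

lemma gr_mono: "(\<And>h. h \<in> Wt \<Longrightarrow> h \<in> S \<Longrightarrow> h \<in> S') \<Longrightarrow> gr S \<subseteq> gr S'"
  by (auto simp: gr_def)

lemma gr_disjoint: "X \<in> gr S \<Longrightarrow> X \<in> gr S' \<Longrightarrow> (\<And>h. h \<in> Wt \<Longrightarrow> h \<in> S \<Longrightarrow> h \<in> S' \<Longrightarrow> False) \<Longrightarrow> X = 0"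
proof -
  assume X: "X \<in> gr S" "X \<in> gr S'" and d: "\<And>h. h \<in> Wt \<Longrightarrow> h \<in> S \<Longrightarrow> h \<in> S' \<Longrightarrow> False"
  then have "pr h X = 0" if "h \<in> Wt" for h using that by (auto simp: gr_def)
  then show "X = 0" using pr(2)[of X] by simp
qed

definition prs where "prs S X = (\<Sum>h\<in>Wt. if h \<in> S then pr h X else 0)"

lemma linear_prs: "linear (prs S)"
proof -
  have "linear (\<lambda>X. if h \<in> S then pr h X else 0)" for h
    by (cases "h \<in> S") (simp_all add: linear_pr linear_zero)
  then show ?thesis unfolding prs_def[abs_def] by (intro linear_compose_sum ballI)
qed

lemma prs_gr: "prs S X \<in> gr S"
  unfolding prs_def
  by (intro subspace_sum[OF sub_gr]) (auto intro: ws_gr[OF pr(1)] Wt_aa subspace_0[OF sub_gr])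

lemma prs_compl: "prs S X + prs (- S) X = X"
proof -
  have "prs S X + prs (- S) X = (\<Sum>h\<in>Wt. pr h X)"
    unfolding prs_def by (subst sum.distrib[symmetric]) (auto intro: sum.cong)
  then show ?thesis using pr(2)[of X] by simp
qed

lemma prs_id: "X \<in> gr S \<Longrightarrow> prs S X = X"
proof -
  assume "X \<in> gr S"
  then have "prs S X = (\<Sum>h\<in>Wt. pr h X)" unfolding prs_def by (intro sum.cong) (auto simp: gr_def)
  then show ?thesis using pr(2)[of X] by simp
qed

lemma prs_0: "X \<in> gr (- S) \<Longrightarrow> prs S X = 0"
  unfolding prs_def by (intro sum.neutral) (auto simp: gr_def)

text \<open>A vector of \<open>aa\<close> on which all weights vanish acts as 0, and
  \<open>adE\<close> is injective.\<close>

lemma weights_span: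
  assumes "Z \<in> aa" "\<And>h. h \<in> Wt \<Longrightarrow> B h Z = 0" shows "Z = 0"
proof (rule adE_inj, rule endo_eqI)
  fix X
  have "bracket G Z X = bracket G Z (\<Sum>k\<in>Wt. pr k X)" using pr(2)[of X] by simp
  also have "\<dots> = (\<Sum>k\<in>Wt. bracket G Z (pr k X))" by (rule linear_sum[OF linear_bracket_right])
  also have "\<dots> = 0" using wsD[OF pr(1) assms(1)] assms(2) by simp
  finally show "ap (adE Z) X = ap 0 X" by simp
qed

lemma Wt_uminus: "h \<in> Wt \<Longrightarrow> - h \<in> Wt"
proof -
  assume h: "h \<in> Wt"
  then obtain X where X: "X \<in> ws h" "X \<noteq> 0" "h \<in> aa"
    unfolding Wt_def using subspace_0[OF sub_ws] by auto
  have "theta X \<noteq> 0" using X theta_theta[of X] linear_0[OF linear_theta] by metis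
  then show ?thesis using ws_theta[OF X(1)] X(3) subspace_neg[OF sub_aa] by (auto simp: Wt_def)
qed

text \<open>If \<open>a - b\<close> were no weight, \<open>[theta Y, X]\<close> would vanish for
  root vectors \<open>X\<close> and \<open>Y\<close>, and the Leibniz rule would give
  \<open>ip [Y, X] [Y, X] = - ip Y Y * B a b * ip X X\<close>, which is negative.\<close>

lemma root_difference:
  assumes a: "a \<in> Wt" "a \<noteq> 0" and b: "b \<in> Wt" "b \<noteq> 0" and ab: "B a b > 0"
  shows "a - b \<in> Wt"
proof (rule ccontr)
  assume n: "a - b \<notin> Wt"
  obtain X where X: "X \<in> ws a" "X \<noteq> 0" "a \<in> aa" using a(1) unfolding Wt_def using subspace_0[OF sub_ws] by auto
  obtain Y where Y: "Y \<in> ws b" "Y \<noteq> 0" "b \<in> aa" using b(1) unfolding Wt_def using subspace_0[OF sub_ws] by auto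
  have "bracket G X (theta Y) \<in> ws (a + - b)" by (rule ws_bracket[OF X(1) ws_theta[OF Y(1)]])
  then have "bracket G X (theta Y) = 0"
    using n X Y subspace_diff[OF sub_aa] by (auto simp: Wt_def)
  then have z: "bracket G (theta Y) X = 0" using bracket_anti[of "theta Y" X] by simp
  have yy: "ip Y Y > 0" by (rule ip_pos[OF Y(2)])
  have "- (1 / ip Y Y) *\<^sub>R bracket G Y (theta Y) = b"
  proof (rule B_aa_eqI[OF _ Y(3)])
    have ew: "- (1 / ip Y Y) *\<^sub>R bracket G Y (theta Y) \<in> aa \<and> Y \<in> ws (- (1 / ip Y Y) *\<^sub>R bracket G Y (theta Y))"
      by (rule eigenvector_weight[OF Y(2)]) (use wsD[OF Y(1)] in blast)
    then show "- (1 / ip Y Y) *\<^sub>R bracket G Y (theta Y) \<in> aa" by blast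
    fix H assume "H \<in> aa"
    then show "B (- (1 / ip Y Y) *\<^sub>R bracket G Y (theta Y)) H = B b H"
      using wsD[OF Y(1)] wsD[OF conjunct2[OF ew]] Y(2) by (metis scaleR_right_imp_eq)
  qed
  then have br: "bracket G (theta Y) Y = ip Y Y *\<^sub>R b"
    using bracket_anti[of "theta Y" Y] yy by (auto simp: scaleR_scaleR)
  have "0 \<le> ip (bracket G Y X) (bracket G Y X)" by (rule ip_nonneg)
  also have "\<dots> = - ip X (bracket G (theta Y) (bracket G Y X))" by (rule ip_bracket)
  also have "bracket G (theta Y) (bracket G Y X) = ip Y Y *\<^sub>R bracket G b X"
    using Leibniz[of "theta Y" Y X] by (simp add: z br br_simps)
  also have "bracket G b X = B a b *\<^sub>R X" by (rule wsD[OF X(1) Y(3)])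
  finally have "ip Y Y * (B a b * ip X X) \<le> 0" by simp
  moreover have "0 < ip Y Y * (B a b * ip X X)" using yy ab ip_pos[OF X(2)] by simp
  ultimately show False by simp
qed

end

section \<open>The subgroups \<open>K\<close>, \<open>A\<close>, \<open>M\<close>, \<open>N\<close> and \<open>P\<close>\<close>

text \<open>The terms of positive degree all start from \<open>ap x v\<close>, so \<open>v\<close>
  itself may lie outside \<open>S\<close>. It is applied with \<open>S\<close> a sum of higher
  weight spaces.\<close>

lemma ap_exp_diff_subspace:
  assumes S: "subspace S" and inv: "\<And>v. v \<in> S \<Longrightarrow> ap x v \<in> S" and v: "ap x v \<in> S"
  shows "ap (exp x) v - v \<in> S"
proof -
  have p: "ap (x ^ Suc n) v \<in> S" for n by (induction n) (simp_all add: v inv)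
  have "(\<lambda>n. (1 / fact (n + 1)) *\<^sub>R ap (x ^ (n + 1)) v) sums (ap (exp x) v - (\<Sum>n<1. (1 / fact n) *\<^sub>R ap (x ^ n) v))"
    using exp_bilinear_sums[of x v] by (subst sums_iff_shift')
  then have l: "(\<lambda>n. \<Sum>k<n. (1 / fact (k + 1)) *\<^sub>R ap (x ^ (k + 1)) v) \<longlonglongrightarrow> ap (exp x) v - v"
    by (simp add: sums_def)
  have "(\<Sum>k<n. (1 / fact (k + 1)) *\<^sub>R ap (x ^ (k + 1)) v) \<in> S" for n
    using p by (intro subspace_sum[OF S] subspace_scale[OF S]) simp
  from closed_sequentially[OF closed_subspace[OF S] this l] show ?thesis .
qed

context flat_group
begin

lemma exp_aa_ws: "H \<in> aa \<Longrightarrow> X \<in> ws h \<Longrightarrow> ap (exp (adE H)) X = exp (B h H) *\<^sub>R X"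
  by (rule ap_exp_eigenvector) (simp add: wsD)

lemma pr_exp_aa:
  assumes H: "H \<in> aa" shows "pr h (ap (exp (adE H)) X) = exp (B h H) *\<^sub>R pr h X"
proof (cases "h \<in> Wt")
  case True
  have "ap (exp (adE H)) X = ap (exp (adE H)) (\<Sum>k\<in>Wt. pr k X)" using pr(2)[of X] by simp
  also have "\<dots> = (\<Sum>k\<in>Wt. ap (exp (adE H)) (pr k X))" by (rule linear_sum[OF linear_ap])
  also have "\<dots> = (\<Sum>k\<in>Wt. exp (B k H) *\<^sub>R pr k X)" by (simp add: exp_aa_ws[OF H pr(1)])
  finally show ?thesis by (intro pr_unique[OF _ _ True]) (auto intro: subspace_scale[OF sub_ws] pr)
qed (simp add: pr_def)

lemma eq_by_pr: "(\<And>h. h \<in> Wt \<Longrightarrow> pr h X = pr h Y) \<Longrightarrow> X = Y"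
  using pr(2)[of X] pr(2)[of Y] by simp

text \<open>Both operators are diagonalizable with real eigenvalues, and the real exponential is
  injective: on an eigenvector \<open>Ad k w\<close> of the first one, each nonzero component with
  respect to the second must carry the same eigenvalue.\<close>

lemma exp_aa_injective:
  assumes k: "k \<in> carrier G" and H: "H \<in> aa" "H' \<in> aa"
    and eq: "exp (adE (Ad G k H)) = exp (adE H')"
  shows "Ad G k H = H'"
proof (rule adE_eq, rule endo_eqI)
  fix X
  have *: "bracket G (Ad G k H) (Ad G k w) = bracket G H' (Ad G k w)" if w: "w \<in> ws h" for w h
  proof -
    let ?v = "Ad G k w"
    have e: "bracket G (Ad G k H) ?v = B h H *\<^sub>R ?v"
      using wsD[OF w H(1)] linear_scale[OF linear_Ad[OF k]] by (simp flip: Ad_bracket[OF k])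
    have ee: "ap (exp (adE H')) ?v = exp (B h H) *\<^sub>R ?v"
      unfolding eq[symmetric] by (rule ap_exp_eigenvector) (simp add: e)
    have "bracket G H' ?v = B h H *\<^sub>R ?v"
    proof (rule eq_by_pr)
      fix l assume "l \<in> Wt"
      have "exp (B l H') *\<^sub>R pr l ?v = exp (B h H) *\<^sub>R pr l ?v"
        using arg_cong[OF ee, of "pr l"] by (simp add: pr_exp_aa[OF H(2)] linear_scale[OF linear_pr])
      then have "B l H' *\<^sub>R pr l ?v = B h H *\<^sub>R pr l ?v" by auto
      then show "pr l (bracket G H' ?v) = pr l (B h H *\<^sub>R ?v)"
        by (simp add: pr_bracket_aa[OF H(2)] linear_scale[OF linear_pr])
    qed
    then show ?thesis using e by simp
  qed
  let ?Y = "Ad G (inv k) X"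
  have "X = Ad G k (\<Sum>h\<in>Wt. pr h ?Y)" using pr(2)[of ?Y] Ad_inv[OF k] by simp
  also have "\<dots> = (\<Sum>h\<in>Wt. Ad G k (pr h ?Y))" by (rule linear_sum[OF linear_Ad[OF k]])
  finally have X: "X = (\<Sum>h\<in>Wt. Ad G k (pr h ?Y))" .
  have "bracket G (Ad G k H) X = (\<Sum>h\<in>Wt. bracket G (Ad G k H) (Ad G k (pr h ?Y)))"
    by (subst X) (rule linear_sum[OF linear_bracket_right])
  also have "\<dots> = (\<Sum>h\<in>Wt. bracket G H' (Ad G k (pr h ?Y)))" using *[OF pr(1)] by simp
  also have "\<dots> = bracket G H' X"
    by (subst (2) X) (rule linear_sum[OF linear_bracket_right, symmetric])
  finally show "ap (adE (Ad G k H)) X = ap (adE H') X" by simp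
qed

end

locale sym_group = flat_group G kk pp aa
  for G :: "('a, 'e::euclidean_space) manifold_group" (structure) and kk pp aa +
  fixes K A M T :: "'a set"
  assumes maxK: "maximal_compact_subgroup G K" and kkK: "kk = lie_algebra_of G K"
    and A_def: "A = lie_exp G ` aa" and M_def: "M = centralizer_in G K A" and T_def: "T = normalizer_in G K A"
begin

section \<open>Invariance under K\<close>

lemma subK: "subgroup K G" and compactK: "compactin gT K"
  using maxK unfolding maximal_compact_subgroup_def by auto

lemma K_carrier: "k \<in> K \<Longrightarrow> k \<in> carrier G" using subgroup.mem_carrier[OF subK] .

lemma kk_iff: "X \<in> kk \<longleftrightarrow> (\<forall>t::real. expG (t *\<^sub>R X) \<in> K)"
  by (simp add: kkK lie_algebra_of_def expG_def)

lemma exp_kk: "X \<in> kk \<Longrightarrow> expG (t *\<^sub>R X) \<in> K" by (simp add: kk_iff)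

lemma Ad_K_kk: "k \<in> K \<Longrightarrow> X \<in> kk \<Longrightarrow> Ad G k X \<in> kk"
  unfolding kk_iff
proof
  fix t :: real assume k: "k \<in> K" and X: "\<forall>t. expG (t *\<^sub>R X) \<in> K"
  have "k \<otimes> expG (t *\<^sub>R X) \<otimes> inv k \<in> K"
    using k X subK by (intro subgroup.m_closed[OF subK] subgroup.m_inv_closed[OF subK]) auto
  then show "expG (t *\<^sub>R Ad G k X) \<in> K"
    using K_carrier[OF k] by (simp add: exp_conj linear_scale[OF linear_Ad])
qed

text \<open>Describes \<open>pp\<close> as the \<open>B\<close>-complement of \<open>kk\<close>,
  from which its invariance under \<open>K\<close> follows.\<close>

lemma pp_iff: "X \<in> pp \<longleftrightarrow> (\<forall>Z\<in>kk. B X Z = 0)"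
proof
  assume "X \<in> pp"
  then show "\<forall>Z\<in>kk. B X Z = 0" using B_kk_pp B_sym by metis
next
  assume 0: "\<forall>Z\<in>kk. B X Z = 0"
  have "B (X - pk X) (pk X) = 0" using B_kk_pp[OF pk(1) pk(2)] B_sym by metis
  then have "B (pk X) (pk X) = 0" using 0 pk(1)[of X] by simp
  then have "pk X = 0" using B_kk[OF pk(1)[of X]] by force
  then show "X \<in> pp" using pk(2)[of X] by simp
qed

lemma Ad_K_pp:
  assumes k: "k \<in> K" and X: "X \<in> pp" shows "Ad G k X \<in> pp"
  unfolding pp_iff
proof
  fix Z assume Z: "Z \<in> kk"
  have kc: "k \<in> carrier G" using K_carrier k by blast
  have "B X (Ad G (inv k) Z) = 0"
    using X Ad_K_kk[OF subgroup.m_inv_closed[OF subK k] Z] unfolding pp_iff by blast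
  then show "B (Ad G k X) Z = 0" using B_Ad[OF kc, of X "Ad G (inv k) Z"] Ad_inv[OF kc] by simp
qed

lemma Ad_K_theta:
  assumes k: "k \<in> K" shows "theta (Ad G k X) = Ad G k (theta X)"
proof -
  have lin: "linear (Ad G k)" by (rule linear_Ad[OF K_carrier[OF k]])
  have "pk (Ad G k X) = Ad G k (pk X)"
    by (rule pk_eqI) (use Ad_K_kk[OF k pk(1)] Ad_K_pp[OF k pk(2)] in \<open>simp_all flip: linear_diff[OF lin]\<close>)
  then show ?thesis by (simp add: theta_def linear_diff[OF lin])
qed

lemma ip_Ad_K: "k \<in> K \<Longrightarrow> ip (Ad G k X) (Ad G k Y) = ip X Y"
  by (simp add: ip_def Ad_K_theta B_Ad K_carrier)

section \<open>The groups A, T and M\<close>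

lemma A_eq: "A = expG ` aa" by (simp add: A_def expG_def)

lemma exp_aa_mult: "H \<in> aa \<Longrightarrow> H' \<in> aa \<Longrightarrow> expG (H + H') = expG H \<otimes> expG H'"
  by (rule expG_sum) (rule aa_abelian)

lemma A_carrier: "a \<in> A \<Longrightarrow> a \<in> carrier G" by (auto simp: A_eq)

lemma subA: "subgroup A G"
proof (rule subgroupI)
  show "A \<subseteq> carrier G" using A_carrier by blast
  show "A \<noteq> {}" using subspace_0[OF sub_aa] by (auto simp: A_eq)
  show "inv a \<in> A" if "a \<in> A" for a
  proof -
    from that obtain H where "H \<in> aa" "a = expG H" unfolding A_eq by blast
    then show ?thesis unfolding A_eq using imageI[OF subspace_neg[OF sub_aa], of H expG] by (simp add: expG_minus)
  qed
  show "a \<otimes> b \<in> A" if "a \<in> A" "b \<in> A" for a b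
  proof -
    from that obtain H H' where "H \<in> aa" "a = expG H" "H' \<in> aa" "b = expG H'" unfolding A_eq by blast
    then show ?thesis unfolding A_eq using imageI[OF subspace_add[OF sub_aa], of H H' expG] by (simp add: exp_aa_mult)
  qed
qed

lemma Ad_aa_eq:
  assumes k: "k \<in> carrier G" and sub: "\<And>H. H \<in> aa \<Longrightarrow> Ad G k H \<in> aa"
  shows "Ad G k ` aa = aa"
proof (rule subspace_dim_equal[OF _ sub_aa])
  show "subspace (Ad G k ` aa)" by (rule linear_subspace_image[OF linear_Ad[OF k] sub_aa])
  show "Ad G k ` aa \<subseteq> aa" using sub by blast
  have "inj_on (Ad G k) (span aa)" using Ad_inv(1)[OF k] by (metis inj_on_inverseI)
  then show "dim aa \<le> dim (Ad G k ` aa)" using dim_image_eq[OF linear_Ad[OF k], of aa] by simp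
qed

text \<open>The normalizer of \<open>A\<close> becomes the stabilizer of \<open>aa\<close> under
  \<open>Ad\<close>; the passage from \<open>A\<close> back to \<open>aa\<close> is
  \<open>exp_aa_injective\<close>.\<close>

lemma T_iff: "t \<in> T \<longleftrightarrow> t \<in> K \<and> (\<forall>H\<in>aa. Ad G t H \<in> aa)"
proof -
  have Ac: "A \<subseteq> carrier G" using A_carrier by blast
  have conj: "t <#\<^bsub>G\<^esub> A #>\<^bsub>G\<^esub> inv t = (\<lambda>a. t \<otimes> a \<otimes> inv t) ` A" for t
  proof (rule Set.set_eqI)
    fix x
    have "x \<in> t <#\<^bsub>G\<^esub> A #>\<^bsub>G\<^esub> inv t \<longleftrightarrow> (\<exists>y\<in>t <#\<^bsub>G\<^esub> A. x = y \<otimes> inv t)"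
      unfolding r_coset_def by simp
    also have "\<dots> \<longleftrightarrow> (\<exists>a\<in>A. x = t \<otimes> a \<otimes> inv t)" unfolding l_coset_def by simp
    finally show "x \<in> t <#\<^bsub>G\<^esub> A #>\<^bsub>G\<^esub> inv t \<longleftrightarrow> x \<in> (\<lambda>a. t \<otimes> a \<otimes> inv t) ` A"
      by (simp add: image_iff)
  qed
  have T: "t \<in> T \<longleftrightarrow> t \<in> K \<and> (\<lambda>a. t \<otimes> a \<otimes> inv t) ` A = A" for t
    using Ac K_carrier by (auto simp: T_def normalizer_in_def normalizer_def stabilizer_def conj)
  show ?thesis unfolding T
  proof (intro conj_cong refl iffI ballI)
    fix H assume tK: "t \<in> K" and eq: "(\<lambda>a. t \<otimes> a \<otimes> inv t) ` A = A" and H: "H \<in> aa"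
    have tc: "t \<in> carrier G" by (rule K_carrier[OF tK])
    have "t \<otimes> expG H \<otimes> inv t \<in> (\<lambda>a. t \<otimes> a \<otimes> inv t) ` A" by (intro imageI) (simp add: A_eq H)
    then have "t \<otimes> expG H \<otimes> inv t \<in> A" unfolding eq .
    then obtain H' where H': "H' \<in> aa" "expG (Ad G t H) = expG H'"
      unfolding A_eq using exp_conj[OF tc] by auto
    then have "Ad G t H = H'" using exp_aa_injective[OF tc H H'(1)] AdE_exp by metis
    then show "Ad G t H \<in> aa" using H' by simp
  next
    assume tK: "t \<in> K" and sub: "\<forall>H\<in>aa. Ad G t H \<in> aa"
    have tc: "t \<in> carrier G" by (rule K_carrier[OF tK])
    have "(\<lambda>a. t \<otimes> a \<otimes> inv t) ` A = expG ` (Ad G t ` aa)"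
      unfolding A_eq image_image by (rule image_cong) (simp_all add: exp_conj tc)
    then show "(\<lambda>a. t \<otimes> a \<otimes> inv t) ` A = A" using Ad_aa_eq[OF tc] sub by (simp add: A_eq)
  qed
qed

lemma T_K: "t \<in> T \<Longrightarrow> t \<in> K" and T_carrier: "t \<in> T \<Longrightarrow> t \<in> carrier G" and T_aa: "t \<in> T \<Longrightarrow> H \<in> aa \<Longrightarrow> Ad G t H \<in> aa"
  using T_iff K_carrier by auto

lemma T_mult: "s \<in> T \<Longrightarrow> t \<in> T \<Longrightarrow> s \<otimes> t \<in> T"
  unfolding T_iff using K_carrier by (auto simp: Ad_mult subgroup.m_closed[OF subK])

lemma T_inv: "t \<in> T \<Longrightarrow> inv t \<in> T"
  unfolding T_iff
proof (intro conjI ballI)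
  assume t: "t \<in> K \<and> (\<forall>H\<in>aa. Ad G t H \<in> aa)"
  then have tc: "t \<in> carrier G" using K_carrier by blast
  show "inv t \<in> K" using t subgroup.m_inv_closed[OF subK] by blast
  fix H assume "H \<in> aa"
  then obtain H' where "H' \<in> aa" "H = Ad G t H'" using Ad_aa_eq[OF tc] t by blast
  then show "Ad G (inv t) H \<in> aa" using Ad_inv[OF tc] by simp
qed

lemma T_one: "\<one> \<in> T" unfolding T_iff by (simp add: Ad_one subgroup.one_closed[OF subK])

lemma M_iff: "m \<in> M \<longleftrightarrow> m \<in> K \<and> (\<forall>H\<in>aa. Ad G m H = H)"
proof
  assume m: "m \<in> M"
  then have mK: "m \<in> K" by (simp add: M_def centralizer_in_def)
  have mc: "m \<in> carrier G" by (rule K_carrier[OF mK])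
  have "Ad G m H = H" if H: "H \<in> aa" for H
  proof -
    have "m \<otimes> expG H = expG H \<otimes> m" using m H by (auto simp: M_def centralizer_in_def A_eq)
    then have "m \<otimes> expG H \<otimes> inv m = expG H" using mc by (simp add: inv_solve_right')
    then have "expG (Ad G m H) = expG H" using exp_conj[OF mc] by simp
    then show ?thesis using exp_aa_injective[OF mc H H] AdE_exp by metis
  qed
  then show "m \<in> K \<and> (\<forall>H\<in>aa. Ad G m H = H)" using mK by blast
next
  assume m: "m \<in> K \<and> (\<forall>H\<in>aa. Ad G m H = H)"
  then have mc: "m \<in> carrier G" using K_carrier by blast
  have "m \<otimes> a = a \<otimes> m" if a: "a \<in> A" for a
  proof -
    obtain H where H: "H \<in> aa" "a = expG H" using a by (auto simp: A_eq)
    then have "m \<otimes> a \<otimes> inv m = a" using exp_conj[OF mc, of H] m by simp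
    then show ?thesis using mc A_carrier[OF a] by (metis inv_solve_right' m_closed)
  qed
  then show "m \<in> M" using m by (simp add: M_def centralizer_in_def)
qed

lemma M_T: "m \<in> M \<Longrightarrow> m \<in> T" by (simp add: M_iff T_iff)
lemma M_carrier: "m \<in> M \<Longrightarrow> m \<in> carrier G" using M_T T_carrier by blast
lemma M_A_commute: "m \<in> M \<Longrightarrow> a \<in> A \<Longrightarrow> m \<otimes> a = a \<otimes> m" by (simp add: M_def centralizer_in_def)

lemma subM: "subgroup M G"
proof (rule subgroupI)
  show "M \<subseteq> carrier G" using M_carrier by blast
  have "\<one> \<in> M" using subgroup.one_closed[OF subK] by (simp add: M_iff Ad_one)
  then show "M \<noteq> {}" by blast
  show "inv a \<in> M" if "a \<in> M" for a
    using that T_inv[OF M_T[OF that]] Ad_inv(1)[OF M_carrier[OF that]] unfolding M_iff T_iff by metis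
  show "a \<otimes> b \<in> M" if "a \<in> M" "b \<in> M" for a b
    using that T_mult[OF M_T M_T] by (auto simp: M_iff T_iff Ad_mult K_carrier)
qed

lemma Ad_T_ws: "t \<in> T \<Longrightarrow> X \<in> ws h \<Longrightarrow> Ad G t X \<in> ws (Ad G t h)"
  unfolding ws_def mem_Collect_eq
proof
  fix H assume t: "t \<in> T" and X: "\<forall>H\<in>aa. bracket G H X = B h H *\<^sub>R X" and H: "H \<in> aa"
  have tc: "t \<in> carrier G" by (rule T_carrier[OF t])
  let ?H = "Ad G (inv t) H"
  have "?H \<in> aa" using T_aa[OF T_inv[OF t] H] .
  then have "Ad G t (bracket G ?H X) = B h ?H *\<^sub>R Ad G t X" using X linear_scale[OF linear_Ad[OF tc]] by simp
  moreover have "B h ?H = B (Ad G t h) H" using B_Ad[OF tc, of h ?H] Ad_inv[OF tc] by simp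
  ultimately show "bracket G H (Ad G t X) = B (Ad G t h) H *\<^sub>R Ad G t X"
    using Ad_inv[OF tc] by (simp add: Ad_bracket[OF tc])
qed

lemma Ad_M_ws: "m \<in> M \<Longrightarrow> h \<in> aa \<Longrightarrow> X \<in> ws h \<Longrightarrow> Ad G m X \<in> ws h"
  using Ad_T_ws[OF M_T, of m X h] by (auto simp: M_iff)

lemma Ad_T_Wt: "t \<in> T \<Longrightarrow> h \<in> Wt \<Longrightarrow> Ad G t h \<in> Wt"
proof -
  assume t: "t \<in> T" and h: "h \<in> Wt"
  then obtain X where X: "X \<in> ws h" "X \<noteq> 0" "h \<in> aa"
    unfolding Wt_def using subspace_0[OF sub_ws] by auto
  have "Ad G t X \<noteq> 0"
    using X Ad_inv(1)[OF T_carrier[OF t], of X] linear_0[OF linear_Ad[OF inv_closed[OF T_carrier[OF t]]]] by metis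
  then show ?thesis using Ad_T_ws[OF t X(1)] T_aa[OF t X(3)] by (auto simp: Wt_def)
qed

lemma Ad_T_pr:
  assumes t: "t \<in> T" and h: "h \<in> aa" shows "Ad G t (pr h X) = pr (Ad G t h) (Ad G t X)"
proof -
  have tc: "t \<in> carrier G" by (rule T_carrier[OF t])
  have lin: "linear (Ad G t)" by (rule linear_Ad[OF tc])
  have "Ad G t X = Ad G t (\<Sum>k\<in>Wt. pr k X)" using pr(2)[of X] by simp
  also have "\<dots> = (\<Sum>k\<in>Wt. Ad G t (pr k X))" by (rule linear_sum[OF lin])
  finally have "pr (Ad G t h) (Ad G t X) = (\<Sum>k\<in>Wt. pr (Ad G t h) (Ad G t (pr k X)))"
    using linear_sum[OF linear_pr] by metis
  also have "\<dots> = (\<Sum>k\<in>Wt. if k = h then Ad G t (pr h X) else 0)"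
  proof (rule sum.cong[OF refl])
    fix k assume k: "k \<in> Wt"
    have "Ad G t k = Ad G t h \<Longrightarrow> k = h" using Ad_inv(1)[OF tc] by metis
    then show "pr (Ad G t h) (Ad G t (pr k X)) = (if k = h then Ad G t (pr h X) else 0)"
      using pr_ws[OF Ad_T_ws[OF t pr(1)] T_aa[OF t Wt_aa[OF k]], of "Ad G t h"] by auto
  qed
  also have "\<dots> = Ad G t (pr h X)"
    using finite_Wt by (cases "h \<in> Wt") (auto simp: pr_def linear_0[OF lin])
  finally show ?thesis ..
qed

lemma exp_pp_symmetric:
  assumes X: "X \<in> pp" shows "ip (ap (exp (adE X)) u) v = ip u (ap (exp (adE X)) v)"
proof -
  have bl: "bounded_linear (\<lambda>u. ip u w)" "bounded_linear (\<lambda>u. ip w u)" for w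
    by (simp_all flip: linear_conv_bounded_linear add: linear_iff)
  have p: "ip (ap (adE X ^ n) u) w = ip u (ap (adE X ^ n) w)" for n w
  proof (induction n arbitrary: w)
    case (Suc n)
    have "ip (ap (adE X ^ Suc n) u) w = ip (ap (adE X ^ n) u) (bracket G X w)"
      using ip_bracket_pp[OF X] by simp
    moreover have "ap (adE X ^ n) (bracket G X w) = bracket G X (ap (adE X ^ n) w)"
      using arg_cong[OF power_commutes[of "adE X" n], of "\<lambda>y. ap y w"] by simp
    ultimately show ?case by (simp add: Suc)
  qed simp
  have "(\<lambda>n. ip ((1 / fact n) *\<^sub>R ap (adE X ^ n) u) v) sums ip (ap (exp (adE X)) u) v"
    by (rule bounded_linear.sums[OF bl(1) exp_bilinear_sums])
  moreover have "(\<lambda>n. ip u ((1 / fact n) *\<^sub>R ap (adE X ^ n) v)) sums ip u (ap (exp (adE X)) v)"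
    by (rule bounded_linear.sums[OF bl(2) exp_bilinear_sums])
  ultimately show ?thesis using p by (simp add: sums_unique2)
qed

text \<open>Comparing \<open>S S\<^sup>*\<close> for both sides of \<open>exp (Ad k H) = exp H' \<kappa>\<close> removes \<open>\<kappa>\<close>.\<close>

lemma stabilizer_T:
  assumes k: "k \<in> K" and st: "\<And>H. H \<in> aa \<Longrightarrow> \<exists>H'\<in>aa. \<exists>k'\<in>K. k \<otimes> expG H = expG H' \<otimes> k'"
  shows "k \<in> T"
  unfolding T_iff
proof (intro conjI k ballI)
  fix H assume H: "H \<in> aa"
  have kc: "k \<in> carrier G" by (rule K_carrier[OF k])
  obtain H' k' where H': "H' \<in> aa" "k' \<in> K" "k \<otimes> expG H = expG H' \<otimes> k'" using st[OF H] by blast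
  define c where "c = k' \<otimes> inv k"
  have cK: "c \<in> K" unfolding c_def by (intro subgroup.m_closed[OF subK] subgroup.m_inv_closed[OF subK] H' k)
  have cc: "c \<in> carrier G" by (rule K_carrier[OF cK])
  let ?X = "Ad G k H"
  have Xpp: "?X \<in> pp" by (rule Ad_K_pp[OF k aa_pp[OF H]])
  have "expG ?X = expG H' \<otimes> c"
    using H' kc K_carrier[OF H'(2)] by (simp add: exp_conj[OF kc, symmetric] c_def m_assoc)
  then have "inv (expG ?X) = inv c \<otimes> inv (expG H')" using cc by (simp add: inv_mult_group)
  then have e: "Ad G (expG (- ?X)) u = Ad G (inv c) (Ad G (expG (- H')) u)" for u
    using cc by (simp add: expG_minus Ad_mult)
  have icK: "inv c \<in> K" by (rule subgroup.m_inv_closed[OF subK cK])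
  have e2: "Ad G (expG (- Z)) (Ad G (expG (- Z)) u) = Ad G (expG (2 *\<^sub>R (- Z))) u" for Z u
  proof -
    have "expG (2 *\<^sub>R (- Z)) = expG (- Z) \<otimes> expG (- Z)" using expG_add[of 1 1 "- Z"] by simp
    then show ?thesis by (simp add: Ad_mult)
  qed
  have sym: "ip (Ad G (expG (- Z)) u) v = ip u (Ad G (expG (- Z)) v)" if "Z \<in> pp" for Z u v
    using exp_pp_symmetric[of "- Z" u v] subspace_neg[OF sub_pp that] by (simp flip: AdE_exp)
  have a: "ip (Ad G (expG (2 *\<^sub>R (- Z))) u) v = ip (Ad G (expG (- Z)) u) (Ad G (expG (- Z)) v)"
    if "Z \<in> pp" for Z u v
    by (simp only: e2[symmetric] sym[OF that])
  \<comment> \<open>An operator is determined by its \<open>ip\<close>-products, from which the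
    isometry \<open>Ad (inv c)\<close> has dropped out; moving one factor across the product
    accounts for the 2.\<close>
  have "Ad G (expG (2 *\<^sub>R (- ?X))) u = Ad G (expG (2 *\<^sub>R (- H'))) u" for u
  proof -
    let ?D = "Ad G (expG (2 *\<^sub>R (- ?X))) u - Ad G (expG (2 *\<^sub>R (- H'))) u"
    have "ip (Ad G (expG (2 *\<^sub>R (- ?X))) u) v = ip (Ad G (expG (2 *\<^sub>R (- H'))) u) v" for v
      by (simp only: a[OF Xpp] a[OF aa_pp[OF H'(1)]] e ip_Ad_K[OF icK])
    then have "ip ?D ?D = 0" by simp
    then have "?D = 0" by (simp only: ip_eq_0)
    then show ?thesis by simp
  qed
  then have "AdE (expG (2 *\<^sub>R (- ?X))) = AdE (expG (2 *\<^sub>R (- H')))" by (intro endo_eqI) simp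
  moreover have "2 *\<^sub>R (- ?X) = Ad G k (2 *\<^sub>R (- H))"
    by (simp only: linear_scale[OF linear_Ad[OF kc]] linear_neg[OF linear_Ad[OF kc]])
  ultimately have "Ad G k (2 *\<^sub>R (- H)) = 2 *\<^sub>R (- H')"
    by (intro exp_aa_injective[OF kc] subspace_scale[OF sub_aa] subspace_neg[OF sub_aa] H H'(1)) (simp add: AdE_exp)
  then have "2 *\<^sub>R ?X = 2 *\<^sub>R H'"
    by (simp add: linear_scale[OF linear_Ad[OF kc]] linear_neg[OF linear_Ad[OF kc]])
  then show "Ad G k H \<in> aa" using H'(1) by simp
qed

end

locale parab_group = sym_group G kk pp aa K A M T
  for G :: "('a, 'e::euclidean_space) manifold_group" (structure) and kk pp aa K A M T +
  fixes H0 :: 'e and N P :: "'a set"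
  assumes H0: "H0 \<in> aa" and regular: "h \<in> Wt \<Longrightarrow> h \<noteq> 0 \<Longrightarrow> B h H0 \<noteq> 0"
    and N_eq: "N = expG ` gr {h. 0 < B h H0}" and P_def: "P = M <#>\<^bsub>G\<^esub> A <#>\<^bsub>G\<^esub> N"
begin

abbreviation pos where "pos \<equiv> {h. 0 < B h H0}"
abbreviation nonneg where "nonneg \<equiv> {h. 0 \<le> B h H0}"
abbreviation neg where "neg \<equiv> {h. B h H0 < 0}"
abbreviation nonpos where "nonpos \<equiv> {h. B h H0 \<le> 0}"

section \<open>N as a contraction group\<close>

lemma N_carrier: "n \<in> N \<Longrightarrow> n \<in> carrier G" by (auto simp: N_eq)

definition conj_H0 where "conj_H0 n g = expG (- (real n *\<^sub>R H0)) \<otimes> g \<otimes> expG (real n *\<^sub>R H0)"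
text \<open>Convergence of the conjugates to the identity passes to products and inverses, which is
  how \<open>N\<close> is shown to be a subgroup without multiplying out two exponentials.\<close>

definition contracted where
  "contracted g \<longleftrightarrow> g \<in> carrier G \<and> (\<forall>W. openin gT W \<longrightarrow> \<one> \<in> W \<longrightarrow> (\<forall>\<^sub>F n in sequentially. conj_H0 n g \<in> W))"

lemma conj_H0_mult: "g \<in> carrier G \<Longrightarrow> h \<in> carrier G \<Longrightarrow> conj_H0 n (g \<otimes> h) = conj_H0 n g \<otimes> conj_H0 n h"
  by (simp add: conj_H0_def expG_minus m_assoc inv_mult_cancel)

lemma conj_H0_inv: "g \<in> carrier G \<Longrightarrow> conj_H0 n (inv g) = inv (conj_H0 n g)"
  by (simp add: conj_H0_def expG_minus inv_mult_group m_assoc)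

lemma conj_H0_exp: "conj_H0 n (expG X) = expG (ap (exp (adE (- (real n *\<^sub>R H0)))) X)"
proof -
  have "conj_H0 n (expG X) = expG (- (real n *\<^sub>R H0)) \<otimes> expG X \<otimes> inv (expG (- (real n *\<^sub>R H0)))"
    by (simp add: conj_H0_def expG_minus)
  then show ?thesis by (simp add: exp_conj flip: AdE_exp)
qed

lemma conj_H0_Suc: "g \<in> carrier G \<Longrightarrow> conj_H0 (Suc n) g = conj_H0 1 (conj_H0 n g)"
proof -
  assume g: "g \<in> carrier G"
  have "expG (real (Suc n) *\<^sub>R H0) = expG (real n *\<^sub>R H0) \<otimes> expG (1 *\<^sub>R H0)"
    using expG_add[of "real n" 1 H0] by (simp add: add.commute)
  then show ?thesis using g by (simp add: conj_H0_def expG_minus inv_mult_group m_assoc)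
qed

lemma contracted_closed:
  assumes "contracted g" "contracted h"
  shows "contracted (g \<otimes> h)" "contracted (inv g)"
proof -
  have c: "g \<in> carrier G" "h \<in> carrier G" using assms by (auto simp: contracted_def)
  show "contracted (g \<otimes> h)"
    unfolding contracted_def
  proof (intro conjI allI impI)
    fix W assume W: "openin gT W" "\<one> \<in> W"
    obtain U where U: "openin gT U" "\<one> \<in> U" "\<And>g h. g \<in> U \<Longrightarrow> h \<in> U \<Longrightarrow> g \<otimes> h \<in> W"
      using nbhd_mult[OF W] by metis
    have "\<forall>\<^sub>F n in sequentially. conj_H0 n g \<in> U \<and> conj_H0 n h \<in> U"
      using assms U(1,2) unfolding contracted_def by (simp add: eventually_conj)
    then show "\<forall>\<^sub>F n in sequentially. conj_H0 n (g \<otimes> h) \<in> W"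
      by (rule eventually_mono) (simp add: conj_H0_mult c U(3))
  qed (use c in simp)
  show "contracted (inv g)"
    unfolding contracted_def
  proof (intro conjI allI impI)
    fix W assume W: "openin gT W" "\<one> \<in> W"
    obtain U where U: "openin gT U" "\<one> \<in> U" "\<And>g. g \<in> U \<Longrightarrow> inv g \<in> W"
      using nbhd_mult[OF W] by metis
    have "\<forall>\<^sub>F n in sequentially. conj_H0 n g \<in> U" using assms U(1,2) unfolding contracted_def by simp
    then show "\<forall>\<^sub>F n in sequentially. conj_H0 n (inv g) \<in> W"
      by (rule eventually_mono) (simp add: conj_H0_inv c U(3))
  qed (use c in simp)
qed

lemma scal_aa: "- (real n *\<^sub>R H0) \<in> aa" by (intro subspace_neg[OF sub_aa] subspace_scale[OF sub_aa] H0)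

lemma continuous_pr: "continuous_on UNIV (pr h)"
  by (simp add: linear_continuous_on linear_pr flip: linear_conv_bounded_linear)

lemma tendsto_exp_neg: "0 < c \<Longrightarrow> (\<lambda>n. exp (- (real n * c))) \<longlonglongrightarrow> 0"
proof -
  assume c: "0 < c"
  have "exp (- (real n * c)) = exp (- c) ^ n" for n by (simp flip: exp_of_nat_mult)
  moreover have "(\<lambda>n. exp (- c) ^ n) \<longlonglongrightarrow> 0" by (rule LIMSEQ_power_zero) (use c in simp)
  ultimately show ?thesis by simp
qed

lemma contraction_pos:
  assumes X: "X \<in> gr pos"
  shows "(\<lambda>n. ap (exp (adE (- (real n *\<^sub>R H0)))) X) \<longlonglongrightarrow> 0"
proof -
  let ?f = "\<lambda>n. ap (exp (adE (- (real n *\<^sub>R H0)))) X"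
  have f: "?f n = (\<Sum>h\<in>Wt. exp (- (real n * B h H0)) *\<^sub>R pr h X)" for n
    using pr(2)[of "?f n"] by (simp add: pr_exp_aa[OF scal_aa])
  have "(\<lambda>n. exp (- (real n * B h H0)) *\<^sub>R pr h X) \<longlonglongrightarrow> 0" if h: "h \<in> Wt" for h
  proof (cases "0 < B h H0")
    case True
    from tendsto_scaleR[OF tendsto_exp_neg[OF True] tendsto_const[of "pr h X"]] show ?thesis by simp
  next
    case False
    then have "pr h X = 0" using X h by (simp add: gr_def)
    then show ?thesis by simp
  qed
  then have "(\<lambda>n. \<Sum>h\<in>Wt. exp (- (real n * B h H0)) *\<^sub>R pr h X) \<longlonglongrightarrow> (\<Sum>h\<in>Wt. 0)"
    by (intro tendsto_sum) auto
  then show ?thesis unfolding f by simp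
qed

text \<open>\<open>N\<close> is the contraction group of \<open>exp (-H0)\<close>: the logarithms \<open>Z\<^sub>n\<close> of a contracted orbit satisfy
  \<open>Z\<^sub>n\<^sub>+\<^sub>1 = exp (- ad H0) Z\<^sub>n\<close> and tend to \<open>0\<close>, so they lie in the sum of the positive root spaces.\<close>

lemma N_iff: "g \<in> N \<longleftrightarrow> contracted g"
proof
  assume "g \<in> N"
  then obtain X where X: "X \<in> gr pos" "g = expG X" by (auto simp: N_eq)
  show "contracted g"
    unfolding contracted_def
  proof (intro conjI allI impI)
    show "g \<in> carrier G" using X by simp
    fix W assume W: "openin gT W" "\<one> \<in> W"
    from exp_nbhd[OF W] obtain s where s: "s > 0" "\<And>X. norm X < s \<Longrightarrow> expG X \<in> W" by blast
    have "\<forall>\<^sub>F n in sequentially. dist (ap (exp (adE (- (real n *\<^sub>R H0)))) X) 0 < s"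
      using contraction_pos[OF X(1)] s(1) by (rule tendstoD)
    then show "\<forall>\<^sub>F n in sequentially. conj_H0 n g \<in> W"
      by (rule eventually_mono) (simp add: X(2) conj_H0_exp s(2))
  qed
next
  assume g: "contracted g"
  then have gc: "g \<in> carrier G" by (simp add: contracted_def)
  have bl: "bounded_linear adE" using linear_adE by (simp add: linear_conv_bounded_linear)
  define E where "E = exp (adE (- H0))"
  obtain C where C: "C > 0" "\<And>X. norm (adE X) \<le> norm X * C"
    using bounded_linear.pos_bounded[OF bl] by blast
  \<comment> \<open>Chosen so that \<open>Z\<close> and \<open>ap E Z\<close> both have
    \<open>ad\<close> of norm at most 1/4, where \<open>ad_exp_unique\<close> identifies the
    logarithms of consecutive terms.\<close>
  define e where "e = 1 / (4 * C * (norm E + 1))"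
  have p: "0 < norm E + 1" by (simp add: add_nonneg_pos)
  have e0: "e > 0" using C p by (simp add: e_def)
  have eC: "x * C \<le> 1/4" if "x < e * (norm E + 1)" for x
  proof -
    have "e * (norm E + 1) * C = 1/4" using C p by (simp add: e_def)
    moreover have "x * C \<le> e * (norm E + 1) * C" using that C(1) by (intro mult_right_mono) auto
    ultimately show ?thesis by linarith
  qed
  have small: "norm (adE Z) \<le> 1/4" "norm (adE (ap E Z)) \<le> 1/4" if "norm Z < e" for Z
  proof -
    have "norm (ap E Z) \<le> norm E * norm Z" by (rule norm_ap)
    also have "\<dots> \<le> norm E * e" using that by (intro mult_left_mono) auto
    also have "\<dots> < e * (norm E + 1)" using e0 by (simp add: algebra_simps)
    finally show "norm (adE (ap E Z)) \<le> 1/4" by (rule order_trans[OF C(2) eC])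
    have "e * 1 \<le> e * (norm E + 1)" using e0 by (intro mult_left_mono) auto
    then have "norm Z < e * (norm E + 1)" using that by linarith
    then show "norm (adE Z) \<le> 1/4" by (rule order_trans[OF C(2) eC])
  qed
  have ev: "\<forall>\<^sub>F n in sequentially. \<exists>Z. norm Z < d \<and> conj_H0 n g = expG Z" if d: "d > 0" for d
  proof -
    obtain V where V: "openin gT V" "\<one> \<in> V" "\<And>g. g \<in> V \<Longrightarrow> \<exists>Z. norm Z < d \<and> g = expG Z"
      using log_nbhd[OF d] by metis
    then have "\<forall>\<^sub>F n in sequentially. conj_H0 n g \<in> V" using g by (simp add: contracted_def)
    then show ?thesis by (rule eventually_mono) (rule V(3))
  qed
  obtain n0 where n0: "\<And>n. n \<ge> n0 \<Longrightarrow> \<exists>Z. norm Z < e \<and> conj_H0 n g = expG Z"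
    using ev[OF e0] unfolding eventually_sequentially by blast
  then obtain Z where Z: "\<And>n. n \<ge> n0 \<Longrightarrow> norm (Z n) < e \<and> conj_H0 n g = expG (Z n)" by metis
  have uniq: "X = Y" if "expG X = expG Y" "norm (adE X) \<le> 1/4" "norm (adE Y) \<le> 1/4" for X Y
    by (rule ad_exp_unique[OF _ that(2,3)]) (simp flip: AdE_exp add: that(1))
  have rec: "Z (Suc n) = ap E (Z n)" if n: "n \<ge> n0" for n
  proof (rule uniq)
    show "expG (Z (Suc n)) = expG (ap E (Z n))"
      using Z[OF n] Z[of "Suc n"] n conj_H0_Suc[OF gc, of n] by (simp add: conj_H0_exp E_def)
  qed (use Z[OF n] Z[of "Suc n"] n small in auto)
  have Zk: "pr h (Z (n0 + k)) = exp (- (real k * B h H0)) *\<^sub>R pr h (Z n0)" for h k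
  proof (induction k)
    case (Suc k)
    have "pr h (Z (n0 + Suc k)) = exp (B h (- H0)) *\<^sub>R pr h (Z (n0 + k))"
      using rec[of "n0 + k"] pr_exp_aa[OF subspace_neg[OF sub_aa H0], of h "Z (n0 + k)"] by (simp add: E_def)
    moreover have "exp (- B h H0) * exp (- (real k * B h H0)) = exp (- (real (Suc k) * B h H0))"
      by (simp add: mult_exp_exp algebra_simps)
    ultimately show ?case using Suc by simp
  qed simp
  have Z0: "Z \<longlonglongrightarrow> 0"
    unfolding tendsto_iff
  proof (intro allI impI)
    fix d :: real assume d: "d > 0"
    have "\<forall>\<^sub>F n in sequentially. (\<exists>Z. norm Z < min d e \<and> conj_H0 n g = expG Z) \<and> n \<ge> n0"
      using ev[of "min d e"] d e0 by (simp add: eventually_conj eventually_ge_at_top)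
    then show "\<forall>\<^sub>F n in sequentially. dist (Z n) 0 < d"
    proof (rule eventually_mono)
      fix n assume "(\<exists>Z. norm Z < min d e \<and> conj_H0 n g = expG Z) \<and> n \<ge> n0"
      then obtain Z' where Z': "norm Z' < min d e" "conj_H0 n g = expG Z'" "n \<ge> n0" by blast
      then have "Z n = Z'" using Z[OF Z'(3)] small by (intro uniq) auto
      then show "dist (Z n) 0 < d" using Z' by simp
    qed
  qed
  have "Z n0 \<in> gr pos"
    unfolding gr_def mem_Collect_eq
  proof (intro ballI impI)
    fix h assume h: "h \<in> Wt" "\<not> 0 < B h H0"
    have "(\<lambda>k. pr h (Z (k + n0))) \<longlonglongrightarrow> pr h 0"
      using LIMSEQ_ignore_initial_segment[OF Z0, of n0] continuous_pr
      by (intro isCont_tendsto_compose[of 0 "pr h"]) (auto simp: continuous_on_eq_continuous_at)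
    then have l: "(\<lambda>k. norm (pr h (Z (n0 + k)))) \<longlonglongrightarrow> 0"
      by (simp add: linear_0[OF linear_pr] add.commute tendsto_norm_zero)
    \<comment> \<open>For a weight that is not positive the factor in \<open>Zk\<close> is at least
      1: this component never falls below its value at \<open>n0\<close>, although it tends to
      0.\<close>
    have "norm (pr h (Z n0)) \<le> norm (pr h (Z (n0 + k)))" for k
    proof -
      have "1 \<le> exp (- (real k * B h H0))" using h(2) by (simp add: mult_nonneg_nonpos)
      then show ?thesis unfolding Zk by (simp add: mult_le_cancel_right1)
    qed
    then have "norm (pr h (Z n0)) \<le> 0" by (intro LIMSEQ_le_const[OF l]) blast
    then show "pr h (Z n0) = 0" by simp
  qed
  moreover have "g = expG (ap (exp (adE (real n0 *\<^sub>R H0))) (Z n0))"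
  proof -
    have "conj_H0 n0 g = expG (Z n0)" using Z[of n0] by simp
    then have "expG (real n0 *\<^sub>R H0) \<otimes> conj_H0 n0 g \<otimes> inv (expG (real n0 *\<^sub>R H0)) = expG (ap (exp (adE (real n0 *\<^sub>R H0))) (Z n0))"
      by (simp add: exp_conj flip: AdE_exp)
    then show ?thesis using gc by (simp add: conj_H0_def expG_minus m_assoc inv_mult_cancel)
  qed
  moreover have "ap (exp (adE (real n0 *\<^sub>R H0))) X \<in> gr pos" if "X \<in> gr pos" for X
    using that by (simp add: gr_def pr_exp_aa[OF subspace_scale[OF sub_aa H0]])
  ultimately show "g \<in> N" by (auto simp: N_eq)
qed

lemma subN: "subgroup N G"
proof (rule subgroupI)
  show "N \<subseteq> carrier G" using N_carrier by blast
  have "expG 0 \<in> N" unfolding N_eq by (intro imageI subspace_0[OF sub_gr])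
  then show "N \<noteq> {}" by blast
qed (simp_all add: N_iff contracted_closed)

lemma Ad_A_gr: "a \<in> A \<Longrightarrow> X \<in> gr S \<Longrightarrow> Ad G a X \<in> gr S"
proof -
  assume a: "a \<in> A" and X: "X \<in> gr S"
  obtain H where H: "H \<in> aa" "a = expG H" using a by (auto simp: A_eq)
  have "ap (exp (adE H)) X \<in> gr S" using X by (simp add: gr_def pr_exp_aa[OF H(1)])
  then show ?thesis by (simp add: H(2) flip: AdE_exp)
qed

lemma Ad_T_gr: "t \<in> T \<Longrightarrow> X \<in> gr S \<Longrightarrow> Ad G t X \<in> gr (Ad G t ` S)"
proof -
  assume t: "t \<in> T" and X: "X \<in> gr S"
  have lin: "linear (Ad G t)" by (rule linear_Ad[OF T_carrier[OF t]])
  show ?thesis using X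
  proof (induction rule: gr_induct)
    case subspace
    show ?case using sub_gr[of "Ad G t ` S"]
      by (auto simp: subspace_def linear_0[OF lin] linear_add[OF lin] linear_scale[OF lin])
  next
    case (ws h Y)
    then show ?case using Ad_T_ws[OF t ws(3)] T_aa[OF t Wt_aa] by (intro ws_gr[of _ "Ad G t h"]) auto
  qed
qed

lemma Ad_M_gr: "m \<in> M \<Longrightarrow> X \<in> gr S \<Longrightarrow> Ad G m X \<in> gr S"
proof -
  assume m: "m \<in> M" and X: "X \<in> gr S"
  have lin: "linear (Ad G m)" by (rule linear_Ad[OF M_carrier[OF m]])
  show ?thesis using X
  proof (induction rule: gr_induct)
    case subspace
    show ?case using sub_gr[of S]
      by (auto simp: subspace_def linear_0[OF lin] linear_add[OF lin] linear_scale[OF lin])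
  next
    case (ws h Y)
    then show ?case using Ad_M_ws[OF m Wt_aa ws(3)] Wt_aa by (intro ws_gr[of _ h]) auto
  qed
qed

text \<open>The condition under which \<open>gr S\<close> is invariant under \<open>N\<close>, and
  then under \<open>P\<close>, as \<open>M\<close> and \<open>A\<close> preserve each weight
  space.\<close>

definition upper where "upper S \<longleftrightarrow> (\<forall>h\<in>S. \<forall>k\<in>pos \<inter> Wt. k + h \<in> Wt \<longrightarrow> k + h \<in> S)"

lemma upper_nonneg: "upper nonneg" by (auto simp: upper_def)

text \<open>The second alternative admits components of \<open>X\<close> whose weight vanishes on
  \<open>H0\<close>; by regularity the only such weight is 0.\<close>

lemma exp_upper:
  assumes S: "upper S" and X: "X \<in> gr nonneg" and S0: "X \<in> gr pos \<or> (\<forall>k\<in>Wt. \<forall>h\<in>S. B k H0 = 0 \<longrightarrow> k + h \<in> S)"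
    and Y: "Y \<in> gr S"
  shows "ap (exp (adE X)) Y \<in> gr S"
proof (rule ap_exp_subspace[OF sub_gr _ Y])
  fix Y assume Y: "Y \<in> gr S"
  show "ap (adE X) Y \<in> gr S"
  proof (cases "X \<in> gr pos")
    case True
    then have "X \<in> gr (pos \<inter> Wt)" by (auto simp: gr_def)
    then have "bracket G X Y \<in> gr S"
      by (rule gr_bracket[OF _ Y]) (use S in \<open>auto simp: upper_def\<close>)
    then show ?thesis by simp
  next
    case False
    have "X \<in> gr (nonneg \<inter> Wt)" using X by (auto simp: gr_def)
    then have "bracket G X Y \<in> gr S"
    proof (rule gr_bracket[OF _ Y])
      fix k h assume kh: "k \<in> nonneg \<inter> Wt" "h \<in> S" "k + h \<in> Wt"
      show "k + h \<in> S"
      proof (cases "B k H0 = 0")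
        case True
        then show ?thesis using S0 False kh by auto
      next
        case False
        then show ?thesis using S kh by (auto simp: upper_def)
      qed
    qed
    then show ?thesis by simp
  qed
qed

lemma gr_pos_nonneg: "gr pos \<subseteq> gr nonneg" by (rule gr_mono) auto

lemma Ad_N_gr: "n \<in> N \<Longrightarrow> upper S \<Longrightarrow> X \<in> gr S \<Longrightarrow> Ad G n X \<in> gr S"
proof -
  assume n: "n \<in> N" and S: "upper S" and X: "X \<in> gr S"
  obtain Y where Y: "Y \<in> gr pos" "n = expG Y" using n by (auto simp: N_eq)
  have "ap (exp (adE Y)) X \<in> gr S" by (rule exp_upper[OF S _ _ X]) (use Y gr_pos_nonneg in auto)
  then show ?thesis by (simp add: Y(2) flip: AdE_exp)
qed

section \<open>The group P\<close>

lemma M_normalizes_N: "m \<in> M \<Longrightarrow> n \<in> N \<Longrightarrow> m \<otimes> n \<otimes> inv m \<in> N"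
  unfolding N_eq using Ad_M_gr M_carrier by (auto simp: exp_conj)

lemma A_normalizes_N: "a \<in> A \<Longrightarrow> n \<in> N \<Longrightarrow> a \<otimes> n \<otimes> inv a \<in> N"
  unfolding N_eq using Ad_A_gr A_carrier by (auto simp: exp_conj)

definition "MA = {m \<otimes> a | m a. m \<in> M \<and> a \<in> A}"

lemma MA_carrier: "l \<in> MA \<Longrightarrow> l \<in> carrier G" using M_carrier A_carrier by (auto simp: MA_def)

lemma subMA: "subgroup MA G"
proof (rule subgroupI)
  show "MA \<subseteq> carrier G" using MA_carrier by blast
  show "MA \<noteq> {}" using subgroup.one_closed[OF subM] subgroup.one_closed[OF subA] by (auto simp: MA_def)
  fix x assume "x \<in> MA"
  then obtain m a where x: "m \<in> M" "a \<in> A" "x = m \<otimes> a" by (auto simp: MA_def)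
  have "inv x = inv m \<otimes> inv a"
    using x M_A_commute[OF x(1,2)] M_carrier A_carrier by (simp add: inv_mult_group)
  then show "inv x \<in> MA" using x subgroup.m_inv_closed[OF subM] subgroup.m_inv_closed[OF subA] by (auto simp: MA_def)
  fix y assume "y \<in> MA"
  then obtain m' a' where y: "m' \<in> M" "a' \<in> A" "y = m' \<otimes> a'" by (auto simp: MA_def)
  have c: "m \<in> carrier G" "a \<in> carrier G" "m' \<in> carrier G" "a' \<in> carrier G" using x y M_carrier A_carrier by auto
  have "x \<otimes> y = m \<otimes> (a \<otimes> m') \<otimes> a'" using c x y by (simp add: m_assoc)
  also have "a \<otimes> m' = m' \<otimes> a" using M_A_commute x y by simp
  finally have "x \<otimes> y = (m \<otimes> m') \<otimes> (a \<otimes> a')" using c by (simp add: m_assoc)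
  then show "x \<otimes> y \<in> MA" unfolding MA_def
    using subgroup.m_closed[OF subM x(1) y(1)] subgroup.m_closed[OF subA x(2) y(2)] by blast
qed

lemma MA_normalizes_N: "l \<in> MA \<Longrightarrow> n \<in> N \<Longrightarrow> l \<otimes> n \<otimes> inv l \<in> N"
proof -
  assume l: "l \<in> MA" and n: "n \<in> N"
  obtain m a where x: "m \<in> M" "a \<in> A" "l = m \<otimes> a" using l by (auto simp: MA_def)
  have c: "m \<in> carrier G" "a \<in> carrier G" "n \<in> carrier G" using x n M_carrier A_carrier N_carrier by auto
  have "l \<otimes> n \<otimes> inv l = m \<otimes> (a \<otimes> n \<otimes> inv a) \<otimes> inv m" using c by (simp add: x(3) inv_mult_group m_assoc)
  then show ?thesis using M_normalizes_N[OF x(1) A_normalizes_N[OF x(2) n]] by simp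
qed

lemma Ad_MA_gr: "l \<in> MA \<Longrightarrow> X \<in> gr S \<Longrightarrow> Ad G l X \<in> gr S"
  unfolding MA_def using Ad_M_gr Ad_A_gr M_carrier A_carrier by (auto simp: Ad_mult)

lemma P_iff: "p \<in> P \<longleftrightarrow> (\<exists>l\<in>MA. \<exists>n\<in>N. p = l \<otimes> n)"
  unfolding P_def set_mult_def MA_def by blast

lemma P_iff': "p \<in> P \<longleftrightarrow> (\<exists>l\<in>MA. \<exists>n\<in>N. p = n \<otimes> l)"
proof
  assume "p \<in> P"
  then obtain l n where ln: "l \<in> MA" "n \<in> N" "p = l \<otimes> n" unfolding P_iff by blast
  then have "p = (l \<otimes> n \<otimes> inv l) \<otimes> l" using MA_carrier N_carrier by (simp add: m_assoc)
  then show "\<exists>l\<in>MA. \<exists>n\<in>N. p = n \<otimes> l" using MA_normalizes_N ln by blast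
next
  assume "\<exists>l\<in>MA. \<exists>n\<in>N. p = n \<otimes> l"
  then obtain l n where ln: "l \<in> MA" "n \<in> N" "p = n \<otimes> l" by blast
  have il: "inv l \<in> MA" by (rule subgroup.m_inv_closed[OF subMA ln(1)])
  have "p = l \<otimes> (inv l \<otimes> n \<otimes> inv (inv l))" using ln MA_carrier N_carrier by (simp add: m_assoc inv_mult_cancel)
  then show "p \<in> P" unfolding P_iff using MA_normalizes_N[OF il ln(2)] ln(1) by blast
qed

lemma P_carrier: "p \<in> P \<Longrightarrow> p \<in> carrier G" using MA_carrier N_carrier by (auto simp: P_iff)
lemma MA_P: "l \<in> MA \<Longrightarrow> l \<in> P"
  unfolding P_iff by (intro bexI[of _ l] bexI[of _ "\<one>"]) (simp_all add: MA_carrier subgroup.one_closed[OF subN])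
lemma A_MA: "a \<in> A \<Longrightarrow> a \<in> MA"
  unfolding MA_def mem_Collect_eq
  by (intro exI[of _ "\<one>"] exI[of _ a]) (simp add: A_carrier subgroup.one_closed[OF subM])

lemma subP: "subgroup P G"
proof (rule subgroupI)
  show "P \<subseteq> carrier G" using P_carrier by blast
  show "P \<noteq> {}" using MA_P subgroup.one_closed[OF subMA] by blast
  fix x assume "x \<in> P"
  then obtain l n where x: "l \<in> MA" "n \<in> N" "x = l \<otimes> n" unfolding P_iff by blast
  have "inv x = inv n \<otimes> inv l" using x MA_carrier N_carrier by (simp add: inv_mult_group)
  then show "inv x \<in> P" unfolding P_iff' using x subgroup.m_inv_closed[OF subMA] subgroup.m_inv_closed[OF subN] by blast
  fix y assume "y \<in> P"
  then obtain l' n' where y: "l' \<in> MA" "n' \<in> N" "y = n' \<otimes> l'" unfolding P_iff' by blast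
  have nn: "n \<otimes> n' \<in> N" by (rule subgroup.m_closed[OF subN x(2) y(2)])
  have c: "l \<in> carrier G" "n \<in> carrier G" "l' \<in> carrier G" "n' \<in> carrier G" using x y MA_carrier N_carrier by auto
  have "x \<otimes> y = (l \<otimes> (n \<otimes> n') \<otimes> inv l) \<otimes> (l \<otimes> l')" using c x y by (simp add: m_assoc inv_mult_cancel)
  then show "x \<otimes> y \<in> P" unfolding P_iff'
    using MA_normalizes_N[OF x(1) nn] subgroup.m_closed[OF subMA x(1) y(1)] by blast
qed

lemma Ad_P_gr: "p \<in> P \<Longrightarrow> upper S \<Longrightarrow> X \<in> gr S \<Longrightarrow> Ad G p X \<in> gr S"
  unfolding P_iff using Ad_MA_gr Ad_N_gr MA_carrier N_carrier by (auto simp: Ad_mult)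

lemma H0_gr0: "H0 \<in> gr {h. B h H0 = 0}"
  by (rule ws_gr[of _ 0]) (use ws_zero H0 subspace_0[OF sub_aa] in auto)

text \<open>\<open>Ad n H0 - H0\<close> has only positive weights and, by assumption, no positive
  component; so \<open>n\<close> fixes \<open>H0\<close> and commutes with the multiples
  \<open>expG (k H0)\<close>. Its conjugates are then constant and converge to the identity, while
  points are closed.\<close>

lemma N_trivial:
  assumes n: "n \<in> N" and st: "Ad G n H0 \<in> gr nonpos" shows "n = \<one>"
proof (rule ccontr)
  assume n1: "n \<noteq> \<one>"
  have nc: "n \<in> carrier G" by (rule N_carrier[OF n])
  obtain Y where Y: "Y \<in> gr pos" "n = expG Y" using n by (auto simp: N_eq)
  have "ap (exp (adE Y)) H0 - H0 \<in> gr pos"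
  proof (rule ap_exp_diff_subspace[OF sub_gr])
    fix v assume v: "v \<in> gr pos"
    have "bracket G Y v \<in> gr pos" by (rule gr_bracket[OF Y(1) v]) auto
    then show "ap (adE Y) v \<in> gr pos" by simp
  next
    have "bracket G Y H0 \<in> gr pos" by (rule gr_bracket[OF Y(1) H0_gr0]) auto
    then show "ap (adE Y) H0 \<in> gr pos" by simp
  qed
  then have d: "Ad G n H0 - H0 \<in> gr pos" by (simp add: Y(2) flip: AdE_exp)
  have "H0 \<in> gr nonpos" using H0_gr0 gr_mono[of "{h. B h H0 = 0}" nonpos] by auto
  then have "Ad G n H0 - H0 \<in> gr nonpos" using st subspace_diff[OF sub_gr] by blast
  then have e: "Ad G n H0 = H0" using gr_disjoint[OF d] by fastforce
  have sqn: "conj_H0 k n = n" for k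
  proof -
    have "n \<otimes> expG (real k *\<^sub>R H0) \<otimes> inv n = expG (real k *\<^sub>R H0)"
      using exp_conj[OF nc] e by (simp add: linear_scale[OF linear_Ad[OF nc]])
    then have "n \<otimes> expG (real k *\<^sub>R H0) = expG (real k *\<^sub>R H0) \<otimes> n" using nc by (metis exp_closed inv_solve_right' m_closed)
    then show ?thesis using nc by (simp add: conj_H0_def expG_minus m_assoc inv_mult_cancel)
  qed
  have "closedin gT {n}" using Hausdorff nc topspace_gtop by (simp add: closedin_Hausdorff_sing_eq)
  then have "openin gT (carrier G - {n})" using topspace_gtop by (simp add: closedin_def)
  then have "\<forall>\<^sub>F k in sequentially. conj_H0 k n \<in> carrier G - {n}"
    using n n1 unfolding N_iff contracted_def by (metis DiffI one_closed singletonD)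
  then show False by (simp add: sqn)
qed

end

section \<open>Analytic continuation along one-parameter subgroups\<close>

text \<open>These functions form an algebra that contains the entries of \<open>exp (t x)\<close>,
  and the identity theorem holds for them.\<close>

definition entire_real :: "(real \<Rightarrow> real) \<Rightarrow> bool" where
  "entire_real f \<longleftrightarrow> (\<exists>F. F holomorphic_on UNIV \<and> (\<forall>t. F (complex_of_real t) = complex_of_real (f t)))"

lemma entire_real_const: "entire_real (\<lambda>t. c)"
  unfolding entire_real_def by (intro exI[of _ "\<lambda>_. complex_of_real c"]) auto

lemma entire_real_add: "entire_real f \<Longrightarrow> entire_real g \<Longrightarrow> entire_real (\<lambda>t. f t + g t)"
  unfolding entire_real_def
proof (elim exE conjE)
  fix F H assume "F holomorphic_on UNIV" "\<forall>t. F (complex_of_real t) = complex_of_real (f t)"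
    "H holomorphic_on UNIV" "\<forall>t. H (complex_of_real t) = complex_of_real (g t)"
  then show "\<exists>F. F holomorphic_on UNIV \<and> (\<forall>t. F (complex_of_real t) = complex_of_real (f t + g t))"
    by (intro exI[of _ "\<lambda>z. F z + H z"]) (auto intro: holomorphic_intros)
qed

lemma entire_real_mult: "entire_real f \<Longrightarrow> entire_real g \<Longrightarrow> entire_real (\<lambda>t. f t * g t)"
  unfolding entire_real_def
proof (elim exE conjE)
  fix F H assume "F holomorphic_on UNIV" "\<forall>t. F (complex_of_real t) = complex_of_real (f t)"
    "H holomorphic_on UNIV" "\<forall>t. H (complex_of_real t) = complex_of_real (g t)"
  then show "\<exists>F. F holomorphic_on UNIV \<and> (\<forall>t. F (complex_of_real t) = complex_of_real (f t * g t))"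
    by (intro exI[of _ "\<lambda>z. F z * H z"]) (auto intro: holomorphic_intros)
qed

lemma entire_real_sum: "finite I \<Longrightarrow> (\<And>i. i \<in> I \<Longrightarrow> entire_real (f i)) \<Longrightarrow> entire_real (\<lambda>t. \<Sum>i\<in>I. f i t)"
  by (induction I rule: finite_induct) (auto intro: entire_real_const entire_real_add)

lemma entire_real_prod: "finite I \<Longrightarrow> (\<And>i. i \<in> I \<Longrightarrow> entire_real (f i)) \<Longrightarrow> entire_real (\<lambda>t. \<Prod>i\<in>I. f i t)"
  by (induction I rule: finite_induct) (auto intro: entire_real_const entire_real_mult)

lemma entire_real_identity:
  assumes f: "entire_real f" and d: "d > 0" and z: "\<And>t. \<bar>t\<bar> < d \<Longrightarrow> f t = 0"
  shows "f t = 0"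
proof -
  obtain F where F: "F holomorphic_on UNIV" "\<And>t. F (complex_of_real t) = complex_of_real (f t)"
    using f unfolding entire_real_def by blast
  let ?U = "complex_of_real ` {t. \<bar>t\<bar> < d}"
  have "(0::complex) islimpt ?U"
    unfolding islimpt_approachable
  proof (intro allI impI)
    fix e :: real assume e: "e > 0"
    let ?x = "complex_of_real (min d e / 2)"
    show "\<exists>x'\<in>?U. x' \<noteq> 0 \<and> dist x' 0 < e"
      by (intro bexI[of _ ?x] conjI imageI) (use d e in \<open>auto simp: norm_divide\<close>)
  qed
  moreover have "F w = 0" if "w \<in> ?U" for w using that F(2) z by force
  ultimately have "F (complex_of_real t) = 0"
    by (rule analytic_continuation[OF F(1) open_UNIV connected_UNIV subset_UNIV UNIV_I _ _ UNIV_I])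
  then show ?thesis using F(2)[of t] by simp
qed

lemma entire_real_exp_entry: "entire_real (\<lambda>t. ap (exp (t *\<^sub>R x)) u \<bullet> w)"
proof -
  define a where "a n = complex_of_real ((ap (x ^ n) u \<bullet> w) / fact n)" for n
  define F where "F z = (\<Sum>n. a n * z ^ n)" for z
  have summ: "summable (\<lambda>n. a n * z ^ n)" for z
  proof (rule summable_comparison_test)
    have "norm (a n * z ^ n) \<le> norm u * norm w * ((norm x * norm z) ^ n /\<^sub>R fact n)" for n
    proof -
      have "\<bar>ap (x ^ n) u \<bullet> w\<bar> \<le> norm (ap (x ^ n) u) * norm w" by (rule Cauchy_Schwarz_ineq2)
      also have "\<dots> \<le> norm x ^ n * norm u * norm w"
        by (intro mult_right_mono order_trans[OF norm_ap] norm_power_ineq) auto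
      finally have "\<bar>ap (x ^ n) u \<bullet> w\<bar> / fact n * norm z ^ n \<le> norm x ^ n * norm u * norm w / fact n * norm z ^ n"
        by (intro mult_right_mono divide_right_mono) auto
      then show ?thesis
        unfolding a_def norm_mult norm_power norm_of_real abs_divide
        by (simp add: power_mult_distrib divide_inverse mult_ac)
    qed
    then show "\<exists>N. \<forall>n\<ge>N. norm (a n * z ^ n) \<le> norm u * norm w * ((norm x * norm z) ^ n /\<^sub>R fact n)" by blast
    show "summable (\<lambda>n. norm u * norm w * ((norm x * norm z) ^ n /\<^sub>R fact n))"
      by (intro summable_mult summable_exp_generic)
  qed
  have "F holomorphic_on UNIV"
    unfolding holomorphic_on_def field_differentiable_def F_def[abs_def]
    using termdiffs_strong_converges_everywhere[OF summ] by blast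
  moreover have "F (complex_of_real t) = complex_of_real (ap (exp (t *\<^sub>R x)) u \<bullet> w)" for t
  proof -
    have "(\<lambda>n. ((1 / fact n) *\<^sub>R ap ((t *\<^sub>R x) ^ n) u) \<bullet> w) sums (ap (exp (t *\<^sub>R x)) u \<bullet> w)"
      by (rule bounded_linear.sums[OF bounded_linear_inner_left exp_bilinear_sums])
    then have "(\<lambda>n. complex_of_real (((1 / fact n) *\<^sub>R ap ((t *\<^sub>R x) ^ n) u) \<bullet> w)) sums complex_of_real (ap (exp (t *\<^sub>R x)) u \<bullet> w)"
      by (rule sums_of_real)
    moreover have "complex_of_real (((1 / fact n) *\<^sub>R ap ((t *\<^sub>R x) ^ n) u) \<bullet> w) = a n * complex_of_real t ^ n" for n
      by (simp add: a_def scaleR_power)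
    ultimately have "(\<lambda>n. a n * complex_of_real t ^ n) sums complex_of_real (ap (exp (t *\<^sub>R x)) u \<bullet> w)"
      by (simp only:)
    from sums_unique[OF this] show ?thesis by (simp add: F_def)
  qed
  ultimately show ?thesis unfolding entire_real_def by blast
qed

text \<open>An index type, so that determinants can be taken with respect to the given
  basis.\<close>

typedef (overloaded) ('a::euclidean_space) bidx = "Basis :: 'a set" by (simp add: ex_in_conv)

instance bidx :: (euclidean_space) finite
proof
  have "(UNIV :: 'a bidx set) = Abs_bidx ` Basis"
    using type_definition.Abs_image[OF type_definition_bidx] by metis
  then show "finite (UNIV :: 'a bidx set)" by (metis finite_imageI finite_Basis)
qed

lemma sum_bidx: "(\<Sum>i\<in>(UNIV :: 'a::euclidean_space bidx set). f (Rep_bidx i)) = (\<Sum>b\<in>Basis. f b)"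
proof -
  have "bij_betw Rep_bidx (UNIV :: 'a bidx set) Basis"
    unfolding bij_betw_def using Rep_bidx_inject type_definition.Rep_range[OF type_definition_bidx]
    by (auto intro: injI)
  then show ?thesis by (rule sum.reindex_bij_betw)
qed

definition matE :: "'a::euclidean_space endo \<Rightarrow> real ^ 'a bidx ^ 'a bidx" where
  "matE x = (\<chi> i j. ap x (Rep_bidx j) \<bullet> Rep_bidx i)"

lemma det_matE_eq_0_iff: "det (matE x) = 0 \<longleftrightarrow> (\<exists>v. v \<noteq> 0 \<and> ap x v = 0)"
proof -
  define tv :: "real ^ 'a bidx \<Rightarrow> 'a" where "tv c = (\<Sum>j\<in>UNIV. (c $ j) *\<^sub>R Rep_bidx j)" for c
  define ct :: "'a \<Rightarrow> real ^ 'a bidx" where "ct v = (\<chi> i. v \<bullet> Rep_bidx i)" for v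
  have tc: "tv (ct v) = v" for v
    unfolding tv_def ct_def using sum_bidx[of "\<lambda>b. (v \<bullet> b) *\<^sub>R b"] by (simp add: euclidean_representation)
  have ct: "ct (tv c) = c" for c
  proof -
    have "tv c \<bullet> Rep_bidx i = c $ i" for i
    proof -
      have "tv c \<bullet> Rep_bidx i = (\<Sum>j\<in>UNIV. c $ j * (Rep_bidx j \<bullet> Rep_bidx i))"
        by (simp add: tv_def inner_sum_left)
      also have "\<dots> = (\<Sum>j\<in>UNIV. if j = i then c $ j else 0)"
        by (rule sum.cong) (auto simp: inner_Basis Rep_bidx Rep_bidx_inject)
      finally show ?thesis by simp
    qed
    then show ?thesis by (simp add: ct_def vec_eq_iff)
  qed
  have mul: "matE x *v c = ct (ap x (tv c))" for c
    unfolding vec_eq_iff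
  proof
    fix i
    have "ap x (tv c) = (\<Sum>j\<in>UNIV. (c $ j) *\<^sub>R ap x (Rep_bidx j))"
      unfolding tv_def by (subst linear_sum[OF linear_ap]) simp
    then show "(matE x *v c) $ i = ct (ap x (tv c)) $ i"
      by (simp add: matE_def matrix_vector_mult_def ct_def inner_sum_left mult.commute)
  qed
  have ct0: "ct v = 0 \<longleftrightarrow> v = 0" for v
    using tc[of v] by (auto simp: tv_def ct_def vec_eq_iff)
  have "det (matE x) = 0 \<longleftrightarrow> \<not> (\<forall>c. matE x *v c = 0 \<longrightarrow> c = 0)"
    unfolding matrix_left_invertible_ker[symmetric] invertible_left_inverse[symmetric] invertible_det_nz by simp
  also have "\<dots> \<longleftrightarrow> (\<exists>c. ap x (tv c) = 0 \<and> c \<noteq> 0)" by (auto simp: mul ct0)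
  also have "\<dots> \<longleftrightarrow> (\<exists>v. v \<noteq> 0 \<and> ap x v = 0)" by (metis ct tc ct0)
  finally show ?thesis .
qed

lemma entire_real_det:
  assumes "\<And>b c. b \<in> Basis \<Longrightarrow> c \<in> Basis \<Longrightarrow> entire_real (\<lambda>t. ap (x t) b \<bullet> c)"
  shows "entire_real (\<lambda>t. det (matE (x t)))"
  unfolding det_def
  by (intro entire_real_sum entire_real_mult entire_real_const entire_real_prod finite_permutations finite)
    (simp_all add: matE_def assms Rep_bidx)

lemma second_derivative_min:
  fixes f f' :: "real \<Rightarrow> real"
  assumes d1: "\<And>t. (f has_real_derivative f' t) (at t)" and d2: "(f' has_real_derivative c) (at 0)"
    and m: "\<And>t. f 0 \<le> f t"
  shows "f' 0 = 0" "0 \<le> c"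
proof -
  show f0: "f' 0 = 0" by (rule DERIV_local_min[OF d1, of 1]) (use m in auto)
  show "0 \<le> c"
  proof (rule ccontr)
    assume "\<not> 0 \<le> c"
    then obtain d where d: "d > 0" "\<And>h. h > 0 \<Longrightarrow> h < d \<Longrightarrow> f' h < 0"
      using DERIV_neg_dec_right[OF d2] f0 by auto
    obtain z where z: "0 < z" "z < d / 2" "f (d / 2) - f 0 = (d / 2 - 0) * f' z"
      using MVT2[of 0 "d / 2" f f'] d1 d by auto
    have "f' z < 0" using z d by auto
    then have "f (d / 2) - f 0 < 0" unfolding z(3) using d by (simp add: mult_pos_neg)
    then show False using m[of "d / 2"] by simp
  qed
qed

section \<open>The Weyl group\<close>

context sym_group
begin

definition reg where "reg Y \<longleftrightarrow> Y \<in> aa \<and> (\<forall>h\<in>Wt. h \<noteq> 0 \<longrightarrow> B h Y \<noteq> 0)"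

text \<open>A regular \<open>Y\<close> forces all components of \<open>X\<close> of nonzero weight
  to vanish, so \<open>X\<close> commutes with the whole of \<open>aa\<close>.\<close>

lemma reg_centralizer:
  assumes Y: "reg Y" and X: "X \<in> pp" "bracket G Y X = 0" shows "X \<in> aa"
proof (rule centralizer_in_aa[OF X(1)])
  have Ya: "Y \<in> aa" using Y by (simp add: reg_def)
  have "B h Y *\<^sub>R pr h X = 0" for h
    using pr_bracket_aa[OF Ya, of h X] X(2) by (simp add: linear_0[OF linear_pr])
  then have "pr h X = 0" if "h \<in> Wt" "h \<noteq> 0" for h using Y that by (auto simp: reg_def)
  then have "X \<in> gr {0}" by (auto simp: gr_def)
  then have "X \<in> ws 0"
    by (induction rule: gr_induct) (use sub_ws in \<open>auto simp: subspace_def\<close>)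
  then show "bracket G H X = 0" if "H \<in> aa" for H using wsD[OF _ that, of X 0] by simp
qed

lemma continuous_B_Ad: "continuous_map gT euclideanreal (\<lambda>g. B (Ad G g Y) H)"
proof -
  have "linear (\<lambda>X. B X H)" by (rule linearI) simp_all
  then have "continuous_on UNIV (\<lambda>X. B X H)"
    by (simp add: linear_continuous_on linear_conv_bounded_linear)
  then have "continuous_map euclidean euclideanreal (\<lambda>X. B X H)" by simp
  from continuous_map_compose[OF continuous_Ad this] show ?thesis by (simp add: o_def)
qed

text \<open>Minimise \<open>k \<mapsto> B (Ad k Y) H\<close> on the centralizer of \<open>Y1\<close> in \<open>K\<close>. At a critical point \<open>Ad k Y\<close>
  commutes with \<open>H\<close>; the second variation gives the sign condition.\<close>

lemma minimal_orbit_point: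
  assumes Y1: "Y1 \<in> aa" and Y: "Y \<in> aa" and H: "reg H"
  obtains k where "k \<in> K" "Ad G k Y1 = Y1" "Ad G k Y \<in> aa"
    "\<And>h. h \<in> Wt \<Longrightarrow> B h Y1 = 0 \<Longrightarrow> B h (Ad G k Y) * B h H \<le> 0"
proof -
  let ?f = "\<lambda>g. B (Ad G g Y) H"
  have Ha: "H \<in> aa" using H by (simp add: reg_def)
  define Kz where "Kz = K \<inter> {g \<in> topspace gT. Ad G g Y1 \<in> {Y1}}"
  have "closedin gT {g \<in> topspace gT. Ad G g Y1 \<in> {Y1}}"
    by (rule closedin_continuous_map_preimage[OF continuous_Ad]) simp
  then have "compactin gT Kz" unfolding Kz_def by (rule compact_Int_closedin[OF compactK])
  then have "compact (?f ` Kz)"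
    using image_compactin[OF _ continuous_B_Ad] by (metis compactin_euclidean_iff)
  moreover have "\<one> \<in> Kz" using subgroup.one_closed[OF subK] topspace_gtop by (simp add: Kz_def Ad_one)
  ultimately obtain k where k: "k \<in> Kz" "\<And>g. g \<in> Kz \<Longrightarrow> ?f k \<le> ?f g"
    using compact_attains_inf[of "?f ` Kz"] by (metis (no_types, lifting) empty_iff imageE imageI)
  have kK: "k \<in> K" and kY1: "Ad G k Y1 = Y1" using k by (auto simp: Kz_def)
  have kc: "k \<in> carrier G" by (rule K_carrier[OF kK])
  define Y' where "Y' = Ad G k Y"
  have Y'pp: "Y' \<in> pp" unfolding Y'_def by (rule Ad_K_pp[OF kK aa_pp[OF Y]])
  have Y'Y1: "bracket G Y1 Y' = 0"
    using Ad_bracket[OF kc, of Y1 Y] aa_abelian[OF Y1 Y] linear_0[OF linear_Ad[OF kc]]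
    by (simp add: kY1 Y'_def)
  have var: "B (bracket G X Y') H = 0 \<and> 0 \<le> B (bracket G X (bracket G X Y')) H"
    if X: "X \<in> kk" "bracket G X Y1 = 0" for X
  proof -
    define f where "f t = B (ap (exp (t *\<^sub>R adE X)) Y') H" for t
    have lin: "linear (\<lambda>Z. B Z H)" by (rule linearI) simp_all
    then have bl: "bounded_linear (\<lambda>Z. B Z H)" by (simp add: linear_conv_bounded_linear)
    have der: "((\<lambda>t. B (ap (exp (t *\<^sub>R adE X)) Z) H) has_real_derivative
        B (ap (exp (t *\<^sub>R adE X)) (bracket G X Z)) H) (at t)" for Z t
      using bounded_linear.has_vector_derivative[OF bl exp_ap_vector_derivative[of "adE X" Z t]]
      by (simp add: has_real_derivative_iff_has_vector_derivative)
    have min: "f 0 \<le> f t" for t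
    proof -
      have eK: "expG (t *\<^sub>R X) \<in> K" by (rule exp_kk[OF X(1)])
      have e: "Ad G (expG (t *\<^sub>R X)) Z = ap (exp (t *\<^sub>R adE X)) Z" for Z
        by (simp flip: ap_AdE add: AdE_exp linear_scale[OF linear_adE])
      have "Ad G (expG (t *\<^sub>R X)) Y1 = exp 0 *\<^sub>R Y1"
        unfolding e by (rule ap_exp_eigenvector) (simp add: X(2))
      then have "expG (t *\<^sub>R X) \<otimes> k \<in> Kz"
        using subgroup.m_closed[OF subK eK kK] kc topspace_gtop by (simp add: Kz_def Ad_mult kY1)
      from k(2)[OF this] show ?thesis using kc by (simp add: f_def Ad_mult e Y'_def)
    qed
    have d1: "(f has_real_derivative B (ap (exp (t *\<^sub>R adE X)) (bracket G X Y')) H) (at t)" for t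
      unfolding f_def by (rule der)
    from second_derivative_min[OF d1 der min] show ?thesis by simp
  qed
  \<comment> \<open>\<open>W\<close> lies in \<open>kk\<close> and commutes with \<open>Y1\<close>,
    so it is an admissible direction. The first variation along it is \<open>B W W\<close>, and
    \<open>B\<close> is negative definite on \<open>kk\<close>.\<close>
  define W where "W = bracket G Y' H"
  have Wkk: "W \<in> kk" unfolding W_def by (rule pp_pp[OF Y'pp aa_pp[OF Ha]])
  have WY1: "bracket G W Y1 = 0"
  proof -
    have "bracket G Y1 W = 0"
      unfolding W_def using Leibniz[of Y1 Y' H] Y'Y1 aa_abelian[OF Y1 Ha] by (simp add: br_simps)
    then show ?thesis using bracket_anti[of W Y1] by simp
  qed
  have "B W W = 0" using var[OF Wkk WY1] B_invariant[of W Y' H] by (simp add: W_def)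
  then have W0: "W = 0" using B_kk[OF Wkk] by force
  then have "bracket G H Y' = 0" using bracket_anti[of H Y'] by (simp add: W_def)
  then have Y'a: "Y' \<in> aa" by (rule reg_centralizer[OF H Y'pp])
  show thesis
  proof (rule that[OF kK kY1 Y'a[unfolded Y'_def]])
    fix h assume h: "h \<in> Wt" "B h Y1 = 0"
    show "B h (Ad G k Y) * B h H \<le> 0"
    proof (cases "h = 0")
      case False
      obtain X where X: "X \<in> ws h" "X \<noteq> 0" "h \<in> aa"
        using h unfolding Wt_def using subspace_0[OF sub_ws] by auto
      \<comment> \<open>\<open>?Z\<close> is a direction in \<open>kk\<close> attached to the root
        \<open>h\<close>. It maps \<open>H'\<close> in \<open>aa\<close> to
        \<open>- (B h H' *\<^sub>R ?D)\<close>, so the second variation along it is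
        \<open>- (B h Y' * B h H * B ?D ?D)\<close>.\<close>
      let ?Z = "X + theta X" and ?D = "X - theta X"
      have tX: "theta X \<in> ws (- h)" by (rule ws_theta[OF X(1)])
      have "pk ?Z = ?Z"
      proof -
        have "theta ?Z = ?Z" by (simp add: theta_add)
        then have "2 *\<^sub>R pk ?Z = 2 *\<^sub>R ?Z" unfolding theta_def by (simp add: algebra_simps scaleR_2)
        then show ?thesis by simp
      qed
      then have Zkk: "?Z \<in> kk" using pk(1)[of ?Z] by simp
      have "pk ?D = 0"
      proof -
        have "theta ?D = - ?D" by (simp add: linear_diff[OF linear_theta])
        then have "2 *\<^sub>R pk ?D = 0" unfolding theta_def by (simp add: algebra_simps scaleR_2)
        then show ?thesis by simp
      qed
      then have Dpp: "?D \<in> pp" using pk(2)[of ?D] by simp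
      have D0: "?D \<noteq> 0"
      proof
        assume "?D = 0"
        then have "X \<in> ws (- h)" using tX by simp
        moreover have "h \<noteq> - h" using False by (simp add: eq_neg_iff_add_eq_0 flip: scaleR_2)
        ultimately have "pr h X = 0" using pr_ws[of X "- h" h] X(3) subspace_neg[OF sub_aa] by simp
        then show False using pr_ws[OF X(1,3), of h] X(2) by simp
      qed
      have br: "bracket G ?Z H' = - (B h H' *\<^sub>R ?D)" if "H' \<in> aa" for H'
        using wsD[OF X(1) that] wsD[OF tX that] bracket_anti[of ?Z H'] by (simp add: br_simps algebra_simps)
      have "bracket G ?Z Y1 = 0" using br[OF Y1] h(2) by simp
      then have "0 \<le> B (bracket G ?Z (bracket G ?Z Y')) H" using var[OF Zkk] by blast
      also have "\<dots> = - B (bracket G (bracket G ?Z Y') ?Z) H"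
        using bracket_anti[of ?Z "bracket G ?Z Y'"] by simp
      also have "\<dots> = - B (bracket G ?Z Y') (bracket G ?Z H)" by (simp only: B_invariant)
      also have "\<dots> = - (B h Y' * B h H * B ?D ?D)" unfolding br[OF Y'a] br[OF Ha] by (simp add: algebra_simps)
      finally have "B h Y' * B h H * B ?D ?D \<le> 0" by simp
      then show ?thesis using B_pp[OF Dpp D0] unfolding Y'_def by (simp add: mult_le_0_iff)
    qed simp
  qed
qed

text \<open>An element of \<open>aa\<close> pulled back by \<open>k\<close> commutes with the
  regular \<open>Y\<close>, hence lies in \<open>aa\<close> again.\<close>

lemma reg_T:
  assumes Y: "reg Y" and k: "k \<in> K" "Ad G k Y \<in> aa" shows "k \<in> T"
proof -
  have kc: "k \<in> carrier G" by (rule K_carrier[OF k(1)])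
  have ik: "inv k \<in> K" by (rule subgroup.m_inv_closed[OF subK k(1)])
  have "Ad G (inv k) Z \<in> aa" if Z: "Z \<in> aa" for Z
  proof (rule reg_centralizer[OF Y Ad_K_pp[OF ik aa_pp[OF Z]]])
    have "bracket G Y (Ad G (inv k) Z) = Ad G (inv k) (bracket G (Ad G k Y) Z)"
      using Ad_bracket[of "inv k" "Ad G k Y" Z] kc by (simp add: Ad_inv)
    then show "bracket G Y (Ad G (inv k) Z) = 0"
      using aa_abelian[OF k(2) Z] kc by (simp add: linear_0[OF linear_Ad])
  qed
  then have "inv k \<in> T" using ik unfolding T_iff by blast
  then have "inv (inv k) \<in> T" by (rule T_inv)
  then show ?thesis using kc by simp
qed

lemma reg_Ad_T: "t \<in> T \<Longrightarrow> reg Y \<Longrightarrow> reg (Ad G t Y)"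
  unfolding reg_def
proof (intro conjI ballI impI)
  assume t: "t \<in> T" and Y: "Y \<in> aa \<and> (\<forall>h\<in>Wt. h \<noteq> 0 \<longrightarrow> B h Y \<noteq> 0)"
  have tc: "t \<in> carrier G" by (rule T_carrier[OF t])
  show "Ad G t Y \<in> aa" using T_aa[OF t] Y by blast
  fix h assume h: "h \<in> Wt" "h \<noteq> 0"
  have "Ad G (inv t) h \<in> Wt" by (rule Ad_T_Wt[OF T_inv[OF t] h(1)])
  moreover have "Ad G (inv t) h \<noteq> 0"
    using h(2) Ad_inv(2)[OF tc, of h] linear_0[OF linear_Ad[OF tc]] by metis
  ultimately have "B (Ad G (inv t) h) Y \<noteq> 0" using Y by blast
  then show "B h (Ad G t Y) \<noteq> 0" using B_Ad[OF tc, of "Ad G (inv t) h" Y] Ad_inv[OF tc] by simp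
qed

end

context parab_group
begin

lemma reg_H0: "reg H0" using H0 regular by (auto simp: reg_def)

section \<open>Positive roots and the chamber of H0\<close>

abbreviation pos_roots where "pos_roots \<equiv> Wt \<inter> pos"

lemma Wt_cases: "h \<in> Wt \<Longrightarrow> h = 0 \<or> h \<in> pos_roots \<or> - h \<in> pos_roots"
  using regular[of h] Wt_uminus[of h]
  by (cases "h = 0"; cases "B h H0" "0 :: real" rule: linorder_cases) simp_all

lemma B_Ad_inv: "t \<in> carrier G \<Longrightarrow> B (Ad G t h) Y = B h (Ad G (inv t) Y)"
  using B_Ad[of t h "Ad G (inv t) Y"] by (simp add: Ad_inv)

text \<open>Minimising over all of \<open>K\<close>, that is with \<open>Y1 = 0\<close>, moves
  \<open>H0\<close> into the chamber opposite to its own.\<close>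

lemma exists_opposition: obtains t where "t \<in> T" "\<And>h. h \<in> pos_roots \<Longrightarrow> - Ad G t h \<in> pos_roots"
proof -
  obtain k where k: "k \<in> K" "Ad G k H0 \<in> aa" "\<And>h. h \<in> Wt \<Longrightarrow> B h (Ad G k H0) * B h H0 \<le> 0"
    using minimal_orbit_point[OF subspace_0[OF sub_aa] H0 reg_H0] by (metis B_simps(10))
  have kT: "k \<in> T" by (rule reg_T[OF reg_H0 k(1,2)])
  have kc: "k \<in> carrier G" by (rule T_carrier[OF kT])
  show thesis
  proof (rule that[OF T_inv[OF kT]])
    fix h assume h: "h \<in> pos_roots"
    have "B h (Ad G k H0) \<noteq> 0" using reg_Ad_T[OF kT reg_H0] h by (auto simp: reg_def)
    then have "B h (Ad G k H0) < 0" using k(3)[of h] h by (auto simp: mult_le_0_iff)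
    then have "B (Ad G (inv k) h) H0 < 0" using B_Ad_inv[of "inv k" h H0] kc by simp
    then show "- Ad G (inv k) h \<in> pos_roots"
      using Ad_T_Wt[OF T_inv[OF kT]] Wt_uminus h by auto
  qed
qed

text \<open>Encodes the usual order on weights: one weight is above another when their difference
  lies here.\<close>

definition cone where "cone = {sum_list l | l. set l \<subseteq> pos_roots}"

lemma cone_add: "x \<in> cone \<Longrightarrow> k \<in> pos_roots \<Longrightarrow> k + x \<in> cone"
proof -
  assume "x \<in> cone" "k \<in> pos_roots"
  then obtain l where "set l \<subseteq> pos_roots" "x = sum_list l" by (auto simp: cone_def)
  then have "k + x = sum_list (k # l)" "set (k # l) \<subseteq> pos_roots" using \<open>k \<in> pos_roots\<close> by auto
  then show ?thesis unfolding cone_def by blast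
qed

lemma cone_0: "0 \<in> cone" unfolding cone_def by (intro CollectI exI[of _ "[]"]) simp

lemma cone_pos: "x \<in> cone \<Longrightarrow> x = 0 \<or> 0 < B x H0"
proof -
  assume "x \<in> cone"
  then obtain l where l: "set l \<subseteq> pos_roots" "x = sum_list l" by (auto simp: cone_def)
  have "l = [] \<or> 0 < B (sum_list l) H0" using l(1)
  proof (induction l)
    case (Cons a l)
    then have "0 < B a H0" "l = [] \<or> 0 < B (sum_list l) H0" by auto
    then show ?case by auto
  qed simp
  then show ?thesis using l by auto
qed

lemma cone_Ad:
  assumes t: "t \<in> T" "\<And>h. h \<in> pos_roots \<Longrightarrow> Ad G t h \<in> pos_roots" and x: "x \<in> cone"
  shows "Ad G t x \<in> cone"
proof -
  obtain l where l: "set l \<subseteq> pos_roots" "x = sum_list l" using x by (auto simp: cone_def)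
  have lin: "linear (Ad G t)" by (rule linear_Ad[OF T_carrier[OF t(1)]])
  have "Ad G t (sum_list l) = sum_list (map (Ad G t) l)"
    by (induction l) (simp_all add: linear_0[OF lin] linear_add[OF lin])
  moreover have "set (map (Ad G t) l) \<subseteq> pos_roots" using l t(2) by auto
  ultimately show ?thesis using l unfolding cone_def by blast
qed

text \<open>An element of \<open>T\<close> cannot move a set \<open>S\<close> of weights that is closed under adding positive roots
  to another such set \<open>S'\<close>: the function \<open>F\<close> below, a polynomial in the entries of \<open>Ad g\<close>, vanishes
  for \<open>g\<close> near \<open>1\<close> because \<open>g = n\<^sup>- q\<close> with \<open>Ad q\<close> preserving \<open>S\<close> and \<open>Ad n\<^sup>-\<close> the complement of \<open>S'\<close>;
  hence it vanishes on the connected group \<open>G\<close>, whereas \<open>F t \<noteq> 0\<close>.\<close>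

lemma upper_image_subset:
  assumes t: "t \<in> T" and S: "upper S" and S': "upper (Ad G t ` S)" and h: "h \<in> Wt" "h \<in> S"
  shows "h \<in> Ad G t ` S"
proof (rule ccontr)
  assume nh: "h \<notin> Ad G t ` S"
  let ?S' = "Ad G t ` S"
  have tc: "t \<in> carrier G" by (rule T_carrier[OF t])
  define Pi where "Pi U = mkE (prs U)" for U
  have Pi: "ap (Pi U) X = prs U X" for U X by (simp add: Pi_def ap_mkE linear_prs)
  \<comment> \<open>The block of \<open>Ad g\<close> from \<open>S\<close> to \<open>?S'\<close>,
    completed on the complements by the block of \<open>Ad t\<close>. For \<open>g = t\<close> this
    is \<open>Ad t\<close> itself, which is invertible.\<close>
  define M where "M g = Pi ?S' * AdE g * Pi S + Pi (- ?S') * AdE t * Pi (- S)" for g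
  define F where "F g = det (matE (M g))" for g
  have line: "entire_real (\<lambda>s. F (g \<otimes> expG (s *\<^sub>R X)))" if g: "g \<in> carrier G" for g X
    unfolding F_def
  proof (rule entire_real_det)
    fix b c :: 'e
    define L where "L u = ap (Pi ?S' * AdE g) u \<bullet> c" for u
    have linL: "linear L" unfolding L_def by (rule linearI) (simp_all only: ap_arg_simps inner_add_left inner_scaleR_left real_scaleR_def)
    define w where "w = (\<Sum>b\<in>Basis. L b *\<^sub>R b)"
    have Lw: "L u = u \<bullet> w" for u
    proof -
      have "L u = L (\<Sum>b\<in>Basis. (u \<bullet> b) *\<^sub>R b)" by (simp add: euclidean_representation)
      also have "\<dots> = (\<Sum>b\<in>Basis. (u \<bullet> b) * L b)" by (simp add: linear_sum[OF linL] linear_scale[OF linL])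
      also have "\<dots> = u \<bullet> w" by (simp add: w_def inner_sum_right mult.commute)
      finally show ?thesis .
    qed
    have "ap (M (g \<otimes> expG (s *\<^sub>R X))) b \<bullet> c
       = ap (exp (s *\<^sub>R adE X)) (ap (Pi S) b) \<bullet> w + ap (Pi (- ?S') * AdE t * Pi (- S)) b \<bullet> c" for s
    proof -
      have "AdE (g \<otimes> expG (s *\<^sub>R X)) = AdE g * exp (s *\<^sub>R adE X)"
        using g by (simp add: AdE_mult AdE_exp linear_scale[OF linear_adE])
      then have "ap (M (g \<otimes> expG (s *\<^sub>R X))) b
         = ap (Pi ?S' * AdE g) (ap (exp (s *\<^sub>R adE X)) (ap (Pi S) b)) + ap (Pi (- ?S') * AdE t * Pi (- S)) b"
        by (simp add: M_def)
      then show ?thesis using Lw[of "ap (exp (s *\<^sub>R adE X)) (ap (Pi S) b)"] by (simp only: inner_add_left L_def)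
    qed
    then show "entire_real (\<lambda>s. ap (M (g \<otimes> expG (s *\<^sub>R X))) b \<bullet> c)"
      by (simp only:) (intro entire_real_add entire_real_exp_entry entire_real_const)
  qed
  \<comment> \<open>Vanishing near \<open>g\<close> propagates along one-parameter subgroups
    translated by \<open>g\<close>, by the identity theorem.\<close>
  have cont: "F (g \<otimes> expG X) = 0" if g: "g \<in> carrier G" and W: "openin gT W" "g \<in> W" "\<And>g'. g' \<in> W \<Longrightarrow> F g' = 0" for g W X
  proof -
    let ?W = "{x \<in> carrier G. g \<otimes> x \<in> W}"
    have Wo: "openin gT ?W" "\<one> \<in> ?W"
      using g W by (auto intro!: openin_preimage continuous_left_translation)
    have "continuous_map euclideanreal gT (\<lambda>t. expG (t *\<^sub>R X))"
      using one_parameter_exp[of X] by (simp add: one_parameter_subgroup_def)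
    from real_hom_continuous_at_0[OF this Wo(1)] Wo(2)
    obtain d where d: "d > 0" "\<And>s. \<bar>s\<bar> < d \<Longrightarrow> expG (s *\<^sub>R X) \<in> ?W" by auto
    have "F (g \<otimes> expG (1 *\<^sub>R X)) = 0"
      by (rule entire_real_identity[OF line[OF g] d(1)]) (use d(2) W(3) in blast)
    then show ?thesis by simp
  qed
  have near1: "\<exists>W. openin gT W \<and> \<one> \<in> W \<and> (\<forall>g\<in>W. F g = 0)"
  proof -
    have lin: "linear (prs neg)" "linear (prs (- neg))" by (rule linear_prs)+
    obtain V where V: "openin gT V" "\<one> \<in> V"
      "\<And>g. g \<in> V \<Longrightarrow> \<exists>Z. norm Z < 1 \<and> g = expG (prs neg Z) \<otimes> expG (prs (- neg) Z)"
      using two_factor[OF lin prs_compl, of 1] by (metis zero_less_one)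
    have "F g = 0" if g: "g \<in> V" for g
    proof -
      obtain Z where Z: "g = expG (prs neg Z) \<otimes> expG (prs (- neg) Z)" using V(3)[OF g] by blast
      define Q where "Q = prs (- neg) Z"
      have Q: "- Q \<in> gr nonneg"
        using subspace_neg[OF sub_gr prs_gr[of "- neg" Z]] gr_mono[of "- neg" nonneg] by (auto simp: Q_def)
      obtain X where X: "X \<in> ws h" "X \<noteq> 0" "h \<in> aa"
        using h unfolding Wt_def using subspace_0[OF sub_ws] by auto
      \<comment> \<open>Chosen so that \<open>Ad g v\<close> is \<open>X\<close> moved by the
        negative factor alone. Then \<open>v\<close> lies in \<open>gr S\<close> and its image has
        no component in \<open>?S'\<close>, so \<open>v\<close> is in the kernel of
        \<open>M g\<close>.\<close>
      define v where "v = Ad G (expG (- Q)) X"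
      have "ap (exp (adE (- Q))) X \<in> gr S"
        using regular by (intro exp_upper[OF S Q] ws_gr[OF X(1) h(2) X(3)]) force
      then have vS: "v \<in> gr S" by (simp add: v_def flip: AdE_exp)
      have v0: "v \<noteq> 0"
        using X(2) Ad_inv(2)[of "expG (- Q)" X] Ad_inv(1)[of "expG (- Q)" X] linear_0[OF linear_Ad[of "inv (expG (- Q))"]]
        unfolding v_def by (metis exp_closed inv_closed)
      have gv: "Ad G g v = Ad G (expG (prs neg Z)) X"
        using Ad_inv(2)[of "expG Q" X] by (simp add: Z v_def Ad_mult expG_minus Q_def)
      have "ap (exp (adE (prs neg Z))) X \<in> gr (- ?S')"
      proof (rule ap_exp_subspace[OF sub_gr])
        show "X \<in> gr (- ?S')" by (rule ws_gr[OF X(1) _ X(3)]) (use nh in simp)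
        fix Y assume Y: "Y \<in> gr (- ?S')"
        then have "Y \<in> gr (- ?S' \<inter> Wt)" by (auto simp: gr_def)
        moreover have "prs neg Z \<in> gr (neg \<inter> Wt)" using prs_gr[of neg Z] by (auto simp: gr_def)
        ultimately have "bracket G (prs neg Z) Y \<in> gr (- ?S')"
        proof (intro gr_bracket[of _ "neg \<inter> Wt" _ "- ?S' \<inter> Wt"])
          fix k l assume kl: "k \<in> neg \<inter> Wt" "l \<in> - ?S' \<inter> Wt" "k + l \<in> Wt"
          show "k + l \<in> - ?S'"
          proof
            assume "k + l \<in> ?S'"
            moreover have "- k \<in> pos \<inter> Wt" "- k + (k + l) \<in> Wt" using kl Wt_uminus by auto
            ultimately have "- k + (k + l) \<in> ?S'" using S' unfolding upper_def by blast
            then show False using kl by simp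
          qed
        qed
        then show "ap (adE (prs neg Z)) Y \<in> gr (- ?S')" by simp
      qed
      then have gv': "Ad G g v \<in> gr (- ?S')" by (simp add: gv flip: AdE_exp)
      have gc: "g \<in> carrier G" using Z by simp
      have "v \<in> gr (- (- S))" using vS by simp
      then have "ap (M g) v = 0"
        using vS gv' gc by (simp add: M_def Pi prs_id prs_0 linear_0[OF linear_prs] linear_0[OF linear_Ad[OF tc]] tc)
      then show "F g = 0" unfolding F_def det_matE_eq_0_iff using v0 by blast
    qed
    then show ?thesis using V by blast
  qed
  obtain V where V: "openin gT V" "\<one> \<in> V" "\<And>g. g \<in> V \<Longrightarrow> \<exists>Z. norm Z < 1 \<and> g = expG Z"
    using log_nbhd[OF zero_less_one] by metis
  \<comment> \<open>Local vanishing is carried from \<open>g\<close> to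
    \<open>g \<otimes> v\<close>, because every point of the translate of \<open>V\<close> by
    \<open>g\<close> has the form \<open>g \<otimes> expG Z\<close>.\<close>
  have "\<exists>W. openin gT W \<and> t \<in> W \<and> (\<forall>g\<in>W. F g = 0)"
  proof (rule conn_induct[where P = "\<lambda>g. \<exists>W. openin gT W \<and> g \<in> W \<and> (\<forall>g\<in>W. F g = 0)",
        OF V(1,2) near1 _ tc])
    fix g v assume g: "g \<in> carrier G" "\<exists>W. openin gT W \<and> g \<in> W \<and> (\<forall>g\<in>W. F g = 0)" and v: "v \<in> V"
    have vc: "v \<in> carrier G" using v V(1) nbhd_carrier by blast
    let ?W = "{x \<in> carrier G. inv g \<otimes> x \<in> V}"
    have "openin gT ?W" using g by (intro openin_preimage continuous_left_translation V(1)) simp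
    moreover have "g \<otimes> v \<in> ?W" using g v vc by (simp add: inv_mult_cancel)
    moreover have "F x = 0" if x: "x \<in> ?W" for x
    proof -
      obtain Z where Z: "inv g \<otimes> x = expG Z" using V(3) x by blast
      have "F (g \<otimes> expG Z) = 0" using g cont by blast
      then show ?thesis using Z x g by (metis (no_types, lifting) inv_mult_cancel(2) mem_Collect_eq)
    qed
    ultimately show "\<exists>W. openin gT W \<and> g \<otimes> v \<in> W \<and> (\<forall>g\<in>W. F g = 0)" by blast
  qed
  then have "F t = 0" by blast
  then obtain v where v: "v \<noteq> 0" "ap (M t) v = 0" unfolding F_def det_matE_eq_0_iff by blast
  have "Ad G t (prs S v) \<in> gr ?S'" by (rule Ad_T_gr[OF t prs_gr])
  then have 1: "prs ?S' (Ad G t (prs S v)) = Ad G t (prs S v)" by (rule prs_id)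
  have "Ad G t (prs (- S) v) \<in> gr (Ad G t ` (- S))" by (rule Ad_T_gr[OF t prs_gr])
  moreover have "Ad G t ` (- S) \<subseteq> - ?S'"
    by (rule inj_image_Compl_subset, rule inj_on_inverseI, rule Ad_inv(1)[OF tc])
  ultimately have "Ad G t (prs (- S) v) \<in> gr (- ?S')" using gr_mono[of "Ad G t ` (- S)" "- ?S'"] by blast
  then have 2: "prs (- ?S') (Ad G t (prs (- S) v)) = Ad G t (prs (- S) v)" by (rule prs_id)
  have "Ad G t v = Ad G t (prs S v) + Ad G t (prs (- S) v)"
    by (simp only: linear_add[OF linear_Ad[OF tc], symmetric] prs_compl)
  also have "\<dots> = ap (M t) v" by (simp add: M_def Pi tc 1 2)
  finally have "Ad G t v = 0" using v(2) by simp
  then show False using v(1) Ad_inv(1)[OF tc, of v] linear_0[OF linear_Ad[OF inv_closed[OF tc]]] by simp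
qed

text \<open>The weights above a positive root \<open>b\<close> form a set that is
  \<open>upper\<close>, and so do their images, as \<open>t\<close> permutes the positive roots. By
  \<open>upper_image_subset\<close> this set is preserved, so \<open>b\<close> and
  \<open>Ad t b\<close> lie above each other.\<close>

lemma chamber_stabilizer_trivial:
  assumes t: "t \<in> T" and pos: "\<And>h. h \<in> pos_roots \<Longrightarrow> Ad G t h \<in> pos_roots" and H: "H \<in> aa"
  shows "Ad G t H = H"
proof -
  have tc: "t \<in> carrier G" by (rule T_carrier[OF t])
  have lin: "linear (Ad G t)" by (rule linear_Ad[OF tc])
  have inj: "inj_on (Ad G t) X" for X using Ad_inv(1)[OF tc] by (metis inj_on_inverseI)
  have fR: "finite pos_roots" using finite_Wt by simp
  have sur: "Ad G t ` pos_roots = pos_roots"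
    by (rule endo_inj_surj[OF fR _ inj]) (use pos in blast)
  have fx: "Ad G t b = b" if b: "b \<in> pos_roots" for b
  proof -
    define S where "S = {h \<in> Wt. h - b \<in> cone}"
    have up: "upper S"
      unfolding upper_def
    proof (intro ballI impI)
      fix h k assume "h \<in> S" "k \<in> pos \<inter> Wt" "k + h \<in> Wt"
      then show "k + h \<in> S" using cone_add[of "h - b" k] by (simp add: S_def algebra_simps)
    qed
    have up': "upper (Ad G t ` S)"
      unfolding upper_def
    proof (intro ballI impI)
      fix h' k' assume h': "h' \<in> Ad G t ` S" and k': "k' \<in> pos \<inter> Wt" and s: "k' + h' \<in> Wt"
      obtain h where h: "h \<in> S" "h' = Ad G t h" using h' by blast
      obtain k where k: "k \<in> pos_roots" "k' = Ad G t k" using k' sur by blast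
      have e: "k' + h' = Ad G t (k + h)" using h k by (simp add: linear_add[OF lin])
      have "k + h \<in> Wt" using Ad_T_Wt[OF T_inv[OF t] s] Ad_inv(1)[OF tc] by (simp add: e)
      then have "k + h \<in> S" using up h k unfolding upper_def by blast
      then show "k' + h' \<in> Ad G t ` S" using e by blast
    qed
    have SS: "S \<subseteq> Ad G t ` S" using upper_image_subset[OF t up up'] by (auto simp: S_def)
    have fS: "finite S" using finite_Wt by (simp add: S_def)
    have "S = Ad G t ` S"
      by (rule card_subset_eq[OF _ SS]) (simp_all add: fS card_image inj)
    moreover have bS: "b \<in> S" using b cone_0 by (simp add: S_def)
    ultimately have "Ad G t b \<in> S" "b \<in> Ad G t ` S" by blast+
    then obtain h where h: "h \<in> S" "b = Ad G t h" by blast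
    have c1: "Ad G t b - b \<in> cone" using \<open>Ad G t b \<in> S\<close> by (simp add: S_def)
    have "Ad G t (h - b) \<in> cone" by (rule cone_Ad[OF t pos]) (use h in \<open>simp_all add: S_def\<close>)
    then have c2: "b - Ad G t b \<in> cone" using h(2) by (simp add: linear_diff[OF lin])
    show ?thesis using cone_pos[OF c1] cone_pos[OF c2] by auto
  qed
  have "Ad G t H - H = 0"
  proof (rule weights_span)
    show "Ad G t H - H \<in> aa" using T_aa[OF t H] H subspace_diff[OF sub_aa] by blast
    fix h assume h: "h \<in> Wt"
    have "Ad G t h = h"
      using Wt_cases[OF h] fx[of h] fx[of "- h"] by (auto simp: linear_0[OF lin] linear_neg[OF lin])
    then have "B h (Ad G t H) = B h H" using B_Ad[OF tc, of h H] by simp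
    then show "B h (Ad G t H - H) = 0" by simp
  qed
  then show ?thesis by simp
qed

end

section \<open>Simple reflections and the longest element\<close>

context flat_group
begin

lemma B_aa_pos: "H \<in> aa \<Longrightarrow> H \<noteq> 0 \<Longrightarrow> 0 < B H H" using B_pp[OF aa_pp] by blast

lemma B_sum: "B (\<Sum>i\<in>I. f i) Z = (\<Sum>i\<in>I. B (f i) Z)"
proof -
  have "linear (\<lambda>X. B X Z)" by (rule linearI) simp_all
  then show ?thesis by (rule linear_sum)
qed

lemma B_sum_list: "B (sum_list l) Z = sum_list (map (\<lambda>x. B x Z) l)"
  by (induction l) simp_all

text \<open>Only the component of weight 0 pairs with \<open>aa\<close>, and its
  \<open>pp\<close>-part lies in \<open>aa\<close> by maximality.\<close>

lemma riesz_aa: obtains Y where "Y \<in> aa" "\<And>H. H \<in> aa \<Longrightarrow> B Z H = B Y H"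
proof -
  define X where "X = pr 0 Z"
  define Y where "Y = (1/2) *\<^sub>R (X - theta X)"
  have X0: "X \<in> ws 0" unfolding X_def by (rule pr)
  have tX: "theta X \<in> ws 0" using ws_theta[OF X0] by simp
  have "pk (X - theta X) = 0"
  proof -
    have "theta (X - theta X) = - (X - theta X)" by (simp add: linear_diff[OF linear_theta])
    then have "2 *\<^sub>R pk (X - theta X) = 0" unfolding theta_def by (simp add: algebra_simps scaleR_2)
    then show ?thesis by simp
  qed
  then have "X - theta X \<in> pp" using pk(2)[of "X - theta X"] by simp
  then have "Y \<in> pp" unfolding Y_def by (rule subspace_scale[OF sub_pp])
  moreover have "Y \<in> ws 0" unfolding Y_def by (intro subspace_scale[OF sub_ws] subspace_diff[OF sub_ws] X0 tX)
  ultimately have Ya: "Y \<in> aa" by (intro centralizer_in_aa) (auto simp: ws_def)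
  show thesis
  proof (rule that[OF Ya])
    fix H assume H: "H \<in> aa"
    have "B Z H = (\<Sum>h\<in>Wt. B (pr h Z) H)" by (subst pr(2)[of Z]) (rule B_sum)
    also have "\<dots> = (\<Sum>h\<in>Wt. if h = 0 then B X H else 0)"
    proof (rule sum.cong[OF refl])
      fix h assume h: "h \<in> Wt"
      show "B (pr h Z) H = (if h = 0 then B X H else 0)"
      proof (cases "h = 0")
        case False
        have "ip (pr h Z) H = 0"
          by (rule ws_orthogonal[OF pr(1) _ Wt_aa[OF h] subspace_0[OF sub_aa] False]) (use ws_zero H in blast)
        then show ?thesis using B_aa_eq_ip[OF H] False by simp
      qed (simp add: X_def)
    qed
    also have "\<dots> = B X H" using finite_Wt by (cases "0 \<in> Wt") (auto simp: X_def pr_def)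
    also have "\<dots> = B Y H"
      using B_theta[of X H] theta_pp[OF aa_pp[OF H]] by (simp add: Y_def)
    finally show "B Z H = B Y H" .
  qed
qed

lemma riesz_linear:
  assumes g: "linear g" obtains Y where "Y \<in> aa" "\<And>H. H \<in> aa \<Longrightarrow> g H = B Y H"
proof -
  define v where "v = (\<Sum>b\<in>Basis. g b *\<^sub>R b)"
  have gv: "g X = B (BSi v) X" for X
  proof -
    have "g X = g (\<Sum>b\<in>Basis. (X \<bullet> b) *\<^sub>R b)" by (simp add: euclidean_representation)
    also have "\<dots> = (\<Sum>b\<in>Basis. (X \<bullet> b) * g b)" by (simp add: linear_sum[OF g] linear_scale[OF g])
    also have "\<dots> = v \<bullet> X" by (simp add: v_def inner_sum_left mult.commute inner_commute[of X])
    finally show ?thesis by (simp add: B_expand BSi)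
  qed
  obtain Y where "Y \<in> aa" "\<And>H. H \<in> aa \<Longrightarrow> B (BSi v) H = B Y H" by (rule riesz_aa) blast
  then show thesis using that gv by simp
qed

end

context parab_group
begin

section \<open>Simple roots\<close>

definition simple where "simple = {a \<in> pos_roots. \<not> (\<exists>b\<in>pos_roots. \<exists>c\<in>pos_roots. a = b + c)}"

lemma finite_pos_roots: "finite pos_roots" using finite_Wt by simp
lemma finite_simple: "finite simple" by (rule finite_subset[OF _ finite_pos_roots]) (auto simp: simple_def)
lemma simple_pos_roots: "a \<in> simple \<Longrightarrow> a \<in> pos_roots" by (simp add: simple_def)
lemma pos_roots_aa: "h \<in> pos_roots \<Longrightarrow> h \<in> aa" using Wt_aa by auto
lemma pos_roots_nz: "h \<in> pos_roots \<Longrightarrow> h \<noteq> 0" by auto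

text \<open>Induction on the number of positive roots with a smaller value at \<open>H0\<close>:
  both summands of a decomposition have smaller values.\<close>

lemma simple_generate: "h \<in> pos_roots \<Longrightarrow> \<exists>l. set l \<subseteq> simple \<and> l \<noteq> [] \<and> h = sum_list l"
proof (induction "card {k \<in> pos_roots. B k H0 < B h H0}" arbitrary: h rule: less_induct)
  case less
  show ?case
  proof (cases "h \<in> simple")
    case True
    then show ?thesis by (intro exI[of _ "[h]"]) simp
  next
    case False
    then obtain b c where bc: "b \<in> pos_roots" "c \<in> pos_roots" "h = b + c" using less.prems by (auto simp: simple_def)
    have small: "card {k \<in> pos_roots. B k H0 < B x H0} < card {k \<in> pos_roots. B k H0 < B h H0}" if "x \<in> pos_roots" "B x H0 < B h H0" for x
    proof (rule psubset_card_mono)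
      show "finite {k \<in> pos_roots. B k H0 < B h H0}" by (rule finite_subset[OF _ finite_pos_roots]) auto
      show "{k \<in> pos_roots. B k H0 < B x H0} \<subset> {k \<in> pos_roots. B k H0 < B h H0}" using that by auto
    qed
    have "B b H0 < B h H0" "B c H0 < B h H0" using bc by auto
    then obtain l l' where "set l \<subseteq> simple" "l \<noteq> []" "b = sum_list l" "set l' \<subseteq> simple" "c = sum_list l'"
      using less.hyps[OF small bc(1)] less.hyps[OF small bc(2)] bc by metis
    then show ?thesis using bc by (intro exI[of _ "l @ l'"]) auto
  qed
qed

text \<open>Otherwise \<open>a - b\<close> or its negative would be a positive root, by
  \<open>root_difference\<close>, and one of the two simple roots would decompose.\<close>

lemma simple_obtuse:
  assumes "a \<in> simple" "b \<in> simple" "a \<noteq> b" shows "B a b \<le> 0"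
proof (rule ccontr)
  assume "\<not> B a b \<le> 0"
  then have "a - b \<in> Wt" using assms simple_pos_roots pos_roots_nz by (intro root_difference) auto
  then consider "a - b \<in> pos_roots" | "b - a \<in> pos_roots" using Wt_cases[of "a - b"] assms(3) by auto
  then show False
  proof cases
    case 1
    moreover have "a = (a - b) + b" by simp
    ultimately show False using assms(1,2) unfolding simple_def by blast
  next
    case 2
    moreover have "b = (b - a) + a" by simp
    ultimately show False using assms(1,2) unfolding simple_def by blast
  qed
qed

text \<open>A linear relation splits into \<open>x = y\<close> with nonnegative coefficients
  \<open>p\<close> and \<open>m\<close> that are never both nonzero. Obtuse angles give
  \<open>B x x \<le> 0\<close>, so \<open>x = 0\<close>, and pairing with \<open>H0\<close> makes
  all coefficients vanish.\<close>

lemma simple_independent: "independent simple"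
proof (rule ccontr)
  assume "\<not> independent simple"
  then obtain u v where u: "v \<in> simple" "u v \<noteq> 0" "(\<Sum>a\<in>simple. u a *\<^sub>R a) = 0"
    using dependent_finite[OF finite_simple] by blast
  define p where "p a = max (u a) 0" for a
  define m where "m a = max (- u a) 0" for a
  define x where "x = (\<Sum>a\<in>simple. p a *\<^sub>R a)"
  define y where "y = (\<Sum>a\<in>simple. m a *\<^sub>R a)"
  have pm: "0 \<le> p a" "0 \<le> m a" "u a = p a - m a" "p a * m a = 0" for a
    by (auto simp: p_def m_def max_def)
  have xy: "x = y"
    using u(3) unfolding x_def y_def by (simp add: pm(3) scaleR_diff_left sum_subtractf)
  have "B x x = (\<Sum>a\<in>simple. p a * B a y)" by (subst (2) xy) (simp add: x_def B_sum)
  also have "\<dots> = (\<Sum>a\<in>simple. \<Sum>b\<in>simple. p a * m b * B a b)"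
    unfolding y_def by (simp add: B_sym[of _ "sum _ _"] B_sum sum_distrib_left mult.assoc)
      (simp add: B_sym)
  also have "\<dots> \<le> 0"
  proof (intro sum_nonpos)
    fix a b assume ab: "a \<in> simple" "b \<in> simple"
    show "p a * m b * B a b \<le> 0"
    proof (cases "a = b")
      case False
      then show ?thesis using simple_obtuse[OF ab] pm by (simp add: mult_nonneg_nonpos)
    next
      case True
      then show ?thesis using pm(4)[of b] by (metis mult_zero_left order_refl)
    qed
  qed
  finally have xx: "B x x \<le> 0" .
  have xa: "x \<in> aa" unfolding x_def
    by (intro subspace_sum[OF sub_aa] subspace_scale[OF sub_aa] pos_roots_aa simple_pos_roots)
  have x0: "x = 0" using B_aa_pos[OF xa] xx by force
  have z: "c a = 0" if "\<And>a. 0 \<le> c a" "(\<Sum>a\<in>simple. c a *\<^sub>R a) = 0" "a \<in> simple" for c a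
  proof -
    have "B (\<Sum>a\<in>simple. c a *\<^sub>R a) H0 = 0" using that(2) by simp
    then have s: "(\<Sum>a\<in>simple. c a * B a H0) = 0" by (simp add: B_sum)
    have "\<And>a. a \<in> simple \<Longrightarrow> 0 \<le> c a * B a H0" using that(1) simple_pos_roots by fastforce
    then have "c a * B a H0 = 0" using s sum_nonneg_eq_0_iff[OF finite_simple, of "\<lambda>a. c a * B a H0"] that(3) by blast
    then show ?thesis using simple_pos_roots[OF that(3)] by auto
  qed
  have "p v = 0" by (rule z[OF pm(1) _ u(1)]) (use x0 x_def in simp)
  moreover have "m v = 0" by (rule z[OF pm(2) _ u(1)]) (use x0 xy y_def in simp)
  ultimately show False using u(2) pm(3)[of v] by simp
qed

section \<open>Points on a wall and simple reflections\<close>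

definition wall_point where "wall_point a Y \<longleftrightarrow> Y \<in> aa \<and> B a Y = 0 \<and> (\<forall>b\<in>simple - {a}. 0 < B b Y)"

lemma exists_wall_point: assumes a: "a \<in> simple" obtains Y where "wall_point a Y"
proof -
  obtain g where g: "linear g" "\<And>x. x \<in> simple \<Longrightarrow> g x = (if x = a then 0 else 1 :: real)"
    using linear_independent_extend[OF simple_independent, of "\<lambda>x. if x = a then 0 else 1 :: real"] by auto
  obtain Y where Y: "Y \<in> aa" "\<And>H. H \<in> aa \<Longrightarrow> g H = B Y H" using riesz_linear[OF g(1)] by blast
  have e: "B b Y = (if b = a then 0 else 1)" if "b \<in> simple" for b
    using g(2)[OF that] Y(2)[OF pos_roots_aa[OF simple_pos_roots[OF that]]] B_sym[of b Y] by simp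
  show thesis by (rule that[of Y]) (use Y(1) e a in \<open>auto simp: wall_point_def\<close>)
qed

text \<open>Restricted root systems may fail to be reduced: \<open>2 a\<close> can be a root along
  with \<open>a\<close>.\<close>

definition multiple where "multiple a h \<longleftrightarrow> (\<exists>n>0. h = real n *\<^sub>R a)"

lemma wall_point_pos_roots:
  assumes a: "a \<in> simple" and Y: "wall_point a Y" and h: "h \<in> pos_roots"
  shows "0 \<le> B h Y" "B h Y = 0 \<longleftrightarrow> multiple a h"
proof -
  obtain l where l: "set l \<subseteq> simple" "l \<noteq> []" "h = sum_list l" using simple_generate[OF h] by blast
  have n: "0 \<le> B b Y \<and> (B b Y = 0 \<longleftrightarrow> b = a)" if "b \<in> set l" for b
  proof (cases "b = a")
    case True
    then show ?thesis using Y by (simp add: wall_point_def)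
  next
    case False
    then have "0 < B b Y" using l(1) that Y unfolding wall_point_def by blast
    then show ?thesis using False by simp
  qed
  show "0 \<le> B h Y" unfolding l(3) B_sum_list by (rule sum_list_nonneg) (use n in auto)
  show "B h Y = 0 \<longleftrightarrow> multiple a h"
  proof
    assume "B h Y = 0"
    then have "\<forall>b\<in>set l. B b Y = 0"
      unfolding l(3) B_sum_list using sum_list_nonneg_eq_0_iff[of "map (\<lambda>x. B x Y) l"] n by auto
    then have "\<forall>b\<in>set l. b = a" using n by blast
    then have "l = replicate (length l) a" by (simp add: replicate_length_same)
    moreover have "sum_list (replicate n a) = real n *\<^sub>R a" for n
      by (induction n) (simp_all add: scaleR_left_distrib)
    ultimately have "h = real (length l) *\<^sub>R a" using l(3) by metis
    then show "multiple a h" using l(2) by (auto simp: multiple_def)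
  next
    assume "multiple a h"
    then show "B h Y = 0" using Y by (auto simp: multiple_def wall_point_def)
  qed
qed

text \<open>This is \<open>minimal_orbit_point\<close> on the centralizer of a wall point. Positive
  roots that are not multiples of \<open>a\<close> are positive on \<open>Y\<close>, and
  \<open>t\<close> preserves that value, while the sign condition reverses \<open>a\<close>.\<close>

lemma flip:
  assumes a: "a \<in> simple" and Y: "wall_point a Y"
  obtains t where "t \<in> T" "Ad G t Y = Y" "Ad G t a = - a"
    "\<And>h. h \<in> pos_roots \<Longrightarrow> \<not> multiple a h \<Longrightarrow> Ad G t h \<in> pos_roots \<and> \<not> multiple a (Ad G t h)"
proof -
  have Ya: "Y \<in> aa" using Y by (simp add: wall_point_def)
  obtain k where k: "k \<in> K" "Ad G k Y = Y" "Ad G k H0 \<in> aa"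
    "\<And>h. h \<in> Wt \<Longrightarrow> B h Y = 0 \<Longrightarrow> B h (Ad G k H0) * B h H0 \<le> 0"
    using minimal_orbit_point[OF Ya H0 reg_H0] by metis
  have kT: "k \<in> T" by (rule reg_T[OF reg_H0 k(1,3)])
  have kc: "k \<in> carrier G" by (rule T_carrier[OF kT])
  define t where "t = inv k"
  have tT: "t \<in> T" unfolding t_def by (rule T_inv[OF kT])
  have tc: "t \<in> carrier G" by (rule T_carrier[OF tT])
  have lin: "linear (Ad G t)" by (rule linear_Ad[OF tc])
  have tY: "Ad G t Y = Y" using Ad_inv(1)[OF kc, of Y] by (simp add: t_def k(2))
  have BtY: "B (Ad G t h) Y = B h Y" for h using B_Ad[OF tc, of h Y] by (simp add: tY)
  have aR: "a \<in> pos_roots" "a \<noteq> 0" using simple_pos_roots[OF a] by auto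
  have "B a (Ad G k H0) \<noteq> 0" using reg_Ad_T[OF kT reg_H0] aR by (auto simp: reg_def)
  moreover have "B a Y = 0" using Y by (simp add: wall_point_def)
  ultimately have "B a (Ad G k H0) < 0" using k(4)[of a] aR by (auto simp: mult_le_0_iff)
  then have neg: "B (Ad G t a) H0 < 0" using B_Ad_inv[OF tc, of a H0] kc by (simp add: t_def)
  have taW: "Ad G t a \<in> Wt" using Ad_T_Wt[OF tT] aR by auto
  then have m: "- Ad G t a \<in> pos_roots" using neg Wt_uminus by auto
  have "B (- Ad G t a) Y = 0" using BtY[of a] \<open>B a Y = 0\<close> by simp
  then have "multiple a (- Ad G t a)" using wall_point_pos_roots(2)[OF a Y m] by blast
  then obtain n where n: "n > 0" "- Ad G t a = real n *\<^sub>R a" by (auto simp: multiple_def)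
  \<comment> \<open>So far \<open>- Ad t a\<close> is some positive multiple \<open>n\<close> of
    \<open>a\<close>; invariance of \<open>B\<close> forces \<open>n = 1\<close>.\<close>
  have "B (- Ad G t a) (- Ad G t a) = B a a" using B_Ad[OF tc, of a a] by simp
  then have "real n * real n * B a a = B a a" unfolding n(2) by simp
  moreover have "B a a > 0" using B_aa_pos[OF pos_roots_aa[OF aR(1)] aR(2)] .
  ultimately have "real n * real n = 1" by simp
  then have "n * n = 1" by (metis of_nat_1 of_nat_eq_iff of_nat_mult)
  then have "n = 1" by simp
  then have ta: "Ad G t a = - a" using n(2) by (metis minus_minus of_nat_1 scaleR_one)
  show thesis
  proof (rule that[OF tT tY ta])
    fix h assume h: "h \<in> pos_roots" "\<not> multiple a h"
    then have "0 < B h Y" using wall_point_pos_roots[OF a Y h(1)] by fastforce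
    then have p: "0 < B (Ad G t h) Y" by (simp add: BtY)
    have thW: "Ad G t h \<in> Wt" using Ad_T_Wt[OF tT] h by auto
    have "Ad G t h \<in> pos_roots"
    proof (rule ccontr)
      assume "Ad G t h \<notin> pos_roots"
      then have "Ad G t h = 0 \<or> - Ad G t h \<in> pos_roots" using Wt_cases[OF thW] by blast
      then show False using p wall_point_pos_roots(1)[OF a Y, of "- Ad G t h"] by auto
    qed
    moreover from wall_point_pos_roots(2)[OF a Y this] p have "\<not> multiple a (Ad G t h)" by auto
    ultimately show "Ad G t h \<in> pos_roots \<and> \<not> multiple a (Ad G t h)" by blast
  qed
qed

definition reflect where "reflect a H = H - (2 * B a H / B a a) *\<^sub>R a"

lemma reflect_simps: "reflect a (X + Y) = reflect a X + reflect a Y" "reflect a (c *\<^sub>R X) = c *\<^sub>R reflect a X" "reflect a (- X) = - reflect a X"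
  by (simp_all add: reflect_def add_divide_distrib algebra_simps)

text \<open>Flips at two wall points compose to an element that preserves the positive roots and so
  acts trivially; hence one flip fixes all wall points. These span the hyperplane orthogonal to
  \<open>a\<close>, which leaves only the reflection.\<close>

lemma reflection:
  assumes a: "a \<in> simple"
  obtains t where "t \<in> T" "\<And>H. H \<in> aa \<Longrightarrow> Ad G t H = reflect a H"
    "\<And>h. h \<in> pos_roots \<Longrightarrow> \<not> multiple a h \<Longrightarrow> reflect a h \<in> pos_roots \<and> \<not> multiple a (reflect a h)"
proof -
  obtain Y where Y: "wall_point a Y" using exists_wall_point[OF a] .
  obtain t where t: "t \<in> T" "Ad G t Y = Y" "Ad G t a = - a"
    "\<And>h. h \<in> pos_roots \<Longrightarrow> \<not> multiple a h \<Longrightarrow> Ad G t h \<in> pos_roots \<and> \<not> multiple a (Ad G t h)"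
    using flip[OF a Y] by metis
  have tc: "t \<in> carrier G" by (rule T_carrier[OF t(1)])
  have lin: "linear (Ad G t)" by (rule linear_Ad[OF tc])
  have aR: "a \<in> pos_roots" "a \<noteq> 0" "a \<in> aa" using simple_pos_roots[OF a] pos_roots_aa by auto
  have Baa: "B a a > 0" by (rule B_aa_pos[OF aR(3,2)])
  have wall_point_fix: "Ad G t Y2 = Y2" if Y2: "wall_point a Y2" for Y2
  proof -
    obtain s where s: "s \<in> T" "Ad G s Y2 = Y2" "Ad G s a = - a"
      "\<And>h. h \<in> pos_roots \<Longrightarrow> \<not> multiple a h \<Longrightarrow> Ad G s h \<in> pos_roots \<and> \<not> multiple a (Ad G s h)"
      using flip[OF a Y2] by metis
    have sc: "s \<in> carrier G" by (rule T_carrier[OF s(1)])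
    have lins: "linear (Ad G s)" by (rule linear_Ad[OF sc])
    have Y2a: "Y2 \<in> aa" using Y2 by (simp add: wall_point_def)
    have "Ad G (t \<otimes> s) Y2 = Y2"
    proof (rule chamber_stabilizer_trivial[OF T_mult[OF t(1) s(1)] _ Y2a])
      fix h assume h: "h \<in> pos_roots"
      show "Ad G (t \<otimes> s) h \<in> pos_roots"
      proof (cases "multiple a h")
        case True
        then obtain n where "h = real n *\<^sub>R a" by (auto simp: multiple_def)
        then have "Ad G (t \<otimes> s) h = h"
          using tc sc s(3) t(3) by (simp add: Ad_mult linear_scale[OF lin] linear_scale[OF lins] linear_neg[OF lin])
        then show ?thesis using h by simp
      next
        case False
        then show ?thesis using s(4)[OF h] t(4) tc sc by (simp add: Ad_mult)
      qed
    qed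
    then show ?thesis using tc sc by (simp add: Ad_mult s(2))
  qed
  have ker: "Ad G t Z = Z" if Z: "Z \<in> aa" "B a Z = 0" for Z
  proof -
    \<comment> \<open>The sum dominates each of its terms, so adding \<open>c\<close> times
      \<open>Y\<close> makes all other simple roots positive on the result.\<close>
    define c where "c = 1 + (\<Sum>b\<in>simple - {a}. \<bar>B b Z\<bar> / B b Y)"
    have pos: "0 < B b Y" if "b \<in> simple - {a}" for b using Y that by (auto simp: wall_point_def)
    have gc: "wall_point a (Z + c *\<^sub>R Y)"
      unfolding wall_point_def
    proof (intro conjI ballI)
      show "Z + c *\<^sub>R Y \<in> aa" using Z Y by (auto simp: wall_point_def intro: subspace_add[OF sub_aa] subspace_scale[OF sub_aa])
      show "B a (Z + c *\<^sub>R Y) = 0" using Z Y by (simp add: wall_point_def)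
      fix b assume b: "b \<in> simple - {a}"
      have "\<bar>B b Z\<bar> / B b Y \<le> (\<Sum>b\<in>simple - {a}. \<bar>B b Z\<bar> / B b Y)"
        using finite_simple pos by (intro member_le_sum[OF b]) (auto simp: less_imp_le)
      then have "\<bar>B b Z\<bar> / B b Y < c" by (simp add: c_def)
      then have "\<bar>B b Z\<bar> < c * B b Y" using pos[OF b] by (simp add: pos_divide_less_eq)
      then show "0 < B b (Z + c *\<^sub>R Y)" by simp
    qed
    have "Ad G t (Z + c *\<^sub>R Y) = Z + c *\<^sub>R Y" by (rule wall_point_fix[OF gc])
    then show ?thesis by (simp add: linear_add[OF lin] linear_scale[OF lin] t(2))
  qed
  have refl: "Ad G t H = reflect a H" if H: "H \<in> aa" for H
  proof -
    let ?c = "B a H / B a a"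
    have "Ad G t (H - ?c *\<^sub>R a) = H - ?c *\<^sub>R a"
      by (rule ker) (use H aR Baa in \<open>auto intro: subspace_diff[OF sub_aa] subspace_scale[OF sub_aa]\<close>)
    then have "Ad G t H = H - ?c *\<^sub>R a - ?c *\<^sub>R a"
      by (simp add: linear_diff[OF lin] linear_scale[OF lin] t(3) algebra_simps)
    moreover have "?c *\<^sub>R a + ?c *\<^sub>R a = (2 * B a H / B a a) *\<^sub>R a" by (simp flip: scaleR_left_distrib)
    ultimately show ?thesis by (simp add: reflect_def algebra_simps)
  qed
  show thesis
  proof (rule that[OF t(1) refl])
    fix h assume h: "h \<in> pos_roots" "\<not> multiple a h"
    show "reflect a h \<in> pos_roots \<and> \<not> multiple a (reflect a h)" using t(4)[OF h] unfolding refl[OF pos_roots_aa[OF h(1)]] .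
  qed
qed

lemma reflect_self: "a \<in> simple \<Longrightarrow> reflect a a = - a"
  using B_aa_pos[OF pos_roots_aa[OF simple_pos_roots], of a] pos_roots_nz[OF simple_pos_roots] by (simp add: reflect_def scaleR_2)

lemma reflect_reflect: "a \<in> simple \<Longrightarrow> reflect a (reflect a H) = H"
proof -
  assume a: "a \<in> simple"
  have "reflect a (reflect a H) = reflect a H - (2 * B a H / B a a) *\<^sub>R reflect a a"
    by (simp add: reflect_def[of a H] reflect_simps diff_conv_add_uminus del: add_uminus_conv_diff)
  then show ?thesis by (simp add: reflect_self[OF a]) (simp add: reflect_def)
qed

lemma not_pos_roots_neg: "h \<in> pos_roots \<Longrightarrow> - h \<notin> pos_roots" by auto

text \<open>The inversions are counted among the indivisible roots because a root and its double are flipped by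
  the same simple reflection.\<close>

definition indivisible where "indivisible = {h \<in> pos_roots. \<forall>c. 0 < c \<and> c < 1 \<longrightarrow> c *\<^sub>R h \<notin> pos_roots}"

lemma finite_indivisible: "finite indivisible" by (rule finite_subset[OF _ finite_pos_roots]) (auto simp: indivisible_def)

lemma simple_indivisible: "a \<in> simple \<Longrightarrow> a \<in> indivisible"
proof -
  assume a: "a \<in> simple"
  obtain Y where Y: "wall_point a Y" using exists_wall_point[OF a] .
  have "c *\<^sub>R a \<notin> pos_roots" if c: "0 < c" "c < 1" for c
  proof
    assume ca: "c *\<^sub>R a \<in> pos_roots"
    have "B (c *\<^sub>R a) Y = 0" using Y by (simp add: wall_point_def)
    then have "multiple a (c *\<^sub>R a)" using wall_point_pos_roots(2)[OF a Y ca] by blast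
    then obtain n where n: "n > 0" "c *\<^sub>R a = real n *\<^sub>R a" by (auto simp: multiple_def)
    then have "c = real n" using pos_roots_nz[OF simple_pos_roots[OF a]] by simp
    then show False using c n(1) by simp
  qed
  then show ?thesis using simple_pos_roots[OF a] by (auto simp: indivisible_def)
qed

lemma indivisible_multiple: "a \<in> simple \<Longrightarrow> h \<in> indivisible \<Longrightarrow> multiple a h \<Longrightarrow> h = a"
proof -
  assume a: "a \<in> simple" and h: "h \<in> indivisible" "multiple a h"
  then obtain n where n: "n > 0" "h = real n *\<^sub>R a" by (auto simp: multiple_def)
  show "h = a"
  proof (rule ccontr)
    assume "h \<noteq> a"
    then have "n \<noteq> 1" using n by auto
    then have "n > 1" using n by simp
    moreover have "(1 / real n) *\<^sub>R h = a" using n by simp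
    ultimately show False using h simple_pos_roots[OF a] unfolding indivisible_def
      by (metis (no_types, lifting) divide_less_eq_1_pos mem_Collect_eq n(1) of_nat_0_less_iff of_nat_1 of_nat_less_iff zero_less_divide_1_iff)
  qed
qed

text \<open>A root that is a proper fraction of the image would reflect back to a fraction of
  \<open>h\<close>. It cannot be a multiple of \<open>a\<close>, because \<open>h\<close> would then
  be negative on \<open>H0\<close>.\<close>

lemma reflect_indivisible:
  assumes a: "a \<in> simple" and h: "h \<in> indivisible - {a}" shows "reflect a h \<in> indivisible - {a}"
proof -
  obtain t where t: "\<And>h. h \<in> pos_roots \<Longrightarrow> \<not> multiple a h \<Longrightarrow> reflect a h \<in> pos_roots \<and> \<not> multiple a (reflect a h)"
    using reflection[OF a] by metis
  have hR: "h \<in> pos_roots" "\<not> multiple a h" using h indivisible_multiple[OF a] by (auto simp: indivisible_def)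
  have r: "reflect a h \<in> pos_roots" "\<not> multiple a (reflect a h)" using t[OF hR] by auto
  have "c *\<^sub>R reflect a h \<notin> pos_roots" if c: "0 < c" "c < 1" for c
  proof
    assume k: "c *\<^sub>R reflect a h \<in> pos_roots"
    show False
    proof (cases "multiple a (c *\<^sub>R reflect a h)")
      case True
      then obtain n where n: "n > 0" "c *\<^sub>R reflect a h = real n *\<^sub>R a" by (auto simp: multiple_def)
      have "c *\<^sub>R h = reflect a (c *\<^sub>R reflect a h)" by (simp add: reflect_simps reflect_reflect[OF a])
      also have "\<dots> = - (real n *\<^sub>R a)" unfolding n(2) by (simp add: reflect_simps reflect_self[OF a])
      finally have "c * B h H0 = - (real n * B a H0)" by (metis B_simps(5,7))
      moreover have "0 < c * B h H0" "0 < real n * B a H0" using c hR simple_pos_roots[OF a] n(1) by auto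
      ultimately show False by simp
    next
      case False
      have "reflect a (c *\<^sub>R reflect a h) \<in> pos_roots" using t[OF k False] by blast
      then have "c *\<^sub>R h \<in> pos_roots" by (simp add: reflect_simps reflect_reflect[OF a])
      then show False using h c by (auto simp: indivisible_def)
    qed
  qed
  moreover have "reflect a h \<noteq> a"
  proof
    assume "reflect a h = a"
    then have "multiple a (reflect a h)" unfolding multiple_def by (intro exI[of _ 1]) simp
    then show False using r by blast
  qed
  ultimately show ?thesis using r by (auto simp: indivisible_def)
qed

text \<open>The argument is a bare function, so that both \<open>Ad G t\<close> and a word of
  reflections can be inserted.\<close>

definition inversions where "inversions w = card {h \<in> indivisible. w h \<notin> pos_roots}"

text \<open>\<open>reflect a\<close> permutes the indivisible roots other than \<open>a\<close> and
  negates \<open>a\<close>, so the two counts differ by the contribution of \<open>a\<close>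
  alone.\<close>

lemma inversions_reflect:
  assumes a: "a \<in> simple"
  shows "inversions (\<lambda>h. w (reflect a h)) \<le> Suc (inversions w)"
    and "w a \<notin> pos_roots \<Longrightarrow> w (- a) \<in> pos_roots \<Longrightarrow> Suc (inversions (\<lambda>h. w (reflect a h))) = inversions w"
proof -
  define C where "C = {h \<in> indivisible - {a}. w h \<notin> pos_roots}"
  have fC: "finite C" using finite_indivisible by (simp add: C_def)
  have bij: "card {h \<in> indivisible - {a}. w (reflect a h) \<notin> pos_roots} = card C"
  proof (rule bij_betw_same_card[of "reflect a"])
    show "bij_betw (reflect a) {h \<in> indivisible - {a}. w (reflect a h) \<notin> pos_roots} C"
      by (rule bij_betwI[of _ _ _ "reflect a"]) (use reflect_indivisible[OF a] reflect_reflect[OF a] in \<open>auto simp: C_def\<close>)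
  qed
  have e1: "{h \<in> indivisible. w h \<notin> pos_roots} = (if w a \<notin> pos_roots then insert a C else C)"
    using simple_indivisible[OF a] by (auto simp: C_def)
  have e2: "{h \<in> indivisible. w (reflect a h) \<notin> pos_roots} = (if w (- a) \<notin> pos_roots then insert a {h \<in> indivisible - {a}. w (reflect a h) \<notin> pos_roots} else {h \<in> indivisible - {a}. w (reflect a h) \<notin> pos_roots})"
    using simple_indivisible[OF a] reflect_self[OF a] by auto
  have aC: "a \<notin> C" by (simp add: C_def)
  have n1: "inversions w = (if w a \<notin> pos_roots then Suc (card C) else card C)"
    unfolding inversions_def e1 using fC aC by simp
  have n2: "inversions (\<lambda>h. w (reflect a h)) = (if w (- a) \<notin> pos_roots then Suc (card C) else card C)"
    unfolding inversions_def e2 using bij finite_indivisible by simp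
  show "inversions (\<lambda>h. w (reflect a h)) \<le> Suc (inversions w)" using n1 n2 by simp
  show "w a \<notin> pos_roots \<Longrightarrow> w (- a) \<in> pos_roots \<Longrightarrow> Suc (inversions (\<lambda>h. w (reflect a h))) = inversions w" using n1 n2 by simp
qed

lemma inversions_foldr: "set as \<subseteq> simple \<Longrightarrow> inversions (foldr reflect as) \<le> length as"
proof (induction as rule: rev_induct)
  case Nil
  have "{h \<in> indivisible. foldr reflect [] h \<notin> pos_roots} = {}" by (auto simp: indivisible_def)
  then show ?case unfolding inversions_def by (metis card.empty zero_le)
next
  case (snoc a as)
  have "inversions (foldr reflect (as @ [a])) = inversions (\<lambda>h. foldr reflect as (reflect a h))"
    by (rule arg_cong[of _ _ inversions]) (simp add: fun_eq_iff)
  then show ?case using inversions_reflect(1)[of a "foldr reflect as"] snoc by simp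
qed

lemma simple_to_pos_roots:
  assumes t: "t \<in> T" and s: "\<And>a. a \<in> simple \<Longrightarrow> Ad G t a \<in> pos_roots" and h: "h \<in> pos_roots"
  shows "Ad G t h \<in> pos_roots"
proof -
  have lin: "linear (Ad G t)" by (rule linear_Ad[OF T_carrier[OF t]])
  obtain l where l: "set l \<subseteq> simple" "l \<noteq> []" "h = sum_list l" using simple_generate[OF h] by blast
  have "0 < B (Ad G t (sum_list l)) H0 \<or> l = []" using l(1)
  proof (induction l)
    case (Cons b l)
    then have "0 < B (Ad G t b) H0" "0 < B (Ad G t (sum_list l)) H0 \<or> l = []" using s by auto
    then show ?case by (auto simp: linear_add[OF lin] linear_0[OF lin])
  qed simp
  then show ?thesis using l Ad_T_Wt[OF t] h by auto
qed

lemma inversions_simple: "t \<in> T \<Longrightarrow> 0 < inversions (Ad G t) \<Longrightarrow> \<exists>a\<in>simple. Ad G t a \<notin> pos_roots"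
proof (rule ccontr)
  assume t: "t \<in> T" "0 < inversions (Ad G t)" and n: "\<not> (\<exists>a\<in>simple. Ad G t a \<notin> pos_roots)"
  then have "Ad G t h \<in> pos_roots" if "h \<in> pos_roots" for h using simple_to_pos_roots[OF t(1) _ that] by blast
  then have "{h \<in> indivisible. Ad G t h \<notin> pos_roots} = {}" by (auto simp: indivisible_def)
  then show False using t(2) unfolding inversions_def by (metis card.empty less_irrefl)
qed

text \<open>Induction on the inversions: composing with the reflection of an inverted simple root
  removes one. Without inversions \<open>t\<close> preserves the positive roots and acts trivially
  by \<open>chamber_stabilizer_trivial\<close>.\<close>

lemma word_exists:
  "t \<in> T \<Longrightarrow> \<exists>as. set as \<subseteq> simple \<and> length as = inversions (Ad G t) \<and> (\<forall>H\<in>aa. Ad G t H = foldr reflect as H)"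
proof (induction "inversions (Ad G t)" arbitrary: t)
  case 0
  have "Ad G t a \<in> pos_roots" if a: "a \<in> simple" for a
  proof (rule ccontr)
    assume "Ad G t a \<notin> pos_roots"
    then have "a \<in> {h \<in> indivisible. Ad G t h \<notin> pos_roots}" using simple_indivisible[OF a] by simp
    then have "inversions (Ad G t) \<noteq> 0" unfolding inversions_def using finite_indivisible by auto
    then show False using 0 by simp
  qed
  then have "Ad G t h \<in> pos_roots" if "h \<in> pos_roots" for h using simple_to_pos_roots[OF 0(2) _ that] by blast
  then have "Ad G t H = H" if "H \<in> aa" for H using chamber_stabilizer_trivial[OF 0(2) _ that] by blast
  then show ?case using 0 by (intro exI[of _ "[]"]) simp
next
  case (Suc n)
  have t: "t \<in> T" by fact
  have tc: "t \<in> carrier G" by (rule T_carrier[OF t])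
  obtain a where a: "a \<in> simple" "Ad G t a \<notin> pos_roots" using inversions_simple[OF t] Suc(2) by auto
  have lin: "linear (Ad G t)" by (rule linear_Ad[OF tc])
  obtain s where s: "s \<in> T" "\<And>H. H \<in> aa \<Longrightarrow> Ad G s H = reflect a H" using reflection[OF a(1)] by metis
  have sc: "s \<in> carrier G" by (rule T_carrier[OF s(1)])
  have "Ad G t a \<in> Wt" using Ad_T_Wt[OF t] simple_pos_roots[OF a(1)] by blast
  moreover have "Ad G t a \<noteq> 0"
    using pos_roots_nz[OF simple_pos_roots[OF a(1)]] Ad_inv(1)[OF tc, of a] linear_0[OF linear_Ad[OF inv_closed[OF tc]]] by metis
  ultimately have "- Ad G t a \<in> pos_roots" using Wt_cases[of "Ad G t a"] a(2) by blast
  then have m: "Ad G t (- a) \<in> pos_roots" unfolding linear_neg[OF lin] .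
  have e: "inversions (Ad G (t \<otimes> s)) = inversions (\<lambda>h. Ad G t (reflect a h))"
  proof -
    have "Ad G (t \<otimes> s) h = Ad G t (reflect a h)" if "h \<in> indivisible" for h
      using s(2)[OF pos_roots_aa, of h] that tc sc by (simp add: Ad_mult indivisible_def)
    then have "{h \<in> indivisible. Ad G (t \<otimes> s) h \<notin> pos_roots} = {h \<in> indivisible. Ad G t (reflect a h) \<notin> pos_roots}" by auto
    then show ?thesis by (simp add: inversions_def)
  qed
  then have n: "n = inversions (Ad G (t \<otimes> s))" using inversions_reflect(2)[OF a(1,2) m] Suc(2) by simp
  obtain as where as: "set as \<subseteq> simple" "length as = inversions (Ad G (t \<otimes> s))" "\<forall>H\<in>aa. Ad G (t \<otimes> s) H = foldr reflect as H"
    using Suc(1)[OF n T_mult[OF t s(1)]] by blast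
  have "Ad G t H = foldr reflect (as @ [a]) H" if H: "H \<in> aa" for H
  proof -
    have r: "reflect a H \<in> aa" using T_aa[OF s(1) H] s(2)[OF H] by simp
    have "Ad G (t \<otimes> s) (reflect a H) = Ad G t (reflect a (reflect a H))" using s(2)[OF r] tc sc by (simp add: Ad_mult)
    then show ?thesis using as(3) r by (simp add: reflect_reflect[OF a(1)])
  qed
  then show ?case using as a n Suc(2) by (intro exI[of _ "as @ [a]"]) auto
qed

text \<open>The element of \<open>exists_opposition\<close> inverts all indivisible roots, so its
  words have at least \<open>card indivisible\<close> letters. A longest \<open>w\<close> has a word
  with \<open>inversions\<close> letters, so it inverts all of them too, in particular the simple
  roots.\<close>

lemma longest_flips:
  assumes w: "w \<in> T"
    and longest: "\<And>t. t \<in> T \<Longrightarrow>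
      (LEAST l. \<exists>as. length as = l \<and> set as \<subseteq> simple \<and> (\<forall>H\<in>aa. Ad G t H = foldr reflect as H))
      \<le> (LEAST l. \<exists>as. length as = l \<and> set as \<subseteq> simple \<and> (\<forall>H\<in>aa. Ad G w H = foldr reflect as H))"
    and h: "h \<in> pos_roots"
  shows "- Ad G w h \<in> pos_roots"
proof -
  let ?P = "\<lambda>t l. \<exists>as. length as = l \<and> set as \<subseteq> simple \<and> (\<forall>H\<in>aa. Ad G t H = foldr reflect as H)"
  obtain t where t: "t \<in> T" "\<And>h. h \<in> pos_roots \<Longrightarrow> - Ad G t h \<in> pos_roots" by (rule exists_opposition) blast
  have wc: "w \<in> carrier G" by (rule T_carrier[OF w])
  have lin: "linear (Ad G w)" by (rule linear_Ad[OF wc])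
  have "{h \<in> indivisible. Ad G t h \<notin> pos_roots} = indivisible" using t(2) not_pos_roots_neg by (fastforce simp: indivisible_def)
  then have nt: "inversions (Ad G t) = card indivisible" by (simp add: inversions_def)
  have "?P t (inversions (Ad G t))" using word_exists[OF t(1)] by blast
  then have "?P t (LEAST l. ?P t l)" by (rule LeastI)
  then obtain as where as: "length as = (LEAST l. ?P t l)" "set as \<subseteq> simple" "\<forall>H\<in>aa. Ad G t H = foldr reflect as H" by blast
  have "{h \<in> indivisible. Ad G t h \<notin> pos_roots} = {h \<in> indivisible. foldr reflect as h \<notin> pos_roots}" using as(3) pos_roots_aa by (auto simp: indivisible_def)
  then have "card indivisible \<le> (LEAST l. ?P t l)" using inversions_foldr[OF as(2)] nt as(1) by (simp add: inversions_def)
  also have "\<dots> \<le> (LEAST l. ?P w l)" by (rule longest[OF t(1)])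
  also have "\<dots> \<le> inversions (Ad G w)" by (rule Least_le) (use word_exists[OF w] in blast)
  finally have "card indivisible \<le> card {h \<in> indivisible. Ad G w h \<notin> pos_roots}" by (simp add: inversions_def)
  then have all: "{h \<in> indivisible. Ad G w h \<notin> pos_roots} = indivisible" by (intro card_seteq finite_indivisible) auto
  have simple: "0 < B (- Ad G w a) H0" if a: "a \<in> simple" for a
  proof -
    have "Ad G w a \<notin> pos_roots" using all simple_indivisible[OF a] by blast
    moreover have "Ad G w a \<in> Wt" using Ad_T_Wt[OF w] simple_pos_roots[OF a] by blast
    moreover have "Ad G w a \<noteq> 0"
      using pos_roots_nz[OF simple_pos_roots[OF a]] Ad_inv(1)[OF wc, of a] linear_0[OF linear_Ad[OF inv_closed[OF wc]]] by metis
    ultimately show ?thesis using Wt_cases by blast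
  qed
  obtain l where l: "set l \<subseteq> simple" "l \<noteq> []" "h = sum_list l" using simple_generate[OF h] by blast
  have "0 < B (- Ad G w (sum_list l)) H0 \<or> l = []" using l(1)
  proof (induction l)
    case (Cons b l)
    then have "0 < B (- Ad G w b) H0" "0 < B (- Ad G w (sum_list l)) H0 \<or> l = []" using simple by auto
    then show ?case by (auto simp: linear_add[OF lin] linear_0[OF lin])
  qed simp
  then show ?thesis using l Ad_T_Wt[OF w] h Wt_uminus by auto
qed

end

section \<open>Opposite points and flats\<close>

lemma (in group) l_coset_eq_iff:
  assumes H: "subgroup H G" and gh: "g \<in> carrier G" "h \<in> carrier G"
  shows "g <#\<^bsub>G\<^esub> H = h <#\<^bsub>G\<^esub> H \<longleftrightarrow> inv g \<otimes> h \<in> H"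
proof
  assume eq: "g <#\<^bsub>G\<^esub> H = h <#\<^bsub>G\<^esub> H"
  have "h \<in> h <#\<^bsub>G\<^esub> H" 
    unfolding l_coset_def using subgroup.one_closed[OF H] r_one[OF gh(2)] by (intro UN_I[of \<one>]) simp_all
  then have "h \<in> g <#\<^bsub>G\<^esub> H" by (simp only: eq)
  then obtain x where x: "x \<in> H" "h = g \<otimes> x" unfolding l_coset_def by (elim UN_E) simp
  then show "inv g \<otimes> h \<in> H" using gh subgroup.mem_carrier[OF H x(1)] by (simp add: inv_mult_cancel)
next
  assume x: "inv g \<otimes> h \<in> H"
  have "g <#\<^bsub>G\<^esub> H \<subseteq> h <#\<^bsub>G\<^esub> H" if "inv g \<otimes> h \<in> H" "g \<in> carrier G" "h \<in> carrier G" for g h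
  proof
    fix z assume "z \<in> g <#\<^bsub>G\<^esub> H"
    then obtain y where y: "y \<in> H" "z = g \<otimes> y" unfolding l_coset_def by (elim UN_E) simp
    have yc: "y \<in> carrier G" by (rule subgroup.mem_carrier[OF H y(1)])
    have "inv (inv g \<otimes> h) \<otimes> y \<in> H" by (intro subgroup.m_closed[OF H] subgroup.m_inv_closed[OF H] that(1) y(1))
    moreover have "z = h \<otimes> (inv (inv g \<otimes> h) \<otimes> y)" using that yc y(2)
      by (simp add: inv_mult_group m_assoc inv_mult_cancel)
    ultimately show "z \<in> h <#\<^bsub>G\<^esub> H" unfolding l_coset_def by blast
  qed
  from this[OF x gh] this[OF _ gh(2,1)] show "g <#\<^bsub>G\<^esub> H = h <#\<^bsub>G\<^esub> H"
    using subgroup.m_inv_closed[OF H x] gh by (simp add: inv_mult_group subset_antisym)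
qed

locale opposed_group = parab_group G kk pp aa K A M T H0 N P
  for G :: "('a, 'e::euclidean_space) manifold_group" (structure) and kk pp aa K A M T H0 N P +
  fixes w0
  assumes w0: "w0 \<in> T" and flips: "h \<in> pos_roots \<Longrightarrow> - Ad G w0 h \<in> pos_roots"
begin

lemma w0_carrier: "w0 \<in> carrier G" by (rule T_carrier[OF w0])

section \<open>The big cell\<close>

lemma flips_nonneg: "h \<in> nonneg \<inter> Wt \<Longrightarrow> Ad G w0 h \<in> nonpos"
proof -
  assume h: "h \<in> nonneg \<inter> Wt"
  show ?thesis
  proof (cases "h = 0")
    case True
    then show ?thesis by (simp add: linear_0[OF linear_Ad[OF w0_carrier]])
  next
    case False
    then have "h \<in> pos_roots" using h regular[of h] by force
    then show ?thesis using flips[of h] by auto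
  qed
qed

lemma Ad_w0_nonneg: "X \<in> gr nonneg \<Longrightarrow> Ad G w0 X \<in> gr nonpos"
proof -
  assume "X \<in> gr nonneg"
  then have "X \<in> gr (nonneg \<inter> Wt)" by (auto simp: gr_def)
  then have "Ad G w0 X \<in> gr (Ad G w0 ` (nonneg \<inter> Wt))" by (rule Ad_T_gr[OF w0])
  moreover have "gr (Ad G w0 ` (nonneg \<inter> Wt)) \<subseteq> gr nonpos"
    by (rule gr_mono) (use flips_nonneg in blast)
  ultimately show ?thesis by blast
qed

lemma aa_gr_nonneg: "H \<in> aa \<Longrightarrow> H \<in> gr nonneg"
  by (rule ws_gr[of _ 0]) (use ws_zero subspace_0[OF sub_aa] in auto)

text \<open>\<open>T\<close> keeps \<open>H0\<close> in \<open>aa\<close>, \<open>P\<close>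
  preserves the nonnegative part, and \<open>w0\<close> reverses it. Together with
  \<open>N_trivial\<close> this separates \<open>N\<close> from the other factors.\<close>

lemma Ad_big_cell_H0: "p \<in> P \<Longrightarrow> s \<in> T \<Longrightarrow> Ad G (w0 \<otimes> p \<otimes> s) H0 \<in> gr nonpos"
  using Ad_w0_nonneg[OF Ad_P_gr[OF _ upper_nonneg aa_gr_nonneg[OF T_aa[OF _ H0]]]]
  by (simp add: Ad_mult w0_carrier P_carrier T_carrier m_assoc)

lemma N_opposite_trivial: "n \<in> N \<Longrightarrow> p \<in> P \<Longrightarrow> s \<in> T \<Longrightarrow> n = w0 \<otimes> p \<otimes> s \<Longrightarrow> n = \<one>"
  using N_trivial Ad_big_cell_H0 by metis

lemma T_normalizes_MA: "t \<in> T \<Longrightarrow> l \<in> MA \<Longrightarrow> inv t \<otimes> l \<otimes> t \<in> MA"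
proof -
  assume t: "t \<in> T" and l: "l \<in> MA"
  obtain m a where ma: "m \<in> M" "a \<in> A" "l = m \<otimes> a" using l by (auto simp: MA_def)
  obtain H where H: "H \<in> aa" "a = expG H" using ma(2) by (auto simp: A_eq)
  have c: "t \<in> carrier G" "m \<in> carrier G" "a \<in> carrier G" using t ma T_carrier M_carrier A_carrier by auto
  have it: "inv t \<in> T" by (rule T_inv[OF t])
  have "inv t \<otimes> m \<otimes> t \<in> M"
    unfolding M_iff
  proof (intro conjI ballI)
    show "inv t \<otimes> m \<otimes> t \<in> K"
      using T_K[OF it] T_K[OF t] ma(1) by (intro subgroup.m_closed[OF subK]) (auto simp: M_iff)
    fix H assume H: "H \<in> aa"
    then have "Ad G m (Ad G t H) = Ad G t H" using ma(1) T_aa[OF t H] by (auto simp: M_iff)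
    then show "Ad G (inv t \<otimes> m \<otimes> t) H = H" using c by (simp add: Ad_mult Ad_inv)
  qed
  moreover have "inv t \<otimes> a \<otimes> t \<in> A"
    using exp_conj[of "inv t" H] c T_aa[OF it H(1)] by (simp add: H(2) A_eq)
  moreover have "inv t \<otimes> l \<otimes> t = (inv t \<otimes> m \<otimes> t) \<otimes> (inv t \<otimes> a \<otimes> t)"
    using c by (simp add: ma(3) m_assoc inv_mult_cancel)
  ultimately show ?thesis unfolding MA_def by blast
qed

text \<open>The stabilizer of the pair \<open>(P, w\<^sub>0P)\<close> is \<open>MA\<close>.\<close>

lemma P_opposite_MA:
  assumes p: "p \<in> P" "q \<in> P" and s: "s \<in> T" and eq: "p \<otimes> s = w0 \<otimes> q"
  shows "p \<in> MA"
proof -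
  obtain l n where ln: "l \<in> MA" "n \<in> N" "p = n \<otimes> l" using p(1) unfolding P_iff' by blast
  have c: "n \<in> carrier G" "l \<in> carrier G" "s \<in> carrier G" "q \<in> carrier G"
    using ln MA_carrier N_carrier T_carrier[OF s] P_carrier[OF p(2)] by auto
  define l' where "l' = inv s \<otimes> inv l \<otimes> s"
  have l': "l' \<in> MA" unfolding l'_def by (rule T_normalizes_MA[OF s subgroup.m_inv_closed[OF subMA ln(1)]])
  \<comment> \<open>Moving \<open>l\<close> across \<open>s\<close> isolates \<open>n\<close> in the
    form required by \<open>N_opposite_trivial\<close>.\<close>
  have "n \<otimes> s = n \<otimes> l \<otimes> s \<otimes> l'"
    using c by (simp add: l'_def m_assoc inv_mult_cancel)
  also have "\<dots> = w0 \<otimes> (q \<otimes> l')" using eq c MA_carrier[OF l'] w0_carrier by (simp add: ln(3) m_assoc)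
  finally have "n = w0 \<otimes> (q \<otimes> l') \<otimes> inv s"
    using c MA_carrier[OF l'] w0_carrier by (metis inv_solve_right m_closed)
  then have "n = \<one>"
    by (rule N_opposite_trivial[OF ln(2) subgroup.m_closed[OF subP p(2) MA_P[OF l']] T_inv[OF s]])
  then show ?thesis using ln c by simp
qed

section \<open>Flats and their boundaries\<close>

abbreviation FA where "FA \<equiv> canonical_flat G K A"

lemma Ksub: "K \<subseteq> carrier G" and Psub: "P \<subseteq> carrier G"
  using K_carrier P_carrier by auto

lemma translate_FA: "g \<in> carrier G \<Longrightarrow> translate G g FA = {(g \<otimes> a) <#\<^bsub>G\<^esub> K | a. a \<in> A}"
proof -
  assume g: "g \<in> carrier G"
  have "translate G g FA = (\<lambda>a. g <#\<^bsub>G\<^esub> (a <#\<^bsub>G\<^esub> K)) ` A"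
    by (auto simp: translate_def canonical_flat_def)
  also have "\<dots> = (\<lambda>a. (g \<otimes> a) <#\<^bsub>G\<^esub> K) ` A"
    by (intro image_cong refl lcos_m_assoc Ksub g A_carrier)
  finally show ?thesis by auto
qed

lemma translate_FA_mult:
  assumes g: "g \<in> carrier G" and t: "t \<in> T" and a: "a \<in> A"
  shows "translate G (g \<otimes> (a \<otimes> t)) FA = translate G g FA"
proof -
  have sub: "translate G (g \<otimes> (a \<otimes> t)) FA \<subseteq> translate G g FA"
    if g: "g \<in> carrier G" and t: "t \<in> T" and a: "a \<in> A" for g a t
  proof
    fix C assume "C \<in> translate G (g \<otimes> (a \<otimes> t)) FA"
    then obtain b where b: "b \<in> A" "C = (g \<otimes> (a \<otimes> t) \<otimes> b) <#\<^bsub>G\<^esub> K"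
      using translate_FA[of "g \<otimes> (a \<otimes> t)"] g T_carrier[OF t] A_carrier[OF a] by auto
    have c: "t \<in> carrier G" "a \<in> carrier G" "b \<in> carrier G" using t a b T_carrier A_carrier by auto
    obtain H where H: "H \<in> aa" "b = expG H" using b by (auto simp: A_eq)
    define b' where "b' = t \<otimes> b \<otimes> inv t"
    have b': "b' \<in> A" using exp_conj[OF c(1)] T_aa[OF t H(1)] by (simp add: b'_def H A_eq)
    have e: "g \<otimes> (a \<otimes> t) \<otimes> b = g \<otimes> (a \<otimes> b') \<otimes> t" using g c by (simp add: b'_def m_assoc)
    have "C = (g \<otimes> (a \<otimes> b')) <#\<^bsub>G\<^esub> K"
      unfolding b(2) e using g c A_carrier[OF b'] T_K[OF t]
      by (subst l_coset_eq_iff[OF subK]) (simp_all add: inv_mult_group m_assoc inv_mult_cancel subgroup.m_inv_closed[OF subK])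
    then show "C \<in> translate G g FA" using translate_FA[OF g] subgroup.m_closed[OF subA a b'] by blast
  qed
  have c: "t \<in> carrier G" "a \<in> carrier G" using t a T_carrier A_carrier by auto
  obtain H where H: "H \<in> aa" "a = expG H" using a by (auto simp: A_eq)
  define a' where "a' = inv t \<otimes> inv a \<otimes> t"
  have "- H \<in> aa" by (rule subspace_neg[OF sub_aa H(1)])
  then have a': "a' \<in> A"
    using exp_conj[of "inv t" "- H"] T_aa[OF T_inv[OF t]] c by (simp add: a'_def H A_eq expG_minus)
  have "g = g \<otimes> (a \<otimes> t) \<otimes> (a' \<otimes> inv t)"
    using g c by (simp add: a'_def m_assoc inv_mult_cancel)
  then have "translate G g FA \<subseteq> translate G (g \<otimes> (a \<otimes> t)) FA"
    using sub[of "g \<otimes> (a \<otimes> t)" "inv t" a'] g c T_inv[OF t] a' by simp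
  then show ?thesis using sub[OF g t a] by blast
qed

text \<open>The base point of the second flat gives \<open>h = g a k\<close> with \<open>k\<close>
  in \<open>K\<close>; comparing the other points shows that \<open>k\<close> meets the condition of
  \<open>stabilizer_T\<close>.\<close>

lemma translate_FA_eq:
  assumes g: "g \<in> carrier G" "h \<in> carrier G" and eq: "translate G g FA = translate G h FA"
  obtains a t where "a \<in> A" "t \<in> T" "h = g \<otimes> (a \<otimes> t)"
proof -
  have "h <#\<^bsub>G\<^esub> K \<in> translate G h FA"
    unfolding translate_FA[OF g(2)] using subgroup.one_closed[OF subA] r_one[OF g(2)]
    by (intro CollectI exI[of _ \<one>]) simp
  then obtain a where a: "a \<in> A" "(g \<otimes> a) <#\<^bsub>G\<^esub> K = h <#\<^bsub>G\<^esub> K"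
    unfolding eq[symmetric] translate_FA[OF g(1)] by auto
  have ac: "a \<in> carrier G" by (rule A_carrier[OF a(1)])
  define k where "k = inv (g \<otimes> a) \<otimes> h"
  have k: "k \<in> K" using a(2) g ac by (simp add: k_def l_coset_eq_iff[OF subK])
  have kc: "k \<in> carrier G" by (rule K_carrier[OF k])
  have h: "h = g \<otimes> (a \<otimes> k)" using g ac by (simp add: k_def inv_mult_group m_assoc inv_mult_cancel)
  have "k \<in> T"
  proof (rule stabilizer_T[OF k])
    fix H assume H: "H \<in> aa"
    have "(h \<otimes> expG H) <#\<^bsub>G\<^esub> K \<in> translate G h FA"
      unfolding translate_FA[OF g(2)] using imageI[OF H, of expG] by (intro CollectI exI[of _ "expG H"]) (simp add: A_eq)
    then obtain b where b: "b \<in> A" "(g \<otimes> b) <#\<^bsub>G\<^esub> K = (h \<otimes> expG H) <#\<^bsub>G\<^esub> K"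
      unfolding eq[symmetric] translate_FA[OF g(1)] by auto
    have bc: "b \<in> carrier G" by (rule A_carrier[OF b(1)])
    define k' where "k' = inv (g \<otimes> b) \<otimes> (h \<otimes> expG H)"
    have k': "k' \<in> K" using b(2) g bc by (simp add: k'_def l_coset_eq_iff[OF subK])
    have "g \<otimes> b \<otimes> k' = h \<otimes> expG H" using g bc by (simp add: k'_def inv_mult_group m_assoc inv_mult_cancel)
    then have "g \<otimes> (b \<otimes> k') = g \<otimes> (a \<otimes> k \<otimes> expG H)" using g bc ac kc K_carrier[OF k'] by (simp add: h m_assoc)
    then have "b \<otimes> k' = a \<otimes> (k \<otimes> expG H)" using g bc ac kc K_carrier[OF k'] by (simp add: m_assoc)
    then have "k \<otimes> expG H = (inv a \<otimes> b) \<otimes> k'"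
      using bc ac kc K_carrier[OF k'] by (simp add: m_assoc inv_mult_cancel)
    moreover have "inv a \<otimes> b \<in> A" by (intro subgroup.m_closed[OF subA] subgroup.m_inv_closed[OF subA] a b)
    then obtain H' where "H' \<in> aa" "inv a \<otimes> b = expG H'" by (auto simp: A_eq)
    ultimately show "\<exists>H'\<in>aa. \<exists>k'\<in>K. k \<otimes> expG H = expG H' \<otimes> k'" using k' by (intro bexI) simp_all
  qed
  then show thesis using that a(1) h by blast
qed

lemma canonical_boundary: "g \<in> carrier G \<Longrightarrow> translate G g (canonical_flat_boundary G K A P) = {(g \<otimes> t) <#\<^bsub>G\<^esub> P | t. t \<in> T}"
proof -
  assume g: "g \<in> carrier G"
  have "translate G g (canonical_flat_boundary G K A P) = (\<lambda>t. g <#\<^bsub>G\<^esub> (t <#\<^bsub>G\<^esub> P)) ` T"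
    by (auto simp: translate_def canonical_flat_boundary_def T_def)
  also have "\<dots> = (\<lambda>t. (g \<otimes> t) <#\<^bsub>G\<^esub> P) ` T"
    by (intro image_cong refl lcos_m_assoc Psub g T_carrier)
  finally show ?thesis by auto
qed

text \<open>Two representatives of a flat differ by an element of \<open>A T\<close>, and
  \<open>T\<close> normalizes \<open>MA\<close>; so all sets in the union that defines the boundary
  coincide.\<close>

lemma flat_boundary_translate:
  assumes g: "g \<in> carrier G"
  shows "flat_boundary G K A P (translate G g FA) = {(g \<otimes> t) <#\<^bsub>G\<^esub> P | t. t \<in> T}"
proof (rule subset_antisym)
  show "{(g \<otimes> t) <#\<^bsub>G\<^esub> P | t. t \<in> T} \<subseteq> flat_boundary G K A P (translate G g FA)"
    unfolding flat_boundary_def canonical_boundary[OF g, symmetric] using g by blast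
  show "flat_boundary G K A P (translate G g FA) \<subseteq> {(g \<otimes> t) <#\<^bsub>G\<^esub> P | t. t \<in> T}"
  proof
    fix C assume "C \<in> flat_boundary G K A P (translate G g FA)"
    then obtain h where h: "h \<in> carrier G" "translate G g FA = translate G h FA"
      "C \<in> translate G h (canonical_flat_boundary G K A P)"
      unfolding flat_boundary_def by blast
    then obtain s where s: "s \<in> T" "C = (h \<otimes> s) <#\<^bsub>G\<^esub> P" by (auto simp: canonical_boundary)
    obtain a t where at: "a \<in> A" "t \<in> T" "h = g \<otimes> (a \<otimes> t)" using translate_FA_eq[OF g h(1,2)] .
    have c: "a \<in> carrier G" "t \<in> carrier G" "s \<in> carrier G" using at s A_carrier T_carrier by auto
    have ts: "t \<otimes> s \<in> T" by (rule T_mult[OF at(2) s(1)])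
    have "inv (t \<otimes> s) \<otimes> a \<otimes> (t \<otimes> s) \<in> MA" by (rule T_normalizes_MA[OF ts A_MA[OF at(1)]])
    then have "inv (g \<otimes> (t \<otimes> s)) \<otimes> (h \<otimes> s) \<in> P"
      using MA_P g c by (simp add: at(3) inv_mult_group m_assoc inv_mult_cancel)
    then have "(g \<otimes> (t \<otimes> s)) <#\<^bsub>G\<^esub> P = C"
      unfolding s(2) using g h c by (subst l_coset_eq_iff[OF subP]) simp_all
    then show "C \<in> {(g \<otimes> t) <#\<^bsub>G\<^esub> P | t. t \<in> T}" using ts by blast
  qed
qed

text \<open>If both points bound another flat \<open>h FA\<close>, then \<open>g\<close> and some
  \<open>h t\<close> differ by an element of \<open>P\<close> to which \<open>P_opposite_MA\<close>
  applies, and both \<open>MA\<close> and \<open>T\<close> preserve \<open>FA\<close>.\<close>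

lemma flat_through_pair:
  assumes g: "g \<in> carrier G"
  shows "flat_through G K A P (g <#\<^bsub>G\<^esub> P) (g <#\<^bsub>G\<^esub> (w0 <#\<^bsub>G\<^esub> P)) = translate G g FA"
  unfolding flat_through_def
proof (rule the_equality)
  have gw: "g <#\<^bsub>G\<^esub> (w0 <#\<^bsub>G\<^esub> P) = (g \<otimes> w0) <#\<^bsub>G\<^esub> P" by (rule lcos_m_assoc[OF Psub g w0_carrier])
  show "translate G g FA \<in> maximal_flats G K A \<and> g <#\<^bsub>G\<^esub> P \<in> flat_boundary G K A P (translate G g FA) \<and>
      g <#\<^bsub>G\<^esub> (w0 <#\<^bsub>G\<^esub> P) \<in> flat_boundary G K A P (translate G g FA)"
  proof (intro conjI)
    show "translate G g FA \<in> maximal_flats G K A" unfolding maximal_flats_def using g by (intro CollectI exI conjI) simp_all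
    show "g <#\<^bsub>G\<^esub> P \<in> flat_boundary G K A P (translate G g FA)"
      unfolding flat_boundary_translate[OF g] using T_one r_one[OF g] by (intro CollectI exI[of _ \<one>]) simp
    show "g <#\<^bsub>G\<^esub> (w0 <#\<^bsub>G\<^esub> P) \<in> flat_boundary G K A P (translate G g FA)"
      unfolding flat_boundary_translate[OF g] gw using w0 by (intro CollectI exI[of _ w0]) simp
  qed
  fix F assume F: "F \<in> maximal_flats G K A \<and> g <#\<^bsub>G\<^esub> P \<in> flat_boundary G K A P F \<and> g <#\<^bsub>G\<^esub> (w0 <#\<^bsub>G\<^esub> P) \<in> flat_boundary G K A P F"
  then have "\<exists>h. F = translate G h FA \<and> h \<in> carrier G" unfolding maximal_flats_def mem_Collect_eq by (elim conjE)
  then obtain h where h: "h \<in> carrier G" "F = translate G h FA" by (elim exE conjE)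
  obtain t s where ts: "t \<in> T" "s \<in> T" "g <#\<^bsub>G\<^esub> P = (h \<otimes> t) <#\<^bsub>G\<^esub> P" "(g \<otimes> w0) <#\<^bsub>G\<^esub> P = (h \<otimes> s) <#\<^bsub>G\<^esub> P"
    using F unfolding h(2) flat_boundary_translate[OF h(1)] gw mem_Collect_eq by (elim exE conjE)
  have c: "t \<in> carrier G" "s \<in> carrier G" "w0 \<in> carrier G" using ts T_carrier w0 by auto
  define p where "p = inv g \<otimes> (h \<otimes> t)"
  have p: "p \<in> P" using ts(3) g h c by (simp add: p_def l_coset_eq_iff[OF subP])
  define q where "q = inv (g \<otimes> w0) \<otimes> (h \<otimes> s)"
  have q: "q \<in> P" using ts(4) g h c by (simp add: q_def l_coset_eq_iff[OF subP])
  have "p \<otimes> (inv t \<otimes> s) = w0 \<otimes> q"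
    using g h c by (simp add: p_def q_def inv_mult_group m_assoc inv_mult_cancel)
  then have "p \<in> MA" by (rule P_opposite_MA[OF p q T_mult[OF T_inv[OF ts(1)] ts(2)]])
  then obtain m a where ma: "m \<in> M" "a \<in> A" "p = m \<otimes> a" by (auto simp: MA_def)
  have "p = a \<otimes> m" using ma M_A_commute by simp
  moreover have "h \<otimes> (\<one> \<otimes> t) = g \<otimes> p" using g h c by (simp add: p_def inv_mult_cancel)
  ultimately have "translate G (h \<otimes> (\<one> \<otimes> t)) FA = translate G (g \<otimes> (a \<otimes> m)) FA" by simp
  then show "F = translate G g FA"
    using translate_FA_mult[OF h(1) ts(1) subgroup.one_closed[OF subA]] translate_FA_mult[OF g M_T[OF ma(1)] ma(2)] h(2)
    by simp
qed

end

section \<open>The equivariant map\<close>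

context opposed_group
begin

text \<open>Maximise \<open>B (Ad t Z) H0\<close> over \<open>T\<close>, so that no simple
  reflection increases it. The maximum exists because, by \<open>word_exists\<close>,
  \<open>T\<close> acts through words of bounded length.\<close>

lemma exists_dominant:
  assumes Z: "Z \<in> aa" obtains t where "t \<in> T" "\<And>h. h \<in> pos_roots \<Longrightarrow> 0 \<le> B h (Ad G t Z)"
proof -
  let ?V = "(\<lambda>t. B (Ad G t Z) H0) ` T"
  have "?V \<subseteq> (\<lambda>as. B (foldr reflect as Z) H0) ` {as. set as \<subseteq> simple \<and> length as \<le> card indivisible}"
  proof
    fix x assume "x \<in> ?V"
    then obtain t where t: "t \<in> T" "x = B (Ad G t Z) H0" by blast
    obtain as where as: "set as \<subseteq> simple" "length as = inversions (Ad G t)" "\<forall>H\<in>aa. Ad G t H = foldr reflect as H"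
      using word_exists[OF t(1)] by blast
    have "inversions (Ad G t) \<le> card indivisible" unfolding inversions_def by (intro card_mono finite_indivisible) auto
    then show "x \<in> (\<lambda>as. B (foldr reflect as Z) H0) ` {as. set as \<subseteq> simple \<and> length as \<le> card indivisible}"
      using as Z t(2) by (intro image_eqI[of _ _ as]) auto
  qed
  then have fin: "finite ?V" by (rule finite_subset) (intro finite_imageI finite_lists_length_le finite_simple)
  obtain t where t: "t \<in> T" "\<And>s. s \<in> T \<Longrightarrow> B (Ad G s Z) H0 \<le> B (Ad G t Z) H0"
    using Max_in[OF fin] Max_ge[OF fin] T_one by fastforce
  have tZ: "Ad G t Z \<in> aa" by (rule T_aa[OF t(1) Z])
  have simple: "0 \<le> B a (Ad G t Z)" if a: "a \<in> simple" for a
  proof -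
    have aR: "a \<in> aa" "a \<noteq> 0" "0 < B a H0" using simple_pos_roots[OF a] pos_roots_aa by auto
    have Baa: "0 < B a a" by (rule B_aa_pos[OF aR(1,2)])
    obtain s where s: "s \<in> T" "\<And>H. H \<in> aa \<Longrightarrow> Ad G s H = reflect a H" using reflection[OF a] by metis
    have "Ad G (s \<otimes> t) Z = reflect a (Ad G t Z)" using s(2)[OF tZ] s(1) t(1) by (simp add: Ad_mult T_carrier)
    then have "B (reflect a (Ad G t Z)) H0 \<le> B (Ad G t Z) H0" using t(2)[OF T_mult[OF s(1) t(1)]] by simp
    then have "0 \<le> 2 * B a (Ad G t Z) / B a a * B a H0" by (simp add: reflect_def)
    then show ?thesis using aR(3) Baa by (simp add: zero_le_mult_iff zero_le_divide_iff)
  qed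
  show thesis
  proof (rule that[OF t(1)])
    fix h assume "h \<in> pos_roots"
    then obtain l where l: "set l \<subseteq> simple" "h = sum_list l" using simple_generate by blast
    show "0 \<le> B h (Ad G t Z)" unfolding l(2) B_sum_list by (rule sum_list_nonneg) (use l(1) simple in auto)
  qed
qed

text \<open>There may be several of them, since \<open>G\<close> is not assumed to be
  simple.\<close>

definition highest where "highest = {a \<in> pos_roots. \<forall>b\<in>pos_roots. a + b \<notin> Wt}"

text \<open>Adding positive roots as long as possible never decreases values at dominant points, and
  it ends in a highest root.\<close>

lemma highest_above:
  "h \<in> pos_roots \<Longrightarrow> \<exists>a\<in>highest. \<forall>Z. (\<forall>b\<in>pos_roots. 0 \<le> B b Z) \<longrightarrow> B h Z \<le> B a Z"
proof (induction "card {k \<in> pos_roots. B h H0 < B k H0}" arbitrary: h rule: less_induct)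
  case less
  show ?case
  proof (cases "h \<in> highest")
    case False
    then obtain b where b: "b \<in> pos_roots" "h + b \<in> Wt" using less.prems by (auto simp: highest_def)
    then have hb: "h + b \<in> pos_roots" using less.prems by simp
    have psub: "{k \<in> pos_roots. B (h + b) H0 < B k H0} \<subset> {k \<in> pos_roots. B h H0 < B k H0}"
    proof
      show "{k \<in> pos_roots. B (h + b) H0 < B k H0} \<subseteq> {k \<in> pos_roots. B h H0 < B k H0}" using b by auto
      have "h + b \<in> {k \<in> pos_roots. B h H0 < B k H0}" "h + b \<notin> {k \<in> pos_roots. B (h + b) H0 < B k H0}" using hb b by auto
      then show "{k \<in> pos_roots. B (h + b) H0 < B k H0} \<noteq> {k \<in> pos_roots. B h H0 < B k H0}" by blast
    qed
    have "finite {k \<in> pos_roots. B h H0 < B k H0}" by (rule finite_subset[OF _ finite_pos_roots]) auto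
    from less.hyps[OF psubset_card_mono[OF this psub] hb]
    obtain a where a: "a \<in> highest" "\<forall>Z. (\<forall>b\<in>pos_roots. 0 \<le> B b Z) \<longrightarrow> B (h + b) Z \<le> B a Z" ..
    show ?thesis
    proof (intro bexI[OF _ a(1)] allI impI)
      fix Z assume "\<forall>b\<in>pos_roots. 0 \<le> B b Z"
      then have "B (h + b) Z \<le> B a Z" "0 \<le> B b Z" using a(2) b(1) by blast+
      then show "B h Z \<le> B a Z" by simp
    qed
  qed blast
qed

definition weyl_orbit where "weyl_orbit a = (\<lambda>t. Ad G t a) ` T"

lemma weyl_orbit_Wt: "a \<in> highest \<Longrightarrow> weyl_orbit a \<subseteq> Wt" using Ad_T_Wt by (auto simp: weyl_orbit_def highest_def)
lemma finite_weyl_orbit: "a \<in> highest \<Longrightarrow> finite (weyl_orbit a)" by (rule finite_subset[OF weyl_orbit_Wt finite_Wt])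
lemma weyl_orbit_aa: "a \<in> highest \<Longrightarrow> m \<in> weyl_orbit a \<Longrightarrow> m \<in> aa" using weyl_orbit_Wt Wt_aa by blast
lemma finite_highest: "finite highest" by (rule finite_subset[OF _ finite_pos_roots]) (auto simp: highest_def)

text \<open>At a dominant translate of \<open>Z\<close> a highest root is nonnegative and its image
  under \<open>w0\<close> nonpositive, while both lie in one orbit. So the highest roots vanish
  there, and with them all positive roots below.\<close>

lemma weyl_orbit_separates:
  assumes Z: "Z \<in> aa" and eq: "\<And>a m n. a \<in> highest \<Longrightarrow> m \<in> weyl_orbit a \<Longrightarrow> n \<in> weyl_orbit a \<Longrightarrow> B m Z = B n Z"
  shows "Z = 0"
proof -
  obtain t where t: "t \<in> T" "\<And>h. h \<in> pos_roots \<Longrightarrow> 0 \<le> B h (Ad G t Z)" using exists_dominant[OF Z] by blast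
  have tc: "t \<in> carrier G" by (rule T_carrier[OF t(1)])
  have it: "inv t \<in> T" by (rule T_inv[OF t(1)])
  have Hw0: "B a (Ad G t Z) \<le> 0" if a: "a \<in> highest" for a
  proof -
    have e: "B h (Ad G t Z) = B (Ad G (inv t) h) Z" for h using B_Ad_inv[of "inv t" h Z] tc by simp
    have "Ad G (inv t) a \<in> weyl_orbit a" using it by (auto simp: weyl_orbit_def)
    moreover have "Ad G (inv t) (Ad G w0 a) \<in> weyl_orbit a"
      unfolding weyl_orbit_def using T_mult[OF it w0] tc w0_carrier by (intro image_eqI[of _ _ "inv t \<otimes> w0"]) (simp_all add: Ad_mult)
    ultimately have "B a (Ad G t Z) = B (Ad G w0 a) (Ad G t Z)" unfolding e by (rule eq[OF a])
    moreover have "0 \<le> B (- Ad G w0 a) (Ad G t Z)" by (rule t(2)[OF flips]) (use a in \<open>simp add: highest_def\<close>)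
    ultimately show ?thesis by simp
  qed
  have Rp0: "B h (Ad G t Z) = 0" if h: "h \<in> pos_roots" for h
  proof -
    obtain a where a: "a \<in> highest" "\<forall>Z. (\<forall>b\<in>pos_roots. 0 \<le> B b Z) \<longrightarrow> B h Z \<le> B a Z" using highest_above[OF h] ..
    then have "B h (Ad G t Z) \<le> B a (Ad G t Z)" using t(2) by blast
    then show ?thesis using Hw0[OF a(1)] t(2)[OF h] by simp
  qed
  have "Ad G t Z = 0"
  proof (rule weights_span[OF T_aa[OF t(1) Z]])
    fix h assume "h \<in> Wt"
    from Wt_cases[OF this] show "B h (Ad G t Z) = 0"
    proof (elim disjE)
      assume "- h \<in> pos_roots"
      from Rp0[OF this] show ?thesis by simp
    qed (simp_all only: Rp0 B_simps)
  qed
  then show ?thesis using Ad_inv(1)[OF tc, of Z] by (simp add: linear_0[OF linear_Ad[OF inv_closed[OF tc]]])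
qed

section \<open>Stretching of highest root vectors\<close>

lemma ip_lower: obtains m where "m > 0" "\<And>X. m * (norm X)\<^sup>2 \<le> ip X X"
proof -
  have lin: "linear (\<lambda>X. ip X Y)" "linear (\<lambda>X. ip Y X)" for Y by (rule linearI; simp)+
  have bl: "bounded_bilinear ip" using lin by (simp add: bilinear_def flip: bilinear_conv_bounded_bilinear)
  have co: "continuous_on (sphere 0 1) (\<lambda>X. ip X X)"
    by (intro bounded_bilinear.continuous_on[OF bl] continuous_on_id)
  obtain b :: 'e where "b \<in> Basis" using nonempty_Basis by blast
  then have ne: "sphere (0::'e) 1 \<noteq> {}" by (auto intro!: exI[of _ b])
  obtain e where e: "e \<in> sphere 0 1" "\<And>X. X \<in> sphere 0 1 \<Longrightarrow> ip e e \<le> ip X X"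
    using continuous_attains_inf[OF compact_sphere ne co] by blast
  show thesis
  proof (rule that[of "ip e e"])
    show "0 < ip e e" using e(1) by (intro ip_pos) auto
    fix X :: 'e
    show "ip e e * (norm X)\<^sup>2 \<le> ip X X"
    proof (cases "X = 0")
      case False
      have "(1 / norm X) *\<^sub>R X \<in> sphere 0 1" using False by simp
      from e(2)[OF this] have "ip e e \<le> (1 / norm X) * ((1 / norm X) * ip X X)" by simp
      then show ?thesis using False by (simp add: field_simps power2_eq_square)
    qed simp
  qed
qed

lemma ip_upper: obtains C where "C > 0" "\<And>X Y. \<bar>ip X Y\<bar> \<le> C * norm X * norm Y"
proof -
  have lin: "linear (\<lambda>X. ip X Y)" "linear (\<lambda>X. ip Y X)" for Y by (rule linearI; simp)+
  have "bounded_bilinear ip" using lin by (simp add: bilinear_def flip: bilinear_conv_bounded_bilinear)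
  from bounded_bilinear.pos_bounded[OF this] obtain C where "C > 0" "\<And>X Y. norm (ip X Y) \<le> norm X * norm Y * C"
    by blast
  then show thesis by (intro that[of C]) (auto simp: mult_ac)
qed

definition unit_ws where "unit_ws a = {e \<in> ws a. ip e e = 1}"
definition sq_size where "sq_size m X = ip (pr m X) (pr m X)"
text \<open>Defined on all endomorphisms, so that continuity becomes the estimate of
  \<open>sq_size_lipschitz\<close>, which is uniform in the unit vector.\<close>

definition stretch where "stretch a m x = (SUP e\<in>unit_ws a. sq_size m (ap x e))"

lemma unit_ws_nonempty: "a \<in> Wt \<Longrightarrow> unit_ws a \<noteq> {}"
proof -
  assume "a \<in> Wt"
  then obtain X where X: "X \<in> ws a" "X \<noteq> 0" unfolding Wt_def using subspace_0[OF sub_ws] by auto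
  have p: "0 < ip X X" by (rule ip_pos[OF X(2)])
  let ?Y = "(1 / sqrt (ip X X)) *\<^sub>R X"
  have "sqrt (ip X X) * sqrt (ip X X) = ip X X" using p by simp
  then have "ip ?Y ?Y = 1" using p by (simp add: field_simps)
  then have "?Y \<in> unit_ws a" unfolding unit_ws_def using subspace_scale[OF sub_ws X(1)] by simp
  then show ?thesis by blast
qed

lemma sq_size_lipschitz:
  obtains D where "D > 0"
    "\<And>a e x y. e \<in> unit_ws a \<Longrightarrow> \<bar>sq_size m (ap x e) - sq_size m (ap y e)\<bar> \<le> D * norm (x - y) * (norm x + norm y)"
proof -
  obtain c where c: "c > 0" "\<And>X. c * (norm X)\<^sup>2 \<le> ip X X" using ip_lower by blast
  obtain C where C: "C > 0" "\<And>X Y. \<bar>ip X Y\<bar> \<le> C * norm X * norm Y" using ip_upper by blast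
  obtain E where E: "E > 0" "\<And>X. norm (pr m X) \<le> norm X * E"
    using bounded_linear.pos_bounded[of "pr m"] linear_pr[of m] by (auto simp: linear_conv_bounded_linear)
  \<comment> \<open>\<open>C\<close> bounds \<open>ip\<close>, \<open>E\<close> the projection and
    \<open>1 / c\<close> the square of \<open>norm e\<close>; the estimate is that of a difference
    of squares.\<close>
  show thesis
  proof (rule that[of "C * E\<^sup>2 / c"])
    show "0 < C * E\<^sup>2 / c" using C E c by simp
    fix a e x y assume e: "e \<in> unit_ws a"
    have "c * (norm e)\<^sup>2 \<le> 1" using c(2)[of e] e by (simp add: unit_ws_def)
    then have ne: "(norm e)\<^sup>2 \<le> 1 / c" using c(1) by (simp add: field_simps)
    let ?u = "pr m (ap x e)" and ?v = "pr m (ap y e)"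
    have uv: "?u - ?v = pr m (ap (x - y) e)" "?u + ?v = pr m (ap (x + y) e)"
      by (simp_all add: linear_diff[OF linear_pr] linear_add[OF linear_pr])
    have z: "norm (pr m (ap z e)) \<le> norm z * norm e * E" for z
      by (rule order_trans[OF E(2)]) (use norm_ap[of z e] E(1) in \<open>simp add: mult_right_mono\<close>)
    have b: "norm (?u - ?v) \<le> norm (x - y) * norm e * E" unfolding uv(1) by (rule z)
    have "norm (?u + ?v) \<le> norm (x + y) * norm e * E" unfolding uv(2) by (rule z)
    also have "\<dots> \<le> (norm x + norm y) * norm e * E"
      using E(1) by (intro mult_right_mono norm_triangle_ineq) auto
    finally have b': "norm (?u + ?v) \<le> (norm x + norm y) * norm e * E" .
    have "sq_size m (ap x e) - sq_size m (ap y e) = ip (?u - ?v) (?u + ?v)"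
      by (simp add: sq_size_def ip_sym[of ?v ?u])
    then have "\<bar>sq_size m (ap x e) - sq_size m (ap y e)\<bar> \<le> C * norm (?u - ?v) * norm (?u + ?v)" using C(2) by metis
    also have "\<dots> \<le> C * (norm (x - y) * norm e * E) * ((norm x + norm y) * norm e * E)"
      using b b' C(1) E(1) by (intro mult_mono) auto
    also have "\<dots> = (C * E\<^sup>2 * norm (x - y) * (norm x + norm y)) * (norm e)\<^sup>2"
      by (simp add: power2_eq_square mult_ac)
    also have "\<dots> \<le> (C * E\<^sup>2 * norm (x - y) * (norm x + norm y)) * (1 / c)"
      using ne C(1) by (intro mult_left_mono) auto
    finally show "\<bar>sq_size m (ap x e) - sq_size m (ap y e)\<bar> \<le> C * E\<^sup>2 / c * norm (x - y) * (norm x + norm y)"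
      by simp
  qed
qed

lemma stretch_bdd: "bdd_above ((\<lambda>e. sq_size m (ap x e)) ` unit_ws a)"
proof -
  obtain D where D: "\<And>a e x y. e \<in> unit_ws a \<Longrightarrow> \<bar>sq_size m (ap x e) - sq_size m (ap y e)\<bar> \<le> D * norm (x - y) * (norm x + norm y)"
    using sq_size_lipschitz by metis
  have z: "sq_size m 0 = 0" by (simp add: sq_size_def linear_0[OF linear_pr])
  show ?thesis
  proof (rule bdd_aboveI2)
    fix e assume "e \<in> unit_ws a"
    from D[OF this, of x 0] show "sq_size m (ap x e) \<le> D * norm x * norm x" by (simp add: z)
  qed
qed

lemma continuous_on_stretch: assumes a: "a \<in> Wt" shows "continuous_on UNIV (stretch a m)"
  unfolding continuous_on_eq_continuous_at[OF open_UNIV]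
proof
  fix x
  obtain D where D: "D > 0" "\<And>a e x y. e \<in> unit_ws a \<Longrightarrow> \<bar>sq_size m (ap x e) - sq_size m (ap y e)\<bar> \<le> D * norm (x - y) * (norm x + norm y)"
    using sq_size_lipschitz by metis
  have le: "stretch a m x \<le> stretch a m y + D * norm (x - y) * (norm x + norm y)" for x y
    unfolding stretch_def[of a m x]
  proof (rule cSUP_least[OF unit_ws_nonempty[OF a]])
    fix e assume e: "e \<in> unit_ws a"
    have "sq_size m (ap y e) \<le> stretch a m y" unfolding stretch_def by (rule cSUP_upper[OF e stretch_bdd])
    then show "sq_size m (ap x e) \<le> stretch a m y + D * norm (x - y) * (norm x + norm y)" using D(2)[OF e, of x y] by linarith
  qed
  have n: "norm (stretch a m y - stretch a m x) \<le> D * norm (y - x) * (norm y + norm x)" for y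
    using le[of x y] le[of y x] by (simp add: norm_minus_commute add.commute abs_le_iff)
  have l: "((\<lambda>y. D * norm (y - x) * (norm y + norm x)) \<longlongrightarrow> 0) (at x)"
    by (auto intro!: tendsto_eq_intros)
  have "((\<lambda>y. stretch a m y - stretch a m x) \<longlongrightarrow> 0) (at x)"
    by (rule Lim_null_comparison[OF _ l]) (intro always_eventually allI n)
  then show "isCont (stretch a m) x" by (simp add: isCont_def LIM_zero_iff)
qed

lemma stretch_scale:
  assumes a: "a \<in> Wt" and k: "0 < k" and eq: "\<And>e. e \<in> unit_ws a \<Longrightarrow> sq_size m (ap y e) = k * sq_size m (ap x e)"
  shows "stretch a m y = k * stretch a m x"
proof -
  have "stretch a m y = (SUP s\<in>(\<lambda>e. sq_size m (ap x e)) ` unit_ws a. k * s)"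
    unfolding stretch_def image_image using eq by (intro arg_cong[of _ _ Sup] image_cong) auto
  also have "\<dots> = k * stretch a m x"
    unfolding stretch_def
    by (rule continuous_at_Sup_mono[symmetric]) (use k unit_ws_nonempty[OF a] stretch_bdd in \<open>auto intro!: monoI mult_left_mono continuous_intros\<close>)
  finally show ?thesis .
qed

lemma stretch_A_left:
  assumes a: "a \<in> Wt" and H: "H \<in> aa" and h: "h \<in> carrier G"
  shows "stretch a m (AdE (expG H \<otimes> h)) = exp (2 * B m H) * stretch a m (AdE h)"
  by (rule stretch_scale[OF a]) (use h in \<open>simp_all add: AdE_mult AdE_exp sq_size_def pr_exp_aa[OF H] mult_exp_exp flip: mult.assoc\<close>)

lemma stretch_A_right:
  assumes a: "a \<in> Wt" and H: "H \<in> aa" and h: "h \<in> carrier G"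
  shows "stretch a m (AdE (h \<otimes> expG H)) = exp (2 * B a H) * stretch a m (AdE h)"
proof (rule stretch_scale[OF a])
  fix e assume "e \<in> unit_ws a"
  then have "ap (exp (adE H)) e = exp (B a H) *\<^sub>R e" by (intro exp_aa_ws[OF H]) (simp add: unit_ws_def)
  then show "sq_size m (ap (AdE (h \<otimes> expG H)) e) = exp (2 * B a H) * sq_size m (ap (AdE h) e)"
    using h by (simp add: AdE_mult AdE_exp sq_size_def linear_scale[OF linear_Ad[OF h]] linear_scale[OF linear_pr] mult_exp_exp flip: mult.assoc)
qed simp

lemma stretch_M_left:
  assumes m: "m \<in> aa" and k: "k \<in> M" and h: "h \<in> carrier G"
  shows "stretch a m (AdE (k \<otimes> h)) = stretch a m (AdE h)"
proof -
  have kc: "k \<in> carrier G" and kK: "k \<in> K" and km: "Ad G k m = m" using M_carrier[OF k] k m by (auto simp: M_iff)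
  have "pr m (Ad G k X) = Ad G k (pr m X)" for X using Ad_T_pr[OF M_T[OF k] m, of X] by (simp add: km)
  then have "sq_size m (Ad G k X) = sq_size m X" for X by (simp add: sq_size_def ip_Ad_K[OF kK])
  then show ?thesis using h kc by (simp add: stretch_def AdE_mult)
qed

text \<open>\<open>M\<close> permutes the unit vectors of the root space.\<close>

lemma stretch_M_right:
  assumes a: "a \<in> aa" and k: "k \<in> M" and h: "h \<in> carrier G"
  shows "stretch a m (AdE (h \<otimes> k)) = stretch a m (AdE h)"
proof -
  have kc: "k \<in> carrier G" and kK: "k \<in> K" using M_carrier[OF k] k by (auto simp: M_iff)
  have sub: "Ad G k ` unit_ws a \<subseteq> unit_ws a" if k: "k \<in> M" for k
    using Ad_M_ws[OF k a] ip_Ad_K[of k] k by (auto simp: unit_ws_def M_iff)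
  have "unit_ws a = Ad G k ` Ad G (inv k) ` unit_ws a" using kc by (simp add: image_image Ad_inv)
  then have "Ad G k ` unit_ws a = unit_ws a" using sub[OF k] sub[OF subgroup.m_inv_closed[OF subM k]] by blast
  moreover have "(\<lambda>e. sq_size m (ap (AdE (h \<otimes> k)) e)) ` unit_ws a = (\<lambda>e. sq_size m (ap (AdE h) e)) ` Ad G k ` unit_ws a"
    using h kc by (simp add: image_image AdE_mult)
  ultimately show ?thesis by (simp only: stretch_def)
qed

lemma Ad_N_highest: "a \<in> highest \<Longrightarrow> n \<in> N \<Longrightarrow> e \<in> ws a \<Longrightarrow> Ad G n e = e"
proof -
  assume a: "a \<in> highest" and n: "n \<in> N" and e: "e \<in> ws a"
  obtain X where X: "X \<in> gr pos" "n = expG X" using n by (auto simp: N_eq)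
  have aa: "a \<in> aa" using a pos_roots_aa by (simp add: highest_def)
  have X': "X \<in> gr (pos \<inter> Wt)" using X(1) by (auto simp: gr_def)
  have e': "e \<in> gr {a}" by (rule ws_gr[OF e _ aa]) simp
  have b: "bracket G X e \<in> gr {}"
    by (rule gr_bracket[OF X' e']) (use a in \<open>auto simp: highest_def add.commute\<close>)
  have "bracket G X e = 0" by (rule gr_disjoint[OF b b]) auto
  then have "ap (adE X) e = 0 *\<^sub>R e" by simp
  then have "ap (exp (adE X)) e = exp 0 *\<^sub>R e" by (rule ap_exp_eigenvector)
  then show ?thesis by (simp add: X(2) flip: AdE_exp)
qed

lemma stretch_N_right:
  assumes a: "a \<in> highest" and n: "n \<in> N" and h: "h \<in> carrier G"
  shows "stretch a m (AdE (h \<otimes> n)) = stretch a m (AdE h)"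
  unfolding stretch_def using h N_carrier[OF n] Ad_N_highest[OF a n]
  by (intro arg_cong[of _ _ Sup] image_cong) (simp_all add: AdE_mult unit_ws_def)

section \<open>Positivity at generic elements\<close>

definition generic where "generic = {h \<in> carrier G. \<forall>t\<in>T. opposite G P w0 (h <#\<^bsub>G\<^esub> P) (t <#\<^bsub>G\<^esub> P)}"

lemma generic_carrier: "h \<in> generic \<Longrightarrow> h \<in> carrier G" by (simp add: generic_def)

lemma generic_factor:
  assumes h: "h \<in> generic" and t: "t \<in> T" obtains p q where "p \<in> P" "q \<in> P" "h \<otimes> p \<otimes> w0 = t \<otimes> q"
proof -
  have hc: "h \<in> carrier G" by (rule generic_carrier[OF h])
  have tc: "t \<in> carrier G" by (rule T_carrier[OF t])
  obtain g where g: "g \<in> carrier G" "h <#\<^bsub>G\<^esub> P = g <#\<^bsub>G\<^esub> P" "t <#\<^bsub>G\<^esub> P = g <#\<^bsub>G\<^esub> (w0 <#\<^bsub>G\<^esub> P)"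
    using h t by (auto simp: generic_def opposite_def)
  have "t <#\<^bsub>G\<^esub> P = (g \<otimes> w0) <#\<^bsub>G\<^esub> P" using g(3) lcos_m_assoc[OF Psub g(1) w0_carrier] by simp
  then have q: "inv t \<otimes> (g \<otimes> w0) \<in> P" using g(1) tc w0_carrier by (simp add: l_coset_eq_iff[OF subP])
  have p: "inv h \<otimes> g \<in> P" using g(1,2) hc by (simp add: l_coset_eq_iff[OF subP])
  show thesis by (rule that[OF p q]) (use g(1) hc tc w0_carrier in \<open>simp add: m_assoc inv_mult_cancel\<close>)
qed

text \<open>\<open>N\<close> changes \<open>e\<close> only by weights with a larger value at
  \<open>H0\<close>, and \<open>MA\<close> acts invertibly on each weight space; so the component of
  weight \<open>h\<close> survives.\<close>

lemma pr_P_lowest: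
  assumes q: "q \<in> P" and h: "h \<in> aa" and e: "e \<in> ws h" "e \<noteq> 0" shows "pr h (Ad G q e) \<noteq> 0"
proof -
  obtain l n where ln: "l \<in> MA" "n \<in> N" "q = l \<otimes> n" using q unfolding P_iff by blast
  have c: "l \<in> carrier G" "n \<in> carrier G" using ln MA_carrier N_carrier by auto
  let ?S = "{k. B h H0 < B k H0}"
  obtain X where X: "X \<in> gr pos" "n = expG X" using ln(2) by (auto simp: N_eq)
  have "ap (exp (adE X)) e - e \<in> gr ?S"
  proof (rule ap_exp_diff_subspace[OF sub_gr])
    show "ap (adE X) v \<in> gr ?S" if "v \<in> gr ?S" for v
      using gr_bracket[OF X(1) that, of ?S] by simp
    show "ap (adE X) e \<in> gr ?S" using gr_bracket[OF X(1) ws_gr[OF e(1) _ h, of "{h}"], of ?S] by simp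
  qed
  then have d: "Ad G n e - e \<in> gr ?S" by (simp add: X(2) flip: AdE_exp)
  have lin: "linear (Ad G l)" by (rule linear_Ad[OF c(1)])
  have "Ad G q e = Ad G l e + Ad G l (Ad G n e - e)" using c by (simp add: ln(3) Ad_mult linear_diff[OF lin])
  moreover have "Ad G l (Ad G n e - e) \<in> gr ?S" by (rule Ad_MA_gr[OF ln(1) d])
  then have "pr h (Ad G l (Ad G n e - e)) = 0" by (cases "h \<in> Wt") (auto simp: gr_def pr_def)
  ultimately have pq: "pr h (Ad G q e) = pr h (Ad G l e)" by (simp add: linear_add[OF linear_pr])
  have "e \<in> gr {h}" by (rule ws_gr[OF e(1) _ h]) simp
  then have "Ad G l e \<in> gr {h}" by (rule Ad_MA_gr[OF ln(1)])
  then have "(\<Sum>k\<in>Wt. pr k (Ad G l e)) = (\<Sum>k\<in>Wt. if k = h then pr h (Ad G l e) else 0)"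
    by (intro sum.cong) (auto simp: gr_def)
  also have "\<dots> = pr h (Ad G l e)" using finite_Wt by (simp add: pr_def)
  finally have "Ad G l e = pr h (Ad G l e)" using pr(2)[of "Ad G l e"] by simp
  moreover have "Ad G l e \<noteq> 0" using e(2) Ad_inv(1)[OF c(1), of e] linear_0[OF linear_Ad[OF inv_closed[OF c(1)]]] by metis
  ultimately show ?thesis using pq by simp
qed

text \<open>For \<open>m = Ad s a\<close> the choice \<open>t = s w0\<close> in
  \<open>generic_factor\<close> writes \<open>h\<close> as the product of \<open>t\<close>,
  \<open>q\<close>, \<open>inv w0\<close> and \<open>inv p\<close>. Here \<open>inv p\<close> keeps
  the root space of \<open>a\<close>, \<open>inv w0\<close> carries it to that of \<open>b\<close>,
  \<open>q\<close> leaves a nonzero component of weight \<open>b\<close>, and \<open>t\<close> takes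
  \<open>b\<close> to \<open>m\<close>.\<close>

lemma stretch_pos:
  assumes h: "h \<in> generic" and a: "a \<in> highest" and m: "m \<in> weyl_orbit a" shows "0 < stretch a m (AdE h)"
proof -
  have hc: "h \<in> carrier G" by (rule generic_carrier[OF h])
  have aW: "a \<in> Wt" "a \<in> aa" using a pos_roots_aa by (auto simp: highest_def)
  obtain s where s: "s \<in> T" "m = Ad G s a" using m by (auto simp: weyl_orbit_def)
  define t where "t = s \<otimes> w0"
  have t: "t \<in> T" unfolding t_def by (rule T_mult[OF s(1) w0])
  have c: "s \<in> carrier G" "w0 \<in> carrier G" "t \<in> carrier G" using s t w0 T_carrier by auto
  obtain p q where pq: "p \<in> P" "q \<in> P" "h \<otimes> p \<otimes> w0 = t \<otimes> q" using generic_factor[OF h t] by blast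
  have pc: "p \<in> carrier G" "q \<in> carrier G" using pq P_carrier by auto
  obtain e where e: "e \<in> unit_ws a" using unit_ws_nonempty[OF aW(1)] by blast
  have e1: "e \<in> ws a" "e \<noteq> 0" using e by (auto simp: unit_ws_def)
  let ?iw = "inv w0"
  define b where "b = Ad G ?iw a"
  have iw: "?iw \<in> T" by (rule T_inv[OF w0])
  have b: "b \<in> aa" unfolding b_def by (rule T_aa[OF iw aW(2)])
  obtain l n where ln: "l \<in> MA" "n \<in> N" "p = n \<otimes> l" using pq(1) unfolding P_iff' by blast
  have lc: "l \<in> carrier G" "n \<in> carrier G" using ln MA_carrier N_carrier by auto
  have il: "inv l \<in> MA" by (rule subgroup.m_inv_closed[OF subMA ln(1)])
  obtain f where f: "f \<in> ws a" "f \<noteq> 0" "Ad G (inv p) e = f"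
  proof -
    have "Ad G (inv n) e = e" by (rule Ad_N_highest[OF a subgroup.m_inv_closed[OF subN ln(2)] e1(1)])
    then have ip: "Ad G (inv p) e = Ad G (inv l) e" using lc by (simp add: ln(3) inv_mult_group Ad_mult)
    obtain k c where kc: "k \<in> M" "c \<in> A" "inv l = k \<otimes> c" using il by (auto simp: MA_def)
    obtain H where H: "H \<in> aa" "c = expG H" using kc(2) by (auto simp: A_eq)
    have "Ad G c e = exp (B a H) *\<^sub>R e" using exp_aa_ws[OF H(1) e1(1)] by (simp add: H(2) flip: AdE_exp)
    then have "Ad G c e \<in> ws a" using subspace_scale[OF sub_ws e1(1)] by simp
    then have "Ad G (inv l) e \<in> ws a"
      using Ad_M_ws[OF kc(1) aW(2)] M_carrier[OF kc(1)] A_carrier[OF kc(2)] by (simp add: kc(3) Ad_mult)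
    moreover have "Ad G (inv p) e \<noteq> 0"
      using e1(2) Ad_inv(2)[OF pc(1), of e] linear_0[OF linear_Ad[OF pc(1)]] by metis
    ultimately show ?thesis using that ip by simp
  qed
  define u where "u = Ad G ?iw f"
  have u: "u \<in> ws b" unfolding u_def b_def by (rule Ad_T_ws[OF iw f(1)])
  have u0: "u \<noteq> 0" unfolding u_def
    using f(2) Ad_inv(2)[OF c(2), of f] linear_0[OF linear_Ad[OF c(2)]] by metis
  have pu: "pr b (Ad G q u) \<noteq> 0" by (rule pr_P_lowest[OF pq(2) b u u0])
  have "h = t \<otimes> q \<otimes> ?iw \<otimes> inv p" using hc c pc pq(3) by (metis inv_solve_right m_closed)
  then have hu: "Ad G h e = Ad G t (Ad G q u)" using c pc by (simp add: Ad_mult u_def f(3))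
  have "Ad G t b = m" using c by (simp add: t_def b_def s(2) Ad_mult Ad_inv)
  then have "pr m (Ad G h e) = Ad G t (pr b (Ad G q u))" using Ad_T_pr[OF t b, of "Ad G q u"] by (simp add: hu)
  then have "pr m (Ad G h e) \<noteq> 0"
    using pu Ad_inv(1)[OF c(3), of "pr b (Ad G q u)"] linear_0[OF linear_Ad[OF inv_closed[OF c(3)]]] by metis
  then have "0 < sq_size m (ap (AdE h) e)" using hc ip_pos by (simp add: sq_size_def)
  also have "\<dots> \<le> stretch a m (AdE h)" unfolding stretch_def by (rule cSUP_upper[OF e stretch_bdd])
  finally show ?thesis .
qed

end

context opposed_group
begin

section \<open>The function Psi\<close>

definition orbit_pairs where "orbit_pairs = Sigma highest (\<lambda>a. weyl_orbit a \<times> weyl_orbit a)"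

lemma finite_orbit_pairs: "finite orbit_pairs" unfolding orbit_pairs_def by (intro finite_SigmaI finite_highest finite_cartesian_product finite_weyl_orbit)

lemma orbit_pairs_D: "(a, m, n) \<in> orbit_pairs \<Longrightarrow> a \<in> highest \<and> m \<in> weyl_orbit a \<and> n \<in> weyl_orbit a" by (simp add: orbit_pairs_def)

definition log_stretch where
  "log_stretch x = (\<Sum>(a, m, n)\<in>orbit_pairs. ((ln (stretch a m x) - ln (stretch a n x)) / 2) *\<^sub>R (m - n))"
definition orbit_form where "orbit_form Z = (\<Sum>(a, m, n)\<in>orbit_pairs. (B m Z - B n Z) *\<^sub>R (m - n))"

lemma linear_orbit_form: "linear orbit_form"
  by (rule linearI) (simp_all add: orbit_form_def case_prod_unfold sum.distrib[symmetric] scaleR_sum_right algebra_simps)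

lemma orbit_form_pos:
  assumes Z: "Z \<in> aa" and orbit_form: "orbit_form Z = 0" shows "Z = 0"
proof (rule weyl_orbit_separates[OF Z])
  fix a m n assume a: "a \<in> highest" "m \<in> weyl_orbit a" "n \<in> weyl_orbit a"
  have "(\<Sum>(a, m, n)\<in>orbit_pairs. (B m Z - B n Z)\<^sup>2) = B (orbit_form Z) Z"
    unfolding orbit_form_def B_sum by (intro sum.cong) (auto simp: power2_eq_square)
  then have s: "(\<Sum>(a, m, n)\<in>orbit_pairs. (B m Z - B n Z)\<^sup>2) = 0" by (simp add: orbit_form)
  have "(B m Z - B n Z)\<^sup>2 \<le> (\<Sum>(a, m, n)\<in>orbit_pairs. (B m Z - B n Z)\<^sup>2)"
    using member_le_sum[of "(a, m, n)" orbit_pairs "\<lambda>(a, m, n). (B m Z - B n Z)\<^sup>2"] a finite_orbit_pairs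
    by (auto simp: orbit_pairs_def)
  then have "(B m Z - B n Z)\<^sup>2 \<le> 0" unfolding s .
  then show "B m Z = B n Z" by simp
qed

text \<open>A left inverse whose values lie in \<open>aa\<close> for every argument, so that
  \<open>Psi\<close> has values in \<open>aa\<close> by construction.\<close>

definition orbit_form_inv where "orbit_form_inv = (SOME g. g ` UNIV \<subseteq> aa \<and> linear g \<and> (\<forall>Z\<in>aa. g (orbit_form Z) = Z))"

lemma orbit_form_inv: "orbit_form_inv X \<in> aa" "linear orbit_form_inv" "Z \<in> aa \<Longrightarrow> orbit_form_inv (orbit_form Z) = Z"
proof -
  have "inj_on orbit_form aa"
  proof (rule inj_onI)
    fix X Y assume XY: "X \<in> aa" "Y \<in> aa" "orbit_form X = orbit_form Y"
    have "X - Y = 0" by (rule orbit_form_pos) (use XY in \<open>simp_all add: linear_diff[OF linear_orbit_form] subspace_diff[OF sub_aa]\<close>)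
    then show "X = Y" by simp
  qed
  from linear_exists_left_inverse_on[OF linear_orbit_form sub_aa this]
  have "orbit_form_inv ` UNIV \<subseteq> aa \<and> linear orbit_form_inv \<and> (\<forall>Z\<in>aa. orbit_form_inv (orbit_form Z) = Z)" unfolding orbit_form_inv_def by (rule someI_ex)
  then show "orbit_form_inv X \<in> aa" "linear orbit_form_inv" "Z \<in> aa \<Longrightarrow> orbit_form_inv (orbit_form Z) = Z" by auto
qed

definition Psi where "Psi h = orbit_form_inv (log_stretch (AdE h))"

lemma Psi_aa: "Psi h \<in> aa" by (simp add: Psi_def orbit_form_inv)

text \<open>The part \<open>f a\<close> of the exponent depends on the highest root only and cancels
  in the differences. Left translation uses \<open>f = 0\<close>, right translation
  \<open>H = 0\<close>.\<close>

lemma log_stretch_shift: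
  assumes "\<And>a m. a \<in> highest \<Longrightarrow> m \<in> weyl_orbit a \<Longrightarrow> 0 < stretch a m x"
    and "\<And>a m. a \<in> highest \<Longrightarrow> m \<in> weyl_orbit a \<Longrightarrow> stretch a m y = exp (2 * (f a + B m H)) * stretch a m x"
  shows "log_stretch y = log_stretch x + orbit_form H"
proof -
  have l: "ln (stretch a m y) = 2 * (f a + B m H) + ln (stretch a m x)" if "a \<in> highest" "m \<in> weyl_orbit a" for a m
    unfolding assms(2)[OF that] using assms(1)[OF that] by (simp add: ln_mult)
  show ?thesis
    unfolding log_stretch_def orbit_form_def sum.distrib[symmetric]
  proof (rule sum.cong[OF refl])
    fix z assume z: "z \<in> orbit_pairs"
    obtain a m n where e: "z = (a, m, n)" by (metis prod_cases3)
    have t: "a \<in> highest" "m \<in> weyl_orbit a" "n \<in> weyl_orbit a" using orbit_pairs_D z e by auto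
    have "(ln (stretch a m y) - ln (stretch a n y)) / 2 = (ln (stretch a m x) - ln (stretch a n x)) / 2 + (B m H - B n H)"
      using l[OF t(1,2)] l[OF t(1,3)] by (simp add: field_simps)
    then show "(case z of (a, m, n) \<Rightarrow> ((ln (stretch a m y) - ln (stretch a n y)) / 2) *\<^sub>R (m - n)) =
        (case z of (a, m, n) \<Rightarrow> ((ln (stretch a m x) - ln (stretch a n x)) / 2) *\<^sub>R (m - n)) +
        (case z of (a, m, n) \<Rightarrow> (B m H - B n H) *\<^sub>R (m - n))"
      unfolding e by (simp only: prod.case scaleR_left_distrib)
  qed
qed

lemma highest_Wt: "a \<in> highest \<Longrightarrow> a \<in> Wt" and highest_aa: "a \<in> highest \<Longrightarrow> a \<in> aa"
  using pos_roots_aa by (auto simp: highest_def)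

lemma Psi_left:
  assumes h: "h \<in> generic" and H: "H \<in> aa" and k: "k \<in> M"
  shows "Psi (k \<otimes> (expG H \<otimes> h)) = Psi h + H"
proof -
  have hc: "h \<in> carrier G" by (rule generic_carrier[OF h])
  have "log_stretch (AdE (k \<otimes> (expG H \<otimes> h))) = log_stretch (AdE h) + orbit_form H"
    by (rule log_stretch_shift[where f = "\<lambda>_. 0"])
      (use stretch_pos[OF h] in \<open>simp_all add: stretch_M_left[OF weyl_orbit_aa k] stretch_A_left[OF highest_Wt H] hc\<close>)
  then show ?thesis using orbit_form_inv H by (simp add: Psi_def linear_add)
qed

lemma Psi_right:
  assumes h: "h \<in> generic" and p: "p \<in> P" shows "Psi (h \<otimes> p) = Psi h"
proof -
  have hc: "h \<in> carrier G" by (rule generic_carrier[OF h])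
  obtain l n where ln: "l \<in> MA" "n \<in> N" "p = l \<otimes> n" using p unfolding P_iff by blast
  obtain k c where kc: "k \<in> M" "c \<in> A" "l = k \<otimes> c" using ln(1) by (auto simp: MA_def)
  obtain H where H: "H \<in> aa" "c = expG H" using kc(2) by (auto simp: A_eq)
  have c: "k \<in> carrier G" "n \<in> carrier G" using M_carrier[OF kc(1)] N_carrier[OF ln(2)] by auto
  have "h \<otimes> p = h \<otimes> k \<otimes> expG H \<otimes> n" using c hc by (simp add: ln(3) kc(3) H(2) m_assoc)
  moreover have "stretch a m (AdE (h \<otimes> k \<otimes> expG H \<otimes> n)) = exp (2 * B a H) * stretch a m (AdE h)" if a: "a \<in> highest" for a m
    using c hc by (simp add: stretch_N_right[OF a ln(2)] stretch_A_right[OF highest_Wt[OF a] H(1)] stretch_M_right[OF highest_aa[OF a] kc(1)])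
  ultimately have "log_stretch (AdE (h \<otimes> p)) = log_stretch (AdE h) + orbit_form 0"
    by (intro log_stretch_shift[where f = "\<lambda>a. B a H"]) (use stretch_pos[OF h] in simp_all)
  then show ?thesis by (simp add: Psi_def linear_0[OF linear_orbit_form])
qed

lemma l_coset_mult: "g \<in> carrier G \<Longrightarrow> h \<in> carrier G \<Longrightarrow> g <#\<^bsub>G\<^esub> (h <#\<^bsub>G\<^esub> P) = (g \<otimes> h) <#\<^bsub>G\<^esub> P"
  "g \<in> carrier G \<Longrightarrow> h \<in> carrier G \<Longrightarrow> g <#\<^bsub>G\<^esub> (h <#\<^bsub>G\<^esub> K) = (g \<otimes> h) <#\<^bsub>G\<^esub> K"
  using lcos_m_assoc[OF Psub] lcos_m_assoc[OF Ksub] by auto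

lemma generic_right: "h \<in> generic \<Longrightarrow> p \<in> P \<Longrightarrow> h \<otimes> p \<in> generic"
proof -
  assume h: "h \<in> generic" and p: "p \<in> P"
  have c: "h \<in> carrier G" "p \<in> carrier G" using h p generic_carrier P_carrier by auto
  have "h <#\<^bsub>G\<^esub> P = (h \<otimes> p) <#\<^bsub>G\<^esub> P" using c p by (subst l_coset_eq_iff[OF subP]) (simp_all add: inv_mult_cancel)
  then show ?thesis using h c by (simp add: generic_def)
qed

section \<open>The map Phi and its equivariance\<close>

definition flat_point where "flat_point g h = (g \<otimes> expG (Psi (inv g \<otimes> h))) <#\<^bsub>G\<^esub> K"

lemma opposite_pair_MA:
  assumes c: "g \<in> carrier G" "g' \<in> carrier G"
    and eq: "g <#\<^bsub>G\<^esub> P = g' <#\<^bsub>G\<^esub> P" "(g \<otimes> w0) <#\<^bsub>G\<^esub> P = (g' \<otimes> w0) <#\<^bsub>G\<^esub> P"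
  shows "inv g \<otimes> g' \<in> MA"
proof (rule P_opposite_MA[OF _ _ w0])
  show "inv g \<otimes> g' \<in> P" using eq(1) c by (simp add: l_coset_eq_iff[OF subP])
  show "inv (g \<otimes> w0) \<otimes> (g' \<otimes> w0) \<in> P" using eq(2) c w0_carrier by (simp add: l_coset_eq_iff[OF subP])
  show "inv g \<otimes> g' \<otimes> w0 = w0 \<otimes> (inv (g \<otimes> w0) \<otimes> (g' \<otimes> w0))"
    using c w0_carrier by (simp add: inv_mult_group m_assoc inv_mult_cancel)
qed

text \<open>Another representative of the pair is \<open>g\<close> times \<open>expG H\<close> and
  some \<open>k\<close> in \<open>M\<close>, which shifts \<open>Psi\<close> by \<open>- H\<close>.
  The factor \<open>expG H\<close> restores the point, and \<open>k\<close> is absorbed by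
  \<open>K\<close>.\<close>

lemma flat_point_eq:
  assumes c: "g \<in> carrier G" "g' \<in> carrier G" "h \<in> carrier G" "h' \<in> carrier G"
    and eq: "g <#\<^bsub>G\<^esub> P = g' <#\<^bsub>G\<^esub> P" "(g \<otimes> w0) <#\<^bsub>G\<^esub> P = (g' \<otimes> w0) <#\<^bsub>G\<^esub> P" "h <#\<^bsub>G\<^esub> P = h' <#\<^bsub>G\<^esub> P"
    and gh: "inv g \<otimes> h \<in> generic"
  shows "flat_point g h = flat_point g' h'"
proof -
  define p where "p = inv h \<otimes> h'"
  have p: "p \<in> P" using eq(3) c by (simp add: p_def l_coset_eq_iff[OF subP])
  have pc: "p \<in> carrier G" by (rule P_carrier[OF p])
  obtain k b where kb: "k \<in> M" "b \<in> A" "inv g \<otimes> g' = k \<otimes> b"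
    using opposite_pair_MA[OF c(1,2) eq(1,2)] by (auto simp: MA_def)
  obtain H where H: "H \<in> aa" "b = expG H" using kb(2) by (auto simp: A_eq)
  have kc: "k \<in> carrier G" by (rule M_carrier[OF kb(1)])
  have ik: "inv k \<in> M" by (rule subgroup.m_inv_closed[OF subM kb(1)])
  have mH: "- H \<in> aa" by (rule subspace_neg[OF sub_aa H(1)])
  have kH: "k \<otimes> expG H = expG H \<otimes> k" by (rule M_A_commute[OF kb(1)]) (use H in \<open>simp add: A_eq\<close>)
  have g': "g' = g \<otimes> (expG H \<otimes> k)"
    using kb(3) c kc by (metis H(2) exp_closed kH inv_solve_left m_closed)
  have h': "h' = h \<otimes> p" using c by (simp add: p_def inv_mult_cancel)
  define y where "y = inv g \<otimes> h"
  have yc: "y \<in> carrier G" using c by (simp add: y_def)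
  have "inv g' \<otimes> h' = inv k \<otimes> (expG (- H) \<otimes> (y \<otimes> p))"
    using c kc pc by (simp add: g' h' y_def inv_mult_group expG_minus m_assoc)
  then have "Psi (inv g' \<otimes> h') = Psi (y \<otimes> p) + - H"
    using Psi_left[OF generic_right[OF gh p] mH ik] by (simp only: y_def)
  then have Ps: "Psi (inv g' \<otimes> h') = Psi y - H" using Psi_right[OF gh p] by (simp add: y_def)
  have d: "Psi y - H \<in> aa" by (intro subspace_diff[OF sub_aa] Psi_aa H)
  have "k \<otimes> expG (Psi y - H) = expG (Psi y - H) \<otimes> k"
    by (rule M_A_commute[OF kb(1)]) (use d in \<open>simp add: A_eq\<close>)
  moreover have "expG H \<otimes> expG (Psi y - H) = expG (Psi y)" using exp_aa_mult[OF H(1) d] by simp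
  ultimately have "g' \<otimes> expG (Psi y - H) = g \<otimes> expG (Psi y) \<otimes> k"
    using c kc by (simp add: g' m_assoc) (metis exp_closed m_assoc m_closed)
  moreover have "(g \<otimes> expG (Psi y) \<otimes> k) <#\<^bsub>G\<^esub> K = (g \<otimes> expG (Psi y)) <#\<^bsub>G\<^esub> K"
  proof (subst l_coset_eq_iff[OF subK])
    show "inv (g \<otimes> expG (Psi y) \<otimes> k) \<otimes> (g \<otimes> expG (Psi y)) \<in> K"
      using c kc ik by (simp add: inv_mult_group m_assoc inv_mult_cancel M_iff)
  qed (use c kc in simp_all)
  ultimately show ?thesis unfolding flat_point_def Ps by (simp add: y_def)
qed

text \<open>Meaningful on admissible triples, where \<open>Phi_eval\<close> shows that the choice is
  unique.\<close>

definition Phi where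
  "Phi = (\<lambda>(x, y, z). SOME C. \<exists>g\<in>carrier G. \<exists>h\<in>carrier G. x = g <#\<^bsub>G\<^esub> P \<and> y = (g \<otimes> w0) <#\<^bsub>G\<^esub> P \<and>
     z = h <#\<^bsub>G\<^esub> P \<and> C = flat_point g h)"

lemma Phi_eval:
  assumes c: "g \<in> carrier G" "h \<in> carrier G" and gh: "inv g \<otimes> h \<in> generic"
  shows "Phi (g <#\<^bsub>G\<^esub> P, (g \<otimes> w0) <#\<^bsub>G\<^esub> P, h <#\<^bsub>G\<^esub> P) = flat_point g h"
  unfolding Phi_def prod.case
proof (rule some_equality)
  show "\<exists>g'\<in>carrier G. \<exists>h'\<in>carrier G. g <#\<^bsub>G\<^esub> P = g' <#\<^bsub>G\<^esub> P \<and> (g \<otimes> w0) <#\<^bsub>G\<^esub> P = (g' \<otimes> w0) <#\<^bsub>G\<^esub> P \<and>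
     h <#\<^bsub>G\<^esub> P = h' <#\<^bsub>G\<^esub> P \<and> flat_point g h = flat_point g' h'"
    by (intro bexI[of _ g] bexI[of _ h] conjI refl c)
  fix C assume "\<exists>g'\<in>carrier G. \<exists>h'\<in>carrier G. g <#\<^bsub>G\<^esub> P = g' <#\<^bsub>G\<^esub> P \<and> (g \<otimes> w0) <#\<^bsub>G\<^esub> P = (g' \<otimes> w0) <#\<^bsub>G\<^esub> P \<and>
     h <#\<^bsub>G\<^esub> P = h' <#\<^bsub>G\<^esub> P \<and> C = flat_point g' h'"
  then obtain g' h' where "g' \<in> carrier G" "h' \<in> carrier G" "g <#\<^bsub>G\<^esub> P = g' <#\<^bsub>G\<^esub> P"
    "(g \<otimes> w0) <#\<^bsub>G\<^esub> P = (g' \<otimes> w0) <#\<^bsub>G\<^esub> P" "h <#\<^bsub>G\<^esub> P = h' <#\<^bsub>G\<^esub> P" "C = flat_point g' h'"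
    by (elim bexE conjE)
  then show "C = flat_point g h" using flat_point_eq[OF c(1) _ c(2)] gh by simp
qed

lemma topspace_homogeneous: "topspace (homogeneous_space G H) = (\<lambda>g. g <#\<^bsub>G\<^esub> H) ` carrier G"
  using quotient_imp_surjective_map[OF quotient_map_quotient_topology[of gT "\<lambda>g. g <#\<^bsub>G\<^esub> H"]]
  by (simp add: homogeneous_space_def topspace_gtop)

lemma openin_homogeneous:
  "openin (homogeneous_space G H) U \<longleftrightarrow>
     U \<subseteq> (\<lambda>g. g <#\<^bsub>G\<^esub> H) ` carrier G \<and> openin gT {g \<in> carrier G. g <#\<^bsub>G\<^esub> H \<in> U}"
  by (simp add: homogeneous_space_def openin_quotient_topology topspace_gtop)

lemma admissible_triple:
  assumes "(x, y, z) \<in> admissible_triples G K A P w0"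
  obtains g h where "g \<in> carrier G" "h \<in> carrier G" "x = g <#\<^bsub>G\<^esub> P" "y = (g \<otimes> w0) <#\<^bsub>G\<^esub> P" "z = h <#\<^bsub>G\<^esub> P"
proof -
  have "opposite G P w0 x y" "z \<in> topspace (homogeneous_space G P)"
    using assms unfolding admissible_triples_def by auto
  then obtain g h where gh: "g \<in> carrier G" "x = g <#\<^bsub>G\<^esub> P" "y = g <#\<^bsub>G\<^esub> (w0 <#\<^bsub>G\<^esub> P)" "h \<in> carrier G" "z = h <#\<^bsub>G\<^esub> P"
    unfolding opposite_def topspace_homogeneous by (elim bexE conjE imageE)
  show thesis by (rule that[OF gh(1,4,2) _ gh(5)]) (simp add: gh(3) l_coset_mult gh(1) w0_carrier)
qed

text \<open>Translation by \<open>inv g\<close> moves the flat to \<open>FA\<close>, whose boundary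
  points are the cosets of elements of \<open>T\<close>.\<close>

lemma admissible_generic:
  assumes c: "g \<in> carrier G" "h \<in> carrier G"
    and ad: "(g <#\<^bsub>G\<^esub> P, (g \<otimes> w0) <#\<^bsub>G\<^esub> P, h <#\<^bsub>G\<^esub> P) \<in> admissible_triples G K A P w0"
  shows "inv g \<otimes> h \<in> generic"
  unfolding generic_def mem_Collect_eq
proof (intro conjI ballI)
  show "inv g \<otimes> h \<in> carrier G" using c by simp
  fix t assume t: "t \<in> T"
  have tc: "t \<in> carrier G" by (rule T_carrier[OF t])
  have "\<forall>q\<in>flat_boundary G K A P (translate G g FA). opposite G P w0 (h <#\<^bsub>G\<^esub> P) q"
    using ad flat_through_pair[OF c(1)] c(1) w0_carrier by (simp add: admissible_triples_def l_coset_mult)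
  moreover have "(g \<otimes> t) <#\<^bsub>G\<^esub> P \<in> flat_boundary G K A P (translate G g FA)"
    unfolding flat_boundary_translate[OF c(1)] using t by (intro CollectI exI[of _ t]) simp
  ultimately have "opposite G P w0 (h <#\<^bsub>G\<^esub> P) ((g \<otimes> t) <#\<^bsub>G\<^esub> P)" by (rule bspec)
  then obtain f where f: "f \<in> carrier G" "h <#\<^bsub>G\<^esub> P = f <#\<^bsub>G\<^esub> P" "(g \<otimes> t) <#\<^bsub>G\<^esub> P = f <#\<^bsub>G\<^esub> (w0 <#\<^bsub>G\<^esub> P)"
    unfolding opposite_def by (elim bexE conjE)
  have "(inv g \<otimes> h) <#\<^bsub>G\<^esub> P = (inv g \<otimes> f) <#\<^bsub>G\<^esub> P"
    using arg_cong[OF f(2), of "\<lambda>C. inv g <#\<^bsub>G\<^esub> C"] c f(1) by (simp add: l_coset_mult)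
  moreover have "t <#\<^bsub>G\<^esub> P = (inv g \<otimes> f) <#\<^bsub>G\<^esub> (w0 <#\<^bsub>G\<^esub> P)"
    using arg_cong[OF f(3), of "\<lambda>C. inv g <#\<^bsub>G\<^esub> C"] c f(1) tc w0_carrier
    by (simp add: l_coset_mult inv_mult_cancel m_assoc)
  ultimately show "opposite G P w0 ((inv g \<otimes> h) <#\<^bsub>G\<^esub> P) (t <#\<^bsub>G\<^esub> P)"
    unfolding opposite_def using c f(1) by (intro bexI[of _ "inv g \<otimes> f"]) simp_all
qed

lemma Phi_equivariant:
  assumes f: "f \<in> carrier G" and ad: "(x, y, z) \<in> admissible_triples G K A P w0"
  shows "Phi (f <#\<^bsub>G\<^esub> x, f <#\<^bsub>G\<^esub> y, f <#\<^bsub>G\<^esub> z) = f <#\<^bsub>G\<^esub> Phi (x, y, z)"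
proof -
  obtain g h where g: "g \<in> carrier G" "h \<in> carrier G" "x = g <#\<^bsub>G\<^esub> P" "y = (g \<otimes> w0) <#\<^bsub>G\<^esub> P" "z = h <#\<^bsub>G\<^esub> P"
    using admissible_triple[OF ad] .
  have gh: "inv g \<otimes> h \<in> generic" using admissible_generic[OF g(1,2)] ad unfolding g .
  have e: "inv (f \<otimes> g) \<otimes> (f \<otimes> h) = inv g \<otimes> h"
    using f g(1,2) by (simp add: inv_mult_group m_assoc inv_mult_cancel)
  have "Phi ((f \<otimes> g) <#\<^bsub>G\<^esub> P, (f \<otimes> g \<otimes> w0) <#\<^bsub>G\<^esub> P, (f \<otimes> h) <#\<^bsub>G\<^esub> P) = flat_point (f \<otimes> g) (f \<otimes> h)"
    by (rule Phi_eval) (use f g(1,2) gh e in simp_all)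
  moreover have "flat_point (f \<otimes> g) (f \<otimes> h) = f <#\<^bsub>G\<^esub> flat_point g h"
    unfolding flat_point_def e using f g(1,2) by (simp add: l_coset_mult m_assoc)
  ultimately show ?thesis
    using f g(1,2) w0_carrier unfolding g Phi_eval[OF g(1,2) gh] by (simp add: l_coset_mult m_assoc)
qed

lemma Phi_in_flat:
  assumes ad: "(x, y, z) \<in> admissible_triples G K A P w0"
  shows "Phi (x, y, z) \<in> flat_through G K A P x y"
proof -
  obtain g h where g: "g \<in> carrier G" "h \<in> carrier G" "x = g <#\<^bsub>G\<^esub> P" "y = (g \<otimes> w0) <#\<^bsub>G\<^esub> P" "z = h <#\<^bsub>G\<^esub> P"
    using admissible_triple[OF ad] .
  have gh: "inv g \<otimes> h \<in> generic" using admissible_generic[OF g(1,2)] ad unfolding g .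
  have fl: "flat_through G K A P x y = translate G g FA"
    using flat_through_pair[OF g(1)] g(1) w0_carrier by (simp add: g l_coset_mult)
  have "expG (Psi (inv g \<otimes> h)) \<in> A" using Psi_aa by (simp add: A_eq)
  then have "flat_point g h \<in> translate G g FA"
    unfolding flat_point_def translate_FA[OF g(1)] by (intro CollectI exI[of _ "expG (Psi (inv g \<otimes> h))"]) simp
  then show ?thesis unfolding fl unfolding g Phi_eval[OF g(1,2) gh] .
qed

end

context opposed_group
begin

text \<open>What is known for \<open>expG\<close> is continuity at 0; on the abelian
  \<open>aa\<close> addition carries it to every point.\<close>

lemma continuous_exp_aa: "continuous_map (top_of_set aa) gT expG"
  unfolding continuous_map
proof (intro conjI allI impI)
  show "expG ` topspace (top_of_set aa) \<subseteq> topspace gT" by (simp add: topspace_gtop image_subset_iff)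
  fix W assume W: "openin gT W"
  show "openin (top_of_set aa) {X \<in> topspace (top_of_set aa). expG X \<in> W}"
    unfolding openin_euclidean_subtopology_iff
  proof (intro conjI ballI)
    fix X assume X: "X \<in> {X \<in> topspace (top_of_set aa). expG X \<in> W}"
    then have Xa: "X \<in> aa" by simp
    have "openin gT {g \<in> carrier G. expG X \<otimes> g \<in> W}"
      by (intro openin_preimage continuous_left_translation W exp_closed)
    from exp_nbhd[OF this] obtain s where s: "s > 0" "\<And>Y. norm Y < s \<Longrightarrow> expG Y \<in> {g \<in> carrier G. expG X \<otimes> g \<in> W}"
      using X by auto
    have "expG Y \<in> W" if Y: "Y \<in> aa" "dist Y X < s" for Y
    proof -
      have "expG Y = expG X \<otimes> expG (Y - X)" using exp_aa_mult[OF Xa subspace_diff[OF sub_aa Y(1) Xa]] by simp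
      then show ?thesis using s(2)[of "Y - X"] Y(2) by (simp add: dist_norm)
    qed
    then show "\<exists>e>0. \<forall>x'\<in>aa. dist x' X < e \<longrightarrow> x' \<in> {X \<in> topspace (top_of_set aa). expG X \<in> W}"
      using s(1) by auto
  qed auto
qed

lemma continuous_Psi: "continuous_map (subtopology gT generic) (top_of_set aa) Psi"
proof -
  \<comment> \<open>Here all logarithms are continuous; \<open>stretch_pos\<close> places the
    generic elements in \<open>D\<close>.\<close>
  define D where "D = {x. \<forall>(a, m, n)\<in>orbit_pairs. 0 < stretch a m x \<and> 0 < stretch a n x}"
  have log_stretch: "continuous_on D log_stretch"
    unfolding log_stretch_def
  proof (intro continuous_on_sum)
    fix z assume z: "z \<in> orbit_pairs"
    obtain a m n where e: "z = (a, m, n)" by (metis prod_cases3)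
    have a: "a \<in> Wt" using orbit_pairs_D z e highest_Wt by auto
    have p: "\<forall>x\<in>D. stretch a m x \<noteq> 0" "\<forall>x\<in>D. stretch a n x \<noteq> 0" using z e unfolding D_def by fastforce+
    have c: "continuous_on D (stretch a m)" "continuous_on D (stretch a n)"
      using continuous_on_stretch[OF a] by (auto intro: continuous_on_subset)
    show "continuous_on D (\<lambda>x. case z of (a, m, n) \<Rightarrow> ((ln (stretch a m x) - ln (stretch a n x)) / 2) *\<^sub>R (m - n))"
      unfolding e prod.case using p c by (intro continuous_intros) auto
  qed
  have "bounded_linear orbit_form_inv" using orbit_form_inv(2) by (simp add: linear_conv_bounded_linear)
  from linear_continuous_on[OF this] have "continuous_on D (orbit_form_inv \<circ> log_stretch)" by (rule continuous_on_compose[OF log_stretch])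
  then have c: "continuous_map (top_of_set D) (top_of_set aa) (orbit_form_inv \<circ> log_stretch)"
    using orbit_form_inv(1) by (auto simp: continuous_map_in_subtopology)
  have "continuous_map (subtopology gT generic) (top_of_set D) AdE"
    unfolding continuous_map_in_subtopology
  proof (intro conjI continuous_map_from_subtopology continuous_AdE)
    show "AdE \<in> topspace (subtopology gT generic) \<rightarrow> D" unfolding D_def using stretch_pos orbit_pairs_D by fastforce
  qed
  from continuous_map_compose[OF this c] show ?thesis by (simp add: o_def Psi_def[abs_def])
qed

section \<open>Continuity of Phi\<close>

definition generic_pairs where "generic_pairs = {(g, h). g \<in> carrier G \<and> h \<in> carrier G \<and> inv g \<otimes> h \<in> generic}"

lemma continuous_pair_map:
  "continuous_map (subtopology (prod_topology gT gT) generic_pairs) gT (\<lambda>(g, h). g \<otimes> expG (Psi (inv g \<otimes> h)))"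
proof -
  let ?X = "subtopology (prod_topology gT gT) generic_pairs"
  have f: "continuous_map ?X gT fst" "continuous_map ?X gT snd"
    by (intro continuous_map_from_subtopology continuous_map_fst continuous_map_snd)+
  have mult: "continuous_map ?X gT (\<lambda>z. u z \<otimes> v z)" if "continuous_map ?X gT u" "continuous_map ?X gT v" for u v
    using continuous_map_compose[OF continuous_map_pairedI[OF that] continuous_mult] by (simp add: o_def)
  have "continuous_map ?X gT (\<lambda>z. inv (fst z))"
    using continuous_map_compose[OF f(1) continuous_inv] by (simp add: o_def)
  from mult[OF this f(2)] have "continuous_map ?X (subtopology gT generic) (\<lambda>z. inv (fst z) \<otimes> snd z)"
    by (auto simp: continuous_map_in_subtopology generic_pairs_def)
  from continuous_map_compose[OF continuous_map_compose[OF this continuous_Psi] continuous_exp_aa]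
  have "continuous_map ?X gT (\<lambda>z. expG (Psi (inv (fst z) \<otimes> snd z)))" by (simp add: o_def)
  from mult[OF f(1) this] show ?thesis by (simp add: case_prod_unfold)
qed

text \<open>The full preimage of the image is a union of right translates of
  \<open>W\<close>.\<close>

lemma openin_coset_image:
  assumes H: "subgroup H G" and W: "openin gT W"
  shows "openin (homogeneous_space G H) ((\<lambda>g. g <#\<^bsub>G\<^esub> H) ` W)"
  unfolding openin_homogeneous
proof
  have Wc: "W \<subseteq> carrier G" by (rule nbhd_carrier[OF W])
  then show "(\<lambda>g. g <#\<^bsub>G\<^esub> H) ` W \<subseteq> (\<lambda>g. g <#\<^bsub>G\<^esub> H) ` carrier G" by blast
  have "{g \<in> carrier G. g <#\<^bsub>G\<^esub> H \<in> (\<lambda>g. g <#\<^bsub>G\<^esub> H) ` W} = (\<Union>x\<in>H. {g \<in> carrier G. g \<otimes> x \<in> W})"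
  proof (intro Set.set_eqI iffI)
    fix g assume g: "g \<in> {g \<in> carrier G. g <#\<^bsub>G\<^esub> H \<in> (\<lambda>g. g <#\<^bsub>G\<^esub> H) ` W}"
    then obtain w where w: "w \<in> W" "g <#\<^bsub>G\<^esub> H = w <#\<^bsub>G\<^esub> H" by (elim CollectE conjE imageE)
    have c: "g \<in> carrier G" "w \<in> carrier G" using g w Wc by auto
    have "inv g \<otimes> w \<in> H" using w(2) c by (simp add: l_coset_eq_iff[OF H])
    then show "g \<in> (\<Union>x\<in>H. {g \<in> carrier G. g \<otimes> x \<in> W})"
      by (rule UN_I) (use c w in \<open>simp add: inv_mult_cancel\<close>)
  next
    fix g assume "g \<in> (\<Union>x\<in>H. {g \<in> carrier G. g \<otimes> x \<in> W})"
    then obtain x where x: "x \<in> H" "g \<in> carrier G" "g \<otimes> x \<in> W" by (elim UN_E CollectE conjE)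
    have xc: "x \<in> carrier G" by (rule subgroup.mem_carrier[OF H x(1)])
    have "g <#\<^bsub>G\<^esub> H = (g \<otimes> x) <#\<^bsub>G\<^esub> H"
      using x xc by (subst l_coset_eq_iff[OF H]) (simp_all add: inv_mult_cancel)
    then show "g \<in> {g \<in> carrier G. g <#\<^bsub>G\<^esub> H \<in> (\<lambda>g. g <#\<^bsub>G\<^esub> H) ` W}"
      using x by (intro CollectI conjI image_eqI[of _ _ "g \<otimes> x"])
  qed
  moreover have "openin gT (\<Union>x\<in>H. {g \<in> carrier G. g \<otimes> x \<in> W})"
    by (intro openin_Union ballI) (auto intro!: openin_preimage continuous_right_translation W subgroup.mem_carrier[OF H])
  ultimately show "openin gT {g \<in> carrier G. g <#\<^bsub>G\<^esub> H \<in> (\<lambda>g. g <#\<^bsub>G\<^esub> H) ` W}" by simp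
qed

text \<open>Openness of \<open>g \<mapsto> (gP, gw\<^sub>0P)\<close> onto the opposite pairs: an element of the big cell \<open>Nw\<^sub>0Pw\<^sub>0\<inverse>\<close>
  close to \<open>1\<close> has its \<open>N\<close>-component close to \<open>1\<close>.\<close>

lemma opposite_pair_lift:
  assumes U: "openin gT U" "g \<in> U"
  obtains W where "openin gT W" "g \<in> W"
    "\<And>u v f. u \<in> W \<Longrightarrow> v \<in> W \<Longrightarrow> f \<in> carrier G \<Longrightarrow> u <#\<^bsub>G\<^esub> P = f <#\<^bsub>G\<^esub> P \<Longrightarrow>
      (v \<otimes> w0) <#\<^bsub>G\<^esub> P = (f \<otimes> w0) <#\<^bsub>G\<^esub> P \<Longrightarrow>
      \<exists>g'\<in>U. g' <#\<^bsub>G\<^esub> P = f <#\<^bsub>G\<^esub> P \<and> (g' \<otimes> w0) <#\<^bsub>G\<^esub> P = (f \<otimes> w0) <#\<^bsub>G\<^esub> P"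
proof -
  have gc: "g \<in> carrier G" using nbhd_carrier[OF U(1)] U(2) by blast
  define U' where "U' = {x \<in> carrier G. g \<otimes> x \<in> U}"
  have U1: "openin gT U'" unfolding U'_def by (intro openin_preimage continuous_left_translation U gc)
  have g1: "\<one> \<in> U'" using U(2) gc by (simp add: U'_def)
  obtain U2 where U2: "openin gT U2" "\<one> \<in> U2" "\<And>x y. x \<in> U2 \<Longrightarrow> y \<in> U2 \<Longrightarrow> x \<otimes> y \<in> U'"
    using nbhd_mult[OF U1 g1] by metis
  obtain s where s: "s > 0" "\<And>X. norm X < s \<Longrightarrow> expG X \<in> U2" using exp_nbhd[OF U2(1,2)] by metis
  obtain E where E: "E > 0" "\<And>X. norm (prs pos X) \<le> norm X * E"
    using bounded_linear.pos_bounded[of "prs pos"] linear_prs[of pos] by (auto simp: linear_conv_bounded_linear)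
  have sE: "s / E > 0" using s E by simp
  obtain U3 where U3: "openin gT U3" "\<one> \<in> U3"
    "\<And>x. x \<in> U3 \<Longrightarrow> \<exists>Z. norm Z < s / E \<and> x = expG (prs pos Z) \<otimes> expG (prs (- pos) Z)"
    using two_factor[OF linear_prs linear_prs prs_compl sE] by metis
  obtain U4 where U4: "openin gT U4" "\<one> \<in> U4" "\<And>x y. x \<in> U4 \<Longrightarrow> y \<in> U4 \<Longrightarrow> inv x \<otimes> y \<in> U3"
    using nbhd_mult[OF U3(1,2)] by metis
  \<comment> \<open>\<open>U4\<close> controls the quotient of two elements of \<open>W\<close>, and
    \<open>U2\<close> the product that forms \<open>g'\<close>.\<close>
  define W where "W = {x \<in> carrier G. inv g \<otimes> x \<in> U2 \<inter> U4}"
  show thesis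
  proof (rule that)
    show "openin gT W" unfolding W_def by (intro openin_preimage continuous_left_translation openin_Int U2 U4 inv_closed gc)
    show "g \<in> W" unfolding W_def using gc U2 U4 by simp
    fix u v f assume uv: "u \<in> W" "v \<in> W" and f: "f \<in> carrier G" "u <#\<^bsub>G\<^esub> P = f <#\<^bsub>G\<^esub> P" "(v \<otimes> w0) <#\<^bsub>G\<^esub> P = (f \<otimes> w0) <#\<^bsub>G\<^esub> P"
    have c: "u \<in> carrier G" "v \<in> carrier G" using uv by (auto simp: W_def)
    define p where "p = inv u \<otimes> f"
    have p: "p \<in> P" using f c by (simp add: p_def l_coset_eq_iff[OF subP])
    define q where "q = inv (f \<otimes> w0) \<otimes> (v \<otimes> w0)"
    have "(f \<otimes> w0) <#\<^bsub>G\<^esub> P = (v \<otimes> w0) <#\<^bsub>G\<^esub> P" using f(3) by simp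
    then have q: "q \<in> P" using f(1) c w0_carrier by (simp add: q_def l_coset_eq_iff[OF subP])
    obtain l n where ln: "l \<in> MA" "n \<in> N" "p = n \<otimes> l" using p unfolding P_iff' by blast
    define l' where "l' = inv w0 \<otimes> l \<otimes> w0"
    have l': "l' \<in> MA" unfolding l'_def by (rule T_normalizes_MA[OF w0 ln(1)])
    have c': "l \<in> carrier G" "n \<in> carrier G" "p \<in> carrier G" "q \<in> carrier G" "l' \<in> carrier G"
      using ln l' p q MA_carrier N_carrier P_carrier by auto
    define b where "b = inv u \<otimes> v"
    \<comment> \<open>\<open>u\<close> and \<open>v\<close> represent the two cosets of
      \<open>f\<close> separately, so \<open>inv u \<otimes> v\<close> is a product of an element of
      \<open>N\<close> and one of the conjugate of \<open>P\<close> by \<open>w0\<close>.\<close>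
    have "b = p \<otimes> w0 \<otimes> q \<otimes> inv w0"
      using c f(1) w0_carrier by (simp add: b_def p_def q_def inv_mult_group m_assoc inv_mult_cancel)
    also have "p \<otimes> w0 = n \<otimes> w0 \<otimes> l'" using c' w0_carrier by (simp add: ln(3) l'_def m_assoc inv_mult_cancel)
    finally have b: "b = n \<otimes> (w0 \<otimes> (l' \<otimes> q) \<otimes> inv w0)" using c' w0_carrier by (simp add: m_assoc)
    have "b = inv (inv g \<otimes> u) \<otimes> (inv g \<otimes> v)" using c gc by (simp add: b_def inv_mult_group m_assoc inv_mult_cancel)
    then have "b \<in> U3" using U4(3) uv by (simp add: W_def)
    then obtain Z where Z: "norm Z < s / E" "b = expG (prs pos Z) \<otimes> expG (prs (- pos) Z)" using U3(3) by blast
    define X where "X = prs pos Z"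
    define Y where "Y = prs (- pos) Z"
    have X: "X \<in> gr pos" unfolding X_def by (rule prs_gr)
    have "Y \<in> gr (- pos)" unfolding Y_def by (rule prs_gr)
    then have Y: "Y \<in> gr nonpos" by (auto simp: gr_def)
    have "norm X < s" using E(2)[of Z] Z(1) E(1) unfolding X_def by (simp add: pos_less_divide_eq)
    then have XU: "expG X \<in> U2" by (rule s(2))
    define p' where "p' = inv (l' \<otimes> q)"
    have p': "p' \<in> P" unfolding p'_def
      by (intro subgroup.m_inv_closed[OF subP] subgroup.m_closed[OF subP] MA_P l' q)
    have pc': "p' \<in> carrier G" by (rule P_carrier[OF p'])
    define r where "r = w0 \<otimes> p' \<otimes> inv w0"
    have rc: "r \<in> carrier G" using pc' w0_carrier by (simp add: r_def)
    have "n = b \<otimes> r" using c' w0_carrier by (simp add: b r_def p'_def inv_mult_group m_assoc inv_mult_cancel)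
    also have "b = expG X \<otimes> expG Y" unfolding X_def Y_def by (rule Z(2))
    \<comment> \<open>Two factorizations of \<open>b\<close> are compared. The quotient of their
      \<open>N\<close>-parts sends \<open>H0\<close> into \<open>gr nonpos\<close>, so
      \<open>N_trivial\<close> identifies them, and \<open>n\<close> is small because
      \<open>X\<close> is.\<close>
    finally have nXY: "inv (expG X) \<otimes> n = expG Y \<otimes> r" using rc by (simp add: m_assoc inv_mult_cancel)
    have rH: "Ad G r H0 \<in> gr nonpos" unfolding r_def by (rule Ad_big_cell_H0[OF p' T_inv[OF w0]])
    have "ap (exp (adE Y)) (Ad G r H0) \<in> gr nonpos"
    proof (rule ap_exp_subspace[OF sub_gr _ rH])
      fix v assume "v \<in> gr nonpos"
      then have "bracket G Y v \<in> gr nonpos" by (rule gr_bracket[OF Y]) auto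
      then show "ap (adE Y) v \<in> gr nonpos" by simp
    qed
    then have "Ad G (inv (expG X) \<otimes> n) H0 \<in> gr nonpos" unfolding nXY using rc by (simp add: Ad_mult flip: AdE_exp)
    moreover have "inv (expG X) \<otimes> n \<in> N"
      by (intro subgroup.m_closed[OF subN] subgroup.m_inv_closed[OF subN] ln(2)) (use X in \<open>simp add: N_eq\<close>)
    ultimately have "inv (expG X) \<otimes> n = \<one>" by (intro N_trivial)
    then have n: "n = expG X" using c' by (metis exp_closed inv_equality inv_inv inv_closed)
    \<comment> \<open>\<open>u\<close> is corrected by the small element \<open>n\<close>; the
      result differs from \<open>f\<close> by \<open>l\<close> in \<open>MA\<close>, which preserves
      both cosets.\<close>
    define g' where "g' = u \<otimes> n"
    have gc': "g' \<in> carrier G" using c c' by (simp add: g'_def)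
    have "inv g \<otimes> u \<otimes> expG X \<in> U'" using U2(3)[OF _ XU] uv by (simp add: W_def)
    then have "g' \<in> U" using gc c by (simp add: g'_def U'_def n m_assoc inv_mult_cancel)
    moreover have f': "f = g' \<otimes> l" using c f(1) c' ln(3) by (simp add: g'_def p_def m_assoc) (metis inv_mult_cancel(2) m_assoc)
    then have "inv g' \<otimes> f = l" using gc' c' by (simp add: inv_mult_cancel)
    then have "g' <#\<^bsub>G\<^esub> P = f <#\<^bsub>G\<^esub> P" using gc' f(1) MA_P[OF ln(1)] by (simp add: l_coset_eq_iff[OF subP])
    moreover have "inv (g' \<otimes> w0) \<otimes> (f \<otimes> w0) = l'"
      using gc' c' w0_carrier by (simp add: f' l'_def inv_mult_group m_assoc inv_mult_cancel)
    then have "(g' \<otimes> w0) <#\<^bsub>G\<^esub> P = (f \<otimes> w0) <#\<^bsub>G\<^esub> P"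
      using gc' f(1) w0_carrier MA_P[OF l'] by (simp add: l_coset_eq_iff[OF subP])
    ultimately show "\<exists>g'\<in>U. g' <#\<^bsub>G\<^esub> P = f <#\<^bsub>G\<^esub> P \<and> (g' \<otimes> w0) <#\<^bsub>G\<^esub> P = (f \<otimes> w0) <#\<^bsub>G\<^esub> P"
      by (intro bexI conjI)
  qed
qed

lemma topspace_triple_space: "topspace (triple_space G K A P w0) = admissible_triples G K A P w0"
  by (auto simp: triple_space_def admissible_triples_def)

lemma continuous_Phi: "continuous_map (triple_space G K A P w0) (homogeneous_space G K) Phi"
  unfolding continuous_map topspace_triple_space
proof (intro conjI allI impI subsetI)
  fix C assume "C \<in> Phi ` admissible_triples G K A P w0"
  then obtain x y z where xyz: "(x, y, z) \<in> admissible_triples G K A P w0" "C = Phi (x, y, z)" by auto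
  obtain g h where g: "g \<in> carrier G" "h \<in> carrier G" "x = g <#\<^bsub>G\<^esub> P" "y = (g \<otimes> w0) <#\<^bsub>G\<^esub> P" "z = h <#\<^bsub>G\<^esub> P"
    using admissible_triple[OF xyz(1)] .
  have gh: "inv g \<otimes> h \<in> generic" using admissible_generic[OF g(1,2)] xyz unfolding g by simp
  show "C \<in> topspace (homogeneous_space G K)"
    unfolding topspace_homogeneous xyz(2) g Phi_eval[OF g(1,2) gh] flat_point_def using g(1) by (intro imageI) simp
next
  fix Q assume Q: "openin (homogeneous_space G K) Q"
  let ?S = "{t \<in> admissible_triples G K A P w0. Phi t \<in> Q}"
  have Q': "openin gT {g \<in> carrier G. g <#\<^bsub>G\<^esub> K \<in> Q}" using Q by (simp add: openin_homogeneous)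
  let ?F = "\<lambda>(g, h). g \<otimes> expG (Psi (inv g \<otimes> h))"
  show "openin (triple_space G K A P w0) ?S"
  proof (subst openin_subopen, intro ballI)
    fix t assume t: "t \<in> ?S"
    obtain x y z where xyz: "t = (x, y, z)" by (metis prod_cases3)
    have ad: "(x, y, z) \<in> admissible_triples G K A P w0" "Phi (x, y, z) \<in> Q" using t xyz by auto
    obtain g h where g: "g \<in> carrier G" "h \<in> carrier G" "x = g <#\<^bsub>G\<^esub> P" "y = (g \<otimes> w0) <#\<^bsub>G\<^esub> P" "z = h <#\<^bsub>G\<^esub> P"
      using admissible_triple[OF ad(1)] .
    have gh: "inv g \<otimes> h \<in> generic" using admissible_generic[OF g(1,2)] ad(1) unfolding g .
    have "flat_point g h \<in> Q" using ad(2) unfolding g Phi_eval[OF g(1,2) gh] .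
    then have Fgh: "?F (g, h) \<in> {g \<in> carrier G. g <#\<^bsub>G\<^esub> K \<in> Q}" using g(1) by (simp add: flat_point_def)
    have "openin (subtopology (prod_topology gT gT) generic_pairs)
        {t \<in> topspace (subtopology (prod_topology gT gT) generic_pairs). ?F t \<in> {g \<in> carrier G. g <#\<^bsub>G\<^esub> K \<in> Q}}"
      by (rule openin_continuous_map_preimage[OF continuous_pair_map Q'])
    then obtain O1 where O1: "openin (prod_topology gT gT) O1"
      "{t \<in> topspace (subtopology (prod_topology gT gT) generic_pairs). ?F t \<in> {g \<in> carrier G. g <#\<^bsub>G\<^esub> K \<in> Q}} = O1 \<inter> generic_pairs"
      unfolding openin_subtopology by blast
    have "(g, h) \<in> {t \<in> topspace (subtopology (prod_topology gT gT) generic_pairs). ?F t \<in> {g \<in> carrier G. g <#\<^bsub>G\<^esub> K \<in> Q}}"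
      using Fgh g(1,2) gh topspace_gtop by (simp add: generic_pairs_def)
    then have "(g, h) \<in> O1" unfolding O1(2) by blast
    then obtain U L where UL: "openin gT U" "openin gT L" "g \<in> U" "h \<in> L" "U \<times> L \<subseteq> O1"
      using O1(1) unfolding openin_prod_topology_alt by metis
    obtain W where W: "openin gT W" "g \<in> W"
      "\<And>u v f. u \<in> W \<Longrightarrow> v \<in> W \<Longrightarrow> f \<in> carrier G \<Longrightarrow> u <#\<^bsub>G\<^esub> P = f <#\<^bsub>G\<^esub> P \<Longrightarrow>
        (v \<otimes> w0) <#\<^bsub>G\<^esub> P = (f \<otimes> w0) <#\<^bsub>G\<^esub> P \<Longrightarrow>
        \<exists>g'\<in>U. g' <#\<^bsub>G\<^esub> P = f <#\<^bsub>G\<^esub> P \<and> (g' \<otimes> w0) <#\<^bsub>G\<^esub> P = (f \<otimes> w0) <#\<^bsub>G\<^esub> P"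
      by (rule opposite_pair_lift[OF UL(1,3)]) blast
    \<comment> \<open>The lift is stated for \<open>v\<close> with second point the coset of
      \<open>v \<otimes> w0\<close>, so the neighbourhood for that point is the right translate of
      \<open>W\<close> by \<open>w0\<close>.\<close>
    define W' where "W' = {x \<in> carrier G. x \<otimes> inv w0 \<in> W}"
    have W': "openin gT W'" unfolding W'_def
      by (intro openin_preimage continuous_right_translation W(1) inv_closed w0_carrier)
    let ?c = "\<lambda>g. g <#\<^bsub>G\<^esub> P"
    let ?R = "admissible_triples G K A P w0 \<inter> (?c ` W \<times> ?c ` W' \<times> ?c ` L)"
    have "openin (triple_space G K A P w0) ?R"
      unfolding triple_space_def
      by (intro openin_subtopology_Int2) (simp add: openin_prod_Times_iff openin_coset_image[OF subP] W(1) W' UL(2))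
    moreover have "g \<otimes> w0 \<in> W'" using W(2) g(1) w0_carrier by (simp add: W'_def m_assoc)
    then have "t \<in> ?R" unfolding xyz using ad(1) W(2) UL(4) unfolding g by blast
    moreover have "?R \<subseteq> ?S"
    proof
      fix t' assume t': "t' \<in> ?R"
      obtain x' y' z' where xyz': "t' = (x', y', z')" by (metis prod_cases3)
      have ad': "(x', y', z') \<in> admissible_triples G K A P w0" using t' xyz' by blast
      obtain u where u: "u \<in> W" "x' = u <#\<^bsub>G\<^esub> P" using t' unfolding xyz' by blast
      obtain v' where v': "v' \<in> W'" "y' = v' <#\<^bsub>G\<^esub> P" using t' unfolding xyz' by blast
      obtain h' where h': "h' \<in> L" "z' = h' <#\<^bsub>G\<^esub> P" using t' unfolding xyz' by blast
      have hc': "h' \<in> carrier G" using nbhd_carrier[OF UL(2)] h' by blast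
      define v where "v = v' \<otimes> inv w0"
      have v: "v \<in> W" using v' by (simp add: v_def W'_def)
      have vv: "v' = v \<otimes> w0" using v' w0_carrier by (simp add: v_def W'_def m_assoc)
      obtain f h2 where f: "f \<in> carrier G" "h2 \<in> carrier G" "x' = f <#\<^bsub>G\<^esub> P" "y' = (f \<otimes> w0) <#\<^bsub>G\<^esub> P" "z' = h2 <#\<^bsub>G\<^esub> P"
        using admissible_triple[OF ad'] .
      \<comment> \<open>The representative \<open>f\<close> of the pair may be far from
        \<open>g\<close>; the lift replaces it by one inside \<open>U\<close>.\<close>
      obtain g' where g': "g' \<in> U" "g' <#\<^bsub>G\<^esub> P = f <#\<^bsub>G\<^esub> P" "(g' \<otimes> w0) <#\<^bsub>G\<^esub> P = (f \<otimes> w0) <#\<^bsub>G\<^esub> P"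
        using W(3)[OF u(1) v f(1)] u(2) v'(2) f(3,4) vv by metis
      have gc': "g' \<in> carrier G" using nbhd_carrier[OF UL(1)] g' by blast
      have e: "(x', y', z') = (g' <#\<^bsub>G\<^esub> P, (g' \<otimes> w0) <#\<^bsub>G\<^esub> P, h' <#\<^bsub>G\<^esub> P)"
        using f(3,4) g'(2,3) h'(2) by simp
      have gh': "inv g' \<otimes> h' \<in> generic" by (rule admissible_generic[OF gc' hc']) (use ad' e in simp)
      have "(g', h') \<in> O1 \<inter> generic_pairs" using UL(5) g'(1) h'(1) gc' hc' gh' by (auto simp: generic_pairs_def)
      then have "?F (g', h') \<in> {g \<in> carrier G. g <#\<^bsub>G\<^esub> K \<in> Q}" unfolding O1(2)[symmetric] by blast
      then have "flat_point g' h' \<in> Q" by (simp add: flat_point_def)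
      then have "Phi (x', y', z') \<in> Q" unfolding e Phi_eval[OF gc' hc' gh'] .
      then show "t' \<in> ?S" using ad' xyz' by simp
    qed
    ultimately show "\<exists>T. openin (triple_space G K A P w0) T \<and> t \<in> T \<and> T \<subseteq> ?S" by blast
  qed
qed

end

section \<open>Roots as functionals\<close>

context flat_group
begin

abbreviation functional where "functional h \<equiv> restrict (B h) aa"

lemma root_space_functional: "root_space G aa (functional h) = ws h"
  by (simp add: root_space_def ws_def)

text \<open>By \<open>riesz_linear\<close> a linear form agrees on \<open>aa\<close> with
  \<open>B h\<close> for some \<open>h\<close> in \<open>aa\<close>; this transfers notions about
  roots to the vectors in \<open>Wt\<close>.\<close>

lemma restricted_roots_eq: "restricted_roots G aa = functional ` (Wt - {0})"
proof (intro subset_antisym subsetI)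
  fix r assume "r \<in> restricted_roots G aa"
  then obtain f where f: "r = restrict f aa" "linear f" "\<exists>H\<in>aa. f H \<noteq> 0" "root_space G aa f \<noteq> {0}"
    by (auto simp: restricted_roots_def)
  obtain h where h: "h \<in> aa" "\<And>H. H \<in> aa \<Longrightarrow> f H = B h H" using riesz_linear[OF f(2)] by blast
  have "r = functional h" unfolding f(1) using h(2) by (rule restrict_ext)
  moreover have "root_space G aa f = ws h" using h(2) by (auto simp: root_space_def ws_def)
  then have "h \<in> Wt" using h(1) f(4) by (simp add: Wt_def)
  moreover have "h \<noteq> 0" using f(3) h(2) by auto
  ultimately show "r \<in> functional ` (Wt - {0})" by blast
next
  fix r assume "r \<in> functional ` (Wt - {0})"
  then obtain h where h: "h \<in> Wt" "h \<noteq> 0" "r = functional h" by blast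
  have "linear (B h)" by (rule linearI) simp_all
  moreover have "B h h \<noteq> 0" using B_aa_pos[OF Wt_aa[OF h(1)] h(2)] by simp
  moreover have "root_space G aa (B h) = ws h" by (simp add: root_space_def ws_def)
  ultimately show "r \<in> restricted_roots G aa"
    unfolding restricted_roots_def using h Wt_aa[OF h(1)] by (auto simp: Wt_def)
qed

lemma span_ws_gr: "span (\<Union>h\<in>Wt \<inter> S. ws h) = gr S"
proof (rule subset_antisym)
  show "span (\<Union>h\<in>Wt \<inter> S. ws h) \<subseteq> gr S"
    by (rule span_minimal[OF _ sub_gr]) (use ws_gr Wt_aa in blast)
  show "gr S \<subseteq> span (\<Union>h\<in>Wt \<inter> S. ws h)"
  proof
    fix X assume "X \<in> gr S"
    then show "X \<in> span (\<Union>h\<in>Wt \<inter> S. ws h)"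
      by (induction rule: gr_induct) (auto intro: span_base)
  qed
qed

lemma root_vector_functional: "h \<in> aa \<Longrightarrow> root_vector G aa (functional h) = h"
  unfolding root_vector_def by (rule the_equality) (auto simp: killing_B intro: B_aa_eqI)

end

context parab_group
begin

lemma reflect_aa: "a \<in> aa \<Longrightarrow> H \<in> aa \<Longrightarrow> reflect a H \<in> aa"
  unfolding reflect_def by (intro subspace_diff[OF sub_aa] subspace_scale[OF sub_aa])

lemma root_reflection_functional: "a \<in> aa \<Longrightarrow> H \<in> aa \<Longrightarrow> root_reflection G aa (functional a) H = reflect a H"
  by (simp add: root_reflection_def root_vector_functional reflect_def)

lemma foldr_root_reflection:
  "set as \<subseteq> aa \<Longrightarrow> H \<in> aa \<Longrightarrow> foldr (root_reflection G aa) (map functional as) H = foldr reflect as H \<and> foldr reflect as H \<in> aa"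
  by (induction as) (simp_all add: root_reflection_functional reflect_aa)

lemma simple_roots_functional: "simple_roots aa (functional ` pos_roots) = functional ` simple"
proof -
  have "(\<forall>H\<in>aa. functional a H = functional b H + functional c H) \<longleftrightarrow> a = b + c" if "a \<in> aa" "b \<in> aa" "c \<in> aa" for a b c
    using B_aa_eqI[OF that(1) subspace_add[OF sub_aa that(2,3)]] by auto
  then show ?thesis unfolding simple_roots_def simple_def using pos_roots_aa by blast
qed

text \<open>Lets the word length in root reflections be read as the one that
  \<open>longest_flips\<close> compares.\<close>

lemma weyl_length_functional:
  "weyl_length G aa (functional ` pos_roots) t =
     (LEAST l. \<exists>as. length as = l \<and> set as \<subseteq> simple \<and> (\<forall>H\<in>aa. Ad G t H = foldr reflect as H))"
proof -
  have Sa: "simple \<subseteq> aa" using simple_pos_roots pos_roots_aa by blast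
  have "(\<exists>as. length as = l \<and> set as \<subseteq> functional ` simple \<and> (\<forall>H\<in>aa. Ad G t H = foldr (root_reflection G aa) as H)) \<longleftrightarrow>
    (\<exists>as. length as = l \<and> set as \<subseteq> simple \<and> (\<forall>H\<in>aa. Ad G t H = foldr reflect as H))" (is "?L \<longleftrightarrow> ?R") for l
  proof
    assume ?L
    then obtain rs where rs: "length rs = l" "set rs \<subseteq> functional ` simple" "\<forall>H\<in>aa. Ad G t H = foldr (root_reflection G aa) rs H"
      by blast
    have "rs \<in> map functional ` lists simple" using rs(2) unfolding lists_image[symmetric] by auto
    then obtain as where as: "rs = map functional as" "set as \<subseteq> simple" by auto
    then show ?R using rs foldr_root_reflection[of as] Sa by (intro exI[of _ as]) auto
  next
    assume ?R
    then obtain as where as: "length as = l" "set as \<subseteq> simple" "\<forall>H\<in>aa. Ad G t H = foldr reflect as H" by blast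
    then show ?L using foldr_root_reflection[of as] Sa by (intro exI[of _ "map functional as"]) auto
  qed
  then show ?thesis unfolding weyl_length_def simple_roots_functional by presburger
qed

end

theorem corollary2:
  fixes G :: "('a, 'e::euclidean_space) manifold_group"
    and K A M N P T :: "'a set" and w0 :: 'a
    and \<pp> \<aa> \<nn> :: "'e set" and R :: "('e \<Rightarrow> real) set"
  assumes "lie_group G" and "connected_space (gtop G)"
    and "semisimple G" and "noncompact_type G" and "finite (group_center G)"
    and "maximal_compact_subgroup G K"
    and "cartan_decomposition G (lie_algebra_of G K) \<pp>"
    and "maximal_abelian_in G \<pp> \<aa>"
    and "positive_root_system G \<aa> R"
    and "\<nn> = span (\<Union>\<alpha>\<in>R. root_space G \<aa> \<alpha>)"
    and "A = lie_exp G ` \<aa>" and "N = lie_exp G ` \<nn>"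
    and "M = centralizer_in G K A" and "T = normalizer_in G K A"
    and "P = M <#>\<^bsub>G\<^esub> A <#>\<^bsub>G\<^esub> N"
    and "longest_weyl_representative G T \<aa> R w0"
  shows "\<exists>\<Phi>. continuous_map (triple_space G K A P w0) (homogeneous_space G K) \<Phi> \<and>
    (\<forall>g\<in>carrier G. \<forall>(x, y, z)\<in>admissible_triples G K A P w0.
       \<Phi> (g <#\<^bsub>G\<^esub> x, g <#\<^bsub>G\<^esub> y, g <#\<^bsub>G\<^esub> z) = g <#\<^bsub>G\<^esub> \<Phi> (x, y, z)) \<and>
    (\<forall>(x, y, z)\<in>admissible_triples G K A P w0. \<Phi> (x, y, z) \<in> flat_through G K A P x y)"
proof -
  interpret lie_group G by fact
  interpret sym_group G "lie_algebra_of G K" \<pp> \<aa> K A M T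
    by unfold_locales (fact | rule refl)+
  \<comment> \<open>The regular element that defines \<open>R\<close> serves as the reference point
    for all later positivity.\<close>
  obtain H0 where H0: "H0 \<in> \<aa>" "\<forall>\<alpha>\<in>restricted_roots G \<aa>. \<alpha> H0 \<noteq> 0" "R = {\<alpha> \<in> restricted_roots G \<aa>. \<alpha> H0 > 0}"
    using \<open>positive_root_system G \<aa> R\<close> unfolding positive_root_system_def by blast
  have R: "R = functional ` (Wt \<inter> {h. 0 < B h H0})"
    unfolding H0(3) restricted_roots_eq using H0(1) by auto
  have nilradical: "\<nn> = gr {h. 0 < B h H0}"
    unfolding \<open>\<nn> = span _\<close> R by (simp add: root_space_functional span_ws_gr flip: span_ws_gr)
  interpret parab_group G "lie_algebra_of G K" \<pp> \<aa> K A M T H0 N P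
  proof
    show "H0 \<in> \<aa>" by fact
    show "B h H0 \<noteq> 0" if "h \<in> Wt" "h \<noteq> 0" for h
      using H0(1,2) that unfolding restricted_roots_eq by auto
    show "N = expG ` gr {h. 0 < B h H0}"
      unfolding \<open>N = _\<close> nilradical by (simp add: expG_def)
  qed fact
  have w0: "w0 \<in> T" "\<And>t. t \<in> T \<Longrightarrow> weyl_length G \<aa> R t \<le> weyl_length G \<aa> R w0"
    using \<open>longest_weyl_representative G T \<aa> R w0\<close> unfolding longest_weyl_representative_def by auto
  interpret opposed_group G "lie_algebra_of G K" \<pp> \<aa> K A M T H0 N P w0
  proof
    show "- Ad G w0 h \<in> pos_roots" if "h \<in> pos_roots" for h
      by (rule longest_flips[OF w0(1) _ that]) (use w0(2) in \<open>simp only: R weyl_length_functional\<close>)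
  qed fact
  show ?thesis
    using continuous_Phi Phi_equivariant Phi_in_flat by (intro exI[of _ Phi]) auto
qed

end
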